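(* Let $(M,\varphi)$ be a compact integrable $G_2$ manifold whose characteristic connection $\nabla$ has closed torsion 3-form $T$, $dT=0$. Then the following conditions are equivalent: (a) the torsion is $\nabla$-parallel, $\nabla T=0$; (b) the curvature of $\nabla$ is a $G_2$-instanton.
   Context: Manifolds are smooth; compact means compact without boundary. A $G_2$ manifold $(M,\varphi)$ is a 7-manifold with a 3-form $\varphi$ that near each point can be written, in a local coframe $e_1,\dots,e_7$, as $\varphi=e_{127}+e_{135}-e_{146}-e_{236}-e_{245}+e_{347}+e_{567}$, where $e_{ijk}=e_i\wedge e_j\wedge e_k$. It induces the metric $g$ and orientation for which such coframes are oriented orthonormal; $*$ is the Hodge star, $(\cdot,\cdot)$ the induced scalar product on forms. Indices refer to a local orthonormal frame, and repeated indices are summed. The Lee form is $\theta=-\frac13*( *d\varphi\wedge\varphi)$. The $G_2$ structure is integrable if $d{*\varphi}=\theta\wedge*\varphi$. On an integrable $G_2$ manifold there is a unique linear connection $\nabla$ (the characteristic connection) with $\nabla g=0$, $\nabla\varphi=0$ and totally skew-symmetric torsion, i.e. $T(X,Y,Z)=g(\nabla_XY-\nabla_YX-[X,Y],Z)$ is a 3-form; explicitly $T=-*d\varphi+*(\theta\wedge\varphi)+\frac16(d\varphi,*\varphi)\varphi$. Curvature of $\nabla$: $R(X,Y)Z=[\nabla_X,\nabla_Y]Z-\nabla_{[X,Y]}Z$, $R(X,Y,Z,V)=g(R(X,Y)Z,V)$. $R$ is a $G_2$-instanton if $R_{abij}\varphi_{abk}=0$ for all $i,j,k$, i.e. the curvature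 2-form lies in $\mathfrak g_2\cong\{\alpha\in\Lambda^2: *(\alpha\wedge\varphi)=-\alpha\}$. *)

theory Defs
  imports "HOL-Analysis.Analysis"
begin

section \<open>Smooth manifolds\<close>

definition partial_diff :: "'n \<Rightarrow> (real^'n \<Rightarrow> real) \<Rightarrow> real^'n \<Rightarrow> real" where
  "partial_diff i f x = frechet_derivative f (at x) (axis i 1)"

fun Ck_on :: "nat \<Rightarrow> (real^'n) set \<Rightarrow> (real^'n \<Rightarrow> real) \<Rightarrow> bool" where
  "Ck_on 0 S f \<longleftrightarrow> continuous_on S f"
| "Ck_on (Suc k) S f \<longleftrightarrow> f differentiable_on S \<and> (\<forall>i. Ck_on k S (partial_diff i f))"

text \<open>Only used for open \<open>S\<close>.\<close>

definition smooth_on :: "(real^'n) set \<Rightarrow> (real^'n \<Rightarrow> real) \<Rightarrow> bool" where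
  "smooth_on S f \<longleftrightarrow> (\<forall>k. Ck_on k S f)"

text \<open>A chart is its domain together with its coordinate map; the values of the coordinate map
  outside the domain are irrelevant.\<close>

type_synonym ('a, 'n) chart = "'a set \<times> ('a \<Rightarrow> real^'n)"

definition chart_img :: "('a, 'n) chart \<Rightarrow> (real^'n) set" where
  "chart_img \<kappa> = snd \<kappa> ` fst \<kappa>"

definition overlap :: "('a, 'n) chart \<Rightarrow> ('a, 'n) chart \<Rightarrow> (real^'n) set" where
  "overlap \<kappa> \<mu> = snd \<kappa> ` (fst \<kappa> \<inter> fst \<mu>)"

definition transition :: "('a, 'n) chart \<Rightarrow> ('a, 'n) chart \<Rightarrow> real^'n \<Rightarrow> real^'n" where
  "transition \<kappa> \<mu> x = snd \<mu> (inv_into (fst \<kappa>) (snd \<kappa>) x)"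

definition jacobian :: "('a, 'n) chart \<Rightarrow> ('a, 'n) chart \<Rightarrow> real^'n \<Rightarrow> 'n \<Rightarrow> 'n \<Rightarrow> real" where
  "jacobian \<kappa> \<mu> x i j = partial_diff j (\<lambda>y. transition \<kappa> \<mu> y $ i) x"

definition is_chart :: "'a topology \<Rightarrow> ('a, 'n::finite) chart \<Rightarrow> bool" where
  "is_chart X \<kappa> \<longleftrightarrow> openin X (fst \<kappa>) \<and> open (chart_img \<kappa>) \<and>
     homeomorphic_map (subtopology X (fst \<kappa>)) (top_of_set (chart_img \<kappa>)) (snd \<kappa>)"

text \<open>The smooth structure is given by an atlas, which need not be maximal.\<close>

definition smooth_manifold :: "'a topology \<Rightarrow> ('a, 'n::finite) chart set \<Rightarrow> bool" where
  "smooth_manifold X A \<longleftrightarrow> Hausdorff_space X \<and> second_countable X \<and>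
     (\<forall>\<kappa>\<in>A. is_chart X \<kappa>) \<and> (\<Union>\<kappa>\<in>A. fst \<kappa>) = topspace X \<and>
     (\<forall>\<kappa>\<in>A. \<forall>\<mu>\<in>A. \<forall>i. smooth_on (overlap \<kappa> \<mu>) (\<lambda>x. transition \<kappa> \<mu> x $ i))"

section \<open>Tensors and forms in coordinates\<close>

text \<open>A covariant \<open>k\<close>-tensor on \<open>\<real>\<^sup>n\<close> is its family of components \<open>a [i\<^sub>1, \<dots>, i\<^sub>k]\<close>; values on lists
  whose length is not \<open>k\<close> are irrelevant. A tensor field on a chart image is a map
  \<open>real^'n \<Rightarrow> 'n tensor\<close>, with components relative to the coordinate frame. A tensor field on a
  manifold is a family of these, indexed by the charts and subject to the transformation law.\<close>

type_synonym 'n tensor = "'n list \<Rightarrow> real"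

definition alternating :: "nat \<Rightarrow> 'n tensor \<Rightarrow> bool" where
  "alternating k a \<longleftrightarrow> (\<forall>J \<sigma>. length J = k \<longrightarrow> \<sigma> permutes {..<k} \<longrightarrow>
     a (permute_list \<sigma> J) = of_int (sign \<sigma>) * a J)"

definition tensor_eval :: "nat \<Rightarrow> ('n::finite) tensor \<Rightarrow> (real^'n) list \<Rightarrow> real" where
  "tensor_eval k a vs = (\<Sum>I | length I = k. a I * (\<Prod>m<k. vs ! m $ (I ! m)))"

text \<open>Normalised so that \<open>\<alpha> \<and> \<beta> = \<alpha> \<otimes> \<beta> - \<beta> \<otimes> \<alpha>\<close> for 1-forms.\<close>

definition wedge :: "nat \<Rightarrow> nat \<Rightarrow> 'n tensor \<Rightarrow> 'n tensor \<Rightarrow> 'n tensor" where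
  "wedge p q a b J = (1 / (fact p * fact q)) *
     (\<Sum>\<sigma> | \<sigma> permutes {..<p + q}. of_int (sign \<sigma>) *
        a (take p (permute_list \<sigma> J)) * b (drop p (permute_list \<sigma> J)))"

fun wedge_list :: "(real^'n) list \<Rightarrow> 'n tensor" where
  "wedge_list [] = (\<lambda>_. 1)"
| "wedge_list (v # vs) = wedge 1 (length vs) (\<lambda>I. v $ hd I) (wedge_list vs)"

text \<open>\<open>(d\<alpha>)\<^bsub>j\<^sub>0\<dots>j\<^sub>k\<^esub> = \<Sum>\<^sub>m (-1)\<^sup>m \<partial>\<^bsub>j\<^sub>m\<^esub> \<alpha>\<^bsub>j\<^sub>0\<dots>j\<^sub>k\<^esub>\<close>, with \<open>j\<^sub>m\<close> omitted in the components of \<open>\<alpha>\<close>.\<close>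

definition ext_d :: "(real^'n \<Rightarrow> 'n tensor) \<Rightarrow> real^'n \<Rightarrow> 'n tensor" where
  "ext_d \<alpha> x J = (\<Sum>m<length J.
     (-1) ^ m * partial_diff (J ! m) (\<lambda>y. \<alpha> y (take m J @ drop (Suc m) J)) x)"

text \<open>The metric \<open>G\<close> raises the indices; the normalisation is \<open>\<alpha> \<and> *\<beta> = (\<alpha>, \<beta>) vol\<close>.\<close>

definition hodge :: "real^'n^'n \<Rightarrow> 'n tensor \<Rightarrow> nat \<Rightarrow> ('n::finite) tensor \<Rightarrow> 'n tensor" where
  "hodge G vol k a J = (1 / fact k) *
     (\<Sum>I | length I = k. \<Sum>I' | length I' = k.
        (\<Prod>m<k. matrix_inv G $ (I ! m) $ (I' ! m)) * a I' * vol (I @ J))"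

definition smooth_tensor_field ::
    "('a, 'n::finite) chart set \<Rightarrow> nat \<Rightarrow> (('a, 'n) chart \<Rightarrow> real^'n \<Rightarrow> 'n tensor) \<Rightarrow> bool" where
  "smooth_tensor_field A k \<alpha> \<longleftrightarrow>
     (\<forall>\<kappa>\<in>A. \<forall>J. length J = k \<longrightarrow> smooth_on (chart_img \<kappa>) (\<lambda>x. \<alpha> \<kappa> x J)) \<and>
     (\<forall>\<kappa>\<in>A. \<forall>\<mu>\<in>A. \<forall>x\<in>overlap \<kappa> \<mu>. \<forall>J. length J = k \<longrightarrow>
        \<alpha> \<kappa> x J = (\<Sum>I | length I = k. \<alpha> \<mu> (transition \<kappa> \<mu> x) I *
                     (\<Prod>m<k. jacobian \<kappa> \<mu> x (I ! m) (J ! m))))"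

definition differential_form ::
    "('a, 'n::finite) chart set \<Rightarrow> nat \<Rightarrow> (('a, 'n) chart \<Rightarrow> real^'n \<Rightarrow> 'n tensor) \<Rightarrow> bool" where
  "differential_form A k \<alpha> \<longleftrightarrow> smooth_tensor_field A k \<alpha> \<and>
     (\<forall>\<kappa>\<in>A. \<forall>x\<in>chart_img \<kappa>. alternating k (\<alpha> \<kappa> x))"

section \<open>\<open>G\<^sub>2\<close> structures\<close>

text \<open>A coframe at a point is a matrix whose row \<open>E $ a\<close> is the 1-form \<open>e\<^sub>a\<close>. In the type \<open>7\<close> the
  numerals \<open>1, \<dots>, 7\<close> denote the seven distinct elements (with \<open>7 = 0\<close>).\<close>

definition g2_model :: "real^7^7 \<Rightarrow> 7 tensor" where
  "g2_model E J = (let e = (\<lambda>a b c. wedge_list [E $ a, E $ b, E $ c] J) in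
     e 1 2 7 + e 1 3 5 - e 1 4 6 - e 2 3 6 - e 2 4 5 + e 3 4 7 + e 5 6 7)"

definition g2_adapted :: "7 tensor \<Rightarrow> real^7^7 \<Rightarrow> bool" where
  "g2_adapted a E \<longleftrightarrow> invertible E \<and> (\<forall>J. length J = 3 \<longrightarrow> a J = g2_model E J)"

definition g2_structure ::
    "('a, 7) chart set \<Rightarrow> (('a, 7) chart \<Rightarrow> real^7 \<Rightarrow> 7 tensor) \<Rightarrow> bool" where
  "g2_structure A \<phi> \<longleftrightarrow> differential_form A 3 \<phi> \<and>
     (\<forall>\<kappa>\<in>A. \<forall>x\<in>chart_img \<kappa>. \<exists>W E. open W \<and> x \<in> W \<and> W \<subseteq> chart_img \<kappa> \<and>
        (\<forall>a i. smooth_on W (\<lambda>y. E y $ a $ i)) \<and> (\<forall>y\<in>W. g2_adapted (\<phi> \<kappa> y) (E y)))"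

definition g2_manifold ::
    "'a topology \<Rightarrow> ('a, 7) chart set \<Rightarrow> (('a, 7) chart \<Rightarrow> real^7 \<Rightarrow> 7 tensor) \<Rightarrow> bool" where
  "g2_manifold X A \<phi> \<longleftrightarrow> smooth_manifold X A \<and> g2_structure A \<phi>"

text \<open>The metric and volume form for which adapted coframes are oriented orthonormal. The choice of
  coframe is immaterial, because two adapted coframes at a point differ by an element of
  \<open>G\<^sub>2 \<subseteq> SO(7)\<close>.\<close>

definition g2_coframe :: "7 tensor \<Rightarrow> real^7^7" where
  "g2_coframe a = (SOME E. g2_adapted a E)"

definition g2_metric :: "7 tensor \<Rightarrow> real^7^7" where
  "g2_metric a = transpose (g2_coframe a) ** g2_coframe a"

definition g2_volume :: "7 tensor \<Rightarrow> 7 tensor" where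
  "g2_volume a = wedge_list (map (\<lambda>i. g2_coframe a $ i) [1, 2, 3, 4, 5, 6, 7])"

text \<open>In the following, \<open>f\<close> is the local expression of \<open>\<phi>\<close> in a chart.\<close>

definition metric_field :: "(real^7 \<Rightarrow> 7 tensor) \<Rightarrow> real^7 \<Rightarrow> real^7^7" where
  "metric_field f x = g2_metric (f x)"

definition star :: "(real^7 \<Rightarrow> 7 tensor) \<Rightarrow> nat \<Rightarrow> (real^7 \<Rightarrow> 7 tensor) \<Rightarrow> real^7 \<Rightarrow> 7 tensor" where
  "star f k \<alpha> x = hodge (g2_metric (f x)) (g2_volume (f x)) k (\<alpha> x)"

definition lee_form :: "(real^7 \<Rightarrow> 7 tensor) \<Rightarrow> real^7 \<Rightarrow> 7 tensor" where
  "lee_form f x J = - (1/3) * star f 6 (\<lambda>y. wedge 3 3 (star f 4 (ext_d f) y) (f y)) x J"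

definition g2_integrable ::
    "('a, 7) chart set \<Rightarrow> (('a, 7) chart \<Rightarrow> real^7 \<Rightarrow> 7 tensor) \<Rightarrow> bool" where
  "g2_integrable A \<phi> \<longleftrightarrow> (\<forall>\<kappa>\<in>A. \<forall>x\<in>chart_img \<kappa>. \<forall>J. length J = 5 \<longrightarrow>
     ext_d (star (\<phi> \<kappa>) 3 (\<phi> \<kappa>)) x J =
     wedge 1 4 (lee_form (\<phi> \<kappa>) x) (star (\<phi> \<kappa>) 3 (\<phi> \<kappa>) x) J)"

section \<open>Linear connections\<close>

text \<open>A linear connection is given in each chart by its Christoffel symbols
  \<open>\<nabla>\<^bsub>\<partial>\<^sub>i\<^esub> \<partial>\<^sub>j = \<Sum>\<^sub>k \<Gamma> x i j k \<partial>\<^sub>k\<close>; the second condition is their transformation law.\<close>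

type_synonym 'n christoffel = "real^'n \<Rightarrow> 'n \<Rightarrow> 'n \<Rightarrow> 'n \<Rightarrow> real"

definition linear_connection ::
    "('a, 'n::finite) chart set \<Rightarrow> (('a, 'n) chart \<Rightarrow> 'n christoffel) \<Rightarrow> bool" where
  "linear_connection A \<Gamma> \<longleftrightarrow>
     (\<forall>\<kappa>\<in>A. \<forall>i j k. smooth_on (chart_img \<kappa>) (\<lambda>x. \<Gamma> \<kappa> x i j k)) \<and>
     (\<forall>\<kappa>\<in>A. \<forall>\<mu>\<in>A. \<forall>x\<in>overlap \<kappa> \<mu>. \<forall>i j l.
        (\<Sum>k\<in>UNIV. jacobian \<kappa> \<mu> x l k * \<Gamma> \<kappa> x i j k) =
        (\<Sum>p\<in>UNIV. \<Sum>q\<in>UNIV. \<Gamma> \<mu> (transition \<kappa> \<mu> x) p q l *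
            jacobian \<kappa> \<mu> x p i * jacobian \<kappa> \<mu> x q j) +
        partial_diff i (\<lambda>y. jacobian \<kappa> \<mu> y l j) x)"

text \<open>Vector fields in a chart.\<close>

definition cov_deriv ::
    "('n::finite) christoffel \<Rightarrow> (real^'n \<Rightarrow> real^'n) \<Rightarrow> (real^'n \<Rightarrow> real^'n) \<Rightarrow> real^'n \<Rightarrow> real^'n" where
  "cov_deriv C V W x = (\<chi> k. (\<Sum>i\<in>UNIV. V x $ i * partial_diff i (\<lambda>y. W y $ k) x) +
     (\<Sum>i\<in>UNIV. \<Sum>j\<in>UNIV. C x i j k * V x $ i * W x $ j))"

definition lie_bracket ::
    "(real^'n \<Rightarrow> real^'n) \<Rightarrow> (real^'n \<Rightarrow> real^'n) \<Rightarrow> real^('n::finite) \<Rightarrow> real^'n" where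
  "lie_bracket V W x = (\<chi> k. (\<Sum>i\<in>UNIV. V x $ i * partial_diff i (\<lambda>y. W y $ k) x) -
     (\<Sum>i\<in>UNIV. W x $ i * partial_diff i (\<lambda>y. V y $ k) x))"

definition cov_deriv_tensor ::
    "('n::finite) christoffel \<Rightarrow> (real^'n \<Rightarrow> 'n tensor) \<Rightarrow> real^'n \<Rightarrow> 'n \<Rightarrow> 'n tensor" where
  "cov_deriv_tensor C \<alpha> x i J = partial_diff i (\<lambda>y. \<alpha> y J) x -
     (\<Sum>m<length J. \<Sum>l\<in>UNIV. C x i (J ! m) l * \<alpha> x (J[m := l]))"

definition parallel_tensor ::
    "('a, 'n::finite) chart set \<Rightarrow> (('a, 'n) chart \<Rightarrow> 'n christoffel) \<Rightarrow> nat \<Rightarrow>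
     (('a, 'n) chart \<Rightarrow> real^'n \<Rightarrow> 'n tensor) \<Rightarrow> bool" where
  "parallel_tensor A \<Gamma> k \<alpha> \<longleftrightarrow> (\<forall>\<kappa>\<in>A. \<forall>x\<in>chart_img \<kappa>. \<forall>i J. length J = k \<longrightarrow>
     cov_deriv_tensor (\<Gamma> \<kappa>) (\<alpha> \<kappa>) x i J = 0)"

definition closed_form ::
    "('a, 'n::finite) chart set \<Rightarrow> nat \<Rightarrow> (('a, 'n) chart \<Rightarrow> real^'n \<Rightarrow> 'n tensor) \<Rightarrow> bool" where
  "closed_form A k \<alpha> \<longleftrightarrow> (\<forall>\<kappa>\<in>A. \<forall>x\<in>chart_img \<kappa>. \<forall>J. length J = Suc k \<longrightarrow>
     ext_d (\<alpha> \<kappa>) x J = 0)"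

definition torsion3 ::
    "(real^'n \<Rightarrow> real^'n^'n) \<Rightarrow> ('n::finite) christoffel \<Rightarrow> (real^'n \<Rightarrow> real^'n) \<Rightarrow>
     (real^'n \<Rightarrow> real^'n) \<Rightarrow> (real^'n \<Rightarrow> real^'n) \<Rightarrow> real^'n \<Rightarrow> real" where
  "torsion3 g C U V W x =
     (cov_deriv C U V x - cov_deriv C V U x - lie_bracket U V x) \<bullet> (g x *v W x)"

definition curvature ::
    "('n::finite) christoffel \<Rightarrow> (real^'n \<Rightarrow> real^'n) \<Rightarrow> (real^'n \<Rightarrow> real^'n) \<Rightarrow>
     (real^'n \<Rightarrow> real^'n) \<Rightarrow> real^'n \<Rightarrow> real^'n" where
  "curvature C U V W x = cov_deriv C U (cov_deriv C V W) x - cov_deriv C V (cov_deriv C U W) x -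
     cov_deriv C (lie_bracket U V) W x"

definition curvature4 ::
    "(real^'n \<Rightarrow> real^'n^'n) \<Rightarrow> ('n::finite) christoffel \<Rightarrow> (real^'n \<Rightarrow> real^'n) \<Rightarrow>
     (real^'n \<Rightarrow> real^'n) \<Rightarrow> (real^'n \<Rightarrow> real^'n) \<Rightarrow> (real^'n \<Rightarrow> real^'n) \<Rightarrow> real^'n \<Rightarrow> real" where
  "curvature4 g C U V W Z x = curvature C U V W x \<bullet> (g x *v Z x)"

section \<open>The characteristic connection\<close>

text \<open>Components on the coordinate fields, which are constant in the chart.\<close>

definition torsion_tensor ::
    "(('a, 7) chart \<Rightarrow> real^7 \<Rightarrow> 7 tensor) \<Rightarrow> (('a, 7) chart \<Rightarrow> 7 christoffel) \<Rightarrow>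
     ('a, 7) chart \<Rightarrow> real^7 \<Rightarrow> 7 tensor" where
  "torsion_tensor \<phi> \<Gamma> \<kappa> x J = torsion3 (metric_field (\<phi> \<kappa>)) (\<Gamma> \<kappa>)
     (\<lambda>_. axis (J ! 0) 1) (\<lambda>_. axis (J ! 1) 1) (\<lambda>_. axis (J ! 2) 1) x"

definition metric_tensor ::
    "(('a, 7) chart \<Rightarrow> real^7 \<Rightarrow> 7 tensor) \<Rightarrow> ('a, 7) chart \<Rightarrow> real^7 \<Rightarrow> 7 tensor" where
  "metric_tensor \<phi> \<kappa> x J = metric_field (\<phi> \<kappa>) x $ (J ! 0) $ (J ! 1)"

text \<open>On an integrable \<open>G\<^sub>2\<close> manifold exactly one connection (on the chart images) satisfies this.\<close>

definition characteristic_connection ::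
    "('a, 7) chart set \<Rightarrow> (('a, 7) chart \<Rightarrow> real^7 \<Rightarrow> 7 tensor) \<Rightarrow>
     (('a, 7) chart \<Rightarrow> 7 christoffel) \<Rightarrow> bool" where
  "characteristic_connection A \<phi> \<Gamma> \<longleftrightarrow> linear_connection A \<Gamma> \<and>
     parallel_tensor A \<Gamma> 2 (metric_tensor \<phi>) \<and> parallel_tensor A \<Gamma> 3 \<phi> \<and>
     (\<forall>\<kappa>\<in>A. \<forall>x\<in>chart_img \<kappa>. alternating 3 (torsion_tensor \<phi> \<Gamma> \<kappa> x))"

text \<open>\<open>R\<^bsub>abij\<^esub> \<phi>\<^bsub>abk\<^esub> = 0\<close> in every orthonormal frame \<open>e\<close> at every point. As the curvature is
  tensorial, the frame vectors may be extended to the constant vector fields of the chart.\<close>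

definition g2_instanton ::
    "('a, 7) chart set \<Rightarrow> (('a, 7) chart \<Rightarrow> real^7 \<Rightarrow> 7 tensor) \<Rightarrow>
     (('a, 7) chart \<Rightarrow> 7 christoffel) \<Rightarrow> bool" where
  "g2_instanton A \<phi> \<Gamma> \<longleftrightarrow> (\<forall>\<kappa>\<in>A. \<forall>x\<in>chart_img \<kappa>. \<forall>e :: 7 \<Rightarrow> real^7.
     (\<forall>a b. e a \<bullet> (metric_field (\<phi> \<kappa>) x *v e b) = (if a = b then 1 else 0)) \<longrightarrow>
     (\<forall>i j k. (\<Sum>a\<in>UNIV. \<Sum>b\<in>UNIV.
        curvature4 (metric_field (\<phi> \<kappa>)) (\<Gamma> \<kappa>) (\<lambda>_. e a) (\<lambda>_. e b) (\<lambda>_. e i) (\<lambda>_. e j) x *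
        tensor_eval 3 (\<phi> \<kappa> x) [e a, e b, e k]) = 0))"

end

theory Submission imports Defs begin

text \<open>
  In a moving adapted frame, the first Bianchi identity together with \<open>dT = 0\<close> becomes
  \<open>R\<^bsub>ijkl\<^esub> + R\<^bsub>iklj\<^esub> + R\<^bsub>iljk\<^esub> = \<nabla>\<^sub>i T\<^bsub>jkl\<^esub>\<close>. If \<open>\<nabla>T = 0\<close>, this forces the pair symmetry
  \<open>R\<^bsub>ijkl\<^esub> = R\<^bsub>klij\<^esub>\<close>; the second pair of indices lies in \<open>\<gg>\<^sub>2\<close> because \<open>\<nabla>\<phi> = 0\<close>, hence so does the first.

  Conversely, let \<open>R\<close> be an instanton. Contracting the second Bianchi identity with \<open>*\<phi>\<close> expresses the
  divergence \<open>\<nabla>\<^sub>m R\<^bsub>mnkl\<^esub>\<close> through \<open>R\<close> itself, and since \<open>e\<^sub>m(\<bar>T\<bar>\<^sup>2) = 6 R\<^bsub>mnkl\<^esub> T\<^bsub>nkl\<^esub>\<close> and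
  \<open>3 R\<^bsub>mnkl\<^esub> \<nabla>\<^sub>m T\<^bsub>nkl\<^esub> = \<bar>\<nabla>T\<bar>\<^sup>2\<close>, one obtains an elliptic equation
  \<open>L \<bar>T\<bar>\<^sup>2 = 2 \<bar>\<nabla>T\<bar>\<^sup>2 \<ge> 0\<close> with \<open>L\<close> without zeroth-order term. By the strong maximum principle \<open>\<bar>T\<bar>\<^sup>2\<close> is
  locally constant near each of its local maxima, on a compact manifold therefore everywhere, and then
  \<open>\<nabla>T = 0\<close>. No integration over \<open>M\<close> is needed.\<close>

section \<open>The model form\<close>

text \<open>The metric is read off from a coframe picked by \<open>SOME\<close>, so nothing about it
  is smooth or invariant until all coframes adapted to the same 3-form are known to give the same
  matrix \<open>transpose E ** E\<close>. After that a smooth local adapted coframe may be used.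
  There \<phi> has the constant components \<open>phi0\<close>; differentiating constants puts
  connection and curvature matrices into g2, and the facts about g2 are finite checks on
  \<open>phi0\<close> and \<open>psi0\<close>. Contraction with the 4-form works because an element
  \<alpha> of g2 satisfies \<alpha>_ij psi_ijnm = -2 \<alpha>_nm: the cyclic sum of derivatives of
  an instanton curvature becomes a divergence, and the other terms contain R undifferentiated.
  Paired with T, they become first derivatives of |T|^2. The factor 6 = 2 * 3 comes from the square
  and from the three cyclic terms of \<nabla>T, which also explain the 3 in 3 R \<nabla>T =
  |\<nabla>T|^2. As |T|^2 may take different values on different components of M, the global
  argument maximises it over the set where it is not locally constant, rather than over M.\<close>

lemma exhaust_7:
  fixes x :: 7
  shows "x = 1 \<or> x = 2 \<or> x = 3 \<or> x = 4 \<or> x = 5 \<or> x = 6 \<or> x = 7"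
proof (induct x)
  case (of_int z)
  then have "z = 0 \<or> z = 1 \<or> z = 2 \<or> z = 3 \<or> z = 4 \<or> z = 5 \<or> z = 6" by fastforce
  then show ?case by auto
qed

lemma forall_7: "(\<forall>i::7. P i) \<longleftrightarrow> P 1 \<and> P 2 \<and> P 3 \<and> P 4 \<and> P 5 \<and> P 6 \<and> P 7"
  by (metis exhaust_7)

lemma UNIV_7: "UNIV = {1, 2, 3, 4, 5, 6, 7::7}"
  using exhaust_7 by auto

lemma sum_7: "sum f (UNIV::7 set) = f 1 + f 2 + f 3 + f 4 + f 5 + f 6 + f 7"
  unfolding UNIV_7 by (simp add: ac_simps)

definition kd :: "'n \<Rightarrow> 'n \<Rightarrow> real" where "kd a b = (if a = b then 1 else 0)"

text \<open>The (a, b, c) component of e_p \<and> e_q \<and> e_r in its own coframe, a 3 by 3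
  determinant of Kronecker deltas. Hence \<open>phi0\<close> is the model form for the identity
  coframe.\<close>

definition alt3 :: "'n \<Rightarrow> 'n \<Rightarrow> 'n \<Rightarrow> 'n \<Rightarrow> 'n \<Rightarrow> 'n \<Rightarrow> real" where
  "alt3 p q r a b c = kd p a * (kd q b * kd r c - kd q c * kd r b)
     + kd p b * (kd q c * kd r a - kd q a * kd r c) + kd p c * (kd q a * kd r b - kd q b * kd r a)"

definition phi0 :: "7 \<Rightarrow> 7 \<Rightarrow> 7 \<Rightarrow> real" where
  "phi0 a b c = alt3 1 2 7 a b c + alt3 1 3 5 a b c - alt3 1 4 6 a b c - alt3 2 3 6 a b c
     - alt3 2 4 5 a b c + alt3 3 4 7 a b c + alt3 5 6 7 a b c"

lemma alt3_cyc: "alt3 p q r b c a = alt3 p q r a b c" by (simp add: alt3_def algebra_simps)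
lemma alt3_swap: "alt3 p q r b a c = - alt3 p q r a b c" by (simp add: alt3_def algebra_simps)

lemma phi0_swap: "phi0 b a c = - phi0 a b c"
  unfolding phi0_def by (simp add: alt3_swap[of _ _ _ b a])
lemma phi0_cyc: "phi0 b c a = phi0 a b c"
  unfolding phi0_def by (simp add: alt3_cyc)
lemma phi0_swap23: "phi0 a c b = - phi0 a b c"
  using phi0_swap[of a c b] phi0_cyc[of c b a] by (metis phi0_cyc phi0_swap)

text \<open>The components of \<open>*\<phi>\<close>, up to sign.\<close>

definition psi0 :: "7 \<Rightarrow> 7 \<Rightarrow> 7 \<Rightarrow> 7 \<Rightarrow> real" where
  "psi0 a b c d = (\<Sum>i\<in>UNIV. phi0 i a b * phi0 i c d) - kd a c * kd b d + kd a d * kd b c"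

lemma psi0_swap12: "psi0 b a c d = - psi0 a b c d"
  unfolding psi0_def by (simp add: phi0_swap23[of _ b a] sum_negf algebra_simps)
lemma psi0_swap34: "psi0 a b d c = - psi0 a b c d"
  unfolding psi0_def by (simp add: phi0_swap23[of _ d c] sum_negf algebra_simps)

lemma kd_same: "kd a a = 1" and kd_other: "a \<noteq> b \<Longrightarrow> kd a b = 0"
  by (simp_all add: kd_def)

text \<open>In effect the multiplication table of the imaginary octonions: for fixed j and k,
  \<open>phi0 i j k\<close> as a function of i is zero or plus or minus a single delta. Written with
  \<open>kd\<close>, it lets \<open>kd_sum\<close> collapse a sum over i at once, which keeps the
  checks over all index tuples small.\<close>

lemma phi0_rows:
  "phi0 i 1 1 = 0" "phi0 i 1 2 = kd 7 i" "phi0 i 1 3 = kd 5 i" "phi0 i 1 4 = - kd 6 i" "phi0 i 1 5 = - kd 3 i" "phi0 i 1 6 = kd 4 i" "phi0 i 1 7 = - kd 2 i"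
  "phi0 i 2 1 = - kd 7 i" "phi0 i 2 2 = 0" "phi0 i 2 3 = - kd 6 i" "phi0 i 2 4 = - kd 5 i" "phi0 i 2 5 = kd 4 i" "phi0 i 2 6 = kd 3 i" "phi0 i 2 7 = kd 1 i"
  "phi0 i 3 1 = - kd 5 i" "phi0 i 3 2 = kd 6 i" "phi0 i 3 3 = 0" "phi0 i 3 4 = kd 7 i" "phi0 i 3 5 = kd 1 i" "phi0 i 3 6 = - kd 2 i" "phi0 i 3 7 = - kd 4 i"
  "phi0 i 4 1 = kd 6 i" "phi0 i 4 2 = kd 5 i" "phi0 i 4 3 = - kd 7 i" "phi0 i 4 4 = 0" "phi0 i 4 5 = - kd 2 i" "phi0 i 4 6 = - kd 1 i" "phi0 i 4 7 = kd 3 i"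
  "phi0 i 5 1 = kd 3 i" "phi0 i 5 2 = - kd 4 i" "phi0 i 5 3 = - kd 1 i" "phi0 i 5 4 = kd 2 i" "phi0 i 5 5 = 0" "phi0 i 5 6 = kd 7 i" "phi0 i 5 7 = - kd 6 i"
  "phi0 i 6 1 = - kd 4 i" "phi0 i 6 2 = - kd 3 i" "phi0 i 6 3 = kd 2 i" "phi0 i 6 4 = kd 1 i" "phi0 i 6 5 = - kd 7 i" "phi0 i 6 6 = 0" "phi0 i 6 7 = kd 5 i"
  "phi0 i 7 1 = kd 2 i" "phi0 i 7 2 = - kd 1 i" "phi0 i 7 3 = kd 4 i" "phi0 i 7 4 = - kd 3 i" "phi0 i 7 5 = kd 6 i" "phi0 i 7 6 = - kd 5 i" "phi0 i 7 7 = 0"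
  by (simp_all add: phi0_def alt3_def kd_same kd_other)

lemma kd_sum: "(\<Sum>i\<in>UNIV. kd (p::'n::finite) i * f i) = f p"
  by (simp add: kd_def if_distrib[of "\<lambda>x. x * _"] cong: if_cong)

text \<open>The definition shows antisymmetry within each pair only. Antisymmetry across the pairs,
  hence total antisymmetry, is the basic identity of the G2 cross product; it is verified for all
  7^4 index tuples.\<close>

lemma psi0_swap23: "psi0 a c b d = - psi0 a b c d"
proof -
  have "\<forall>a b d c. psi0 a c b d = - psi0 a b c d"
    unfolding forall_7 psi0_def
    by (simp add: phi0_rows sum_negf kd_sum kd_same kd_other)
  then show ?thesis by blast
qed

section \<open>Smooth functions\<close>

lemma partial_diff_eqI: "(f has_derivative f') (at x) \<Longrightarrow> partial_diff i f x = f' (axis i 1)"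
  unfolding partial_diff_def by (simp add: frechet_derivative_at[symmetric])

lemma partial_diff_cong:
  assumes "open S" "x \<in> S" "\<And>y. y \<in> S \<Longrightarrow> f y = g y"
  shows "partial_diff i f x = partial_diff i g x"
proof -
  have "(f has_derivative f') (at x) \<longleftrightarrow> (g has_derivative f') (at x)" for f'
    using has_derivative_transform_within_open[OF _ assms(1,2), of f f' UNIV g]
      has_derivative_transform_within_open[OF _ assms(1,2), of g f' UNIV f] assms(3) by auto
  then show ?thesis unfolding partial_diff_def frechet_derivative_def by simp
qed

lemma partial_diff_const: "partial_diff i (\<lambda>y. c) x = 0"
  by (rule partial_diff_eqI[OF has_derivative_const])

lemma partial_diff_add:
  assumes "f differentiable (at x)" "g differentiable (at x)"
  shows "partial_diff i (\<lambda>y. f y + g y) x = partial_diff i f x + partial_diff i g x"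
proof -
  obtain f' g' where d: "(f has_derivative f') (at x)" "(g has_derivative g') (at x)"
    using assms unfolding differentiable_def by blast
  show ?thesis
    using partial_diff_eqI[OF has_derivative_add[OF d], of i] partial_diff_eqI[OF d(1), of i]
      partial_diff_eqI[OF d(2), of i] by simp
qed

lemma partial_diff_mult:
  assumes "f differentiable (at x)" "g differentiable (at x)"
  shows "partial_diff i (\<lambda>y. f y * g y) x = partial_diff i f x * g x + f x * partial_diff i g x"
proof -
  obtain f' g' where d: "(f has_derivative f') (at x)" "(g has_derivative g') (at x)"
    using assms unfolding differentiable_def by blast
  show ?thesis
    using partial_diff_eqI[OF has_derivative_mult[OF d], of i] partial_diff_eqI[OF d(1), of i]
      partial_diff_eqI[OF d(2), of i] by simp
qed

lemma partial_diff_sum: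
  assumes "finite A" "\<And>a. a \<in> A \<Longrightarrow> f a differentiable (at x)"
  shows "partial_diff i (\<lambda>y. \<Sum>a\<in>A. f a y) x = (\<Sum>a\<in>A. partial_diff i (f a) x)"
  using assms
proof (induction A)
  case empty
  then show ?case by (simp add: partial_diff_const)
next
  case (insert a A)
  have "(\<lambda>y. \<Sum>a\<in>A. f a y) differentiable (at x)"
    by (rule differentiable_sum) (use insert in auto)
  then show ?case using insert by (simp add: partial_diff_add)
qed

lemma partial_diff_uminus:
  assumes "f differentiable (at x)"
  shows "partial_diff i (\<lambda>y. - f y) x = - partial_diff i f x"
  using partial_diff_mult[of "\<lambda>_. -1" x f i] assms by (simp add: partial_diff_const)

lemma partial_diff_diff:
  assumes "f differentiable (at x)" "g differentiable (at x)"
  shows "partial_diff i (\<lambda>y. f y - g y) x = partial_diff i f x - partial_diff i g x"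
  using partial_diff_add[of f x "\<lambda>y. - g y" i] partial_diff_uminus[of g x i] assms by simp

section \<open>Closure properties of smooth functions\<close>

lemma Ck_on_Suc_imp: "Ck_on (Suc k) S f \<Longrightarrow> Ck_on k S f"
proof (induction k arbitrary: f)
  case 0
  then show ?case by (simp add: differentiable_imp_continuous_on)
next
  case (Suc k)
  then show ?case by simp
qed

lemma smooth_on_partial:
  assumes "smooth_on S f" shows "smooth_on S (partial_diff i f)"
  unfolding smooth_on_def
proof
  fix k
  have "Ck_on (Suc k) S f" using assms unfolding smooth_on_def by blast
  then show "Ck_on k S (partial_diff i f)" by simp
qed

lemma smooth_on_differentiable: "smooth_on S f \<Longrightarrow> open S \<Longrightarrow> x \<in> S \<Longrightarrow> f differentiable (at x)"
proof -
  assume f: "smooth_on S f" and S: "open S" and x: "x \<in> S"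
  have "Ck_on (Suc 0) S f" using f unfolding smooth_on_def by blast
  then have "f differentiable (at x within S)" using x by (simp add: differentiable_on_def)
  then show ?thesis by (simp add: at_within_open[OF x S])
qed

lemma smooth_on_continuous_on:
  assumes "smooth_on S f" shows "continuous_on S f"
proof -
  have "Ck_on 0 S f" using assms unfolding smooth_on_def by blast
  then show ?thesis by simp
qed

text \<open>The rules for \<open>partial_diff\<close> hold at points of differentiability, so they
  identify partial derivatives on S and not as functions on the whole space; this lemma bridges the
  difference.\<close>

lemma Ck_on_cong:
  assumes "open S" "\<And>y. y \<in> S \<Longrightarrow> f y = g y" "Ck_on k S f"
  shows "Ck_on k S g"
  using assms(2,3)
proof (induction k arbitrary: f g)
  case 0
  then show ?case using continuous_on_cong[of S S f g] by simp
next
  case (Suc k)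
  have "g differentiable (at x within S)" if "x \<in> S" for x
  proof (rule differentiable_transform_within[of f x S 1])
    show "f differentiable (at x within S)"
      using Suc.prems(2) that by (simp add: differentiable_on_def)
  qed (use that Suc.prems(1) in auto)
  then have "g differentiable_on S" by (simp add: differentiable_on_def)
  moreover have "Ck_on k S (partial_diff i g)" for i
  proof (rule Suc.IH)
    show "Ck_on k S (partial_diff i f)" using Suc.prems(2) by simp
    show "partial_diff i f y = partial_diff i g y" if "y \<in> S" for y
      by (rule partial_diff_cong[OF assms(1) that]) (rule Suc.prems(1))
  qed
  ultimately show ?case by simp
qed

lemma smooth_on_cong: "open S \<Longrightarrow> smooth_on S f \<Longrightarrow> (\<And>y. y \<in> S \<Longrightarrow> f y = g y) \<Longrightarrow> smooth_on S g"
  by (auto simp: smooth_on_def intro: Ck_on_cong)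

lemma Ck_on_subset: "Ck_on k S f \<Longrightarrow> U \<subseteq> S \<Longrightarrow> Ck_on k U f"
proof (induction k arbitrary: f)
  case 0
  then show ?case using continuous_on_subset by (metis Ck_on.simps(1))
next
  case (Suc k)
  have "f differentiable_on U" using Suc.prems differentiable_on_subset[of f S U] by simp
  then show ?case using Suc by simp
qed

lemma smooth_on_subset: "smooth_on S f \<Longrightarrow> U \<subseteq> S \<Longrightarrow> smooth_on U f"
  by (auto simp: smooth_on_def intro: Ck_on_subset)

lemma Ck_on_const:
  fixes S :: "(real^'n) set"
  shows "Ck_on k S (\<lambda>_. c)"
proof (induction k arbitrary: c)
  case (Suc k)
  have "partial_diff i (\<lambda>_::real^'n. c) = (\<lambda>_. 0)" for i by (rule ext) (rule partial_diff_const)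
  then show ?case using Suc by (simp add: differentiable_on_def)
qed simp

lemma smooth_on_const: "smooth_on S (\<lambda>_. c)"
  by (simp add: smooth_on_def Ck_on_const)

lemma Ck_on_add:
  assumes "open S" "Ck_on k S f" "Ck_on k S g"
  shows "Ck_on k S (\<lambda>y. f y + g y)"
  using assms(2,3)
proof (induction k arbitrary: f g)
  case 0
  then show ?case by (simp add: continuous_on_add)
next
  case (Suc k)
  have d: "f differentiable (at x)" "g differentiable (at x)" if "x \<in> S" for x
  proof -
    have "f differentiable (at x within S)" "g differentiable (at x within S)"
      using Suc.prems that by (simp_all add: differentiable_on_def)
    then show "f differentiable (at x)" "g differentiable (at x)"
      by (simp_all add: at_within_open[OF that assms(1)])
  qed
  have "Ck_on k S (partial_diff i (\<lambda>y. f y + g y))" for i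
    by (rule Ck_on_cong[OF assms(1) _ Suc.IH[of "partial_diff i f" "partial_diff i g"]])
      (use Suc.prems partial_diff_add[OF d] in auto)
  then show ?case using Suc.prems by (simp add: differentiable_on_def differentiable_add)
qed

lemma Ck_on_mult:
  assumes "open S" "Ck_on k S f" "Ck_on k S g"
  shows "Ck_on k S (\<lambda>y. f y * g y)"
  using assms(2,3)
proof (induction k arbitrary: f g)
  case 0
  then show ?case by (simp add: continuous_on_mult)
next
  case (Suc k)
  have d: "f differentiable (at x)" "g differentiable (at x)" if "x \<in> S" for x
  proof -
    have "f differentiable (at x within S)" "g differentiable (at x within S)"
      using Suc.prems that by (simp_all add: differentiable_on_def)
    then show "f differentiable (at x)" "g differentiable (at x)"
      by (simp_all add: at_within_open[OF that assms(1)])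
  qed
  have k: "Ck_on k S f" "Ck_on k S g" using Suc.prems Ck_on_Suc_imp by blast+
  have "Ck_on k S (partial_diff i (\<lambda>y. f y * g y))" for i
    by (rule Ck_on_cong[OF assms(1) _ Ck_on_add[OF assms(1) Suc.IH[of "partial_diff i f" g]
          Suc.IH[of f "partial_diff i g"]]])
      (use Suc.prems k partial_diff_mult[OF d] in auto)
  then show ?case using Suc.prems by (simp add: differentiable_on_def differentiable_mult)
qed

lemma smooth_on_add: "open S \<Longrightarrow> smooth_on S f \<Longrightarrow> smooth_on S g \<Longrightarrow> smooth_on S (\<lambda>y. f y + g y)"
  by (simp add: smooth_on_def Ck_on_add)
lemma smooth_on_mult: "open S \<Longrightarrow> smooth_on S f \<Longrightarrow> smooth_on S g \<Longrightarrow> smooth_on S (\<lambda>y. f y * g y)"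
  by (simp add: smooth_on_def Ck_on_mult)
lemma smooth_on_uminus: "open S \<Longrightarrow> smooth_on S f \<Longrightarrow> smooth_on S (\<lambda>y. - f y)"
  using smooth_on_mult[of S "\<lambda>_. -1" f, OF _ smooth_on_const] by simp
lemma smooth_on_diff: "open S \<Longrightarrow> smooth_on S f \<Longrightarrow> smooth_on S g \<Longrightarrow> smooth_on S (\<lambda>y. f y - g y)"
  using smooth_on_add[of S f "\<lambda>y. - g y", OF _ _ smooth_on_uminus] by simp
lemma smooth_on_sum: "open S \<Longrightarrow> (\<And>a. a \<in> A \<Longrightarrow> smooth_on S (f a)) \<Longrightarrow> smooth_on S (\<lambda>y. \<Sum>a\<in>A. f a y)"
  by (induction A rule: infinite_finite_induct) (auto intro: smooth_on_const smooth_on_add)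
lemma smooth_on_prod: "open S \<Longrightarrow> (\<And>a. a \<in> A \<Longrightarrow> smooth_on S (f a)) \<Longrightarrow> smooth_on S (\<lambda>y. \<Prod>a\<in>A. f a y)"
  by (induction A rule: infinite_finite_induct) (auto intro: smooth_on_const smooth_on_mult)

text \<open>Induction on k: the derivative of 1/f is minus the product of the derivative of f and
  two copies of 1/f, so the order of differentiability of 1/f rises by one.\<close>

lemma smooth_on_inverse:
  assumes S: "open S" and f: "smooth_on S f" and nz: "\<And>x. x \<in> S \<Longrightarrow> f x \<noteq> 0"
  shows "smooth_on S (\<lambda>y. inverse (f y))"
proof -
  have "Ck_on k S (\<lambda>y. inverse (f y))" for k
  proof (induction k)
    case 0
    then show ?case using smooth_on_continuous_on[OF f] nz by (simp add: continuous_on_inverse)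
  next
    case (Suc k)
    have d: "((\<lambda>y. inverse (f y)) has_derivative (\<lambda>h. - (inverse (f x) * f' h * inverse (f x)))) (at x)"
      if "x \<in> S" "(f has_derivative f') (at x)" for x f'
      by (rule Deriv.has_derivative_inverse) (use that nz in auto)
    have pd: "partial_diff i (\<lambda>y. inverse (f y)) x = - (inverse (f x) * partial_diff i f x * inverse (f x))"
      if xS: "x \<in> S" for x i
    proof -
      obtain f' where f': "(f has_derivative f') (at x)"
        using smooth_on_differentiable[OF f S xS] unfolding differentiable_def by blast
      show ?thesis using partial_diff_eqI[OF d[OF xS f'], of i] partial_diff_eqI[OF f', of i] by simp
    qed
    have "Ck_on k S (partial_diff i (\<lambda>y. inverse (f y)))" for i
    proof (rule Ck_on_cong[OF S])
      show "Ck_on k S (\<lambda>x. (- 1) * (inverse (f x) * partial_diff i f x * inverse (f x)))"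
        by (intro Ck_on_mult S Ck_on_const Suc) (use smooth_on_partial[OF f] in \<open>simp add: smooth_on_def\<close>)
    qed (simp add: pd)
    moreover have "(\<lambda>y. inverse (f y)) differentiable_on S"
      unfolding differentiable_on_def
    proof
      fix x assume x: "x \<in> S"
      obtain f' where f': "(f has_derivative f') (at x)"
        using smooth_on_differentiable[OF f S x] unfolding differentiable_def by blast
      show "(\<lambda>y. inverse (f y)) differentiable (at x within S)"
        unfolding differentiable_def at_within_open[OF x S] using d[OF x f'] by blast
    qed
    ultimately show ?case by simp
  qed
  then show ?thesis by (simp add: smooth_on_def)
qed

lemma smooth_on_det:
  fixes M :: "real^'m \<Rightarrow> real^'n^'n"
  assumes S: "open S" and "\<And>i j. smooth_on S (\<lambda>y. M y $ i $ j)"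
  shows "smooth_on S (\<lambda>y. det (M y))"
  unfolding det_def by (intro smooth_on_sum smooth_on_mult smooth_on_prod smooth_on_const S assms)

lemma matrix_inv_mult:
  assumes "invertible E"
  shows "E ** matrix_inv E = mat 1" "matrix_inv E ** E = mat 1"
proof -
  from assms have "\<exists>A'. E ** A' = mat 1 \<and> A' ** E = mat 1" unfolding invertible_def .
  from someI_ex[OF this] show "E ** matrix_inv E = mat 1" "matrix_inv E ** E = mat 1"
    unfolding matrix_inv_def by blast+
qed

text \<open>Cramer's rule for the equation E v = e_j. An entry of the inverse is a quotient of
  determinants and so depends smoothly on the entries of E.\<close>

lemma matrix_inv_entry:
  fixes E :: "real^'n^'n"
  assumes "invertible E"
  shows "matrix_inv E $ i $ j = det (\<chi> a b. if b = i then (if a = j then 1 else 0) else E $ a $ b) * inverse (det E)"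
proof -
  let ?v = "matrix_inv E *v axis j 1"
  have inv: "E ** matrix_inv E = mat 1" using matrix_inv_mult(1)[OF assms] .
  have Ev: "E *v ?v = axis j 1" by (simp add: matrix_vector_mul_assoc inv)
  have dz: "det E \<noteq> 0" using assms invertible_det_nz by blast
  from Ev have "?v = (\<chi> k. det (\<chi> a b. if b = k then axis j 1 $ a else E $ a $ b) / det E)"
    using cramer[OF dz, of ?v "axis j 1"] by blast
  then have "?v $ i = det (\<chi> a b. if b = i then axis j 1 $ a else E $ a $ b) / det E" by simp
  moreover have "?v $ i = matrix_inv E $ i $ j"
    by (simp add: matrix_vector_mult_def axis_def if_distrib cong: if_cong)
  moreover have "(\<chi> a b. if b = i then axis j 1 $ a else E $ a $ b) = (\<chi> a b. if b = i then (if a = j then 1 else 0) else E $ a $ b)"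
    by (simp add: vec_eq_iff axis_def eq_commute)
  ultimately show ?thesis by (simp add: divide_inverse)
qed

lemma smooth_on_matrix_inv:
  fixes M :: "real^'m \<Rightarrow> real^'n^'n"
  assumes S: "open S" and M: "\<And>i j. smooth_on S (\<lambda>y. M y $ i $ j)" and inv: "\<And>y. y \<in> S \<Longrightarrow> invertible (M y)"
  shows "smooth_on S (\<lambda>y. matrix_inv (M y) $ i $ j)"
proof (rule smooth_on_cong[OF S])
  show "smooth_on S (\<lambda>y. det (\<chi> a b. if b = i then (if a = j then 1 else 0) else M y $ a $ b) * inverse (det (M y)))"
  proof (intro smooth_on_mult smooth_on_inverse smooth_on_det S M)
    show "smooth_on S (\<lambda>y. (\<chi> a b. if b = i then (if a = j then 1 else 0) else M y $ a $ b) $ a $ b)" for a b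
      using M by (cases "b = i") (auto intro: smooth_on_const)
    show "det (M y) \<noteq> 0" if "y \<in> S" for y using inv[OF that] invertible_det_nz by blast
  qed
qed (simp add: matrix_inv_entry inv)

section \<open>Mixed partial derivatives and the second derivative test\<close>

lemma partial_diff_line:
  fixes f :: "real^'n \<Rightarrow> real"
  assumes "f differentiable (at (x + t *\<^sub>R axis i 1))"
  shows "((\<lambda>s. f (x + s *\<^sub>R axis i 1)) has_real_derivative partial_diff i f (x + t *\<^sub>R axis i 1)) (at t)"
proof -
  obtain f' where f': "(f has_derivative f') (at (x + t *\<^sub>R axis i 1))"
    using assms unfolding differentiable_def by blast
  have "((\<lambda>s. x + s *\<^sub>R axis i 1) has_derivative (\<lambda>h. h *\<^sub>R axis i 1)) (at t)"
    by (auto intro!: derivative_eq_intros)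
  from has_derivative_compose[OF this f']
  have "((\<lambda>s. f (x + s *\<^sub>R axis i 1)) has_derivative (\<lambda>h. f' (h *\<^sub>R axis i 1))) (at t)" .
  moreover have "f' (h *\<^sub>R axis i 1) = partial_diff i f (x + t *\<^sub>R axis i 1) * h" for h
    using linear_scale[OF has_derivative_linear[OF f']] partial_diff_eqI[OF f', of i] by simp
  ultimately show ?thesis by (simp add: has_field_derivative_def)
qed

text \<open>The mean value theorem is used twice: in direction i for the difference of f in
  direction j, then in direction j for the i-th partial derivative. Two steps of length at most h
  stay in the ball of radius 3 h.\<close>

lemma second_difference_mvt:
  fixes f :: "real^'n \<Rightarrow> real"
  assumes h: "h > 0"
    and d1: "\<And>y. y \<in> ball x (3 * h) \<Longrightarrow> f differentiable (at y)"
    and d2: "\<And>y. y \<in> ball x (3 * h) \<Longrightarrow> partial_diff i f differentiable (at y)"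
  shows "\<exists>y\<in>ball x (3 * h). f (x + h *\<^sub>R axis i 1 + h *\<^sub>R axis j 1) - f (x + h *\<^sub>R axis i 1)
    - f (x + h *\<^sub>R axis j 1) + f x = h * h * partial_diff j (partial_diff i f) y"
proof -
  let ?i = "axis i 1 :: real^'n" and ?j = "axis j 1 :: real^'n"
  have nrm: "x + s *\<^sub>R ?i + t *\<^sub>R ?j \<in> ball x (3 * h)" if "0 \<le> s" "s \<le> h" "0 \<le> t" "t \<le> h" for s t
  proof -
    have "norm (s *\<^sub>R ?i + t *\<^sub>R ?j) \<le> s + t"
      using norm_triangle_ineq[of "s *\<^sub>R ?i" "t *\<^sub>R ?j"] that by (simp add: norm_axis_1)
    moreover have "dist x (x + s *\<^sub>R ?i + t *\<^sub>R ?j) = norm (s *\<^sub>R ?i + t *\<^sub>R ?j)"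
      by (simp add: dist_norm add.assoc norm_minus_commute) (simp add: add.commute)
    ultimately have "dist x (x + s *\<^sub>R ?i + t *\<^sub>R ?j) < 3 * h" using that h by linarith
    then show ?thesis by simp
  qed
  define g where "g s = f (x + h *\<^sub>R ?j + s *\<^sub>R ?i) - f (x + s *\<^sub>R ?i)" for s
  have "\<exists>s>0. s < h \<and> g h - g 0 = (h - 0) * (partial_diff i f (x + h *\<^sub>R ?j + s *\<^sub>R ?i) - partial_diff i f (x + s *\<^sub>R ?i))"
  proof (rule MVT2[OF h])
    fix s assume s: "0 \<le> s" "s \<le> h"
    show "DERIV g s :> partial_diff i f (x + h *\<^sub>R ?j + s *\<^sub>R ?i) - partial_diff i f (x + s *\<^sub>R ?i)"
      unfolding g_def
    proof (rule DERIV_diff)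
      show "DERIV (\<lambda>s. f (x + h *\<^sub>R ?j + s *\<^sub>R ?i)) s :> partial_diff i f (x + h *\<^sub>R ?j + s *\<^sub>R ?i)"
        by (rule partial_diff_line[OF d1]) (use nrm[of s h] s h in \<open>simp add: algebra_simps\<close>)
      show "DERIV (\<lambda>s. f (x + s *\<^sub>R ?i)) s :> partial_diff i f (x + s *\<^sub>R ?i)"
        by (rule partial_diff_line[OF d1]) (use nrm[of s 0] s h in \<open>simp add: algebra_simps\<close>)
    qed
  qed
  then obtain s where s: "0 < s" "s < h"
    "g h - g 0 = h * (partial_diff i f (x + h *\<^sub>R ?j + s *\<^sub>R ?i) - partial_diff i f (x + s *\<^sub>R ?i))" by auto
  have "\<exists>t>0. t < h \<and> partial_diff i f (x + s *\<^sub>R ?i + h *\<^sub>R ?j) - partial_diff i f (x + s *\<^sub>R ?i + 0 *\<^sub>R ?j)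
      = (h - 0) * partial_diff j (partial_diff i f) (x + s *\<^sub>R ?i + t *\<^sub>R ?j)"
    by (rule MVT2[OF h], rule partial_diff_line, rule d2) (use nrm s in auto)
  then obtain t where t: "0 < t" "t < h" "partial_diff i f (x + s *\<^sub>R ?i + h *\<^sub>R ?j) - partial_diff i f (x + s *\<^sub>R ?i)
      = h * partial_diff j (partial_diff i f) (x + s *\<^sub>R ?i + t *\<^sub>R ?j)" by auto
  have e: "x + h *\<^sub>R ?j + s *\<^sub>R ?i = x + s *\<^sub>R ?i + h *\<^sub>R ?j" for s by (simp add: algebra_simps)
  have "f (x + h *\<^sub>R ?i + h *\<^sub>R ?j) - f (x + h *\<^sub>R ?i) - f (x + h *\<^sub>R ?j) + f x = g h - g 0"
    unfolding g_def e by simp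
  also have "\<dots> = h * h * partial_diff j (partial_diff i f) (x + s *\<^sub>R ?i + t *\<^sub>R ?j)"
    unfolding s(3) e t(3) by simp
  finally show ?thesis using nrm[of s t] s t by (intro bexI[of _ "x + s *\<^sub>R ?i + t *\<^sub>R ?j"]) auto
qed

text \<open>The second difference is symmetric in i and j, so by
  \<open>second_difference_mvt\<close> the two mixed derivatives share a value in every small ball
  around x; their continuity at x does the rest.\<close>

lemma partial_diff_commute:
  fixes f :: "real^'n \<Rightarrow> real"
  assumes S: "open S" and f: "smooth_on S f" and x: "x \<in> S"
  shows "partial_diff i (partial_diff j f) x = partial_diff j (partial_diff i f) x"
proof (rule ccontr)
  let ?A = "partial_diff i (partial_diff j f)" and ?B = "partial_diff j (partial_diff i f)"
  assume ne: "?A x \<noteq> ?B x"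
  define e where "e = \<bar>?A x - ?B x\<bar> / 2"
  have e: "e > 0" using ne by (simp add: e_def)
  have c: "isCont ?A x" "isCont ?B x"
    using smooth_on_continuous_on[OF smooth_on_partial[OF smooth_on_partial[OF f]]] S x
    by (auto simp: continuous_on_eq_continuous_at)
  obtain d1 where d1: "d1 > 0" "\<And>y. dist y x < d1 \<Longrightarrow> dist (?A y) (?A x) < e"
    using c(1) e unfolding continuous_at_eps_delta by blast
  obtain d2 where d2: "d2 > 0" "\<And>y. dist y x < d2 \<Longrightarrow> dist (?B y) (?B x) < e"
    using c(2) e unfolding continuous_at_eps_delta by blast
  obtain d3 where d3: "d3 > 0" "ball x d3 \<subseteq> S" using S x open_contains_ball by blast
  define h where "h = min d1 (min d2 d3) / 3"
  have h: "h > 0" using d1 d2 d3 by (simp add: h_def)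
  have sub: "ball x (3 * h) \<subseteq> ball x d1" "ball x (3 * h) \<subseteq> ball x d2" "ball x (3 * h) \<subseteq> S"
    using d3 by (auto simp: h_def)
  have diff: "f differentiable (at y)" "partial_diff k f differentiable (at y)" if "y \<in> ball x (3 * h)" for y k
    using smooth_on_differentiable[OF f S] smooth_on_differentiable[OF smooth_on_partial[OF f] S] sub that by auto
  obtain y where y: "y \<in> ball x (3 * h)" "f (x + h *\<^sub>R axis j 1 + h *\<^sub>R axis i 1) - f (x + h *\<^sub>R axis j 1)
    - f (x + h *\<^sub>R axis i 1) + f x = h * h * ?A y"
    using second_difference_mvt[OF h, of x f j i] diff by blast
  obtain z where z: "z \<in> ball x (3 * h)" "f (x + h *\<^sub>R axis i 1 + h *\<^sub>R axis j 1) - f (x + h *\<^sub>R axis i 1)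
    - f (x + h *\<^sub>R axis j 1) + f x = h * h * ?B z"
    using second_difference_mvt[OF h, of x f i j] diff by blast
  have "h * h * ?A y = h * h * ?B z" using y(2) z(2) by (simp add: algebra_simps)
  then have "?A y = ?B z" using h by simp
  moreover have "dist (?A y) (?A x) < e" "dist (?B z) (?B x) < e"
    using d1(2)[of y] d2(2)[of z] y(1) z(1) sub by (auto simp: dist_commute)
  ultimately show False unfolding e_def dist_real_def by argo
qed

lemma has_derivative_partial:
  assumes "f differentiable (at x)"
  shows "(f has_derivative (\<lambda>v. \<Sum>i\<in>UNIV. v $ i * partial_diff i f x)) (at x)"
proof -
  obtain f' where f': "(f has_derivative f') (at x)" using assms unfolding differentiable_def by blast
  have "f' v = (\<Sum>i\<in>UNIV. v $ i * partial_diff i f x)" for v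
  proof -
    have "f' v = f' (\<Sum>i\<in>UNIV. (v $ i) *\<^sub>R axis i 1)"
      using basis_expansion[of v] by (simp add: scalar_mult_eq_scaleR)
    also have "\<dots> = (\<Sum>i\<in>UNIV. v $ i * f' (axis i 1))"
      using has_derivative_linear[OF f'] by (simp add: linear_sum linear_scale)
    finally show ?thesis using partial_diff_eqI[OF f'] by simp
  qed
  then have "f' = (\<lambda>v. \<Sum>i\<in>UNIV. v $ i * partial_diff i f x)" by blast
  then show ?thesis using f' by simp
qed

lemma partial_diff_coord: "partial_diff j (\<lambda>x::real^'n. x $ i) x = (if i = j then 1 else 0)"
  by (subst partial_diff_eqI[OF bounded_linear_imp_has_derivative[OF bounded_linear_vec_nth]]) (auto simp: axis_def)

lemma smooth_on_coord: "smooth_on S (\<lambda>x::real^'n. x $ i)"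
proof -
  have p: "partial_diff j (\<lambda>x::real^'n. x $ i) = (\<lambda>_. if i = j then 1 else 0)" for j
    by (rule ext) (rule partial_diff_coord)
  have "(\<lambda>x::real^'n. x $ i) differentiable_on S"
    by (rule differentiable_at_imp_differentiable_on)
      (rule bounded_linear_imp_differentiable[OF bounded_linear_vec_nth])
  then have "Ck_on k S (\<lambda>x::real^'n. x $ i)" for k
    by (cases k) (auto simp: p Ck_on_const intro!: continuous_intros)
  then show ?thesis by (simp add: smooth_on_def)
qed

lemma partial_diff_exp:
  assumes "f differentiable (at x)"
  shows "partial_diff i (\<lambda>y. exp (f y)) x = partial_diff i f x * exp (f x)"
proof -
  obtain f' where f': "(f has_derivative f') (at x)" using assms unfolding differentiable_def by blast
  have "((\<lambda>y. exp (f y)) has_derivative (\<lambda>v. f' v * exp (f x))) (at x)"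
    using f' by (auto intro!: derivative_eq_intros)
  then show ?thesis using partial_diff_eqI[OF f', of i] partial_diff_eqI by fastforce
qed

lemma smooth_on_exp:
  assumes S: "open S" and f: "smooth_on S f"
  shows "smooth_on S (\<lambda>y. exp (f y))"
proof -
  have "Ck_on k S (\<lambda>y. exp (f y))" for k
  proof (induction k)
    case 0
    then show ?case using smooth_on_continuous_on[OF f] by (simp add: continuous_on_exp)
  next
    case (Suc k)
    have "Ck_on k S (partial_diff i (\<lambda>y. exp (f y)))" for i
    proof (rule Ck_on_cong[OF S])
      show "Ck_on k S (\<lambda>x. partial_diff i f x * exp (f x))"
        by (intro Ck_on_mult S Suc) (use smooth_on_partial[OF f] in \<open>simp add: smooth_on_def\<close>)
      show "partial_diff i f y * exp (f y) = partial_diff i (\<lambda>y. exp (f y)) y" if "y \<in> S" for y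
        using partial_diff_exp[OF smooth_on_differentiable[OF f S that]] by simp
    qed
    moreover have "(\<lambda>y. exp (f y)) differentiable (at x)" if xS: "x \<in> S" for x
    proof -
      obtain f' where f': "(f has_derivative f') (at x)"
        using smooth_on_differentiable[OF f S xS] unfolding differentiable_def by blast
      have "((\<lambda>y. exp (f y)) has_derivative (\<lambda>v. f' v * exp (f x))) (at x)"
        using f' by (auto intro!: derivative_eq_intros)
      then show ?thesis unfolding differentiable_def by blast
    qed
    then have "(\<lambda>y. exp (f y)) differentiable_on S"
      by (simp add: differentiable_at_imp_differentiable_on)
    ultimately show ?case by simp
  qed
  then show ?thesis by (simp add: smooth_on_def)
qed

text \<open>Reduction to one variable along z + t w. A positive second derivative would make the
  first derivative positive to the right of 0, and the mean value theorem would produce a value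
  above the maximum.\<close>

lemma local_max_second_derivative:
  fixes v :: "real^'n \<Rightarrow> real"
  assumes W: "open W" and v: "smooth_on W v" and z: "z \<in> W"
    and d: "d > 0" "\<And>y. y \<in> ball z d \<Longrightarrow> v y \<le> v z"
  shows "(\<Sum>i\<in>UNIV. w $ i * partial_diff i v z) = 0"
    and "(\<Sum>i\<in>UNIV. \<Sum>j\<in>UNIV. w $ i * w $ j * partial_diff j (partial_diff i v) z) \<le> 0"
proof -
  obtain d1 where d1: "d1 > 0" "ball z d1 \<subseteq> W" using W z open_contains_ball by blast
  \<comment> \<open>The summand 1 covers the case w = 0.\<close>
  define r where "r = min d d1 / (norm w + 1)"
  have nw: "norm w + 1 > 0" by (smt (verit) norm_ge_zero)
  have r: "r > 0" using d(1) d1(1) nw by (simp add: r_def)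
  have inb: "z + t *\<^sub>R w \<in> ball z d" "z + t *\<^sub>R w \<in> W" if "\<bar>t\<bar> < r" for t
  proof -
    have "dist z (z + t *\<^sub>R w) = \<bar>t\<bar> * norm w" by (simp add: dist_norm)
    also have "\<dots> \<le> \<bar>t\<bar> * (norm w + 1)" by (simp add: mult_left_mono)
    also have "\<dots> < min d d1" using that nw by (simp add: r_def less_divide_eq)
    finally show "z + t *\<^sub>R w \<in> ball z d" "z + t *\<^sub>R w \<in> W" using d1(2) by auto
  qed
  have line: "((\<lambda>t. f (z + t *\<^sub>R w)) has_real_derivative (\<Sum>i\<in>UNIV. w $ i * partial_diff i f (z + t *\<^sub>R w))) (at t)"
    if "\<bar>t\<bar> < r" "smooth_on W f" for f t
  proof -
    have "((\<lambda>t. z + t *\<^sub>R w) has_derivative (\<lambda>h. h *\<^sub>R w)) (at t)"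
      by (auto intro!: derivative_eq_intros)
    from has_derivative_compose[OF this has_derivative_partial[OF smooth_on_differentiable[OF that(2) W inb(2)[OF that(1)]]]]
    show ?thesis unfolding has_field_derivative_def
      by (rule has_derivative_eq_rhs) (auto simp: sum_distrib_right sum_distrib_left mult_ac fun_eq_iff)
  qed
  define g where "g t = v (z + t *\<^sub>R w)" for t
  define g1 where "g1 t = (\<Sum>i\<in>UNIV. w $ i * partial_diff i v (z + t *\<^sub>R w))" for t
  have Dg: "DERIV g t :> g1 t" if "\<bar>t\<bar> < r" for t
    using line[OF that v] by (simp add: g_def[abs_def] g1_def)
  have Dg1: "DERIV g1 0 :> (\<Sum>i\<in>UNIV. w $ i * (\<Sum>j\<in>UNIV. w $ j * partial_diff j (partial_diff i v) z))"
    unfolding g1_def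
    by (rule DERIV_sum, rule DERIV_cmult)
      (use line[of 0, OF _ smooth_on_partial[OF v]] r in simp)
  have gmax: "g t \<le> g 0" if "\<bar>t\<bar> < r" for t using d(2)[OF inb(1)[OF that]] by (simp add: g_def)
  have g10: "g1 0 = 0"
    using DERIV_local_max[OF Dg[of 0] r] gmax r by auto
  then show "(\<Sum>i\<in>UNIV. w $ i * partial_diff i v z) = 0" by (simp add: g1_def)
  have "(\<Sum>i\<in>UNIV. w $ i * (\<Sum>j\<in>UNIV. w $ j * partial_diff j (partial_diff i v) z)) \<le> 0"
  proof (rule ccontr)
    assume "\<not> ?thesis"
    then obtain e where e: "e > 0" "\<And>h. 0 < h \<Longrightarrow> h < e \<Longrightarrow> g1 0 < g1 h"
      using DERIV_pos_inc_right[OF Dg1] by auto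
    define h where "h = min e r / 2"
    have h: "0 < h" "h < e" "h < r" using e r by (auto simp: h_def)
    obtain s where s: "0 < s" "s < h" "g h - g 0 = (h - 0) * g1 s"
      using MVT2[OF h(1), of g g1] Dg h by auto
    have "g1 s > 0" using e(2)[of s] s h g10 by auto
    then have "g h > g 0" using s(3) h(1) by (smt (verit) mult_pos_pos)
    then show False using gmax[of h] h by auto
  qed
  then show "(\<Sum>i\<in>UNIV. \<Sum>j\<in>UNIV. w $ i * w $ j * partial_diff j (partial_diff i v) z) \<le> 0"
    by (simp add: sum_distrib_left mult.assoc)
qed

section \<open>The strong maximum principle\<close>

text \<open>The barrier of Hopf's lemma.\<close>

definition bump :: "real \<Rightarrow> real^'n \<Rightarrow> real^'n \<Rightarrow> real" where
  "bump \<alpha> c x = exp (- \<alpha> * (\<Sum>i\<in>UNIV. (x $ i - c $ i) * (x $ i - c $ i)))"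

lemma bump_eq: "bump \<alpha> c x = exp (- \<alpha> * (norm (x - c))\<^sup>2)"
  unfolding bump_def power2_norm_eq_inner inner_vec_def by simp

lemma smooth_on_bump: "smooth_on UNIV (bump \<alpha> c)"
  unfolding bump_def[abs_def]
  by (intro smooth_on_exp smooth_on_mult smooth_on_sum smooth_on_diff smooth_on_const smooth_on_coord open_UNIV)

lemma partial_diff_bump:
  fixes c :: "real^'n"
  shows "partial_diff i (bump \<alpha> c) = (\<lambda>x. (- 2 * \<alpha>) * ((x $ i - c $ i) * bump \<alpha> c x))"
proof
  fix x :: "real^'n"
  have d: "(\<lambda>y::real^'n. y $ k - c $ k) differentiable (at x)" for k
    by (rule smooth_on_differentiable[of UNIV]) (intro smooth_on_diff smooth_on_const smooth_on_coord open_UNIV UNIV_I)+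
  have p: "partial_diff i (\<lambda>y::real^'n. y $ k - c $ k) x = (if k = i then 1 else 0)" for k
    by (subst partial_diff_diff)
      (auto simp: partial_diff_coord partial_diff_const smooth_on_differentiable[OF smooth_on_coord, of UNIV])
  have m: "partial_diff i (\<lambda>y::real^'n. (y $ k - c $ k) * (y $ k - c $ k)) x = (if k = i then 2 * (x $ i - c $ i) else 0)" for k
    by (subst partial_diff_mult[OF d d]) (simp add: p)
  have s: "partial_diff i (\<lambda>y::real^'n. \<Sum>k\<in>UNIV. (y $ k - c $ k) * (y $ k - c $ k)) x = 2 * (x $ i - c $ i)"
    by (subst partial_diff_sum) (simp_all add: m d differentiable_mult)
  have ds: "(\<lambda>y::real^'n. \<Sum>k\<in>UNIV. (y $ k - c $ k) * (y $ k - c $ k)) differentiable (at x)"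
    by (simp add: d differentiable_mult differentiable_sum)
  have "partial_diff i (\<lambda>y::real^'n. - \<alpha> * (\<Sum>k\<in>UNIV. (y $ k - c $ k) * (y $ k - c $ k))) x = - \<alpha> * (2 * (x $ i - c $ i))"
    by (subst partial_diff_mult[OF _ ds]) (simp_all add: s partial_diff_const)
  note pq = this
  have dq: "(\<lambda>y::real^'n. - \<alpha> * (\<Sum>k\<in>UNIV. (y $ k - c $ k) * (y $ k - c $ k))) differentiable (at x)"
    by (intro differentiable_mult ds) simp
  have "partial_diff i (bump \<alpha> c) x = - \<alpha> * (2 * (x $ i - c $ i)) * bump \<alpha> c x"
    unfolding bump_def[abs_def] partial_diff_exp[OF dq] pq ..
  then show "partial_diff i (bump \<alpha> c) x = (- 2 * \<alpha>) * ((x $ i - c $ i) * bump \<alpha> c x)"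
    by simp
qed

lemma partial_diff2_bump:
  fixes c :: "real^'n"
  shows "partial_diff j (partial_diff i (bump \<alpha> c)) x
    = (4 * \<alpha> * \<alpha> * ((x $ i - c $ i) * (x $ j - c $ j)) - 2 * \<alpha> * (if i = j then 1 else 0)) * bump \<alpha> c x"
proof -
  have dc: "(\<lambda>y::real^'n. y $ i) differentiable (at x)"
    using smooth_on_differentiable[OF smooth_on_coord, of UNIV] by simp
  have db: "bump \<alpha> c differentiable (at x)"
    using smooth_on_differentiable[OF smooth_on_bump, of x] by simp
  have p: "partial_diff j (\<lambda>y::real^'n. y $ i - c $ i) x = (if i = j then 1 else 0)"
    by (subst partial_diff_diff) (auto simp: partial_diff_coord partial_diff_const dc)
  have q: "partial_diff j (\<lambda>y. (y $ i - c $ i) * bump \<alpha> c y) x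
      = (if i = j then 1 else 0) * bump \<alpha> c x + (x $ i - c $ i) * partial_diff j (bump \<alpha> c) x"
    by (subst partial_diff_mult) (simp_all add: p db dc differentiable_diff)
  have "partial_diff j (\<lambda>y. (- 2 * \<alpha>) * ((y $ i - c $ i) * bump \<alpha> c y)) x
      = (- 2 * \<alpha>) * ((if i = j then 1 else 0) * bump \<alpha> c x + (x $ i - c $ i) * partial_diff j (bump \<alpha> c) x)"
    by (subst partial_diff_mult) (simp_all add: q db dc differentiable_diff differentiable_mult partial_diff_const)
  then show ?thesis unfolding partial_diff_bump by (simp add: algebra_simps)
qed

text \<open>Hopf's argument. The vectors e_a are the coefficients of the second-order part, and
  \<open>ell\<close> says that they span, which is ellipticity. If the maximal level set is not a
  neighbourhood of x0, a ball outside it touches it at a single point p; near p, u plus a small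
  multiple of the barrier has an interior maximum, although the operator is positive on it.\<close>

lemma strong_maximum_principle:
  fixes u :: "real^'n \<Rightarrow> real" and e :: "real^'n \<Rightarrow> 'a::finite \<Rightarrow> real^'n" and b :: "real^'n \<Rightarrow> real^'n"
  assumes W: "open W" and u: "smooth_on W u"
    and e: "\<And>a i. continuous_on W (\<lambda>x. e x a $ i)" and b: "\<And>i. continuous_on W (\<lambda>x. b x $ i)"
    and ell: "\<And>x w. x \<in> W \<Longrightarrow> (\<And>a. (\<Sum>i\<in>UNIV. e x a $ i * w $ i) = 0) \<Longrightarrow> w = 0"
    and L: "\<And>x. x \<in> W \<Longrightarrow> 0 \<le> (\<Sum>a\<in>UNIV. \<Sum>i\<in>UNIV. \<Sum>j\<in>UNIV. e x a $ i * e x a $ j * partial_diff j (partial_diff i u) x)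
      + (\<Sum>i\<in>UNIV. b x $ i * partial_diff i u x)"
    and x0: "x0 \<in> W" and max: "\<And>y. y \<in> W \<Longrightarrow> u y \<le> u x0"
  shows "\<exists>d>0. \<forall>y\<in>ball x0 d. u y = u x0"
proof (rule ccontr)
  assume contra: "\<not> ?thesis"
  obtain \<rho>' where \<rho>': "\<rho>' > 0" "ball x0 \<rho>' \<subseteq> W" using W x0 open_contains_ball by blast
  \<comment> \<open>Room for the construction: y lies within \<rho> of x0, the ball touching F
    within 2 \<rho>, and the ball D around the point of contact within 3 \<rho>.\<close>
  define \<rho> where "\<rho> = \<rho>' / 3"
  have \<rho>: "\<rho> > 0" "ball x0 (3 * \<rho>) \<subseteq> W" using \<rho>' by (simp_all add: \<rho>_def)
  obtain y where y: "dist x0 y < \<rho>" "u y \<noteq> u x0" using contra \<rho>(1) by (meson mem_ball)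
  have cu: "continuous_on W u" using smooth_on_continuous_on[OF u] .
  have sub2: "cball x0 (2 * \<rho>) \<subseteq> W" using \<rho> by force
  define F where "F = cball x0 (2 * \<rho>) \<inter> u -` {u x0}"
  have "closed F" unfolding F_def
    by (rule continuous_closed_preimage[OF continuous_on_subset[OF cu sub2]]) auto
  moreover have "bounded F" unfolding F_def using bounded_subset[OF bounded_cball] by blast
  ultimately have cF: "compact F" by (simp add: compact_eq_bounded_closed)
  have x0F: "x0 \<in> F" using \<rho>(1) by (simp add: F_def)
  obtain p where p: "p \<in> F" "\<And>z. z \<in> F \<Longrightarrow> dist y p \<le> dist y z"
    using distance_attains_inf[of F y] compact_imp_closed[OF cF] x0F by blast
  define s where "s = dist y p / 2"
  have up: "u p = u x0" using p(1) by (simp add: F_def)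
  have s: "s > 0" using y(2) up by (auto simp: s_def)
  have s\<rho>: "2 * s < \<rho>" using p(2)[OF x0F] y(1) by (simp add: s_def dist_commute)
  \<comment> \<open>The sphere around y through p may meet F in further points. The ball with
    diameter from y to p meets it in p alone.\<close>
  define c where "c = (1/2) *\<^sub>R (y + p)"
  have cy: "c - y = (1/2) *\<^sub>R (p - y)" and pc: "p - c = c - y"
    by (simp_all add: c_def vec_eq_iff field_simps)
  have ncy: "norm (c - y) = s" unfolding cy by (simp add: s_def dist_norm norm_minus_commute)
  have npc: "norm (p - c) = s" using ncy pc by simp
  have only_p: "z = p" if z: "norm (z - c) \<le> s" "u z = u x0" for z
  proof -
    have dyz: "dist y z \<le> 2 * s"
      using norm_triangle_ineq[of "z - c" "c - y"] z(1) ncy by (simp add: dist_norm norm_minus_commute[of y z])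
    have "dist x0 z \<le> 2 * \<rho>" using dist_triangle[of x0 z y] dyz s\<rho> y(1) by linarith
    then have "z \<in> F" using z(2) by (simp add: F_def)
    then have "norm (z - y) \<ge> 2 * s" using p(2)[of z] by (simp add: s_def dist_norm norm_minus_commute[of y])
    \<comment> \<open>A point z with |z - c| at most s and |z - y| at least 2 s is the antipode of
      y, which is p: expanding |z - y|^2 bounds the inner product of z - c and c - y from below, and
      this forces their difference to vanish.\<close>
    then have "(norm (z - y))\<^sup>2 \<ge> 4 * s\<^sup>2" using power_mono[of "2 * s" "norm (z - y)" 2] s by (simp add: power_mult_distrib)
    moreover have "(norm (z - y))\<^sup>2 = (norm (z - c))\<^sup>2 + 2 * ((z - c) \<bullet> (c - y)) + s\<^sup>2"
    proof -
      have "z - y = (z - c) + (c - y)" by simp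
      then have "(norm (z - y))\<^sup>2 = (norm (z - c))\<^sup>2 + 2 * ((z - c) \<bullet> (c - y)) + (norm (c - y))\<^sup>2"
        by (simp only: power2_norm_eq_inner inner_add_left inner_add_right) (simp add: inner_commute)
      then show ?thesis using ncy by simp
    qed
    moreover have zc: "(norm (z - c))\<^sup>2 \<le> s\<^sup>2" using power_mono[OF z(1)] by simp
    ultimately have ge: "2 * ((z - c) \<bullet> (c - y)) \<ge> 2 * s\<^sup>2" by linarith
    have "(norm ((z - c) - (c - y)))\<^sup>2 = (norm (z - c))\<^sup>2 - 2 * ((z - c) \<bullet> (c - y)) + (norm (c - y))\<^sup>2"
      by (simp only: power2_norm_eq_inner inner_diff_left inner_diff_right) (simp add: inner_commute)
    then have "(norm ((z - c) - (c - y)))\<^sup>2 \<le> 0" using ge zc ncy by simp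
    then have "norm ((z - c) - (c - y)) = 0" by (simp only: power2_less_eq_zero_iff)
    then have "z - c = p - c" unfolding pc by (simp only: norm_eq_zero right_minus_eq)
    then show ?thesis by (metis diff_add_cancel)
  qed
  \<comment> \<open>A radius below s keeps D away from c, the critical point of \<open>bump\<close>,
    so that \<open>Af\<close> stays positive on D.\<close>
  define \<delta> where "\<delta> = s / 2"
  have \<delta>: "\<delta> > 0" using s by (simp add: \<delta>_def)
  define D where "D = cball p \<delta>"
  have DW: "D \<subseteq> W"
  proof
    fix z assume "z \<in> D"
    then have "dist x0 z < 3 * \<rho>"
      using dist_triangle[of x0 z p] p(1) s\<rho> s by (simp add: D_def \<delta>_def F_def)
    then show "z \<in> W" using \<rho>(2) by auto
  qed
  have cD: "compact D" by (simp add: D_def)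
  have pD: "p \<in> D" using \<delta> by (simp add: D_def)
  have Dc: "norm (z - c) \<ge> s / 2" if "z \<in> D" for z
    using that npc norm_triangle_ineq[of "p - z" "z - c"] by (simp add: D_def \<delta>_def dist_norm)
  \<comment> \<open>The operator applied to the barrier h is 2 \<alpha> h (2 \<alpha> Af - Cf):
    \<open>Af\<close> is the principal symbol at x - c, and \<open>Cf\<close> collects the remaining
    terms. A large \<alpha> therefore makes it positive on the compact set D.\<close>
  define Af where "Af x = (\<Sum>a\<in>UNIV. (\<Sum>i\<in>UNIV. e x a $ i * (x $ i - c $ i))\<^sup>2)" for x
  define Cf where "Cf x = (\<Sum>a\<in>UNIV. \<Sum>i\<in>UNIV. e x a $ i * e x a $ i) + (\<Sum>i\<in>UNIV. b x $ i * (x $ i - c $ i))" for x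
  have eD: "continuous_on D (\<lambda>x. e x a $ i)" and bD: "continuous_on D (\<lambda>x. b x $ i)" for a i
    using continuous_on_subset[OF e DW] continuous_on_subset[OF b DW] by auto
  have cA: "continuous_on D Af" unfolding Af_def[abs_def] by (intro continuous_intros eD)
  have cC: "continuous_on D Cf" unfolding Cf_def[abs_def] by (intro continuous_intros eD bD)
  obtain zA where zA: "zA \<in> D" "\<And>z. z \<in> D \<Longrightarrow> Af zA \<le> Af z"
    using continuous_attains_inf[OF cD _ cA] pD by blast
  obtain zC where zC: "zC \<in> D" "\<And>z. z \<in> D \<Longrightarrow> Cf z \<le> Cf zC"
    using continuous_attains_sup[OF cD _ cC] pD by blast
  have "Af zA > 0"
  proof -
    have "Af zA \<ge> 0" unfolding Af_def by (simp add: sum_nonneg)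
    moreover have "Af zA \<noteq> 0"
    proof
      assume "Af zA = 0"
      then have "(\<Sum>i\<in>UNIV. e zA a $ i * (zA - c) $ i) = 0" for a
        unfolding Af_def by (subst (asm) sum_nonneg_eq_0_iff) auto
      then have "zA - c = 0" using ell[of zA "zA - c"] zA(1) DW by blast
      then show False using Dc[OF zA(1)] s by simp
    qed
    ultimately show ?thesis by simp
  qed
  define m C where "m = Af zA" and "C = max 0 (Cf zC)"
  define \<alpha> where "\<alpha> = (C + 1) / m"
  have mC: "m > 0" "C \<ge> 0" using \<open>Af zA > 0\<close> by (simp_all add: m_def C_def)
  have \<alpha>: "\<alpha> > 0" "\<alpha> * m = C + 1" using mC by (simp_all add: \<alpha>_def)
  let ?h = "bump \<alpha> c"
  define Lop where "Lop f x = (\<Sum>a\<in>UNIV. \<Sum>i\<in>UNIV. \<Sum>j\<in>UNIV. e x a $ i * e x a $ j * partial_diff j (partial_diff i f) x)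
      + (\<Sum>i\<in>UNIV. b x $ i * partial_diff i f x)" for f x
  have Lh: "Lop ?h x > 0" if x: "x \<in> D" for x
  proof -
    define P where "P a i = e x a $ i * (x $ i - c $ i)" for a i
    define K where "K = 4 * \<alpha> * \<alpha> * ?h x"
    define k where "k = 2 * \<alpha> * ?h x"
    have "Lop ?h x = (\<Sum>a\<in>UNIV. \<Sum>i\<in>UNIV. \<Sum>j\<in>UNIV.
          K * (P a i * P a j) - (if i = j then k * (e x a $ i * e x a $ i) else 0))
        + (\<Sum>i\<in>UNIV. - (k * (b x $ i * (x $ i - c $ i))))"
      unfolding Lop_def partial_diff2_bump unfolding partial_diff_bump P_def K_def k_def
      by (intro arg_cong2[where f="(+)"] sum.cong refl) (auto simp: algebra_simps)
    also have "\<dots> = (\<Sum>a\<in>UNIV. K * (\<Sum>i\<in>UNIV. P a i)\<^sup>2 - k * (\<Sum>i\<in>UNIV. e x a $ i * e x a $ i))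
        - k * (\<Sum>i\<in>UNIV. b x $ i * (x $ i - c $ i))"
    proof -
      have "K * (\<Sum>i\<in>UNIV. P a i)\<^sup>2 = (\<Sum>i\<in>UNIV. \<Sum>j\<in>UNIV. K * (P a i * P a j))" for a
        unfolding power2_eq_square sum_product by (simp add: sum_distrib_left)
      then show ?thesis by (simp add: sum_subtractf sum_distrib_left sum_negf)
    qed
    also have "\<dots> = K * Af x - k * Cf x"
      unfolding Af_def Cf_def P_def by (simp add: sum_subtractf sum_distrib_left[symmetric] algebra_simps)
    also have "\<dots> = 2 * \<alpha> * ?h x * (2 * (\<alpha> * Af x) - Cf x)" by (simp add: K_def k_def algebra_simps)
    finally have eq: "Lop ?h x = 2 * \<alpha> * ?h x * (2 * (\<alpha> * Af x) - Cf x)" .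
    have "\<alpha> * Af x \<ge> C + 1" using zA(2)[OF x] \<alpha> by (metis less_eq_real_def m_def mult_left_mono)
    moreover have "Cf x \<le> C" using zC(2)[OF x] by (simp add: C_def)
    ultimately have "2 * (\<alpha> * Af x) - Cf x > 0" using mC by linarith
    moreover have "?h x > 0" by (simp add: bump_def)
    ultimately show ?thesis unfolding eq using \<alpha> by simp
  qed
  \<comment> \<open>On the part of the sphere inside the ball around c, u lies below its maximum by
    more than a margin \<epsilon>, which outweighs \<epsilon> h because h is at most 1. On the rest
    of the sphere h is smaller than at p. Either way v is smaller than at p.\<close>
  define S1 where "S1 = sphere p \<delta> \<inter> cball c s"
  have S1D: "S1 \<subseteq> D" by (auto simp: S1_def D_def)
  have cS1: "compact S1" by (simp add: S1_def compact_Int_closed)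
  have S1lt: "u z < u x0" if "z \<in> S1" for z
  proof -
    have "z \<noteq> p" using that \<delta> by (auto simp: S1_def)
    then have "u z \<noteq> u x0" using only_p that by (auto simp: S1_def dist_norm norm_minus_commute)
    then show ?thesis using max[of z] that S1D DW by fastforce
  qed
  have "\<exists>\<epsilon>>0. \<forall>z\<in>S1. u z + \<epsilon> < u x0"
  proof (cases "S1 = {}")
    case True
    then show ?thesis by (intro exI[of _ 1]) simp
  next
    case False
    obtain z1 where z1: "z1 \<in> S1" "\<And>z. z \<in> S1 \<Longrightarrow> u z \<le> u z1"
      using continuous_attains_sup[OF cS1 False continuous_on_subset[OF cu]] S1D DW by blast
    show ?thesis
    proof (intro exI conjI ballI)
      show "(u x0 - u z1) / 2 > 0" using S1lt[OF z1(1)] by simp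
      show "u z + (u x0 - u z1) / 2 < u x0" if "z \<in> S1" for z
        using z1(2)[OF that] S1lt[OF z1(1)] by argo
    qed
  qed
  then obtain \<epsilon> where \<epsilon>: "\<epsilon> > 0" "\<And>z. z \<in> S1 \<Longrightarrow> u z + \<epsilon> < u x0" by blast
  define v where "v x = u x + \<epsilon> * ?h x" for x
  have hW: "smooth_on W ?h" using smooth_on_subset[OF smooth_on_bump] by blast
  have v: "smooth_on W v" unfolding v_def[abs_def] by (intro smooth_on_add smooth_on_mult smooth_on_const W u hW)
  have sph: "v z < v p" if z: "z \<in> sphere p \<delta>" for z
  proof (cases "z \<in> cball c s")
    case True
    have "?h z \<le> 1" using \<alpha>(1) by (simp add: bump_eq)
    then have "\<epsilon> * ?h z \<le> \<epsilon>" using \<epsilon>(1) by (simp add: mult_left_le)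
    moreover have "\<epsilon> * ?h p > 0" using \<epsilon>(1) by (simp add: bump_def)
    ultimately show ?thesis using \<epsilon>(2)[of z] True z up by (simp add: v_def S1_def)
  next
    case False
    then have "norm (p - c) < norm (z - c)" by (simp add: npc dist_norm norm_minus_commute[of c])
    then have "(norm (p - c))\<^sup>2 < (norm (z - c))\<^sup>2" by (simp add: power_strict_mono)
    then have "?h z < ?h p" using \<alpha>(1) by (simp add: bump_eq)
    moreover have "z \<in> W" using z DW by (auto simp: D_def)
    ultimately show ?thesis using max[of z] up \<epsilon>(1) by (simp add: v_def add_le_less_mono)
  qed
  obtain z where z: "z \<in> D" "\<And>x. x \<in> D \<Longrightarrow> v x \<le> v z"
    using continuous_attains_sup[OF cD _ continuous_on_subset[OF smooth_on_continuous_on[OF v] DW]] pD by blast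
  \<comment> \<open>So the maximum of v over D is interior and the derivative test gives
    \<open>Lop v z\<close> at most 0, while \<open>Lop u z\<close> is nonnegative and
    \<open>Lop ?h z\<close> positive.\<close>
  have "z \<notin> sphere p \<delta>" using sph[of z] z(2)[OF pD] by auto
  then have zin: "dist p z < \<delta>" using z(1) by (auto simp: D_def)
  have zW: "z \<in> W" using z(1) DW by blast
  have near: "v x \<le> v z" if "x \<in> ball z (\<delta> - dist p z)" for x
    using z(2)[of x] that dist_triangle[of p x z] by (simp add: D_def)
  have Lv: "Lop v z = Lop u z + \<epsilon> * Lop ?h z"
  proof -
    have pv: "partial_diff i v x = partial_diff i u x + \<epsilon> * partial_diff i ?h x" if "x \<in> W" for x i
      unfolding v_def[abs_def]
      by (subst partial_diff_add, use smooth_on_differentiable[OF _ W that] u hW in \<open>simp_all add: differentiable_mult\<close>)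
        (subst partial_diff_mult, use smooth_on_differentiable[OF _ W that] hW in \<open>simp_all add: partial_diff_const\<close>)
    have d1: "partial_diff i u differentiable (at z)" "partial_diff i ?h differentiable (at z)" for i
      using smooth_on_differentiable[OF smooth_on_partial W zW] u hW by auto
    have ppv: "partial_diff j (partial_diff i v) z = partial_diff j (partial_diff i u) z + \<epsilon> * partial_diff j (partial_diff i ?h) z" for i j
    proof -
      have "partial_diff j (partial_diff i v) z = partial_diff j (\<lambda>x. partial_diff i u x + \<epsilon> * partial_diff i ?h x) z"
        by (rule partial_diff_cong[OF W zW]) (rule pv)
      also have "\<dots> = partial_diff j (partial_diff i u) z + partial_diff j (\<lambda>x. \<epsilon> * partial_diff i ?h x) z"
        by (rule partial_diff_add) (simp_all add: d1 differentiable_mult)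
      also have "partial_diff j (\<lambda>x. \<epsilon> * partial_diff i ?h x) z = \<epsilon> * partial_diff j (partial_diff i ?h) z"
        by (subst partial_diff_mult) (simp_all add: d1 partial_diff_const)
      finally show ?thesis .
    qed
    show ?thesis unfolding Lop_def ppv pv[OF zW]
      by (simp add: algebra_simps sum.distrib sum_distrib_left)
  qed
  have "(\<Sum>i\<in>UNIV. b z $ i * partial_diff i v z) = 0"
    by (rule local_max_second_derivative(1)[OF W v zW _ near]) (use zin in auto)
  moreover have "(\<Sum>i\<in>UNIV. \<Sum>j\<in>UNIV. e z a $ i * e z a $ j * partial_diff j (partial_diff i v) z) \<le> 0" for a
    by (rule local_max_second_derivative(2)[OF W v zW _ near]) (use zin in auto)
  ultimately have "Lop v z \<le> 0" unfolding Lop_def by (simp add: sum_nonpos)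
  moreover have "Lop u z \<ge> 0" using L[OF zW] by (simp add: Lop_def)
  moreover have "\<epsilon> * Lop ?h z > 0" using Lh[OF z(1)] \<epsilon>(1) by simp
  ultimately show False using Lv by linarith
qed

section \<open>The Lie algebra \<open>\<gg>\<^sub>2\<close>\<close>

lemma sum_permutes_1: "(\<Sum>\<sigma> | \<sigma> permutes {..<Suc 0}. f \<sigma>) = f id"
  by (simp add: lessThan_Suc)

lemma sum_permutes_2:
  "(\<Sum>\<sigma> | \<sigma> permutes {..<Suc (Suc 0)}. f \<sigma>) = f id + f (Transposition.transpose 0 1)"
proof -
  have s: "{..<Suc (Suc 0)} = insert 1 {0::nat}" by auto
  show ?thesis
    unfolding s by (subst sum_over_permutations_insert) (auto simp: Transposition.transpose_commute)
qed

lemma sum_permutes_3: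
  "(\<Sum>\<sigma> | \<sigma> permutes {..<Suc (Suc (Suc 0))}. f \<sigma>) = f id + f (Transposition.transpose 1 2)
    + f (Transposition.transpose 0 1) + f (Transposition.transpose 0 1 \<circ> Transposition.transpose 1 2)
    + f (Transposition.transpose 0 2) + f (Transposition.transpose 0 2 \<circ> Transposition.transpose 1 2)"
proof -
  have s: "{..<Suc (Suc (Suc 0))} = insert 0 (insert 1 {2::nat})" by auto
  show ?thesis
    unfolding s
    by (subst sum_over_permutations_insert, simp, simp)
      (auto simp: sum_over_permutations_insert algebra_simps)
qed

lemma wedge_list_1: "wedge_list [w] [k] = w $ k"
  by (simp add: wedge_def sum_permutes_1 permute_list_def)

lemma wedge_list_2: "wedge_list [v, w] [j, k] = v $ j * w $ k - v $ k * w $ j"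
proof -
  have "wedge_list [v, w] [j, k] = wedge 1 1 (\<lambda>I. v $ hd I) (wedge_list [w]) [j, k]" by simp
  also have "\<dots> = v $ j * w $ k - v $ k * w $ j"
    unfolding wedge_def
    by (simp add: sum_permutes_2 permute_list_def wedge_list_1 sign_swap_id del: wedge_list.simps)
  finally show ?thesis .
qed

lemma wedge_list_3: "wedge_list [u, v, w] [i, j, k] =
   u $ i * (v $ j * w $ k - v $ k * w $ j) + u $ j * (v $ k * w $ i - v $ i * w $ k)
   + u $ k * (v $ i * w $ j - v $ j * w $ i)"
proof -
  have "wedge_list [u, v, w] [i, j, k] = wedge 1 2 (\<lambda>I. u $ hd I) (wedge_list [v, w]) [i, j, k]" by (simp add: numeral_2_eq_2)
  also have "\<dots> = u $ i * (v $ j * w $ k - v $ k * w $ j) + u $ j * (v $ k * w $ i - v $ i * w $ k)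
   + u $ k * (v $ i * w $ j - v $ j * w $ i)"
    unfolding wedge_def
    by (simp add: sum_permutes_3 permute_list_def wedge_list_2 sign_swap_id sign_compose permutation_swap_id
        Transposition.transpose_def numeral_3_eq_3 fact_numeral upt_rec del: wedge_list.simps) (simp add: algebra_simps)
  finally show ?thesis .
qed

lemma sum_alt3:
  "(\<Sum>a\<in>UNIV. \<Sum>b\<in>UNIV. \<Sum>c\<in>UNIV. alt3 p q r a b c * (X a * Y b * Z c)) =
    X p * (Y q * Z r - Y r * Z q) + X q * (Y r * Z p - Y p * Z r) + X r * (Y p * Z q - Y (q::'n::finite) * Z p)"
proof -
  have "(\<Sum>a\<in>UNIV. \<Sum>b\<in>UNIV. \<Sum>c\<in>UNIV. kd s a * (kd t b * kd v c) * (X a * Y b * Z c)) = X s * Y t * Z v" for s t v :: 'n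
  proof -
    have "(\<Sum>c\<in>UNIV. kd s a * (kd t b * kd v c) * (X a * Y b * Z c)) = kd t b * (kd s a * X a * Y b * Z v)" for a b
      using kd_sum[of v "\<lambda>c. kd s a * kd t b * X a * Y b * Z c"] by (simp add: mult_ac)
    then have "(\<Sum>b\<in>UNIV. \<Sum>c\<in>UNIV. kd s a * (kd t b * kd v c) * (X a * Y b * Z c)) = kd s a * X a * Y t * Z v" for a
      by (simp only: kd_sum)
    moreover have "(\<Sum>a\<in>UNIV. kd s a * X a * Y t * Z v) = X s * Y t * Z v"
      using kd_sum[of s "\<lambda>a. X a * Y t * Z v"] by (simp add: mult.assoc)
    ultimately show ?thesis by simp
  qed
  note S = this
  have "(\<Sum>a\<in>UNIV. \<Sum>b\<in>UNIV. \<Sum>c\<in>UNIV. alt3 p q r a b c * (X a * Y b * Z c)) =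
     (\<Sum>a\<in>UNIV. \<Sum>b\<in>UNIV. \<Sum>c\<in>UNIV. kd p a * (kd q b * kd r c) * (X a * Y b * Z c))
   - (\<Sum>a\<in>UNIV. \<Sum>b\<in>UNIV. \<Sum>c\<in>UNIV. kd p a * (kd r b * kd q c) * (X a * Y b * Z c))
   + (\<Sum>a\<in>UNIV. \<Sum>b\<in>UNIV. \<Sum>c\<in>UNIV. kd r a * (kd p b * kd q c) * (X a * Y b * Z c))
   - (\<Sum>a\<in>UNIV. \<Sum>b\<in>UNIV. \<Sum>c\<in>UNIV. kd q a * (kd p b * kd r c) * (X a * Y b * Z c))
   + (\<Sum>a\<in>UNIV. \<Sum>b\<in>UNIV. \<Sum>c\<in>UNIV. kd q a * (kd r b * kd p c) * (X a * Y b * Z c))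
   - (\<Sum>a\<in>UNIV. \<Sum>b\<in>UNIV. \<Sum>c\<in>UNIV. kd r a * (kd q b * kd p c) * (X a * Y b * Z c))"
    unfolding sum.distrib[symmetric] sum_subtractf[symmetric]
    by (intro sum.cong refl) (simp add: alt3_def algebra_simps)
  then show ?thesis unfolding S by (simp add: algebra_simps)
qed

text \<open>Brings the form built from permutations into tensor shape: a form adapted to E is the
  pullback of \<open>phi0\<close> by E.\<close>

lemma g2_model_eq:
  "g2_model E [i, j, k] = (\<Sum>a\<in>UNIV. \<Sum>b\<in>UNIV. \<Sum>c\<in>UNIV. phi0 a b c * (E $ a $ i * E $ b $ j * E $ c $ k))"
proof -
  let ?t = "\<lambda>p q r. \<Sum>a\<in>UNIV. \<Sum>b\<in>UNIV. \<Sum>c\<in>UNIV. alt3 p q r a b c * (E $ a $ i * E $ b $ j * E $ c $ k)"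
  have t: "wedge_list [E $ p, E $ q, E $ r] [i, j, k] = ?t p q r" for p q r
    unfolding wedge_list_3 sum_alt3 by (simp add: algebra_simps)
  have "(\<Sum>a\<in>UNIV. \<Sum>b\<in>UNIV. \<Sum>c\<in>UNIV. phi0 a b c * (E $ a $ i * E $ b $ j * E $ c $ k))
    = ?t 1 2 7 + ?t 1 3 5 - ?t 1 4 6 - ?t 2 3 6 - ?t 2 4 5 + ?t 3 4 7 + ?t 5 6 7"
    unfolding sum.distrib[symmetric] sum_subtractf[symmetric]
    by (intro sum.cong refl) (simp add: phi0_def algebra_simps)
  then show ?thesis unfolding g2_model_def Let_def t by simp
qed

lemma phi0_cyc': "phi0 c a b = phi0 a b c"
  using phi0_cyc[of b c a] phi0_cyc[of a b c] by simp

text \<open>The two descriptions of the Lie algebra \<open>g\<^sub>2\<close> inside the skew matrices: the annihilator of \<open>\<phi>\<close> and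
  the kernel of \<open>\<alpha> \<mapsto> \<alpha>\<^bsub>ab\<^esub> \<phi>\<^bsub>abk\<^esub>\<close>.\<close>

lemma g2_kernel_imp_derivation:
  assumes sk: "\<And>a b. \<alpha> b a = - \<alpha> a b"
    and H: "\<And>k. (\<Sum>a\<in>UNIV. \<Sum>b\<in>UNIV. \<alpha> a b * phi0 a b k) = 0"
  shows "(\<Sum>q\<in>UNIV. \<alpha> i q * phi0 q j k + \<alpha> j q * phi0 i q k + \<alpha> k q * phi0 i j q) = 0"
proof -
  have s0: "\<alpha> a a = 0" for a using sk[of a a] by simp
  have s: "\<alpha> 1 1 = 0" "\<alpha> 2 1 = - \<alpha> 1 2" "\<alpha> 3 1 = - \<alpha> 1 3" "\<alpha> 4 1 = - \<alpha> 1 4" "\<alpha> 5 1 = - \<alpha> 1 5"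
    "\<alpha> 6 1 = - \<alpha> 1 6" "\<alpha> 7 1 = - \<alpha> 1 7" "\<alpha> 2 2 = 0" "\<alpha> 3 2 = - \<alpha> 2 3" "\<alpha> 4 2 = - \<alpha> 2 4"
    "\<alpha> 5 2 = - \<alpha> 2 5" "\<alpha> 6 2 = - \<alpha> 2 6" "\<alpha> 7 2 = - \<alpha> 2 7" "\<alpha> 3 3 = 0" "\<alpha> 4 3 = - \<alpha> 3 4"
    "\<alpha> 5 3 = - \<alpha> 3 5" "\<alpha> 6 3 = - \<alpha> 3 6" "\<alpha> 7 3 = - \<alpha> 3 7" "\<alpha> 4 4 = 0" "\<alpha> 5 4 = - \<alpha> 4 5"
    "\<alpha> 6 4 = - \<alpha> 4 6" "\<alpha> 7 4 = - \<alpha> 4 7" "\<alpha> 5 5 = 0" "\<alpha> 6 5 = - \<alpha> 5 6" "\<alpha> 7 5 = - \<alpha> 5 7"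
    "\<alpha> 6 6 = 0" "\<alpha> 7 6 = - \<alpha> 6 7" "\<alpha> 7 7 = 0"
    by (rule s0 sk)+
  have H': "(\<Sum>a\<in>UNIV. \<Sum>b\<in>UNIV. \<alpha> a b * phi0 k a b) = 0" for k
    using H[of k] phi0_cyc'[of k] by simp
  \<comment> \<open>The seven kernel equations, solved for seven of the 21 independent entries; the
    other 14 are coordinates on g2. The derivation property is then checked for all i, j, k.\<close>
  have h: "\<alpha> 2 7 = - \<alpha> 3 5 + \<alpha> 4 6"
    "\<alpha> 1 7 = - \<alpha> 3 6 - \<alpha> 4 5"
    "\<alpha> 1 5 = \<alpha> 2 6 + \<alpha> 4 7"
    "\<alpha> 1 6 = - \<alpha> 2 5 + \<alpha> 3 7"
    "\<alpha> 1 3 = \<alpha> 2 4 - \<alpha> 6 7"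
    "\<alpha> 1 4 = - \<alpha> 2 3 - \<alpha> 5 7"
    "\<alpha> 1 2 = - \<alpha> 3 4 - \<alpha> 5 6"
    using H'[of 1] H'[of 2] H'[of 3] H'[of 4] H'[of 5] H'[of 6] H'[of 7]
    by (simp_all add: sum_7 phi0_rows kd_same kd_other s)
  have "\<forall>i j k. (\<Sum>q\<in>UNIV. phi0 q j k * \<alpha> i q) + (\<Sum>q\<in>UNIV. phi0 q k i * \<alpha> j q) + (\<Sum>q\<in>UNIV. phi0 q i j * \<alpha> k q) = 0"
    unfolding forall_7 by (simp add: phi0_rows kd_sum sum_negf s h)
  then have e: "(\<Sum>q\<in>UNIV. phi0 q j k * \<alpha> i q) + (\<Sum>q\<in>UNIV. phi0 q k i * \<alpha> j q) + (\<Sum>q\<in>UNIV. phi0 q i j * \<alpha> k q) = 0"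
    by blast
  have "phi0 i q k = phi0 q k i" "phi0 i j q = phi0 q i j" for q
    using phi0_cyc'[of q k i] phi0_cyc'[of i q k] phi0_cyc'[of q i j] by simp_all
  then show ?thesis using e by (simp add: sum.distrib mult.commute)
qed

lemma g2_derivation_imp_kernel:
  assumes sk: "\<And>a b. \<alpha> b a = - \<alpha> a b"
    and D: "\<And>i j k. (\<Sum>q\<in>UNIV. \<alpha> i q * phi0 q j k + \<alpha> j q * phi0 i q k + \<alpha> k q * phi0 i j q) = 0"
  shows "(\<Sum>a\<in>UNIV. \<Sum>b\<in>UNIV. \<alpha> a b * phi0 a b k) = 0"
proof -
  have s0: "\<alpha> a a = 0" for a using sk[of a a] by simp
  have s: "\<alpha> 1 1 = 0" "\<alpha> 2 1 = - \<alpha> 1 2" "\<alpha> 3 1 = - \<alpha> 1 3" "\<alpha> 4 1 = - \<alpha> 1 4" "\<alpha> 5 1 = - \<alpha> 1 5"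
    "\<alpha> 6 1 = - \<alpha> 1 6" "\<alpha> 7 1 = - \<alpha> 1 7" "\<alpha> 2 2 = 0" "\<alpha> 3 2 = - \<alpha> 2 3" "\<alpha> 4 2 = - \<alpha> 2 4"
    "\<alpha> 5 2 = - \<alpha> 2 5" "\<alpha> 6 2 = - \<alpha> 2 6" "\<alpha> 7 2 = - \<alpha> 2 7" "\<alpha> 3 3 = 0" "\<alpha> 4 3 = - \<alpha> 3 4"
    "\<alpha> 5 3 = - \<alpha> 3 5" "\<alpha> 6 3 = - \<alpha> 3 6" "\<alpha> 7 3 = - \<alpha> 3 7" "\<alpha> 4 4 = 0" "\<alpha> 5 4 = - \<alpha> 4 5"
    "\<alpha> 6 4 = - \<alpha> 4 6" "\<alpha> 7 4 = - \<alpha> 4 7" "\<alpha> 5 5 = 0" "\<alpha> 6 5 = - \<alpha> 5 6" "\<alpha> 7 5 = - \<alpha> 5 7"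
    "\<alpha> 6 6 = 0" "\<alpha> 7 6 = - \<alpha> 6 7" "\<alpha> 7 7 = 0"
    by (rule s0 sk)+
  have D': "(\<Sum>q\<in>UNIV. phi0 q j k * \<alpha> i q) + (\<Sum>q\<in>UNIV. phi0 q k i * \<alpha> j q) + (\<Sum>q\<in>UNIV. phi0 q i j * \<alpha> k q) = 0" for i j k
  proof -
    have "phi0 i q k = phi0 q k i" "phi0 i j q = phi0 q i j" for q
      using phi0_cyc'[of q k i] phi0_cyc'[of i q k] phi0_cyc'[of q i j] by simp_all
    then show ?thesis using D[of i j k] by (simp add: sum.distrib mult.commute)
  qed
  \<comment> \<open>Seven suitable instances of the derivation property already give the seven
    relations that describe the kernel.\<close>
  have h: "\<alpha> 2 7 = - \<alpha> 3 5 + \<alpha> 4 6"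
    "\<alpha> 1 7 = - \<alpha> 3 6 - \<alpha> 4 5"
    "\<alpha> 1 5 = \<alpha> 2 6 + \<alpha> 4 7"
    "\<alpha> 1 6 = - \<alpha> 2 5 + \<alpha> 3 7"
    "\<alpha> 1 3 = \<alpha> 2 4 - \<alpha> 6 7"
    "\<alpha> 1 4 = - \<alpha> 2 3 - \<alpha> 5 7"
    "\<alpha> 1 2 = - \<alpha> 3 4 - \<alpha> 5 6"
    using D'[of 2 3 4] D'[of 1 3 4] D'[of 1 2 4] D'[of 1 2 3] D'[of 1 2 6] D'[of 1 2 5] D'[of 1 3 6]
    by (simp_all add: phi0_rows kd_sum sum_negf s)
  have "\<forall>k. (\<Sum>a\<in>UNIV. \<Sum>b\<in>UNIV. \<alpha> a b * phi0 k a b) = 0"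
    unfolding forall_7 by (simp add: sum_7 phi0_rows kd_same kd_other s h)
  then have "(\<Sum>a\<in>UNIV. \<Sum>b\<in>UNIV. \<alpha> a b * phi0 k a b) = 0" by blast
  then show ?thesis unfolding phi0_cyc'[of k] .
qed

lemma kd_sum': "(\<Sum>i\<in>UNIV. f i * kd i (p::'n::finite)) = f p" "(\<Sum>i\<in>UNIV. f i * kd p i) = f p"
  by (simp_all add: kd_def if_distrib cong: if_cong)

text \<open>\<open>psi0\<close> is made of \<open>phi0\<close> and Kronecker deltas, and \<alpha>
  annihilates both as a derivation.\<close>

lemma psi0_derivation:
  assumes sk: "\<And>a b. \<alpha> b a = - \<alpha> a b"
    and D: "\<And>i j k. (\<Sum>q\<in>UNIV. \<alpha> i q * phi0 q j k + \<alpha> j q * phi0 i q k + \<alpha> k q * phi0 i j q) = 0"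
  shows "(\<Sum>q\<in>UNIV. \<alpha> i q * psi0 q j k l + \<alpha> j q * psi0 i q k l + \<alpha> k q * psi0 i j q l + \<alpha> l q * psi0 i j k q) = 0"
proof -
  \<comment> \<open>\<open>- X m i j\<close> is the action of \<alpha> on the last two slots of
    \<open>phi0\<close>. Moving \<alpha> to the summed slot m in this way makes the two product
    terms cancel, because \<alpha> is skew.\<close>
  define X where "X m i j = (\<Sum>q\<in>UNIV. \<alpha> m q * phi0 q i j)" for m i j
  have X: "(\<Sum>q\<in>UNIV. \<alpha> i q * phi0 m q j + \<alpha> j q * phi0 m i q) = - X m i j" for m i j
    using D[of m i j] by (simp add: X_def sum.distrib)
  have 1: "(\<Sum>q\<in>UNIV. \<alpha> i q * psi0 q j k l + \<alpha> j q * psi0 i q k l)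
     = - (\<Sum>m\<in>UNIV. X m i j * phi0 m k l) - \<alpha> i k * kd j l + \<alpha> i l * kd j k - \<alpha> j l * kd i k + \<alpha> j k * kd i l" for i j k l
  proof -
    have "(\<Sum>q\<in>UNIV. \<alpha> i q * psi0 q j k l + \<alpha> j q * psi0 i q k l)
      = (\<Sum>q\<in>UNIV. \<Sum>m\<in>UNIV. (\<alpha> i q * phi0 m q j + \<alpha> j q * phi0 m i q) * phi0 m k l)
       + (\<Sum>q\<in>UNIV. (- \<alpha> i q * kd j l) * kd q k + (\<alpha> i q * kd j k) * kd q l + (- \<alpha> j q * kd i k) * kd q l + (\<alpha> j q * kd i l) * kd q k)"
      unfolding sum.distrib[symmetric]
      by (intro sum.cong refl) (simp add: psi0_def algebra_simps sum.distrib sum_distrib_left)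
    also have "(\<Sum>q\<in>UNIV. \<Sum>m\<in>UNIV. (\<alpha> i q * phi0 m q j + \<alpha> j q * phi0 m i q) * phi0 m k l)
      = (\<Sum>m\<in>UNIV. (\<Sum>q\<in>UNIV. \<alpha> i q * phi0 m q j + \<alpha> j q * phi0 m i q) * phi0 m k l)"
      by (subst sum.swap) (simp only: sum_distrib_right)
    finally show ?thesis unfolding X by (simp add: sum.distrib sum_subtractf kd_sum' sum_negf)
  qed
  have pair: "psi0 a b c d = psi0 c d a b" for a b c d
    unfolding psi0_def by (simp add: mult.commute kd_def)
  have "(\<Sum>m\<in>UNIV. X m i j * phi0 m k l) = (\<Sum>m\<in>UNIV. \<Sum>q\<in>UNIV. \<alpha> m q * phi0 q i j * phi0 m k l)"
    by (simp add: X_def sum_distrib_right)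
  also have "\<dots> = (\<Sum>q\<in>UNIV. \<Sum>m\<in>UNIV. \<alpha> m q * phi0 q i j * phi0 m k l)" by (rule sum.swap)
  also have "\<dots> = (\<Sum>q\<in>UNIV. \<Sum>m\<in>UNIV. - (\<alpha> q m * phi0 m k l * phi0 q i j))"
    by (intro sum.cong refl) (subst sk, simp)
  also have "\<dots> = - (\<Sum>m\<in>UNIV. X m k l * phi0 m i j)" by (simp add: X_def sum_distrib_right sum_negf)
  finally have 2: "(\<Sum>m\<in>UNIV. X m i j * phi0 m k l) = - (\<Sum>m\<in>UNIV. X m k l * phi0 m i j)" .
  have "(\<Sum>q\<in>UNIV. \<alpha> i q * psi0 q j k l + \<alpha> j q * psi0 i q k l + \<alpha> k q * psi0 i j q l + \<alpha> l q * psi0 i j k q)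
    = (\<Sum>q\<in>UNIV. \<alpha> i q * psi0 q j k l + \<alpha> j q * psi0 i q k l) + (\<Sum>q\<in>UNIV. \<alpha> k q * psi0 q l i j + \<alpha> l q * psi0 k q i j)"
    by (simp add: sum.distrib pair[of i j])
  also have "\<dots> = 0"
    unfolding 1 using 2 sk[of i k] sk[of i l] sk[of j k] sk[of j l] by (simp add: kd_def)
  finally show ?thesis .
qed

text \<open>By the kernel condition the product term of \<open>psi0\<close> contributes nothing, and
  the two delta terms give -2. Thus g2 consists of eigenvectors of the contraction with the
  4-form.\<close>

lemma g2_psi0_contract:
  assumes sk: "\<And>a b. \<alpha> b a = - \<alpha> a b"
    and H: "\<And>k. (\<Sum>a\<in>UNIV. \<Sum>b\<in>UNIV. \<alpha> a b * phi0 a b k) = 0"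
  shows "(\<Sum>i\<in>UNIV. \<Sum>j\<in>UNIV. \<alpha> i j * psi0 i j n m) = - 2 * \<alpha> n m"
proof -
  have "(\<Sum>i\<in>UNIV. \<Sum>j\<in>UNIV. \<alpha> i j * psi0 i j n m)
    = (\<Sum>i\<in>UNIV. \<Sum>j\<in>UNIV. \<Sum>q\<in>UNIV. \<alpha> i j * phi0 q i j * phi0 q n m)
      - (\<Sum>i\<in>UNIV. \<Sum>j\<in>UNIV. \<alpha> i j * kd i n * kd j m) + (\<Sum>i\<in>UNIV. \<Sum>j\<in>UNIV. \<alpha> i j * kd i m * kd j n)"
    unfolding sum.distrib[symmetric] sum_subtractf[symmetric]
    by (intro sum.cong refl) (simp add: psi0_def algebra_simps sum_distrib_left)
  also have "(\<Sum>i\<in>UNIV. \<Sum>j\<in>UNIV. \<Sum>q\<in>UNIV. \<alpha> i j * phi0 q i j * phi0 q n m)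
     = (\<Sum>q\<in>UNIV. (\<Sum>i\<in>UNIV. \<Sum>j\<in>UNIV. \<alpha> i j * phi0 q i j) * phi0 q n m)"
    by (subst sum.swap[of _ UNIV "UNIV :: 7 set"], subst (2) sum.swap) (simp add: sum_distrib_right)
  also have "\<dots> = 0"
  proof -
    have "(\<Sum>i\<in>UNIV. \<Sum>j\<in>UNIV. \<alpha> i j * phi0 q i j) = 0" for q
      using H[of q] phi0_cyc'[of q] by simp
    then show ?thesis by simp
  qed
  finally show ?thesis by (simp add: kd_sum' sk[of m n])
qed

section \<open>The metric of a \<open>G\<^sub>2\<close> form\<close>

definition outer :: "real^'n \<Rightarrow> real^'n \<Rightarrow> real^'n^'n" where
  "outer x y = (\<chi> i j. x $ i * y $ j)"

definition set_col :: "'n \<Rightarrow> real^'n^'n \<Rightarrow> real^'n \<Rightarrow> real^'n^'n" where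
  "set_col k A c = (\<chi> i j. if j = k then c $ i else A $ i $ j)"

lemma det_set_col_mult: "det (set_col k A (A *v x)) = x $ k * det A"
  unfolding set_col_def by (rule cramer_lemma)

lemma det_set_col_1: "det (set_col k (mat 1) x) = x $ k"
  using det_set_col_mult[of k "mat 1" x] by simp

lemma set_col_scale: "set_col k A (c *s x) = set_col k A x ** set_col k (mat 1) (c *s axis k 1)"
  unfolding vec_eq_iff set_col_def matrix_matrix_mult_def mat_def
  by (auto simp: axis_def if_distrib[of "\<lambda>t. _ * t"] cong: if_cong)

text \<open>The matrix Q = 1 + x y^T maps x to (1 + y.x) x. By \<open>det_set_col_mult\<close>,
  putting this vector into column k of Q multiplies det Q by x_k; the resulting determinant is also
  computed directly.\<close>

lemma det_rank_one_update:
  fixes x y :: "real^'n"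
  shows "det (mat 1 + outer x y) = 1 + y \<bullet> x"
proof (cases "x = 0")
  case True
  then have "outer x y = 0" by (simp add: outer_def vec_eq_iff)
  then show ?thesis using True by simp
next
  case False
  then obtain k where k: "x $ k \<noteq> 0" by (auto simp: vec_eq_iff)
  let ?Q = "mat 1 + outer x y"
  define z where "z = (\<chi> j. if j = k then 1 else y $ j)"
  have Qx: "?Q *v x = (1 + y \<bullet> x) *s x"
    unfolding vec_eq_iff matrix_vector_mult_def outer_def mat_def inner_vec_def
    by (simp add: algebra_simps sum.distrib if_distrib[of "\<lambda>t. _ * t"] sum_distrib_left cong: if_cong)
  have S: "det (transpose (set_col k (mat 1) z)) = 1"
    unfolding det_transpose det_set_col_1 by (simp add: z_def)
  \<comment> \<open>Column j of Q is e_j + y_j x. Once x stands in column k, the multiples of x in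
    the other columns come from the right factor, which differs from the identity in row k
    only.\<close>
  have M: "set_col k ?Q x = set_col k (mat 1) x ** transpose (set_col k (mat 1) z)"
  proof -
    have "(set_col k (mat 1) x ** transpose (set_col k (mat 1) z)) $ i $ j
        = (\<Sum>l\<in>UNIV. (if l = k then x $ i * z $ j else 0) + (if l = i \<and> l \<noteq> k \<and> l = j then 1 else 0))" for i j
      unfolding matrix_matrix_mult_def transpose_def set_col_def mat_def by (auto intro!: sum.cong)
    also have "\<dots> i j = x $ i * z $ j + (if i \<noteq> k \<and> i = j then 1 else 0)" for i j
    proof -
      have "(\<Sum>l\<in>UNIV. if l = i \<and> l \<noteq> k \<and> l = j then 1 else (0::real)) = (\<Sum>l\<in>UNIV. if l = i then (if i \<noteq> k \<and> i = j then 1 else 0) else 0)"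
        by (intro sum.cong) auto
      then show ?thesis by (simp add: sum.distrib)
    qed
    finally show ?thesis
      unfolding vec_eq_iff set_col_def outer_def mat_def by (auto simp: z_def)
  qed
  have "x $ k * det ?Q = det (set_col k ?Q ((1 + y \<bullet> x) *s x))"
    unfolding Qx[symmetric] det_set_col_mult ..
  also have "\<dots> = det (set_col k ?Q x) * (1 + y \<bullet> x)"
    unfolding set_col_scale[of k ?Q] det_mul det_set_col_1 by simp
  also have "det (set_col k ?Q x) = x $ k" unfolding M det_mul S det_set_col_1 by simp
  finally show ?thesis using k by simp
qed

lemma outer_mult: "outer x y *v z = (y \<bullet> z) *s x"
  unfolding vec_eq_iff outer_def matrix_vector_mult_def inner_vec_def
  by (simp add: sum_distrib_left algebra_simps)

lemma mult_outer: "A ** outer x y = outer (A *v x) y"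
  unfolding vec_eq_iff outer_def matrix_matrix_mult_def matrix_vector_mult_def
  by (simp add: sum_distrib_left mult_ac)

lemma matrix_add_rdistrib: "(A + B) ** C = A ** C + B ** (C :: real^'n^'m)"
  unfolding vec_eq_iff matrix_matrix_mult_def by (simp add: algebra_simps sum.distrib)

lemma outer_mult_matrix: "outer x y ** A = outer x (transpose A *v y)"
  unfolding vec_eq_iff outer_def matrix_matrix_mult_def matrix_vector_mult_def transpose_def
  by (simp add: sum_distrib_left mult_ac)

text \<open>A shear \<open>1 + u z\<^sup>T\<close> along the kernel of a skew matrix \<open>K\<close> fixes \<open>K\<close> and moves \<open>w\<close> to \<open>w'\<close>.\<close>

lemma det_skew_plus_outer:
  fixes K :: "real^'n^'n"
  assumes sk: "transpose K = - K" and Ku: "K *v u = 0" and wu: "w \<bullet> u \<noteq> 0"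
  shows "det (K + outer w w) * (w' \<bullet> u)\<^sup>2 = det (K + outer w' w') * (w \<bullet> u)\<^sup>2"
proof -
  \<comment> \<open>Chosen so that 1 + z u^T maps w to w + (w.u) z = w'.\<close>
  define z where "z = (1 / (w \<bullet> u)) *s (w' - w)"
  let ?P = "mat 1 + outer u z"
  have tP: "transpose ?P = mat 1 + outer z u"
    by (simp add: transpose_def outer_def mat_def vec_eq_iff mult.commute)
  have KP: "K ** ?P = K"
    unfolding matrix_add_ldistrib mult_outer Ku by (simp add: outer_def vec_eq_iff)
  have "(- K) *v u = - (K *v u)" by (simp add: vec_eq_iff matrix_vector_mult_def sum_negf)
  then have PK: "transpose ?P ** K = K"
    unfolding tP matrix_add_rdistrib outer_mult_matrix sk using Ku by (simp add: outer_def vec_eq_iff)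
  have tPw: "transpose ?P *v w = w'"
    unfolding tP matrix_vector_mult_add_rdistrib outer_mult using wu
    by (simp add: z_def vec_eq_iff inner_commute)
  have 1: "transpose ?P ** (K + outer w w) = K + outer w' w"
    by (simp only: matrix_add_ldistrib[of _ K] PK mult_outer tPw)
  have "transpose ?P ** (K + outer w w) ** ?P = K + outer w' w'"
    unfolding 1 by (simp only: matrix_add_rdistrib[of K] KP outer_mult_matrix tPw)
  then have "det ?P * det (K + outer w w) * det ?P = det (K + outer w' w')"
    by (metis det_mul det_transpose)
  moreover have "det ?P = (w' \<bullet> u) / (w \<bullet> u)"
    unfolding det_rank_one_update using wu by (simp add: z_def inner_diff_left field_simps scalar_mult_eq_scaleR)
  ultimately show ?thesis using wu by (simp add: field_simps power2_eq_square)
qed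

text \<open>The interior product of v with the model form, as a skew matrix; up to sign it is the
  cross product by v.\<close>

definition phi_mat :: "real^7 \<Rightarrow> real^7^7" where
  "phi_mat v = (\<chi> j k. \<Sum>a\<in>UNIV. v $ a * phi0 a j k)"

lemma psi0_swap13: "psi0 c b a d = - psi0 a b c d"
  using psi0_swap12[of b c a d] psi0_swap23[of b c a d] psi0_swap12[of a b c d] by simp

text \<open>The identity |v x w|^2 = |v|^2 |w|^2 - (v.w)^2 in matrix form. The contraction of
  \<open>phi0\<close> with itself is \<open>psi0\<close> plus deltas, and \<open>psi0\<close> drops
  out by antisymmetry in the two slots filled with v.\<close>

lemma phi_mat_square:
  "phi_mat v ** transpose (phi_mat v) = (v \<bullet> v) *\<^sub>R mat 1 - outer v v"
proof -
  have c: "(\<Sum>k\<in>UNIV. phi0 a j k * phi0 b l k) = psi0 a j b l + kd a b * kd j l - kd a l * kd j b" for a b j l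
  proof -
    have "(\<Sum>k\<in>UNIV. phi0 a j k * phi0 b l k) = (\<Sum>k\<in>UNIV. phi0 k a j * phi0 k b l)"
      by (intro sum.cong refl) (simp only: phi0_cyc'[of _ a j] phi0_cyc'[of _ b l])
    then show ?thesis by (simp add: psi0_def)
  qed
  have "(\<Sum>k\<in>UNIV. (\<Sum>a\<in>UNIV. v $ a * phi0 a j k) * (\<Sum>b\<in>UNIV. v $ b * phi0 b l k))
      = (v \<bullet> v) * kd j l - v $ j * v $ l" for j l
  proof -
    have "(\<Sum>k\<in>UNIV. (\<Sum>a\<in>UNIV. v $ a * phi0 a j k) * (\<Sum>b\<in>UNIV. v $ b * phi0 b l k))
      = (\<Sum>k\<in>UNIV. \<Sum>a\<in>UNIV. \<Sum>b\<in>UNIV. v $ a * v $ b * (phi0 a j k * phi0 b l k))"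
      by (simp add: sum_product mult_ac)
    also have "\<dots> = (\<Sum>a\<in>UNIV. \<Sum>k\<in>UNIV. \<Sum>b\<in>UNIV. v $ a * v $ b * (phi0 a j k * phi0 b l k))"
      by (rule sum.swap)
    also have "\<dots> = (\<Sum>a\<in>UNIV. \<Sum>b\<in>UNIV. \<Sum>k\<in>UNIV. v $ a * v $ b * (phi0 a j k * phi0 b l k))"
      by (rule sum.cong[OF refl], rule sum.swap)
    also have "\<dots> = (\<Sum>a\<in>UNIV. \<Sum>b\<in>UNIV. v $ a * v $ b * (psi0 a j b l + kd a b * kd j l - kd a l * kd j b))"
      unfolding c[symmetric] sum_distrib_left ..
    also have "\<dots> = (\<Sum>a\<in>UNIV. \<Sum>b\<in>UNIV. v $ a * v $ b * psi0 a j b l)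
        + (\<Sum>a\<in>UNIV. (\<Sum>b\<in>UNIV. (v $ a * v $ b) * kd a b) * kd j l)
        - (\<Sum>a\<in>UNIV. (\<Sum>b\<in>UNIV. (v $ a * v $ b) * kd j b) * kd a l)"
      unfolding sum_distrib_right sum.distrib[symmetric] sum_subtractf[symmetric]
      by (intro sum.cong refl) (simp add: algebra_simps)
    also have "\<dots> = (\<Sum>a\<in>UNIV. \<Sum>b\<in>UNIV. v $ a * v $ b * psi0 a j b l) + (v \<bullet> v) * kd j l - v $ l * v $ j"
      unfolding kd_sum' inner_vec_def by (simp add: sum_distrib_right)
    also have "(\<Sum>a\<in>UNIV. \<Sum>b\<in>UNIV. v $ a * v $ b * psi0 a j b l) = 0"
    proof -
      have "(\<Sum>a\<in>UNIV. \<Sum>b\<in>UNIV. v $ a * v $ b * psi0 a j b l) = (\<Sum>b\<in>UNIV. \<Sum>a\<in>UNIV. v $ a * v $ b * psi0 a j b l)"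
        by (rule sum.swap)
      also have "\<dots> = - (\<Sum>b\<in>UNIV. \<Sum>a\<in>UNIV. v $ b * v $ a * psi0 b j a l)"
        unfolding sum_negf[symmetric] by (intro sum.cong refl) (subst psi0_swap13, simp)
      finally show ?thesis by (simp only: equal_neg_zero)
    qed
    finally show ?thesis by simp
  qed
  then show ?thesis
    unfolding vec_eq_iff matrix_matrix_mult_def phi_mat_def transpose_def outer_def mat_def
    by (auto simp: kd_def)
qed

lemma transpose_phi_mat: "transpose (phi_mat v) = - phi_mat v"
  unfolding vec_eq_iff
proof (intro allI)
  fix j k
  have "(\<Sum>a\<in>UNIV. v $ a * phi0 a k j) = (\<Sum>a\<in>UNIV. - (v $ a * phi0 a j k))"
    by (intro sum.cong refl) (simp only: phi0_swap23[of _ k j] mult_minus_right)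
  then show "transpose (phi_mat v) $ j $ k = (- phi_mat v) $ j $ k"
    by (simp add: phi_mat_def transpose_def sum_negf)
qed

lemma phi_mat_self: "phi_mat v *v v = 0"
proof -
  have "(\<Sum>k\<in>UNIV. (\<Sum>a\<in>UNIV. v $ a * phi0 a j k) * v $ k) = 0" for j
  proof -
    have "(\<Sum>k\<in>UNIV. (\<Sum>a\<in>UNIV. v $ a * phi0 a j k) * v $ k) = (\<Sum>k\<in>UNIV. \<Sum>a\<in>UNIV. v $ a * v $ k * phi0 a j k)"
      by (simp add: sum_distrib_left mult_ac)
    also have "\<dots> = (\<Sum>a\<in>UNIV. \<Sum>k\<in>UNIV. v $ a * v $ k * phi0 a j k)" by (rule sum.swap)
    also have "\<dots> = - (\<Sum>a\<in>UNIV. \<Sum>k\<in>UNIV. v $ k * v $ a * phi0 k j a)"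
      unfolding sum_negf[symmetric]
    proof (intro sum.cong refl)
      fix a k
      have "phi0 a j k = - phi0 k j a"
        using phi0_swap[of j a k] phi0_cyc[of j a k] by linarith
      then show "v $ a * v $ k * phi0 a j k = - (v $ k * v $ a * phi0 k j a)" by (simp only: mult_minus_right mult.commute[of "v $ a"])
    qed
    also have "(\<Sum>a\<in>UNIV. \<Sum>k\<in>UNIV. v $ k * v $ a * phi0 k j a) = (\<Sum>k\<in>UNIV. (\<Sum>a\<in>UNIV. v $ a * phi0 a j k) * v $ k)"
      by (simp add: sum_distrib_left mult_ac)
    finally show ?thesis by (simp only: equal_neg_zero)
  qed
  then show ?thesis unfolding vec_eq_iff matrix_vector_mult_def phi_mat_def by simp
qed

text \<open>With N the sum and a = v.v, N N^T = a (1 + ((a - 1)/a) v v^T), whose determinant is a^7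
  times a. The sign of det N remains open in this way, hence the square.\<close>

lemma det_phi_mat_plus_outer:
  assumes "v \<noteq> 0"
  shows "(det (phi_mat v + outer v v))\<^sup>2 = (v \<bullet> v) ^ 8"
proof -
  let ?N = "phi_mat v + outer v v" and ?a = "v \<bullet> v"
  have a: "?a \<noteq> 0" using assms by simp
  have sq: "outer v v ** outer v v = ?a *\<^sub>R outer v v"
    unfolding mult_outer outer_mult by (simp add: outer_def vec_eq_iff)
  have "?N ** transpose ?N = phi_mat v ** transpose (phi_mat v) + outer v v ** outer v v"
  proof -
    have "transpose ?N = transpose (phi_mat v) + outer v v"
      by (simp add: transpose_def outer_def vec_eq_iff)
    moreover have "phi_mat v ** outer v v = 0" unfolding mult_outer phi_mat_self by (simp add: outer_def vec_eq_iff)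
    moreover have "outer v v ** transpose (phi_mat v) = 0"
      unfolding outer_mult_matrix transpose_transpose phi_mat_self by (simp add: outer_def vec_eq_iff)
    ultimately show ?thesis by (simp add: matrix_add_ldistrib matrix_add_rdistrib)
  qed
  also have "\<dots> = mat ?a ** (mat 1 + outer (((?a - 1) / ?a) *s v) v)"
  proof -
    have m: "mat ?a ** M = ?a *\<^sub>R M" for M :: "real^7^7"
      by (simp add: vec_eq_iff matrix_matrix_mult_def mat_def if_distrib[of "\<lambda>t. t * _"] cong: if_cong)
    have e: "(if P then b else 0) - p + b * p = b * ((if P then 1 else 0) + (b - 1) / b * p)"
      if "b \<noteq> 0" for b p :: real and P
      using that by (simp add: field_simps)
    show ?thesis unfolding phi_mat_square sq m vec_eq_iff
    proof (intro allI)
      fix i j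
      show "(?a *\<^sub>R mat 1 - outer v v + ?a *\<^sub>R outer v v) $ i $ j
        = (?a *\<^sub>R (mat 1 + outer (((?a - 1) / ?a) *s v) v)) $ i $ j"
        using e[OF a, of "i = j" "v $ i * v $ j"] by (simp add: outer_def mat_def mult.assoc if_distrib cong: if_cong)
    qed
  qed
  finally have eq: "?N ** transpose ?N = mat ?a ** (mat 1 + outer (((?a - 1) / ?a) *s v) v)" .
  have "det ?N * det ?N = det (?N ** transpose ?N)" by (simp only: det_mul det_transpose)
  also have "\<dots> = det (mat ?a :: real^7^7) * (1 + v \<bullet> (((?a - 1) / ?a) *s v))"
    unfolding eq det_mul det_rank_one_update ..
  also have "det (mat ?a :: real^7^7) = ?a ^ 7"
    by (subst det_diagonal) (simp_all add: mat_def)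
  also have "1 + v \<bullet> (((?a - 1) / ?a) *s v) = ?a" using a by (simp add: scalar_mult_eq_scaleR)
  finally show ?thesis using power_Suc2[of ?a 7] by (simp add: power2_eq_square)
qed

section \<open>Uniqueness of the metric and nondegeneracy of the form\<close>

lemma adapted_contract:
  assumes "g2_adapted a E"
  shows "(\<chi> j k. \<Sum>i\<in>UNIV. u $ i * a [i, j, k]) = transpose E ** phi_mat (E *v u) ** E"
proof -
  have "(\<Sum>i\<in>UNIV. u $ i * a [i, j, k]) = (transpose E ** phi_mat (E *v u) ** E) $ j $ k" for j k
  proof -
    have "a [i, j, k] = (\<Sum>p\<in>UNIV. \<Sum>b\<in>UNIV. \<Sum>c\<in>UNIV. phi0 p b c * (E $ p $ i * E $ b $ j * E $ c $ k))" for i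
      using assms by (simp add: g2_adapted_def g2_model_eq)
    then have "(\<Sum>i\<in>UNIV. u $ i * a [i, j, k]) = (\<Sum>i\<in>UNIV. \<Sum>p\<in>UNIV. \<Sum>b\<in>UNIV. \<Sum>c\<in>UNIV. phi0 p b c * (E $ p $ i * u $ i) * (E $ b $ j * E $ c $ k))"
      by (simp add: sum_distrib_left mult_ac)
    also have "\<dots> = (\<Sum>p\<in>UNIV. \<Sum>b\<in>UNIV. \<Sum>c\<in>UNIV. \<Sum>i\<in>UNIV. phi0 p b c * (E $ p $ i * u $ i) * (E $ b $ j * E $ c $ k))"
      by (subst sum.swap, rule sum.cong[OF refl], subst sum.swap, rule sum.cong[OF refl], rule sum.swap)
    also have "\<dots> = (\<Sum>p\<in>UNIV. \<Sum>b\<in>UNIV. \<Sum>c\<in>UNIV. E $ b $ j * ((E *v u) $ p * phi0 p b c) * E $ c $ k)"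
      by (simp add: matrix_vector_mult_def sum_distrib_left sum_distrib_right mult_ac)
    also have "\<dots> = (\<Sum>c\<in>UNIV. \<Sum>b\<in>UNIV. \<Sum>p\<in>UNIV. E $ b $ j * ((E *v u) $ p * phi0 p b c) * E $ c $ k)"
      by (subst sum.swap, subst (2) sum.swap, subst sum.swap) (rule refl)
    also have "\<dots> = (transpose E ** phi_mat (E *v u) ** E) $ j $ k"
      by (simp add: matrix_matrix_mult_def transpose_def phi_mat_def sum_distrib_left sum_distrib_right)
    finally show ?thesis .
  qed
  then show ?thesis by (simp add: vec_eq_iff)
qed

text \<open>\<open>K = u \<lrcorner> \<phi>\<close> is skew with kernel spanned by \<open>u\<close>, so \<open>det (K + w w\<^sup>T)\<close> depends on \<open>w\<close> only
  through \<open>w \<bullet> u\<close>. Evaluating it in both coframes compares the two conformal classes.\<close>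

lemma adapted_det_identity:
  assumes E: "g2_adapted a E" and F: "g2_adapted a F" and u: "u \<noteq> 0"
  shows "\<bar>det E\<bar> * ((E *v u) \<bullet> (E *v u)) = \<bar>det F\<bar> * ((F *v u) \<bullet> (F *v u))"
proof -
  let ?K = "\<chi> j k. \<Sum>i\<in>UNIV. u $ i * a [i, j, k]"
  have inj: "G *v u \<noteq> 0" if "g2_adapted a G" for G
    using that u unfolding g2_adapted_def by (metis inj_matrix_vector_mult injD matrix_vector_mult_0_right)
  have K: "?K = transpose G ** phi_mat (G *v u) ** G" if "g2_adapted a G" for G
    using adapted_contract[OF that] .
  have wu: "(transpose G *v (G *v u)) \<bullet> u = (G *v u) \<bullet> (G *v u)" for G :: "real^7^7"
    by (metis dot_lmul_matrix inner_commute transpose_matrix_vector vector_transpose_matrix)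
  have d: "det (?K + outer (transpose G *v (G *v u)) (transpose G *v (G *v u)))
      = (det G)\<^sup>2 * det (phi_mat (G *v u) + outer (G *v u) (G *v u))" if "g2_adapted a G" for G
  proof -
    have "?K + outer (transpose G *v (G *v u)) (transpose G *v (G *v u))
      = transpose G ** (phi_mat (G *v u) + outer (G *v u) (G *v u)) ** G"
      unfolding K[OF that] matrix_add_ldistrib[of "transpose G"] matrix_add_rdistrib[of _ _ G] mult_outer outer_mult_matrix ..
    then show ?thesis by (simp add: det_mul power2_eq_square)
  qed
  have sk: "transpose ?K = - ?K"
    unfolding K[OF E] matrix_transpose_mul transpose_transpose transpose_phi_mat
    by (simp add: matrix_mul_assoc) (simp add: vec_eq_iff matrix_matrix_mult_def sum_negf)
  have Ku: "?K *v u = 0"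
    unfolding K[OF E] by (simp add: matrix_vector_mul_assoc[symmetric] phi_mat_self)
  let ?a = "(E *v u) \<bullet> (E *v u)" and ?b = "(F *v u) \<bullet> (F *v u)"
  have ab: "?a > 0" "?b > 0" using inj[OF E] inj[OF F] by simp_all
  have "(det E)\<^sup>2 * det (phi_mat (E *v u) + outer (E *v u) (E *v u)) * ?b\<^sup>2
      = (det F)\<^sup>2 * det (phi_mat (F *v u) + outer (F *v u) (F *v u)) * ?a\<^sup>2"
    using det_skew_plus_outer[OF sk Ku, of "transpose E *v (E *v u)" "transpose F *v (F *v u)"] ab
    unfolding wu d[OF E] d[OF F] by simp
  \<comment> \<open>The inner determinants are known up to sign, so the equation is squared; the
    fourth roots taken at the end are those of nonnegative numbers.\<close>
  then have "((det E)\<^sup>2 * det (phi_mat (E *v u) + outer (E *v u) (E *v u)) * ?b\<^sup>2)\<^sup>2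
      = ((det F)\<^sup>2 * det (phi_mat (F *v u) + outer (F *v u) (F *v u)) * ?a\<^sup>2)\<^sup>2" by simp
  then have "(det E) ^ 4 * ?a ^ 8 * ?b ^ 4 = (det F) ^ 4 * ?b ^ 8 * ?a ^ 4"
    unfolding power_mult_distrib det_phi_mat_plus_outer[OF inj[OF E]] det_phi_mat_plus_outer[OF inj[OF F]]
    by (simp flip: power_mult)
  then have "(?a ^ 4 * ?b ^ 4) * ((det E) ^ 4 * ?a ^ 4) = (?a ^ 4 * ?b ^ 4) * ((det F) ^ 4 * ?b ^ 4)"
    by algebra
  then have "(det E) ^ 4 * ?a ^ 4 = (det F) ^ 4 * ?b ^ 4" using ab by simp
  then have "(\<bar>det E\<bar> * ?a) ^ 4 = (\<bar>det F\<bar> * ?b) ^ 4"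
    by (simp add: power_mult_distrib power_even_abs)
  then show ?thesis
    by (rule power_eq_imp_eq_base[where n = 4]) (use ab in auto)
qed

lemma symmetric_matrix_eqI:
  fixes G H :: "real^'n^'n"
  assumes "transpose G = G" "transpose H = H" and q: "\<And>u. u \<bullet> (G *v u) = u \<bullet> (H *v u)"
  shows "G = H"
proof -
  have b: "axis i 1 \<bullet> (M *v axis j 1) = M $ i $ j" for M :: "real^'n^'n" and i j
    by (simp add: inner_axis' matrix_vector_mult_basis column_def)
  have "G $ i $ j = H $ i $ j" for i j
  proof -
    have e: "(axis i 1 + axis j 1) \<bullet> (M *v (axis i 1 + axis j 1)) = M $ i $ i + M $ i $ j + M $ j $ i + M $ j $ j" for M :: "real^'n^'n"
      by (simp add: matrix_vector_right_distrib inner_add_left inner_add_right b)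
    have s: "G $ j $ i = G $ i $ j" "H $ j $ i = H $ i $ j"
      using arg_cong[OF assms(1), of "\<lambda>M. M $ i $ j"] arg_cong[OF assms(2), of "\<lambda>M. M $ i $ j"]
      by (simp_all add: transpose_def)
    show ?thesis using q[of "axis i 1 + axis j 1"] q[of "axis i 1"] q[of "axis j 1"] unfolding e b s by simp
  qed
  then show ?thesis by (simp add: vec_eq_iff)
qed

text \<open>By \<open>adapted_det_identity\<close> the two metrics agree after weighting with |det
  E| and |det F|. Taking determinants in dimension 7 gives |det E|^9 = |det F|^9, where 9 = 7 + 2,
  so the weights agree as well.\<close>

lemma adapted_metric_unique:
  assumes E: "g2_adapted a E" and F: "g2_adapted a F"
  shows "transpose E ** E = transpose F ** F"
proof -
  have pos: "\<bar>det E\<bar> > 0" "\<bar>det F\<bar> > 0"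
    using E F invertible_det_nz by (auto simp: g2_adapted_def)
  have q: "u \<bullet> ((transpose G ** G) *v u) = (G *v u) \<bullet> (G *v u)" for G :: "real^7^7" and u
    by (metis dot_lmul_matrix matrix_vector_mul_assoc transpose_matrix_vector vector_transpose_matrix)
  have sG: "transpose (c *\<^sub>R (transpose G ** G)) = c *\<^sub>R (transpose G ** G)" for c and G :: "real^7^7"
    by (simp add: transpose_scalar matrix_transpose_mul)
  have eq: "\<bar>det E\<bar> *\<^sub>R (transpose E ** E) = \<bar>det F\<bar> *\<^sub>R (transpose F ** F)"
  proof (rule symmetric_matrix_eqI[OF sG sG])
    fix u :: "real^7"
    show "u \<bullet> ((\<bar>det E\<bar> *\<^sub>R (transpose E ** E)) *v u) = u \<bullet> ((\<bar>det F\<bar> *\<^sub>R (transpose F ** F)) *v u)"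
      using adapted_det_identity[OF E F, of u] by (cases "u = 0") (simp_all add: scaleR_matrix_vector_assoc[symmetric] q)
  qed
  have dsc: "det (c *\<^sub>R M) = c ^ 7 * det M" for c and M :: "real^7^7"
  proof -
    have "c *\<^sub>R M = (\<chi> i. c *s M $ i)" by (simp add: vec_eq_iff)
    then show ?thesis using det_rows_mul[of "\<lambda>_. c" "\<lambda>i. M $ i"] by simp
  qed
  have "\<bar>det E\<bar> ^ 7 * (det E * det E) = \<bar>det F\<bar> ^ 7 * (det F * det F)"
    using arg_cong[OF eq, of det] by (simp add: dsc det_mul)
  then have "\<bar>det E\<bar> ^ 7 * (\<bar>det E\<bar> * \<bar>det E\<bar>) = \<bar>det F\<bar> ^ 7 * (\<bar>det F\<bar> * \<bar>det F\<bar>)"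
    by (simp add: abs_mult_self_eq)
  then have "\<bar>det E\<bar> ^ 9 = \<bar>det F\<bar> ^ 9" by (simp flip: power_Suc2 add: numeral_eq_Suc mult.commute mult.left_commute)
  then have "\<bar>det E\<bar> = \<bar>det F\<bar>" by (rule power_eq_imp_eq_base) auto
  then show ?thesis using eq pos by simp
qed

text \<open>Removes the choice made in \<open>g2_coframe\<close>: every adapted coframe, in
  particular a smooth local one, computes the metric.\<close>

lemma g2_metric_eq: "g2_adapted a E \<Longrightarrow> g2_metric a = transpose E ** E"
  unfolding g2_metric_def g2_coframe_def by (rule adapted_metric_unique) (rule someI)

text \<open>If v = E u has zero interior product with the model form, \<open>phi_mat_square\<close>
  equates |v|^2 times the identity with the rank-one matrix v v^T. It serves to show that the
  Jacobian of a change of charts is invertible.\<close>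

lemma adapted_nondegenerate:
  assumes E: "g2_adapted a E" and z: "\<And>j k. (\<Sum>i\<in>UNIV. u $ i * a [i, j, k]) = 0"
  shows "u = 0"
proof (rule ccontr)
  assume u: "u \<noteq> 0"
  have iE: "invertible E" using E by (simp add: g2_adapted_def)
  have v: "E *v u \<noteq> 0"
    using iE u by (metis inj_matrix_vector_mult injD matrix_vector_mult_0_right)
  have "transpose E ** phi_mat (E *v u) ** E = 0"
    unfolding adapted_contract[OF E, symmetric] z by (simp add: vec_eq_iff)
  then have "phi_mat (E *v u) = 0"
  proof -
    assume 0: "transpose E ** phi_mat (E *v u) ** E = 0"
    obtain F where F: "E ** F = mat 1" using iE unfolding invertible_def by blast
    have tF: "transpose F ** transpose E = mat 1" by (metis F matrix_transpose_mul transpose_mat)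
    have "phi_mat (E *v u) = (transpose F ** transpose E) ** phi_mat (E *v u) ** (E ** F)"
      unfolding F tF by simp
    also have "\<dots> = transpose F ** (transpose E ** phi_mat (E *v u) ** E) ** F"
      by (simp only: matrix_mul_assoc)
    also have "\<dots> = 0" unfolding 0 by (simp add: vec_eq_iff matrix_matrix_mult_def)
    finally show ?thesis .
  qed
  then have sq: "((E *v u) \<bullet> (E *v u)) *\<^sub>R mat 1 = outer (E *v u) (E *v u)"
    using phi_mat_square[of "E *v u"] by (simp add: vec_eq_iff matrix_matrix_mult_def)
  have "(E *v u) \<bullet> (E *v u) = 0"
  proof -
    have "(E *v u) $ i * (E *v u) $ j = 0" if "i \<noteq> j" for i j
      using arg_cong[OF sq, of "\<lambda>M. M $ i $ j"] that by (simp add: outer_def mat_def)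
    from this[of 1 2] have "(E *v u) $ 1 = 0 \<or> (E *v u) $ 2 = 0" by simp
    moreover have "(E *v u) \<bullet> (E *v u) = (E *v u) $ i * (E *v u) $ i" for i
      using arg_cong[OF sq, of "\<lambda>M. M $ i $ i"] by (simp add: outer_def mat_def)
    from this[of 1] this[of 2] have "(E *v u) $ 1 = 0 \<or> (E *v u) $ 2 = 0 \<longrightarrow> (E *v u) \<bullet> (E *v u) = 0" by auto
    ultimately show ?thesis by blast
  qed
  then show False using v by simp
qed

section \<open>The contracted second Bianchi identity\<close>

lemma sum3_rot:
  "(\<Sum>a\<in>UNIV. \<Sum>b\<in>UNIV. \<Sum>c\<in>UNIV. h b c a) = (\<Sum>a\<in>UNIV. \<Sum>b\<in>UNIV. \<Sum>c\<in>UNIV. h a b (c :: 'n::finite) :: real)"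
proof -
  have "(\<Sum>a\<in>UNIV. \<Sum>b\<in>UNIV. \<Sum>c\<in>UNIV. h b c a) = (\<Sum>b\<in>UNIV. \<Sum>a\<in>UNIV. \<Sum>c\<in>UNIV. h b c a)" by (rule sum.swap)
  also have "\<dots> = (\<Sum>b\<in>UNIV. \<Sum>c\<in>UNIV. \<Sum>a\<in>UNIV. h b c a)" by (rule sum.cong[OF refl], rule sum.swap)
  finally show ?thesis .
qed

lemma psi0_rot: "psi0 b c a d = psi0 a b c d"
  using psi0_swap23[of b a c d] psi0_swap12[of b a c d] by simp

lemma psi0_front_last: "psi0 m i j n = - psi0 i j n m"
  using psi0_rot[of i j m n] psi0_swap34[of i j n m] by simp

text \<open>\<open>psi0_derivation\<close> contracted with T. The terms with \<alpha> in one of the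
  three slots summed against T agree, since T and \<open>psi0\<close> are invariant under rotation
  of these slots; this is the factor 3. The term with \<alpha> in the free slot forms the right-hand
  side.\<close>

lemma torsion_rotation:
  assumes sk: "\<And>a b. \<alpha> b a = - \<alpha> a b"
    and H: "\<And>k. (\<Sum>a\<in>UNIV. \<Sum>b\<in>UNIV. \<alpha> a b * phi0 a b k) = 0"
    and T: "\<And>a b c. T b c a = T a b (c :: 7)"
  shows "3 * (\<Sum>m\<in>UNIV. \<Sum>i\<in>UNIV. \<Sum>j\<in>UNIV. \<Sum>q\<in>UNIV. psi0 m i j n * T m i q * \<alpha> q j)
    = - (\<Sum>q\<in>UNIV. \<alpha> n q * (\<Sum>m\<in>UNIV. \<Sum>i\<in>UNIV. \<Sum>p\<in>UNIV. T m i p * psi0 m i p q))"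
proof -
  have D: "(\<Sum>q\<in>UNIV. \<alpha> m q * psi0 q i p n + \<alpha> i q * psi0 m q p n + \<alpha> p q * psi0 m i q n + \<alpha> n q * psi0 m i p q) = 0" for m i p
    by (rule psi0_derivation[OF sk]) (rule g2_kernel_imp_derivation[OF sk H])
  define h where "h m i p = (\<Sum>q\<in>UNIV. T m i p * (\<alpha> p q * psi0 m i q n))" for m i p
  have "0 = (\<Sum>m\<in>UNIV. \<Sum>i\<in>UNIV. \<Sum>p\<in>UNIV. T m i p *
     (\<Sum>q\<in>UNIV. \<alpha> m q * psi0 q i p n + \<alpha> i q * psi0 m q p n + \<alpha> p q * psi0 m i q n + \<alpha> n q * psi0 m i p q))"
    by (simp add: D)
  also have "\<dots> = (\<Sum>m\<in>UNIV. \<Sum>i\<in>UNIV. \<Sum>p\<in>UNIV. h i p m + h p m i + h m i p + (\<Sum>q\<in>UNIV. \<alpha> n q * (T m i p * psi0 m i p q)))"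
  proof (intro sum.cong refl)
    fix m i p
    have "T m i p * (\<alpha> m q * psi0 q i p n + \<alpha> i q * psi0 m q p n + \<alpha> p q * psi0 m i q n + \<alpha> n q * psi0 m i p q)
      = T i p m * (\<alpha> m q * psi0 i p q n) + T p m i * (\<alpha> i q * psi0 p m q n) + T m i p * (\<alpha> p q * psi0 m i q n) + \<alpha> n q * (T m i p * psi0 m i p q)" for q
      using T[of i p m] T[of p m i] psi0_rot[of i p q n] psi0_rot[of q p m n] psi0_rot[of p m q n] psi0_rot[of m q p n]
      by (simp add: distrib_left mult_ac)
    then show "T m i p * (\<Sum>q\<in>UNIV. \<alpha> m q * psi0 q i p n + \<alpha> i q * psi0 m q p n + \<alpha> p q * psi0 m i q n + \<alpha> n q * psi0 m i p q)
      = h i p m + h p m i + h m i p + (\<Sum>q\<in>UNIV. \<alpha> n q * (T m i p * psi0 m i p q))"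
      unfolding h_def sum_distrib_left by (simp only: sum.distrib)
  qed
  also have "\<dots> = (\<Sum>m\<in>UNIV. \<Sum>i\<in>UNIV. \<Sum>p\<in>UNIV. h i p m) + (\<Sum>m\<in>UNIV. \<Sum>i\<in>UNIV. \<Sum>p\<in>UNIV. h p m i)
      + (\<Sum>m\<in>UNIV. \<Sum>i\<in>UNIV. \<Sum>p\<in>UNIV. h m i p) + (\<Sum>m\<in>UNIV. \<Sum>i\<in>UNIV. \<Sum>p\<in>UNIV. \<Sum>q\<in>UNIV. \<alpha> n q * (T m i p * psi0 m i p q))"
    by (simp only: sum.distrib)
  also have "(\<Sum>m\<in>UNIV. \<Sum>i\<in>UNIV. \<Sum>p\<in>UNIV. h i p m) = (\<Sum>m\<in>UNIV. \<Sum>i\<in>UNIV. \<Sum>p\<in>UNIV. h m i p)" by (rule sum3_rot)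
  also have "(\<Sum>m\<in>UNIV. \<Sum>i\<in>UNIV. \<Sum>p\<in>UNIV. h p m i) = (\<Sum>m\<in>UNIV. \<Sum>i\<in>UNIV. \<Sum>p\<in>UNIV. h m i p)" by (rule sum3_rot[symmetric])
  also have "(\<Sum>m\<in>UNIV. \<Sum>i\<in>UNIV. \<Sum>p\<in>UNIV. \<Sum>q\<in>UNIV. \<alpha> n q * (T m i p * psi0 m i p q))
      = (\<Sum>q\<in>UNIV. \<alpha> n q * (\<Sum>m\<in>UNIV. \<Sum>i\<in>UNIV. \<Sum>p\<in>UNIV. T m i p * psi0 m i p q))"
    by (simp only: sum_distrib_left) (subst sum.swap, rule sum.cong[OF refl], subst (2) sum.swap, rule sum.cong[OF refl], rule sum.swap)
  also have "(\<Sum>m\<in>UNIV. \<Sum>i\<in>UNIV. \<Sum>p\<in>UNIV. h m i p)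
     = (\<Sum>m\<in>UNIV. \<Sum>i\<in>UNIV. \<Sum>j\<in>UNIV. \<Sum>q\<in>UNIV. psi0 m i j n * T m i q * \<alpha> q j)"
    unfolding h_def by (rule sum.cong[OF refl], rule sum.cong[OF refl], subst sum.swap) (simp add: mult_ac)
  finally show ?thesis by simp
qed

text \<open>\<open>psi0_derivation\<close> for every matrix \<open>om m\<close>, with m also in the
  first slot of \<open>psi0\<close>, contracted with X. Antisymmetry of X identifies the terms in
  the slots i and j, whence the 2; the term in the first slot contains the trace
  \<open>om m m q\<close>.\<close>

lemma connection_rotation:
  assumes sk: "\<And>m a b. om m b a = - om m a b"
    and D: "\<And>m i j k. (\<Sum>q\<in>UNIV. om m i q * phi0 q j k + om m j q * phi0 i q k + om m k q * phi0 i j q) = 0"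
    and X: "\<And>i j n. X j i n = - X i j (n :: 7)"
  shows "2 * (\<Sum>m\<in>UNIV. \<Sum>i\<in>UNIV. \<Sum>j\<in>UNIV. \<Sum>n\<in>UNIV. \<Sum>q\<in>UNIV. psi0 m i j n * om m i q * X q j n)
    + (\<Sum>m\<in>UNIV. \<Sum>i\<in>UNIV. \<Sum>j\<in>UNIV. \<Sum>n\<in>UNIV. \<Sum>q\<in>UNIV. psi0 m i j n * om m n q * X i j q)
    = - (\<Sum>m\<in>UNIV. \<Sum>i\<in>UNIV. \<Sum>j\<in>UNIV. \<Sum>n\<in>UNIV. \<Sum>q\<in>UNIV. - (om m m q * psi0 q i j n * X i j n))"
proof -
  let ?S = "\<lambda>F. \<Sum>m\<in>UNIV. \<Sum>i\<in>UNIV. \<Sum>j\<in>UNIV. \<Sum>n\<in>UNIV. \<Sum>q\<in>(UNIV::7 set). (F m i j n q :: real)"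
  have R: "(\<Sum>q\<in>UNIV. om m m q * psi0 q i j n + om m i q * psi0 m q j n + om m j q * psi0 m i q n + om m n q * psi0 m i j q) = 0" for m i j n
    by (rule psi0_derivation[OF sk D])
  have "0 = (\<Sum>m\<in>UNIV. \<Sum>i\<in>UNIV. \<Sum>j\<in>UNIV. \<Sum>n\<in>UNIV. X i j n *
    (\<Sum>q\<in>UNIV. om m m q * psi0 q i j n + om m i q * psi0 m q j n + om m j q * psi0 m i q n + om m n q * psi0 m i j q))"
    by (simp add: R)
  also have "\<dots> = ?S (\<lambda>m i j n q. om m m q * psi0 q i j n * X i j n) + ?S (\<lambda>m i j n q. om m i q * psi0 m q j n * X i j n)
     + ?S (\<lambda>m i j n q. om m j q * psi0 m i q n * X i j n) + ?S (\<lambda>m i j n q. om m n q * psi0 m i j q * X i j n)"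
    unfolding sum_distrib_left sum.distrib[symmetric] by (intro sum.cong refl) (simp add: distrib_left mult_ac)
  finally have e0: "0 = ?S (\<lambda>m i j n q. om m m q * psi0 q i j n * X i j n) + ?S (\<lambda>m i j n q. om m i q * psi0 m q j n * X i j n)
     + ?S (\<lambda>m i j n q. om m j q * psi0 m i q n * X i j n) + ?S (\<lambda>m i j n q. om m n q * psi0 m i j q * X i j n)" .
  have e1: "?S (\<lambda>m i j n q. om m n q * psi0 m i j q * X i j n) = - ?S (\<lambda>m i j n q. psi0 m i j n * om m n q * X i j q)"
    unfolding sum_negf[symmetric]
    by (rule sum.cong[OF refl], rule sum.cong[OF refl], rule sum.cong[OF refl], subst sum.swap)
      (intro sum.cong refl, subst sk, simp)
  have e2: "?S (\<lambda>m i j n q. om m i q * psi0 m q j n * X i j n) = - ?S (\<lambda>m i j n q. psi0 m i j n * om m i q * X q j n)"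
  proof -
    have "(\<Sum>i\<in>UNIV. \<Sum>j\<in>UNIV. \<Sum>n\<in>UNIV. \<Sum>q\<in>UNIV. om m i q * psi0 m q j n * X i j n)
        = (\<Sum>i\<in>UNIV. \<Sum>q\<in>UNIV. \<Sum>j\<in>UNIV. \<Sum>n\<in>UNIV. om m i q * psi0 m q j n * X i j n)" for m
      by (rule sum.cong[OF refl], rule sum3_rot[symmetric])
    moreover have "\<dots> m = (\<Sum>q\<in>UNIV. \<Sum>i\<in>UNIV. \<Sum>j\<in>UNIV. \<Sum>n\<in>UNIV. om m i q * psi0 m q j n * X i j n)" for m
      by (rule sum.swap)
    moreover have "\<dots> m = (\<Sum>q\<in>UNIV. \<Sum>j\<in>UNIV. \<Sum>n\<in>UNIV. \<Sum>i\<in>UNIV. om m i q * psi0 m q j n * X i j n)" for m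
      by (rule sum.cong[OF refl], rule sum3_rot)
    moreover have "\<dots> m = - (\<Sum>q\<in>UNIV. \<Sum>j\<in>UNIV. \<Sum>n\<in>UNIV. \<Sum>i\<in>UNIV. psi0 m q j n * om m q i * X i j n)" for m
      unfolding sum_negf[symmetric] by (intro sum.cong refl, subst sk, simp)
    ultimately show ?thesis by (simp add: sum_negf)
  qed
  have e3: "?S (\<lambda>m i j n q. om m j q * psi0 m i q n * X i j n) = ?S (\<lambda>m i j n q. om m i q * psi0 m q j n * X i j n)"
    by (rule sum.cong[OF refl], subst sum.swap, intro sum.cong refl, subst psi0_swap23, subst X, simp)
  have "(\<Sum>m\<in>UNIV. \<Sum>i\<in>UNIV. \<Sum>j\<in>UNIV. \<Sum>n\<in>UNIV. \<Sum>q\<in>UNIV. - (om m m q * psi0 q i j n * X i j n))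
    = - ?S (\<lambda>m i j n q. om m m q * psi0 q i j n * X i j n)" by (simp only: sum_negf)
  then show ?thesis using e0 e1 e2 e3 by linarith
qed

text \<open>Applied with \<open>X\<^bsub>ijn\<^esub> = R\<^bsub>ijkl\<^esub> T\<^bsub>nkl\<^esub>\<close>, the connection form \<open>om\<close> and \<open>F\<close> the covariant derivative of \<open>X\<close>
  without the term \<open>R\<^bsub>ijkl\<^esub> \<nabla>\<^sub>m T\<^bsub>nkl\<^esub>\<close>, so that \<open>B\<close> is the second Bianchi identity contracted with \<open>T\<close>.\<close>

lemma contracted_bianchi_divergence:
  assumes sk: "\<And>m a b. om m b a = - om m a b"
    and D: "\<And>m i j k. (\<Sum>q\<in>UNIV. om m i q * phi0 q j k + om m j q * phi0 i q k + om m k q * phi0 i j q) = 0"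
    and X: "\<And>i j n. X j i n = - X i j (n :: 7)"
    and H: "\<And>n k. (\<Sum>a\<in>UNIV. \<Sum>b\<in>UNIV. X a b n * phi0 a b k) = 0"
    and T: "\<And>a b c. T b c a = T a b c" and T': "\<And>a b c. T b a c = - T a b c"
    and B: "\<And>m i j n. F m i j n + F i j m n + F j m i n = 0"
    and F: "\<And>m i j n. F m i j n = G m i j n - (\<Sum>p\<in>UNIV. om m n p * X i j p)
        - (\<Sum>q\<in>UNIV. (om m i q - om i m q - T m i q) * X q j n)"
  shows "3 * (\<Sum>m\<in>UNIV. \<Sum>i\<in>UNIV. \<Sum>j\<in>UNIV. \<Sum>n\<in>UNIV. psi0 m i j n * G m i j n)
    = - (\<Sum>q\<in>UNIV. (6 * (\<Sum>m\<in>UNIV. om m m q) + (\<Sum>m\<in>UNIV. \<Sum>i\<in>UNIV. \<Sum>p\<in>UNIV. T m i p * psi0 m i p q))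
        * (\<Sum>n\<in>UNIV. X q n n))"
proof -
  let ?\<theta> = "\<lambda>q. \<Sum>m\<in>UNIV. \<Sum>i\<in>UNIV. \<Sum>p\<in>UNIV. T m i p * psi0 m i p q"
  let ?Y = "\<lambda>q. \<Sum>n\<in>UNIV. X q n n"
  let ?S = "\<lambda>K. \<Sum>m\<in>UNIV. \<Sum>i\<in>UNIV. \<Sum>j\<in>UNIV. \<Sum>n\<in>(UNIV::7 set). (K m i j n :: real)"
  \<comment> \<open>The three terms of the cyclic identity have the same contraction with
    \<open>psi0\<close>, because \<open>psi0\<close> is invariant under rotation of m, i, j.\<close>
  have F0: "?S (\<lambda>m i j n. psi0 m i j n * F m i j n) = 0"
  proof -
    define h where "h m i j = (\<Sum>n\<in>UNIV. psi0 m i j n * F m i j n)" for m i j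
    have "0 = (\<Sum>m\<in>UNIV. \<Sum>i\<in>UNIV. \<Sum>j\<in>UNIV. \<Sum>n\<in>UNIV. psi0 m i j n * (F m i j n + F i j m n + F j m i n))"
      by (simp add: B)
    also have "\<dots> = (\<Sum>m\<in>UNIV. \<Sum>i\<in>UNIV. \<Sum>j\<in>UNIV. h m i j + h i j m + h j m i)"
    proof (intro sum.cong refl)
      fix m i j
      have "psi0 m i j n * (F m i j n + F i j m n + F j m i n)
        = psi0 m i j n * F m i j n + psi0 i j m n * F i j m n + psi0 j m i n * F j m i n" for n
        using psi0_rot[of i j m n] psi0_rot[of j m i n] by (simp add: distrib_left)
      then show "(\<Sum>n\<in>UNIV. psi0 m i j n * (F m i j n + F i j m n + F j m i n)) = h m i j + h i j m + h j m i"
        by (simp add: h_def sum.distrib)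
    qed
    also have "\<dots> = (\<Sum>m\<in>UNIV. \<Sum>i\<in>UNIV. \<Sum>j\<in>UNIV. h m i j) + (\<Sum>m\<in>UNIV. \<Sum>i\<in>UNIV. \<Sum>j\<in>UNIV. h i j m)
        + (\<Sum>m\<in>UNIV. \<Sum>i\<in>UNIV. \<Sum>j\<in>UNIV. h j m i)"
      by (simp only: sum.distrib)
    also have "(\<Sum>m\<in>UNIV. \<Sum>i\<in>UNIV. \<Sum>j\<in>UNIV. h i j m) = (\<Sum>m\<in>UNIV. \<Sum>i\<in>UNIV. \<Sum>j\<in>UNIV. h m i j)" by (rule sum3_rot)
    also have "(\<Sum>m\<in>UNIV. \<Sum>i\<in>UNIV. \<Sum>j\<in>UNIV. h j m i) = (\<Sum>m\<in>UNIV. \<Sum>i\<in>UNIV. \<Sum>j\<in>UNIV. h m i j)" by (rule sum3_rot[symmetric])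
    finally show ?thesis by (simp add: h_def)
  qed
  \<comment> \<open>The terms by which F differs from G, contracted with \<open>psi0\<close>:
    \<open>gA\<close> and \<open>gC\<close> come from the connection part of the bracket of e_m and
    e_i, \<open>gE\<close> from its torsion part, and \<open>gB\<close> from the connection acting
    on the index n.\<close>
  define gA where "gA = (\<Sum>m\<in>UNIV. \<Sum>i\<in>UNIV. \<Sum>j\<in>UNIV. \<Sum>n\<in>UNIV. \<Sum>q\<in>UNIV. psi0 m i j n * om m i q * X q j n)"
  define gB where "gB = (\<Sum>m\<in>UNIV. \<Sum>i\<in>UNIV. \<Sum>j\<in>UNIV. \<Sum>n\<in>UNIV. \<Sum>q\<in>UNIV. psi0 m i j n * om m n q * X i j q)"
  define gC where "gC = (\<Sum>m\<in>UNIV. \<Sum>i\<in>UNIV. \<Sum>j\<in>UNIV. \<Sum>n\<in>UNIV. \<Sum>q\<in>UNIV. psi0 m i j n * om i m q * X q j n)"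
  define gE where "gE = (\<Sum>m\<in>UNIV. \<Sum>i\<in>UNIV. \<Sum>j\<in>UNIV. \<Sum>n\<in>UNIV. \<Sum>q\<in>UNIV. psi0 m i j n * T m i q * X q j n)"
  have "?S (\<lambda>m i j n. psi0 m i j n * F m i j n) = ?S (\<lambda>m i j n. psi0 m i j n * G m i j n) - gB - (gA - gC - gE)"
    unfolding gA_def gB_def gC_def gE_def sum_subtractf[symmetric]
  proof (intro sum.cong refl)
    fix m i j n
    have 1: "psi0 m i j n * (\<Sum>q\<in>UNIV. (om m i q - om i m q - T m i q) * X q j n) =
      (\<Sum>q\<in>UNIV. psi0 m i j n * om m i q * X q j n - psi0 m i j n * om i m q * X q j n - psi0 m i j n * T m i q * X q j n)"
      unfolding sum_distrib_left by (intro sum.cong refl) (simp add: algebra_simps)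
    have 2: "psi0 m i j n * (\<Sum>p\<in>UNIV. om m n p * X i j p) = (\<Sum>q\<in>UNIV. psi0 m i j n * om m n q * X i j q)"
      unfolding sum_distrib_left by (simp add: mult.assoc)
    show "psi0 m i j n * F m i j n = psi0 m i j n * G m i j n - (\<Sum>q\<in>UNIV. psi0 m i j n * om m n q * X i j q)
      - (\<Sum>q\<in>UNIV. psi0 m i j n * om m i q * X q j n - psi0 m i j n * om i m q * X q j n - psi0 m i j n * T m i q * X q j n)"
      unfolding F right_diff_distrib 1 2 ..
  qed
  moreover have "gC = - gA"
    unfolding gC_def gA_def sum_negf[symmetric]
    by (subst sum.swap) (intro sum.cong refl, subst psi0_swap12, simp)
  \<comment> \<open>As \<open>gC = - gA\<close>, the connection enters through
    \<open>2 * gA + gB\<close>, exactly the combination that \<open>connection_rotation\<close>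
    reduces to a trace.\<close>
  moreover have "2 * gA + gB = 2 * (\<Sum>m\<in>UNIV. \<Sum>q\<in>UNIV. - (om m m q * ?Y q))"
  proof -
    have X2: "(\<Sum>i\<in>UNIV. \<Sum>j\<in>UNIV. \<Sum>n\<in>UNIV. psi0 q i j n * X i j n) = - 2 * ?Y q" for q
    proof -
      have c: "(\<Sum>i\<in>UNIV. \<Sum>j\<in>UNIV. X i j n * psi0 i j n q) = - 2 * X n q n" for n
        by (rule g2_psi0_contract[where \<alpha> = "\<lambda>a b. X a b n", OF X H])
      have "(\<Sum>i\<in>UNIV. \<Sum>j\<in>UNIV. \<Sum>n\<in>UNIV. psi0 q i j n * X i j n) = (\<Sum>n\<in>UNIV. \<Sum>i\<in>UNIV. \<Sum>j\<in>UNIV. psi0 q i j n * X i j n)"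
        by (rule sum3_rot[symmetric])
      also have "\<dots> = (\<Sum>n\<in>UNIV. - (\<Sum>i\<in>UNIV. \<Sum>j\<in>UNIV. X i j n * psi0 i j n q))"
        unfolding sum_negf[symmetric] by (intro sum.cong refl, subst psi0_front_last, simp)
      also have "\<dots> = (\<Sum>n\<in>UNIV. - (2 * X q n n))" unfolding c by (intro sum.cong refl, subst X, simp)
      finally show ?thesis by (simp add: sum_negf sum_distrib_left)
    qed
    have "2 * gA + gB = - (\<Sum>m\<in>UNIV. \<Sum>i\<in>UNIV. \<Sum>j\<in>UNIV. \<Sum>n\<in>UNIV. \<Sum>q\<in>UNIV. - (om m m q * psi0 q i j n * X i j n))"
      unfolding gA_def gB_def by (rule connection_rotation[OF sk D X])
    also have "\<dots> = (\<Sum>m\<in>UNIV. \<Sum>i\<in>UNIV. \<Sum>j\<in>UNIV. \<Sum>n\<in>UNIV. \<Sum>q\<in>UNIV. om m m q * psi0 q i j n * X i j n)"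
      by (simp add: sum_negf)
    also have "\<dots> = (\<Sum>m\<in>UNIV. \<Sum>q\<in>UNIV. \<Sum>i\<in>UNIV. \<Sum>j\<in>UNIV. \<Sum>n\<in>UNIV. om m m q * psi0 q i j n * X i j n)"
    proof (rule sum.cong[OF refl])
      fix m
      have "(\<Sum>i\<in>UNIV. \<Sum>j\<in>UNIV. \<Sum>n\<in>UNIV. \<Sum>q\<in>UNIV. om m m q * psi0 q i j n * X i j n)
        = (\<Sum>i\<in>UNIV. \<Sum>q\<in>UNIV. \<Sum>j\<in>UNIV. \<Sum>n\<in>UNIV. om m m q * psi0 q i j n * X i j n)"
        by (rule sum.cong[OF refl], rule sum3_rot[symmetric])
      also have "\<dots> = (\<Sum>q\<in>UNIV. \<Sum>i\<in>UNIV. \<Sum>j\<in>UNIV. \<Sum>n\<in>UNIV. om m m q * psi0 q i j n * X i j n)" by (rule sum.swap)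
      finally show "(\<Sum>i\<in>UNIV. \<Sum>j\<in>UNIV. \<Sum>n\<in>UNIV. \<Sum>q\<in>UNIV. om m m q * psi0 q i j n * X i j n)
        = (\<Sum>q\<in>UNIV. \<Sum>i\<in>UNIV. \<Sum>j\<in>UNIV. \<Sum>n\<in>UNIV. om m m q * psi0 q i j n * X i j n)" .
    qed
    also have "\<dots> = (\<Sum>m\<in>UNIV. \<Sum>q\<in>UNIV. om m m q * (\<Sum>i\<in>UNIV. \<Sum>j\<in>UNIV. \<Sum>n\<in>UNIV. psi0 q i j n * X i j n))"
      by (simp only: sum_distrib_left mult.assoc)
    finally show ?thesis unfolding X2 by (simp add: sum_distrib_left sum_negf mult_ac)
  qed
  moreover have "3 * gE = (\<Sum>q\<in>UNIV. ?\<theta> q * ?Y q)"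
  proof -
    have e: "3 * (\<Sum>m\<in>UNIV. \<Sum>i\<in>UNIV. \<Sum>j\<in>UNIV. \<Sum>q\<in>UNIV. psi0 m i j n * T m i q * X q j n) = (\<Sum>q\<in>UNIV. X q n n * ?\<theta> q)" for n
    proof -
      have "3 * (\<Sum>m\<in>UNIV. \<Sum>i\<in>UNIV. \<Sum>j\<in>UNIV. \<Sum>q\<in>UNIV. psi0 m i j n * T m i q * X q j n) = - (\<Sum>q\<in>UNIV. X n q n * ?\<theta> q)"
        by (rule torsion_rotation[where \<alpha> = "\<lambda>a b. X a b n", OF X H T])
      also have "\<dots> = (\<Sum>q\<in>UNIV. X q n n * ?\<theta> q)"
        unfolding sum_negf[symmetric] by (intro sum.cong refl, subst X, simp)
      finally show ?thesis .
    qed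
    have "gE = (\<Sum>n\<in>UNIV. \<Sum>m\<in>UNIV. \<Sum>i\<in>UNIV. \<Sum>j\<in>UNIV. \<Sum>q\<in>UNIV. psi0 m i j n * T m i q * X q j n)"
    proof -
      have "gE = (\<Sum>m\<in>UNIV. \<Sum>n\<in>UNIV. \<Sum>i\<in>UNIV. \<Sum>j\<in>UNIV. \<Sum>q\<in>UNIV. psi0 m i j n * T m i q * X q j n)"
        unfolding gE_def by (rule sum.cong[OF refl], rule sum3_rot[symmetric])
      also have "\<dots> = (\<Sum>n\<in>UNIV. \<Sum>m\<in>UNIV. \<Sum>i\<in>UNIV. \<Sum>j\<in>UNIV. \<Sum>q\<in>UNIV. psi0 m i j n * T m i q * X q j n)" by (rule sum.swap)
      finally show ?thesis .
    qed
    then have "3 * gE = (\<Sum>n\<in>UNIV. 3 * (\<Sum>m\<in>UNIV. \<Sum>i\<in>UNIV. \<Sum>j\<in>UNIV. \<Sum>q\<in>UNIV. psi0 m i j n * T m i q * X q j n))"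
      by (simp only: sum_distrib_left)
    also have "\<dots> = (\<Sum>n\<in>UNIV. \<Sum>q\<in>UNIV. X q n n * ?\<theta> q)" by (simp only: e)
    also have "\<dots> = (\<Sum>q\<in>UNIV. \<Sum>n\<in>UNIV. X q n n * ?\<theta> q)" by (rule sum.swap)
    also have "\<dots> = (\<Sum>q\<in>UNIV. ?Y q * ?\<theta> q)" by (simp only: sum_distrib_right)
    also have "\<dots> = (\<Sum>q\<in>UNIV. ?\<theta> q * ?Y q)" by (intro sum.cong refl mult.commute)
    finally show ?thesis .
  qed
  ultimately have "3 * ?S (\<lambda>m i j n. psi0 m i j n * G m i j n) = 3 * (2 * (\<Sum>m\<in>UNIV. \<Sum>q\<in>UNIV. - (om m m q * ?Y q))) - (\<Sum>q\<in>UNIV. ?\<theta> q * ?Y q)"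
    using F0 by linarith
  also have "(\<Sum>m\<in>UNIV. \<Sum>q\<in>UNIV. - (om m m q * ?Y q)) = - (\<Sum>q\<in>UNIV. (\<Sum>m\<in>UNIV. om m m q) * ?Y q)"
    by (subst sum.swap) (simp only: sum_negf sum_distrib_right)
  finally have r: "3 * ?S (\<lambda>m i j n. psi0 m i j n * G m i j n)
      = 3 * (2 * - (\<Sum>q\<in>UNIV. (\<Sum>m\<in>UNIV. om m m q) * ?Y q)) - (\<Sum>q\<in>UNIV. ?\<theta> q * ?Y q)" .
  have "(\<Sum>q\<in>UNIV. (6 * a q + b q) * y q) = 6 * (\<Sum>q\<in>UNIV. a q * y q) + (\<Sum>q\<in>UNIV. b q * y q)" for a b y :: "7 \<Rightarrow> real"
    by (simp add: distrib_right sum.distrib sum_distrib_left mult.assoc)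
  then show ?thesis using r by simp
qed

section \<open>Connections in a moving frame\<close>

text \<open>\<open>E\<close> is a coframe, \<open>ev a\<close> the frame dual to it, \<open>om\<close> the connection form
  \<open>\<nabla>\<^bsub>\<partial>\<^sub>k\<^esub> e\<^sub>a = \<Sum>\<^sub>b om k a b e\<^sub>b\<close>, and \<open>Cv\<close>, \<open>Om\<close> are the curvature with its last two indices in the coordinate
  frame and in the moving frame.\<close>

locale frame_chart =
  fixes W :: "(real^'n::finite) set" and C :: "'n christoffel" and E :: "real^'n \<Rightarrow> real^'n^'n"
  assumes W: "open W"
    and C: "\<And>i j k. smooth_on W (\<lambda>x. C x i j k)"
    and E: "\<And>a i. smooth_on W (\<lambda>x. E x $ a $ i)"
    and E_inv: "\<And>x. x \<in> W \<Longrightarrow> invertible (E x)"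
begin

definition ev :: "'n \<Rightarrow> 'n \<Rightarrow> real^'n \<Rightarrow> real" where
  "ev a i x = matrix_inv (E x) $ i $ a"

text \<open>Coordinate component i of the covariant derivative of e_a along the coordinate field
  k.\<close>

definition De :: "'n \<Rightarrow> 'n \<Rightarrow> 'n \<Rightarrow> real^'n \<Rightarrow> real" where
  "De k a i x = partial_diff k (ev a i) x + (\<Sum>j\<in>UNIV. C x k j i * ev a j x)"

definition om :: "'n \<Rightarrow> 'n \<Rightarrow> 'n \<Rightarrow> real^'n \<Rightarrow> real" where
  "om k a b x = (\<Sum>i\<in>UNIV. E x $ b $ i * De k a i x)"

definition Cv :: "'n \<Rightarrow> 'n \<Rightarrow> 'n \<Rightarrow> 'n \<Rightarrow> real^'n \<Rightarrow> real" where
  "Cv k l i q x = partial_diff k (\<lambda>y. C y l i q) x - partial_diff l (\<lambda>y. C y k i q) x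
    + (\<Sum>p\<in>UNIV. C x k p q * C x l i p - C x l p q * C x k i p)"

definition Om :: "'n \<Rightarrow> 'n \<Rightarrow> 'n \<Rightarrow> 'n \<Rightarrow> real^'n \<Rightarrow> real" where
  "Om k l a b x = partial_diff k (om l a b) x - partial_diff l (om k a b) x
    + (\<Sum>p\<in>UNIV. om l a p x * om k p b x - om k a p x * om l p b x)"

lemmas smooth_rules = smooth_on_add[OF W] smooth_on_mult[OF W] smooth_on_diff[OF W] smooth_on_uminus[OF W]
  smooth_on_sum[OF W] smooth_on_const smooth_on_partial

lemma smooth_ev: "smooth_on W (ev a i)"
  unfolding ev_def[abs_def] by (rule smooth_on_matrix_inv[OF W E E_inv])

lemma smooth_De: "smooth_on W (De k a i)"
  unfolding De_def[abs_def] by (intro smooth_rules smooth_ev C)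

lemma smooth_om: "smooth_on W (om k a b)"
  unfolding om_def[abs_def] by (intro smooth_rules smooth_De E)

lemma smooth_Om: "smooth_on W (Om k l a b)"
  unfolding Om_def[abs_def] by (intro smooth_rules smooth_om)

context fixes x assumes x: "x \<in> W" begin

lemmas diffb = smooth_on_differentiable[OF _ W x]

lemma pd_add: "smooth_on W f \<Longrightarrow> smooth_on W g \<Longrightarrow> partial_diff k (\<lambda>y. f y + g y) x = partial_diff k f x + partial_diff k g x"
  by (rule partial_diff_add) (auto intro: diffb)
lemma pd_diff: "smooth_on W f \<Longrightarrow> smooth_on W g \<Longrightarrow> partial_diff k (\<lambda>y. f y - g y) x = partial_diff k f x - partial_diff k g x"
  by (rule partial_diff_diff) (auto intro: diffb)
lemma pd_mult: "smooth_on W f \<Longrightarrow> smooth_on W g \<Longrightarrow> partial_diff k (\<lambda>y. f y * g y) x = partial_diff k f x * g x + f x * partial_diff k g x"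
  by (rule partial_diff_mult) (auto intro: diffb)
lemma pd_sum: "(\<And>a. a \<in> I \<Longrightarrow> smooth_on W (f a)) \<Longrightarrow> finite I \<Longrightarrow> partial_diff k (\<lambda>y. \<Sum>a\<in>I. f a y) x = (\<Sum>a\<in>I. partial_diff k (f a) x)"
  by (rule partial_diff_sum) (auto intro: diffb)

lemma dual1: "(\<Sum>i\<in>UNIV. E x $ b $ i * ev a i x) = (if a = b then 1 else 0)"
proof -
  have "(E x ** matrix_inv (E x)) $ b $ a = (if b = a then 1 else 0)"
    unfolding matrix_inv_mult(1)[OF E_inv[OF x]] by (simp add: mat_def)
  then show ?thesis by (simp add: matrix_matrix_mult_def ev_def eq_commute)
qed

lemma dual2: "(\<Sum>a\<in>UNIV. ev a i x * E x $ a $ j) = (if i = j then 1 else 0)"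
proof -
  have "(matrix_inv (E x) ** E x) $ i $ j = (if i = j then 1 else 0)"
    unfolding matrix_inv_mult(2)[OF E_inv[OF x]] by (simp add: mat_def)
  then show ?thesis by (simp add: matrix_matrix_mult_def ev_def)
qed

lemma frame_expand: "(\<Sum>b\<in>UNIV. (\<Sum>i\<in>UNIV. E x $ b $ i * v i) * ev b j x) = v j"
proof -
  have "(\<Sum>b\<in>UNIV. (\<Sum>i\<in>UNIV. E x $ b $ i * v i) * ev b j x) = (\<Sum>b\<in>UNIV. \<Sum>i\<in>UNIV. v i * (ev b j x * E x $ b $ i))"
    by (simp add: sum_distrib_left mult_ac)
  also have "\<dots> = (\<Sum>i\<in>UNIV. v i * (\<Sum>b\<in>UNIV. ev b j x * E x $ b $ i))"
    by (subst sum.swap) (simp add: sum_distrib_left)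
  finally show ?thesis unfolding dual2 by (simp add: if_distrib cong: if_cong)
qed

lemma De_om: "De k a i x = (\<Sum>b\<in>UNIV. om k a b x * ev b i x)"
  unfolding om_def frame_expand ..

lemma pd_ev: "partial_diff k (ev a i) x = (\<Sum>b\<in>UNIV. om k a b x * ev b i x) - (\<Sum>j\<in>UNIV. C x k j i * ev a j x)"
  using De_om[of k a i] unfolding De_def by simp

text \<open>Leibniz rule for filling one slot of a tensor with e_a. The derivative of e_a is its
  covariant derivative minus Christoffel terms; the former gives the rotation by \<open>om\<close>,
  the latter turn the derivative of \<beta> into a covariant one in this slot. Tensors of higher
  rank are treated slot by slot.\<close>

lemma pd_slot:
  assumes \<beta>: "\<And>i. smooth_on W (\<beta> i)"
  shows "partial_diff m (\<lambda>y. \<Sum>i\<in>UNIV. \<beta> i y * ev a i y) x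
    = (\<Sum>i\<in>UNIV. (partial_diff m (\<beta> i) x - (\<Sum>l\<in>UNIV. C x m i l * \<beta> l x)) * ev a i x)
      + (\<Sum>p\<in>UNIV. om m a p x * (\<Sum>i\<in>UNIV. \<beta> i x * ev p i x))"
proof -
  have "partial_diff m (\<lambda>y. \<Sum>i\<in>UNIV. \<beta> i y * ev a i y) x = (\<Sum>i\<in>UNIV. partial_diff m (\<lambda>y. \<beta> i y * ev a i y) x)"
    by (rule pd_sum) (auto intro: smooth_rules \<beta> smooth_ev)
  also have "\<dots> = (\<Sum>i\<in>UNIV. partial_diff m (\<beta> i) x * ev a i x + \<beta> i x * partial_diff m (ev a i) x)"
    by (intro sum.cong refl pd_mult \<beta> smooth_ev)
  also have "\<dots> = (\<Sum>i\<in>UNIV. partial_diff m (\<beta> i) x * ev a i x) + (\<Sum>i\<in>UNIV. \<Sum>p\<in>UNIV. om m a p x * (\<beta> i x * ev p i x))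
     - (\<Sum>i\<in>UNIV. \<Sum>l\<in>UNIV. C x m l i * \<beta> i x * ev a l x)"
    unfolding pd_ev sum.distrib[symmetric] sum_subtractf[symmetric]
    by (intro sum.cong refl) (simp add: right_diff_distrib sum_distrib_left sum_subtractf mult_ac)
  also have "(\<Sum>i\<in>UNIV. \<Sum>l\<in>UNIV. C x m l i * \<beta> i x * ev a l x) = (\<Sum>i\<in>UNIV. (\<Sum>l\<in>UNIV. C x m i l * \<beta> l x) * ev a i x)"
    by (subst sum.swap) (simp add: sum_distrib_right)
  also have "(\<Sum>i\<in>UNIV. \<Sum>p\<in>UNIV. om m a p x * (\<beta> i x * ev p i x)) = (\<Sum>p\<in>UNIV. om m a p x * (\<Sum>i\<in>UNIV. \<beta> i x * ev p i x))"
    by (subst sum.swap) (simp add: sum_distrib_left)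
  finally show ?thesis by (simp add: left_diff_distrib sum_subtractf)
qed

end

text \<open>Cartan's second structure equation. Both sides are the commutator of covariant
  derivatives applied to e_a, expanded in the frame (\<open>expand\<close>) and in coordinates
  (\<open>expand2\<close>); the second derivatives of the frame cancel by symmetry.\<close>

lemma curvature_frame:
  assumes x: "x \<in> W"
  shows "(\<Sum>i\<in>UNIV. Cv k l i q x * ev a i x) = (\<Sum>b\<in>UNIV. Om k l a b x * ev b q x)"
proof -
  have expand: "partial_diff k (De l a q) x + (\<Sum>j\<in>UNIV. C x k j q * De l a j x)
      = (\<Sum>b\<in>UNIV. (partial_diff k (om l a b) x + (\<Sum>p\<in>UNIV. om l a p x * om k p b x)) * ev b q x)" for k l
  proof -
    have "partial_diff k (De l a q) x = partial_diff k (\<lambda>y. \<Sum>b\<in>UNIV. om l a b y * ev b q y) x"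
      by (rule partial_diff_cong[OF W x]) (rule De_om)
    also have "\<dots> = (\<Sum>b\<in>UNIV. partial_diff k (\<lambda>y. om l a b y * ev b q y) x)"
      by (rule pd_sum[OF x]) (auto intro: smooth_rules smooth_om smooth_ev)
    also have "\<dots> = (\<Sum>b\<in>UNIV. partial_diff k (om l a b) x * ev b q x + om l a b x * partial_diff k (ev b q) x)"
      by (intro sum.cong refl pd_mult[OF x] smooth_om smooth_ev)
    finally have 1: "partial_diff k (De l a q) x = \<dots>" .
    have 2: "(\<Sum>j\<in>UNIV. C x k j q * De l a j x) = (\<Sum>b\<in>UNIV. om l a b x * (\<Sum>j\<in>UNIV. C x k j q * ev b j x))"
      unfolding De_om[OF x] sum_distrib_left by (subst sum.swap) (simp add: mult_ac)
    have 3: "(\<Sum>b\<in>UNIV. om l a b x * (\<Sum>c\<in>UNIV. om k b c x * ev c q x))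
        = (\<Sum>b\<in>UNIV. (\<Sum>p\<in>UNIV. om l a p x * om k p b x) * ev b q x)"
      unfolding sum_distrib_left sum_distrib_right by (subst sum.swap) (simp add: mult_ac)
    show ?thesis unfolding 1 2 pd_ev[OF x]
      using 3 by (simp add: distrib_right right_diff_distrib sum.distrib sum_subtractf)
  qed
  have expand2: "partial_diff k (De l a q) x + (\<Sum>j\<in>UNIV. C x k j q * De l a j x)
      = partial_diff k (partial_diff l (ev a q)) x
       + (\<Sum>j\<in>UNIV. C x l j q * partial_diff k (ev a j) x + C x k j q * partial_diff l (ev a j) x)
       + (\<Sum>j\<in>UNIV. (partial_diff k (\<lambda>y. C y l j q) x + (\<Sum>p\<in>UNIV. C x k p q * C x l j p)) * ev a j x)" for k l
  proof -
    have "partial_diff k (De l a q) x = partial_diff k (partial_diff l (ev a q)) x + partial_diff k (\<lambda>y. \<Sum>j\<in>UNIV. C y l j q * ev a j y) x"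
      unfolding De_def[abs_def] by (rule pd_add[OF x]) (intro smooth_rules smooth_ev C)+
    also have "partial_diff k (\<lambda>y. \<Sum>j\<in>UNIV. C y l j q * ev a j y) x = (\<Sum>j\<in>UNIV. partial_diff k (\<lambda>y. C y l j q * ev a j y) x)"
      by (rule pd_sum[OF x]) (auto intro: smooth_rules smooth_ev C)
    also have "\<dots> = (\<Sum>j\<in>UNIV. partial_diff k (\<lambda>y. C y l j q) x * ev a j x + C x l j q * partial_diff k (ev a j) x)"
      by (intro sum.cong refl pd_mult[OF x] C smooth_ev)
    finally have 1: "partial_diff k (De l a q) x = partial_diff k (partial_diff l (ev a q)) x + \<dots>" .
    have 2: "(\<Sum>j\<in>UNIV. C x k j q * De l a j x) = (\<Sum>j\<in>UNIV. C x k j q * partial_diff l (ev a j) x)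
        + (\<Sum>j\<in>UNIV. (\<Sum>p\<in>UNIV. C x k p q * C x l j p) * ev a j x)"
    proof -
      have "(\<Sum>j\<in>UNIV. C x k j q * (\<Sum>i\<in>UNIV. C x l i j * ev a i x)) = (\<Sum>j\<in>UNIV. (\<Sum>p\<in>UNIV. C x k p q * C x l j p) * ev a j x)"
        unfolding sum_distrib_left sum_distrib_right by (subst sum.swap) (simp add: mult_ac)
      then show ?thesis by (simp add: De_def distrib_left sum.distrib)
    qed
    show ?thesis unfolding 1 2 by (simp add: sum.distrib distrib_right)
  qed
  have com: "partial_diff k (partial_diff l (ev a q)) x = partial_diff l (partial_diff k (ev a q)) x"
    by (rule partial_diff_commute[OF W smooth_ev x])
  have "(\<Sum>i\<in>UNIV. Cv k l i q x * ev a i x) =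
     (\<Sum>j\<in>UNIV. (partial_diff k (\<lambda>y. C y l j q) x + (\<Sum>p\<in>UNIV. C x k p q * C x l j p)) * ev a j x)
   - (\<Sum>j\<in>UNIV. (partial_diff l (\<lambda>y. C y k j q) x + (\<Sum>p\<in>UNIV. C x l p q * C x k j p)) * ev a j x)"
    unfolding Cv_def sum_subtractf[symmetric] left_diff_distrib[symmetric] by (intro sum.cong refl) (simp add: sum_subtractf)
  also have "\<dots> = (partial_diff k (De l a q) x + (\<Sum>j\<in>UNIV. C x k j q * De l a j x))
     - (partial_diff l (De k a q) x + (\<Sum>j\<in>UNIV. C x l j q * De k a j x))"
    unfolding expand2 com by (simp add: sum.distrib)
  also have "\<dots> = (\<Sum>b\<in>UNIV. Om k l a b x * ev b q x)"
    unfolding expand Om_def sum_subtractf[symmetric] left_diff_distrib[symmetric] by (intro sum.cong refl) (simp add: sum_subtractf)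
  finally show ?thesis .
qed

end

context frame_chart begin

text \<open>The covariant derivative in the frame indices only; as the first three indices get
  antisymmetrised below, the Christoffel symbols of a torsion-free connection would drop out.\<close>

definition DOm :: "'n \<Rightarrow> 'n \<Rightarrow> 'n \<Rightarrow> 'n \<Rightarrow> 'n \<Rightarrow> real^'n \<Rightarrow> real" where
  "DOm m k l a b x = partial_diff m (Om k l a b) x - (\<Sum>p\<in>UNIV. om m a p x * Om k l p b x)
      + (\<Sum>p\<in>UNIV. Om k l a p x * om m p b x)"

lemma second_bianchi:
  assumes x: "x \<in> W"
  shows "DOm m k l a b x + DOm k l m a b x + DOm l m k a b x = 0"
proof -
  \<comment> \<open>The kinds of terms in the covariant derivative of the curvature: second
    derivatives, products with the derivative on the left or on the right factor, and triple
    products. Each kind cancels separately in the cyclic sum.\<close>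
  define dd where "dd m k l = partial_diff m (partial_diff k (om l a b)) x" for m k l
  define d1 where "d1 m k l = (\<Sum>p\<in>UNIV. partial_diff m (om k a p) x * om l p b x)" for m k l
  define d2 where "d2 k m l = (\<Sum>p\<in>UNIV. om k a p x * partial_diff m (om l p b) x)" for k m l
  define t3 where "t3 k l m = (\<Sum>p\<in>UNIV. \<Sum>q\<in>UNIV. om k a p x * om l p q x * om m q b x)" for k l m
  have dd: "dd m k l = dd k m l" for m k l
    unfolding dd_def by (rule partial_diff_commute[OF W smooth_om x])
  have "DOm m k l a b x = dd m k l - dd m l k + d1 m l k + d2 l m k - d1 m k l - d2 k m l
      - (d2 m k l - d2 m l k + t3 m l k - t3 m k l) + (d1 k l m - d1 l k m + t3 l k m - t3 k l m)" for m k l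
  proof -
    have "partial_diff m (Om k l a b) x = partial_diff m (\<lambda>y. partial_diff k (om l a b) y - partial_diff l (om k a b) y) x
        + partial_diff m (\<lambda>y. \<Sum>p\<in>UNIV. om l a p y * om k p b y - om k a p y * om l p b y) x"
      unfolding Om_def[abs_def] by (rule pd_add[OF x]) (intro smooth_rules smooth_om)+
    also have "partial_diff m (\<lambda>y. partial_diff k (om l a b) y - partial_diff l (om k a b) y) x = dd m k l - dd m l k"
      unfolding dd_def by (rule pd_diff[OF x]) (intro smooth_rules smooth_om)+
    also have "partial_diff m (\<lambda>y. \<Sum>p\<in>UNIV. om l a p y * om k p b y - om k a p y * om l p b y) x
       = (\<Sum>p\<in>UNIV. partial_diff m (\<lambda>y. om l a p y * om k p b y - om k a p y * om l p b y) x)"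
      by (rule pd_sum[OF x]) (intro smooth_rules smooth_om finite)+
    also have "\<dots> = (\<Sum>p\<in>UNIV. partial_diff m (\<lambda>y. om l a p y * om k p b y) x - partial_diff m (\<lambda>y. om k a p y * om l p b y) x)"
      by (intro sum.cong refl pd_diff[OF x] smooth_rules smooth_om)
    also have "\<dots> = (\<Sum>p\<in>UNIV. (partial_diff m (om l a p) x * om k p b x + om l a p x * partial_diff m (om k p b) x)
       - (partial_diff m (om k a p) x * om l p b x + om k a p x * partial_diff m (om l p b) x))"
      by (intro sum.cong refl arg_cong2[where f = "(-)"] pd_mult[OF x] smooth_om)
    also have "\<dots> = d1 m l k + d2 l m k - d1 m k l - d2 k m l"
      by (simp add: d1_def d2_def sum.distrib sum_subtractf)
    finally have 1: "partial_diff m (Om k l a b) x = dd m k l - dd m l k + (d1 m l k + d2 l m k - d1 m k l - d2 k m l)" .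
    have 2: "(\<Sum>p\<in>UNIV. om m a p x * Om k l p b x) = d2 m k l - d2 m l k + t3 m l k - t3 m k l"
      by (simp add: Om_def d2_def t3_def distrib_left right_diff_distrib sum.distrib sum_subtractf sum_distrib_left mult.assoc)
    have sw: "(\<Sum>p\<in>UNIV. \<Sum>q\<in>UNIV. om k a q x * om l q p x * om m p b x) = t3 k l m" for k l m
      unfolding t3_def by (rule sum.swap)
    have 3: "(\<Sum>p\<in>UNIV. Om k l a p x * om m p b x) = d1 k l m - d1 l k m + t3 l k m - t3 k l m"
      using sw[of k l m] sw[of l k m]
      by (simp add: Om_def d1_def distrib_right left_diff_distrib sum.distrib sum_subtractf sum_distrib_right)
    show ?thesis unfolding DOm_def 1 2 3 by simp
  qed
  then show ?thesis using dd[of m k l] dd[of k l m] dd[of l m k] by simp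
qed

section \<open>Frame components of tensors and their derivatives\<close>

definition fr2 :: "('n \<Rightarrow> 'n \<Rightarrow> real^'n \<Rightarrow> real) \<Rightarrow> 'n \<Rightarrow> 'n \<Rightarrow> real^'n \<Rightarrow> real" where
  "fr2 \<beta> a b x = (\<Sum>i\<in>UNIV. (\<Sum>j\<in>UNIV. \<beta> i j x * ev b j x) * ev a i x)"

definition fr3 :: "('n \<Rightarrow> 'n \<Rightarrow> 'n \<Rightarrow> real^'n \<Rightarrow> real) \<Rightarrow> 'n \<Rightarrow> 'n \<Rightarrow> 'n \<Rightarrow> real^'n \<Rightarrow> real" where
  "fr3 \<alpha> a b c x = (\<Sum>i\<in>UNIV. (\<Sum>j\<in>UNIV. (\<Sum>k\<in>UNIV. \<alpha> i j k x * ev c k x) * ev b j x) * ev a i x)"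

definition cov2 :: "('n \<Rightarrow> 'n \<Rightarrow> real^'n \<Rightarrow> real) \<Rightarrow> 'n \<Rightarrow> 'n \<Rightarrow> 'n \<Rightarrow> real^'n \<Rightarrow> real" where
  "cov2 \<beta> m i j x = partial_diff m (\<beta> i j) x - (\<Sum>l\<in>UNIV. C x m i l * \<beta> l j x) - (\<Sum>l\<in>UNIV. C x m j l * \<beta> i l x)"

definition cov3 :: "('n \<Rightarrow> 'n \<Rightarrow> 'n \<Rightarrow> real^'n \<Rightarrow> real) \<Rightarrow> 'n \<Rightarrow> 'n \<Rightarrow> 'n \<Rightarrow> 'n \<Rightarrow> real^'n \<Rightarrow> real" where
  "cov3 \<alpha> m i j k x = partial_diff m (\<alpha> i j k) x - (\<Sum>l\<in>UNIV. C x m i l * \<alpha> l j k x)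
     - (\<Sum>l\<in>UNIV. C x m j l * \<alpha> i l k x) - (\<Sum>l\<in>UNIV. C x m k l * \<alpha> i j l x)"

lemma smooth_fr3:
  assumes "\<And>i j k. smooth_on W (\<alpha> i j k)" shows "smooth_on W (fr3 \<alpha> a b c)"
  unfolding fr3_def[abs_def] by (intro smooth_rules smooth_ev assms)

text \<open>The derivative of a frame component is the frame component of the covariant derivative
  plus a rotation by \<open>om\<close> in every slot. A parallel tensor with constant frame
  components therefore constrains \<open>om\<close>.\<close>

lemma pd_fr2:
  assumes x: "x \<in> W" and \<beta>: "\<And>i j. smooth_on W (\<beta> i j)"
  shows "partial_diff m (fr2 \<beta> a b) x = fr2 (cov2 \<beta> m) a b x
     + (\<Sum>p\<in>UNIV. om m a p x * fr2 \<beta> p b x) + (\<Sum>p\<in>UNIV. om m b p x * fr2 \<beta> a p x)"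
proof -
  define \<gamma> where "\<gamma> b i y = (\<Sum>j\<in>UNIV. \<beta> i j y * ev b j y)" for b i y
  have s\<gamma>: "smooth_on W (\<gamma> b i)" for b i unfolding \<gamma>_def[abs_def] by (intro smooth_rules \<beta> smooth_ev)
  have p\<gamma>: "partial_diff m (\<gamma> b i) x = (\<Sum>j\<in>UNIV. (partial_diff m (\<beta> i j) x - (\<Sum>l\<in>UNIV. C x m j l * \<beta> i l x)) * ev b j x)
      + (\<Sum>p\<in>UNIV. om m b p x * \<gamma> p i x)" for i
    unfolding \<gamma>_def[abs_def] using pd_slot[OF x, of "\<beta> i" m b] \<beta> by simp
  have f: "fr2 \<beta> a b = (\<lambda>y. \<Sum>i\<in>UNIV. \<gamma> b i y * ev a i y)" for a b
    by (simp add: fr2_def \<gamma>_def fun_eq_iff)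
  have "partial_diff m (fr2 \<beta> a b) x = (\<Sum>i\<in>UNIV. (partial_diff m (\<gamma> b i) x - (\<Sum>l\<in>UNIV. C x m i l * \<gamma> b l x)) * ev a i x)
      + (\<Sum>p\<in>UNIV. om m a p x * fr2 \<beta> p b x)"
    unfolding f by (rule pd_slot[OF x]) (rule s\<gamma>)
  moreover have "partial_diff m (\<gamma> b i) x - (\<Sum>l\<in>UNIV. C x m i l * \<gamma> b l x)
     = (\<Sum>j\<in>UNIV. cov2 \<beta> m i j x * ev b j x) + (\<Sum>p\<in>UNIV. om m b p x * \<gamma> p i x)" for i
  proof -
    have "(\<Sum>l\<in>UNIV. C x m i l * \<gamma> b l x) = (\<Sum>j\<in>UNIV. (\<Sum>l\<in>UNIV. C x m i l * \<beta> l j x) * ev b j x)"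
      unfolding \<gamma>_def sum_distrib_left sum_distrib_right by (subst sum.swap) (simp add: mult.assoc)
    then show ?thesis unfolding p\<gamma> cov2_def by (simp add: left_diff_distrib sum_subtractf)
  qed
  moreover have "(\<Sum>i\<in>UNIV. (\<Sum>p\<in>UNIV. om m b p x * \<gamma> p i x) * ev a i x) = (\<Sum>p\<in>UNIV. om m b p x * fr2 \<beta> a p x)"
    unfolding f sum_distrib_left sum_distrib_right by (subst sum.swap) (simp add: mult.assoc)
  ultimately show ?thesis by (simp add: fr2_def distrib_right sum.distrib)
qed

lemma pd_fr3:
  assumes x: "x \<in> W" and \<alpha>: "\<And>i j k. smooth_on W (\<alpha> i j k)"
  shows "partial_diff m (fr3 \<alpha> a b c) x = fr3 (cov3 \<alpha> m) a b c x
     + (\<Sum>p\<in>UNIV. om m a p x * fr3 \<alpha> p b c x) + (\<Sum>p\<in>UNIV. om m b p x * fr3 \<alpha> a p c x)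
     + (\<Sum>p\<in>UNIV. om m c p x * fr3 \<alpha> a b p x)"
proof -
  define \<gamma> where "\<gamma> c i j y = (\<Sum>k\<in>UNIV. \<alpha> i j k y * ev c k y)" for c i j y
  have s\<gamma>: "smooth_on W (\<gamma> c i j)" for c i j unfolding \<gamma>_def[abs_def] by (intro smooth_rules \<alpha> smooth_ev)
  have p\<gamma>: "partial_diff m (\<gamma> c i j) x = (\<Sum>k\<in>UNIV. (partial_diff m (\<alpha> i j k) x - (\<Sum>l\<in>UNIV. C x m k l * \<alpha> i j l x)) * ev c k x)
      + (\<Sum>p\<in>UNIV. om m c p x * \<gamma> p i j x)" for i j
    unfolding \<gamma>_def[abs_def] using pd_slot[OF x, of "\<alpha> i j" m c] \<alpha> by simp
  have f: "fr3 \<alpha> a b c = fr2 (\<gamma> c) a b" for a b c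
    by (simp add: fr3_def fr2_def \<gamma>_def fun_eq_iff)
  have sw: "(\<Sum>l\<in>UNIV. C x m i l * \<gamma> c (g l) (h l) x) = (\<Sum>k\<in>UNIV. (\<Sum>l\<in>UNIV. C x m i l * \<alpha> (g l) (h l) k x) * ev c k x)" for i g h
    unfolding \<gamma>_def sum_distrib_left sum_distrib_right by (subst sum.swap) (simp add: mult.assoc)
  have cv: "cov2 (\<gamma> c) m i j x = (\<Sum>k\<in>UNIV. cov3 \<alpha> m i j k x * ev c k x) + (\<Sum>p\<in>UNIV. om m c p x * \<gamma> p i j x)" for i j
    unfolding cov2_def p\<gamma> sw[of i "\<lambda>l. l" "\<lambda>l. j"] sw[of j "\<lambda>l. i" "\<lambda>l. l"] cov3_def
    by (simp add: left_diff_distrib sum_subtractf)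
  have "fr2 (cov2 (\<gamma> c) m) a b x = fr3 (cov3 \<alpha> m) a b c x + (\<Sum>p\<in>UNIV. om m c p x * fr2 (\<gamma> p) a b x)"
  proof -
    have 1: "(\<Sum>j\<in>UNIV. (\<Sum>p\<in>UNIV. om m c p x * \<gamma> p i j x) * ev b j x) = (\<Sum>p\<in>UNIV. om m c p x * (\<Sum>j\<in>UNIV. \<gamma> p i j x * ev b j x))" for i
      unfolding sum_distrib_left sum_distrib_right by (subst sum.swap) (simp add: mult.assoc)
    have 2: "(\<Sum>i\<in>UNIV. (\<Sum>p\<in>UNIV. om m c p x * (\<Sum>j\<in>UNIV. \<gamma> p i j x * ev b j x)) * ev a i x) = (\<Sum>p\<in>UNIV. om m c p x * fr2 (\<gamma> p) a b x)"
    proof -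
      have "(\<Sum>i\<in>UNIV. (\<Sum>p\<in>UNIV. om m c p x * B p i) * ev a i x) = (\<Sum>p\<in>UNIV. om m c p x * (\<Sum>i\<in>UNIV. B p i * ev a i x))" for B
        unfolding sum_distrib_left sum_distrib_right by (subst sum.swap) (simp add: mult.assoc)
      then show ?thesis unfolding fr2_def .
    qed
    have "fr2 (cov2 (\<gamma> c) m) a b x = (\<Sum>i\<in>UNIV. ((\<Sum>j\<in>UNIV. (\<Sum>k\<in>UNIV. cov3 \<alpha> m i j k x * ev c k x) * ev b j x)
        + (\<Sum>j\<in>UNIV. (\<Sum>p\<in>UNIV. om m c p x * \<gamma> p i j x) * ev b j x)) * ev a i x)"
      unfolding fr2_def cv distrib_right sum.distrib ..
    also have "\<dots> = fr3 (cov3 \<alpha> m) a b c x + (\<Sum>i\<in>UNIV. (\<Sum>j\<in>UNIV. (\<Sum>p\<in>UNIV. om m c p x * \<gamma> p i j x) * ev b j x) * ev a i x)"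
      unfolding fr3_def distrib_right sum.distrib ..
    finally show ?thesis unfolding 1 2 .
  qed
  then show ?thesis unfolding f pd_fr2[OF x s\<gamma>] by simp
qed

end

section \<open>Metric connections with closed skew-symmetric torsion\<close>

text \<open>The coframe \<open>E\<close> is orthonormal for \<open>gm\<close>, and \<open>T\<close>
  is the torsion with its last index lowered. Antisymmetry in the first pair is built into
  \<open>T\<close>; together with the assumption on the last pair it makes \<open>T\<close> a
  3-form.\<close>

locale torsion_chart = frame_chart W C E for W :: "(real^'n::finite) set" and C E +
  fixes gm T
  defines "gm \<equiv> \<lambda>i j x. \<Sum>a\<in>UNIV. E x $ a $ i * E x $ a $ j"
    and "T \<equiv> \<lambda>i j k x. \<Sum>p\<in>UNIV. (C x i j p - C x j i p) * gm p k x"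
  assumes metric: "\<And>x m i j. x \<in> W \<Longrightarrow> cov2 gm m i j x = 0"
    and T_swap23: "\<And>x i j k. x \<in> W \<Longrightarrow> T i k j x = - T i j k x"
    and T_closed: "\<And>x i j k l. x \<in> W \<Longrightarrow> partial_diff i (T j k l) x - partial_diff j (T i k l) x
      + partial_diff k (T i j l) x - partial_diff l (T i j k) x = 0"
begin

lemma smooth_gm: "smooth_on W (gm i j)"
  unfolding gm_def by (intro smooth_rules E)

lemma smooth_T: "smooth_on W (T i j k)"
  unfolding T_def by (intro smooth_rules C smooth_gm)

lemma gm_sym: "gm j i x = gm i j x"
  unfolding gm_def by (simp add: mult.commute)

lemma T_swap12: "T j i k x = - T i j k x"
  unfolding T_def sum_negf[symmetric] by (intro sum.cong refl) (simp add: algebra_simps)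

lemma T_cyc: "x \<in> W \<Longrightarrow> T j k i x = T i j k x"
  using T_swap23[of x j k i] T_swap12[of j i k x] by simp

lemma gm_ev:
  assumes x: "x \<in> W" shows "(\<Sum>j\<in>UNIV. gm i j x * ev b j x) = E x $ b $ i"
proof -
  have "(\<Sum>j\<in>UNIV. gm i j x * ev b j x) = (\<Sum>a\<in>UNIV. E x $ a $ i * (\<Sum>j\<in>UNIV. E x $ a $ j * ev b j x))"
    unfolding gm_def sum_distrib_left sum_distrib_right by (subst sum.swap) (simp add: mult.assoc)
  then show ?thesis unfolding dual1[OF x] by (simp add: if_distrib cong: if_cong)
qed

lemma fr2_gm: "x \<in> W \<Longrightarrow> fr2 gm a b x = (if a = b then 1 else 0)"
  unfolding fr2_def gm_ev dual1 by simp

text \<open>The metric is parallel and has constant components in the orthonormal frame, so the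
  derivative of these constants leaves the symmetric part of \<open>om\<close>.\<close>

lemma om_skew:
  assumes x: "x \<in> W" shows "om m b a x = - om m a b x"
proof -
  have "partial_diff m (fr2 gm a b) x = partial_diff m (\<lambda>_. if a = b then 1 else 0) x"
    by (rule partial_diff_cong[OF W x]) (rule fr2_gm)
  then have "0 = fr2 (cov2 gm m) a b x + (\<Sum>p\<in>UNIV. om m a p x * fr2 gm p b x) + (\<Sum>p\<in>UNIV. om m b p x * fr2 gm a p x)"
    unfolding pd_fr2[OF x smooth_gm] by (simp add: partial_diff_const)
  moreover have "fr2 (cov2 gm m) a b x = 0" unfolding fr2_def metric[OF x] by simp
  ultimately show ?thesis unfolding fr2_gm[OF x] by (simp add: if_distrib cong: if_cong)
qed

lemma Om_skew:
  assumes x: "x \<in> W" shows "Om k l b a x = - Om k l a b x"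
proof -
  have pd: "partial_diff k (om l b a) x = - partial_diff k (om l a b) x" for k l
  proof -
    have "partial_diff k (om l b a) x = partial_diff k (\<lambda>y. - om l a b y) x"
      by (rule partial_diff_cong[OF W x]) (rule om_skew)
    then show ?thesis using partial_diff_uminus[OF diffb[OF x smooth_om]] by simp
  qed
  have "(\<Sum>p\<in>UNIV. om l b p x * om k p a x - om k b p x * om l p a x) = - (\<Sum>p\<in>UNIV. om l a p x * om k p b x - om k a p x * om l p b x)"
    unfolding sum_negf[symmetric]
  proof (intro sum.cong refl)
    fix p
    show "om l b p x * om k p a x - om k b p x * om l p a x = - (om l a p x * om k p b x - om k a p x * om l p b x)"
      using om_skew[OF x, of l b p] om_skew[OF x, of k a p] om_skew[OF x, of k b p] om_skew[OF x, of l a p] by simp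
  qed
  then show ?thesis unfolding Om_def pd by simp
qed

definition Rl :: "'n \<Rightarrow> 'n \<Rightarrow> 'n \<Rightarrow> 'n \<Rightarrow> real^'n \<Rightarrow> real" where
  "Rl k l i m x = (\<Sum>q\<in>UNIV. Cv k l i q x * gm q m x)"

lemma Rl_frame:
  assumes x: "x \<in> W"
  shows "Rl k l i m x = (\<Sum>a\<in>UNIV. \<Sum>b\<in>UNIV. Om k l a b x * (E x $ a $ i * E x $ b $ m))"
proof -
  have "Cv k l i q x = (\<Sum>a\<in>UNIV. E x $ a $ i * (\<Sum>b\<in>UNIV. Om k l a b x * ev b q x))" for q
  proof -
    have "(\<Sum>a\<in>UNIV. E x $ a $ i * (\<Sum>j\<in>UNIV. Cv k l j q x * ev a j x)) = (\<Sum>j\<in>UNIV. Cv k l j q x * (\<Sum>a\<in>UNIV. ev a j x * E x $ a $ i))"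
      unfolding sum_distrib_left by (subst sum.swap) (simp add: mult_ac)
    also have "\<dots> = Cv k l i q x" unfolding dual2[OF x] by (simp add: if_distrib cong: if_cong)
    finally show ?thesis unfolding curvature_frame[OF x] by simp
  qed
  then have "Rl k l i m x = (\<Sum>q\<in>UNIV. \<Sum>a\<in>UNIV. E x $ a $ i * (\<Sum>b\<in>UNIV. Om k l a b x * (gm m q x * ev b q x)))"
    unfolding Rl_def by (simp add: sum_distrib_left sum_distrib_right mult_ac gm_sym[of m])
  also have "\<dots> = (\<Sum>a\<in>UNIV. E x $ a $ i * (\<Sum>b\<in>UNIV. Om k l a b x * (\<Sum>q\<in>UNIV. gm m q x * ev b q x)))"
    by (subst sum.swap) (rule sum.cong[OF refl], simp only: sum_distrib_left[symmetric], subst sum.swap, simp only: sum_distrib_left)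
  finally show ?thesis unfolding gm_ev[OF x] by (simp add: sum_distrib_left mult_ac)
qed

lemma Rl_swap12: "Rl l k i m x = - Rl k l i m x"
  unfolding Rl_def Cv_def sum_negf[symmetric]
proof (intro sum.cong refl)
  fix q
  have "(\<Sum>p\<in>UNIV. C x l p q * C x k i p - C x k p q * C x l i p) = - (\<Sum>p\<in>UNIV. C x k p q * C x l i p - C x l p q * C x k i p)"
    unfolding sum_negf[symmetric] by simp
  then show "(partial_diff l (\<lambda>y. C y k i q) x - partial_diff k (\<lambda>y. C y l i q) x + (\<Sum>p\<in>UNIV. C x l p q * C x k i p - C x k p q * C x l i p)) * gm q m x
    = - ((partial_diff k (\<lambda>y. C y l i q) x - partial_diff l (\<lambda>y. C y k i q) x + (\<Sum>p\<in>UNIV. C x k p q * C x l i p - C x l p q * C x k i p)) * gm q m x)"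
    by (simp add: algebra_simps)
qed

lemma Rl_swap34:
  assumes x: "x \<in> W" shows "Rl k l m i x = - Rl k l i m x"
proof -
  have "Rl k l m i x = (\<Sum>b\<in>UNIV. \<Sum>a\<in>UNIV. Om k l a b x * (E x $ a $ m * E x $ b $ i))"
    unfolding Rl_frame[OF x] by (rule sum.swap)
  also have "\<dots> = (\<Sum>b\<in>UNIV. \<Sum>a\<in>UNIV. - (Om k l b a x * (E x $ b $ i * E x $ a $ m)))"
    by (intro sum.cong refl, subst Om_skew[OF x], simp)
  finally show ?thesis unfolding Rl_frame[OF x] by (simp only: sum_negf)
qed

definition Kt :: "'n \<Rightarrow> 'n \<Rightarrow> 'n \<Rightarrow> 'n \<Rightarrow> real^'n \<Rightarrow> real" where
  "Kt a b c d x = (\<Sum>p\<in>UNIV. C x a b p * T c d p x)"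

text \<open>The inner product of T(a, b) and T(c, d), the quadratic torsion term of the Bianchi
  identities. \<open>Kt\<close> is its half before antisymmetrisation, in the form in which the
  Christoffel terms of \<open>cov3 T\<close> produce it.\<close>

definition Ht :: "'n \<Rightarrow> 'n \<Rightarrow> 'n \<Rightarrow> 'n \<Rightarrow> real^'n \<Rightarrow> real" where
  "Ht a b c d x = Kt a b c d x - Kt b a c d x"

lemma Ht_sym: "Ht c d a b x = Ht a b c d x"
proof -
  have e: "Ht a b c d x = (\<Sum>p\<in>UNIV. \<Sum>q\<in>UNIV. (C x a b p - C x b a p) * (C x c d q - C x d c q) * gm q p x)" for a b c d
  proof -
    have "Ht a b c d x = (\<Sum>p\<in>UNIV. (C x a b p - C x b a p) * T c d p x)"
      by (simp add: Ht_def Kt_def left_diff_distrib sum_subtractf)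
    then show ?thesis unfolding T_def sum_distrib_left by (simp add: mult.assoc)
  qed
  have "Ht c d a b x = (\<Sum>q\<in>UNIV. \<Sum>p\<in>UNIV. (C x c d p - C x d c p) * (C x a b q - C x b a q) * gm q p x)"
    unfolding e by (rule sum.swap)
  also have "\<dots> = Ht a b c d x" unfolding e by (intro sum.cong refl) (simp add: gm_sym mult_ac)
  finally show ?thesis .
qed

lemma Ht_swap12: "Ht b a c d x = - Ht a b c d x"
  by (simp add: Ht_def)

lemma Kt_swap34: "Kt a b d c x = - Kt a b c d x"
  unfolding Kt_def sum_negf[symmetric] by (intro sum.cong refl) (subst T_swap12, simp)

lemma Ht_swap34: "Ht a b d c x = - Ht a b c d x"
  unfolding Ht_def by (simp add: Kt_swap34[of _ _ d c])

lemma cov3_T: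
  assumes x: "x \<in> W"
  shows "cov3 T m k l i x = partial_diff m (T k l i) x - Kt m k l i x - Kt m l i k x - Kt m i k l x"
proof -
  have "T p l i x = T l i p x" "T k p i x = T i k p x" for p
    using T_cyc[OF x, of l i p] T_cyc[OF x, of k p i] by simp_all
  then show ?thesis unfolding cov3_def Kt_def by simp
qed

lemma pd_T_swap12:
  assumes x: "x \<in> W" shows "partial_diff m (T j i k) x = - partial_diff m (T i j k) x"
proof -
  have "T j i k = (\<lambda>y. - T i j k y)" by (rule ext) (rule T_swap12)
  then show ?thesis using partial_diff_uminus[OF diffb[OF x smooth_T]] by simp
qed

lemma pd_T_cyc:
  assumes x: "x \<in> W" shows "partial_diff m (T j k i) x = partial_diff m (T i j k) x"
  by (rule partial_diff_cong[OF W x]) (rule T_cyc)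

text \<open>The cyclic sum of the curvature consists of derivatives of the torsion in the directions
  k, l, i. Closedness of T trades them for the single derivative in direction m; the passage to the
  covariant derivative costs the terms \<open>Ht\<close>.\<close>

lemma first_bianchi:
  assumes x: "x \<in> W"
  shows "Rl k l i m x + Rl l i k m x + Rl i k l m x = cov3 T m k l i x + Ht m k l i x + Ht m l i k x + Ht m i k l x"
proof -
  define G where "G k p m = (\<Sum>q\<in>UNIV. C x k p q * gm q m x)" for k p m
  define a where "a k l i m = (\<Sum>q\<in>UNIV. partial_diff k (\<lambda>y. C y l i q) x * gm q m x)" for k l i m
  define b where "b k l i m = (\<Sum>p\<in>UNIV. C x l i p * G k p m)" for k l i m
  have R: "Rl k l i m x = a k l i m - a l k i m + b k l i m - b l k i m" for k l i m
  proof -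
    have "(\<Sum>q\<in>UNIV. (\<Sum>p\<in>UNIV. C x k p q * C x l i p) * gm q m x) = b k l i m" for k l
      unfolding b_def G_def sum_distrib_left sum_distrib_right by (subst sum.swap) (simp add: mult_ac)
    from this[of k l] this[of l k] show ?thesis
      unfolding Rl_def Cv_def a_def by (simp add: distrib_right left_diff_distrib sum.distrib sum_subtractf)
  qed
  have pg: "partial_diff k (gm q m) x = G k q m + G k m q" for k q m
    using metric[OF x, of k q m] unfolding cov2_def G_def by (simp add: gm_sym[of q])
  \<comment> \<open>Derivatives of the metric inside \<open>T\<close> are resolved by metric
    compatibility; the part that falls on the index m becomes \<open>Kt\<close>.\<close>
  have pT: "partial_diff k (T l i m) x = a k l i m - a k i l m + b k l i m - b k i l m + Kt k m l i x" for k l i m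
  proof -
    have "partial_diff k (T l i m) x = (\<Sum>q\<in>UNIV. partial_diff k (\<lambda>y. (C y l i q - C y i l q) * gm q m y) x)"
      unfolding T_def by (rule pd_sum[OF x]) (intro smooth_rules C smooth_gm finite)+
    also have "\<dots> = (\<Sum>q\<in>UNIV. partial_diff k (\<lambda>y. C y l i q - C y i l q) x * gm q m x + (C x l i q - C x i l q) * partial_diff k (gm q m) x)"
      by (intro sum.cong refl pd_mult[OF x] smooth_rules C smooth_gm)
    also have "\<dots> = (\<Sum>q\<in>UNIV. (partial_diff k (\<lambda>y. C y l i q) x - partial_diff k (\<lambda>y. C y i l q) x) * gm q m x + (C x l i q - C x i l q) * (G k q m + G k m q))"
      unfolding pg by (intro sum.cong refl) (subst pd_diff[OF x C C], rule refl)
    also have "\<dots> = a k l i m - a k i l m + b k l i m - b k i l m + (\<Sum>q\<in>UNIV. (C x l i q - C x i l q) * G k m q)"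
      unfolding a_def b_def by (simp add: distrib_left left_diff_distrib sum.distrib sum_subtractf)
    also have "(\<Sum>q\<in>UNIV. (C x l i q - C x i l q) * G k m q) = Kt k m l i x"
      unfolding G_def Kt_def T_def sum_distrib_left by (subst sum.swap) (simp add: gm_sym mult_ac)
    finally show ?thesis .
  qed
  have "partial_diff k (T l i m) x - partial_diff l (T k i m) x + partial_diff i (T k l m) x - partial_diff m (T k l i) x = 0"
    by (rule T_closed[OF x])
  then show ?thesis
    unfolding R cov3_T[OF x] Ht_def using pT[of k l i m] pT[of l i k m] pT[of i k l m] pd_T_swap12[OF x, of l k i m] by simp
qed

text \<open>The equation dT = 0 in terms of covariant derivatives. For a connection with torsion the
  Christoffel symbols survive antisymmetrisation, and what they leave is the sum of the terms
  \<open>Ht\<close>.\<close>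

lemma cov3_T_closed:
  assumes x: "x \<in> W"
  shows "cov3 T i j k l x - cov3 T j i k l x + cov3 T k i j l x - cov3 T l i j k x
    = - 2 * (Ht i j k l x + Ht i k l j x + Ht i l j k x)"
proof -
  have "partial_diff i (T j k l) x - partial_diff j (T i k l) x + partial_diff k (T i j l) x - partial_diff l (T i j k) x = 0"
    by (rule T_closed[OF x])
  moreover have "Ht j k l i x = Ht l i j k x" "Ht j l i k x = Ht i k j l x" "Ht k l i j x = Ht i j k l x" by (rule Ht_sym)+
  ultimately show ?thesis
    unfolding cov3_T[OF x]
    using Kt_swap34[of k i l j x] Kt_swap34[of i k j l x] Kt_swap34[of l j k i x]
    unfolding Ht_def by algebra
qed

lemma cov3_T_swap23:
  assumes x: "x \<in> W" shows "cov3 T m a c b x = - cov3 T m a b c x"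
proof -
  have "partial_diff m (T a c b) x = - partial_diff m (T a b c) x"
    using pd_T_cyc[OF x, of m c b a] pd_T_swap12[OF x, of m c b a] pd_T_cyc[OF x, of m b c a] by linarith
  then show ?thesis
    unfolding cov3_T[OF x] using Kt_swap34[of m a c b x] Kt_swap34[of m b a c x] Kt_swap34[of m c b a x] by linarith
qed

text \<open>The first Bianchi identities for all four choices of the index outside the cyclic sum
  are added. By skewness the curvatures whose first pair avoids i cancel, and those whose first pair
  contains i double. On the right, \<open>cov3_T_closed\<close> turns the derivatives in the
  directions j, k, l into one in direction i and removes the terms \<open>Ht\<close>.\<close>

lemma curvature_last_cyclic:
  assumes x: "x \<in> W"
  shows "Rl i j k l x + Rl i k l j x + Rl i l j k x = cov3 T i j k l x"
proof -
  have R: "Rl j k l i x = - Rl j k i l x" "Rl k l j i x = - Rl k l i j x" "Rl l j k i x = - Rl l j i k x"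
    "Rl i k j l x = - Rl i k l j x" "Rl i l k j x = - Rl i l j k x" "Rl i j l k x = - Rl i j k l x"
    by (rule Rl_swap34[OF x])+
  have R': "Rl k i j l x = - Rl i k j l x" "Rl l i k j x = - Rl i l k j x" "Rl j i l k x = - Rl i j l k x"
    by (rule Rl_swap12)+
  have H: "Ht l i j k x = - Ht i l j k x" "Ht k i l j x = - Ht i k l j x" "Ht j i k l x = - Ht i j k l x"
    by (rule Ht_swap12)+
  have H': "Ht i j l k x = - Ht i j k l x" "Ht i k j l x = - Ht i k l j x" "Ht i l k j x = - Ht i l j k x"
    by (rule Ht_swap34)+
  have H'': "Ht l j k i x = Ht k i l j x" "Ht l k i j x = Ht i j l k x" "Ht j k l i x = Ht l i j k x"
    "Ht j l i k x = Ht i k j l x" "Ht k l j i x = Ht j i k l x" "Ht k j i l x = Ht i l k j x"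
    by (rule Ht_sym)+
  note b = first_bianchi[OF x, of i j k l, unfolded R' R H'' H H'] first_bianchi[OF x, of i k l j, unfolded R' R H'' H H']
    first_bianchi[OF x, of i l j k, unfolded R' R H'' H H'] first_bianchi[OF x, of j k l i, unfolded R' R H'' H H']
  have "2 * (Rl i j k l x + Rl i k l j x + Rl i l j k x) = cov3 T l i j k x + cov3 T j i k l x + cov3 T k i l j x + cov3 T i j k l x
     - 2 * (Ht i j k l x + Ht i k l j x + Ht i l j k x)"
    using b by algebra
  then show ?thesis using cov3_T_closed[OF x, of i j k l] cov3_T_swap23[OF x, of k i l j] by argo
qed

end

section \<open>Torsion and curvature in frame components\<close>

context frame_chart begin

lemma fr2_triple: "fr2 \<beta> a b x = (\<Sum>i\<in>UNIV. \<Sum>j\<in>UNIV. \<beta> i j x * (ev a i x * ev b j x))"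
  unfolding fr2_def sum_distrib_right by (simp add: mult_ac)

lemma fr3_triple: "fr3 \<alpha> a b c x = (\<Sum>i\<in>UNIV. \<Sum>j\<in>UNIV. \<Sum>k\<in>UNIV. \<alpha> i j k x * (ev a i x * ev b j x * ev c k x))"
  unfolding fr3_def sum_distrib_right by (simp add: mult_ac)

lemma fr3_rot: "fr3 (\<lambda>i j k. \<alpha> j k i) a b c x = fr3 \<alpha> b c a x"
proof -
  have "fr3 (\<lambda>i j k. \<alpha> j k i) a b c x = (\<Sum>i\<in>UNIV. \<Sum>j\<in>UNIV. \<Sum>k\<in>UNIV. \<alpha> j k i x * (ev b j x * ev c k x * ev a i x))"
    unfolding fr3_triple by (simp add: mult_ac)
  also have "\<dots> = fr3 \<alpha> b c a x" unfolding fr3_triple by (rule sum3_rot)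
  finally show ?thesis .
qed

lemma fr3_add: "fr3 (\<lambda>i j k x. \<alpha> i j k x + \<beta> i j k x) a b c x = fr3 \<alpha> a b c x + fr3 \<beta> a b c x"
  unfolding fr3_triple by (simp add: distrib_right sum.distrib)

lemma fr3_diff: "fr3 (\<lambda>i j k x. \<alpha> i j k x - \<beta> i j k x) a b c x = fr3 \<alpha> a b c x - fr3 \<beta> a b c x"
  unfolding fr3_triple by (simp add: left_diff_distrib sum_subtractf)

lemma fr3_swap12:
  assumes "\<And>i j k. \<alpha> j i k x = - \<alpha> i j k x"
  shows "fr3 \<alpha> b a c x = - fr3 \<alpha> a b c x"
proof -
  have "fr3 \<alpha> b a c x = (\<Sum>i\<in>UNIV. \<Sum>j\<in>UNIV. \<Sum>k\<in>UNIV. \<alpha> j i k x * (ev b j x * ev a i x * ev c k x))"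
    unfolding fr3_triple by (rule sum.swap)
  also have "\<dots> = - fr3 \<alpha> a b c x"
    unfolding fr3_triple sum_negf[symmetric] by (intro sum.cong refl, subst assms, simp)
  finally show ?thesis .
qed

lemma fr3_swap23:
  assumes "\<And>i j k. \<alpha> i k j x = - \<alpha> i j k x"
  shows "fr3 \<alpha> a c b x = - fr3 \<alpha> a b c x"
proof -
  have "fr3 \<alpha> a c b x = (\<Sum>i\<in>UNIV. \<Sum>j\<in>UNIV. \<Sum>k\<in>UNIV. \<alpha> i k j x * (ev a i x * ev c k x * ev b j x))"
    unfolding fr3_triple by (rule sum.cong[OF refl], rule sum.swap)
  also have "\<dots> = - fr3 \<alpha> a b c x"
    unfolding fr3_triple sum_negf[symmetric] by (intro sum.cong refl, subst assms, simp)
  finally show ?thesis .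
qed

lemma fr2_swap:
  assumes "\<And>i j. \<beta> j i x = - \<beta> i j x"
  shows "fr2 \<beta> b a x = - fr2 \<beta> a b x"
proof -
  have "fr2 \<beta> b a x = (\<Sum>i\<in>UNIV. \<Sum>j\<in>UNIV. \<beta> j i x * (ev b j x * ev a i x))"
    unfolding fr2_triple by (rule sum.swap)
  also have "\<dots> = - fr2 \<beta> a b x"
    unfolding fr2_triple sum_negf[symmetric] by (intro sum.cong refl, subst assms, simp)
  finally show ?thesis .
qed

text \<open>Frame components: \<open>omh\<close> of the connection form, \<open>fd m\<close> the derivative along \<open>e\<^sub>m\<close>, \<open>RF\<close> of
  the curvature and, in the next context, \<open>TF\<close> of \<open>T\<close> and \<open>NF\<close> of \<open>\<nabla>T\<close>.\<close>

definition omh :: "'n \<Rightarrow> 'n \<Rightarrow> 'n \<Rightarrow> real^'n \<Rightarrow> real" where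
  "omh m a b x = (\<Sum>s\<in>UNIV. ev m s x * om s a b x)"

definition fd :: "'n \<Rightarrow> (real^'n \<Rightarrow> real) \<Rightarrow> real^'n \<Rightarrow> real" where
  "fd m f x = (\<Sum>s\<in>UNIV. ev m s x * partial_diff s f x)"

definition RF :: "'n \<Rightarrow> 'n \<Rightarrow> 'n \<Rightarrow> 'n \<Rightarrow> real^'n \<Rightarrow> real" where
  "RF i j a b = fr2 (\<lambda>k l. Om k l a b) i j"

lemma Om_swap12: "Om l k a b x = - Om k l a b x"
proof -
  have "(\<Sum>p\<in>UNIV. om k a p x * om l p b x - om l a p x * om k p b x) = - (\<Sum>p\<in>UNIV. om l a p x * om k p b x - om k a p x * om l p b x)"
    unfolding sum_negf[symmetric] by simp
  then show ?thesis unfolding Om_def by simp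
qed

lemma RF_swap12: "RF j i a b x = - RF i j a b x"
  unfolding RF_def by (rule fr2_swap) (rule Om_swap12)

end

context torsion_chart begin

definition TF :: "'n \<Rightarrow> 'n \<Rightarrow> 'n \<Rightarrow> real^'n \<Rightarrow> real" where
  "TF = fr3 T"

definition NF :: "'n \<Rightarrow> 'n \<Rightarrow> 'n \<Rightarrow> 'n \<Rightarrow> real^'n \<Rightarrow> real" where
  "NF m a b c x = (\<Sum>s\<in>UNIV. ev m s x * fr3 (cov3 T s) a b c x)"

lemma TF_swap12: "TF b a c x = - TF a b c x"
  unfolding TF_def by (rule fr3_swap12) (rule T_swap12)

lemma TF_swap23: "x \<in> W \<Longrightarrow> TF a c b x = - TF a b c x"
  unfolding TF_def by (rule fr3_swap23) (rule T_swap23)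

lemma TF_cyc: "x \<in> W \<Longrightarrow> TF b c a x = TF a b c x"
  using TF_swap23[of x b c a] TF_swap12[of b a c x] by simp

lemma RF_swap34: "x \<in> W \<Longrightarrow> RF i j b a x = - RF i j a b x"
  unfolding RF_def fr2_triple sum_negf[symmetric] by (intro sum.cong refl) (subst Om_skew, simp_all)

lemma RF_eq:
  assumes x: "x \<in> W"
  shows "RF m a b c x = (\<Sum>s\<in>UNIV. ev m s x * fr3 (\<lambda>i j k. Rl s i j k) a b c x)"
proof -
  have 1: "(\<Sum>k\<in>UNIV. Rl s i j k x * ev c k x) = (\<Sum>p\<in>UNIV. Om s i p c x * E x $ p $ j)" for s i j
  proof -
    have "(\<Sum>k\<in>UNIV. Rl s i j k x * ev c k x) = (\<Sum>k\<in>UNIV. \<Sum>p\<in>UNIV. \<Sum>q\<in>UNIV. Om s i p q x * E x $ p $ j * (E x $ q $ k * ev c k x))"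
      unfolding Rl_frame[OF x] sum_distrib_right by (simp add: mult_ac)
    also have "\<dots> = (\<Sum>p\<in>UNIV. \<Sum>q\<in>UNIV. \<Sum>k\<in>UNIV. Om s i p q x * E x $ p $ j * (E x $ q $ k * ev c k x))"
      by (rule sum3_rot)
    also have "\<dots> = (\<Sum>p\<in>UNIV. \<Sum>q\<in>UNIV. Om s i p q x * E x $ p $ j * (if c = q then 1 else 0))"
      unfolding sum_distrib_left[symmetric] dual1[OF x] ..
    finally show ?thesis by (simp add: if_distrib cong: if_cong)
  qed
  have 2: "(\<Sum>j\<in>UNIV. (\<Sum>p\<in>UNIV. Om s i p c x * E x $ p $ j) * ev b j x) = Om s i b c x" for s i
  proof -
    have "(\<Sum>j\<in>UNIV. (\<Sum>p\<in>UNIV. Om s i p c x * E x $ p $ j) * ev b j x) = (\<Sum>p\<in>UNIV. Om s i p c x * (\<Sum>j\<in>UNIV. E x $ p $ j * ev b j x))"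
      unfolding sum_distrib_left sum_distrib_right by (subst sum.swap) (simp add: mult.assoc)
    then show ?thesis unfolding dual1[OF x] by (simp add: if_distrib cong: if_cong)
  qed
  have "(\<Sum>s\<in>UNIV. ev m s x * fr3 (\<lambda>i j k. Rl s i j k) a b c x) = (\<Sum>s\<in>UNIV. ev m s x * (\<Sum>i\<in>UNIV. Om s i b c x * ev a i x))"
    unfolding fr3_def 1 2 ..
  also have "\<dots> = RF m a b c x" unfolding RF_def fr2_def by (simp add: mult_ac)
  finally show ?thesis ..
qed

lemma NF_eq:
  assumes x: "x \<in> W"
  shows "NF m a b c x = RF m a b c x + RF m b c a x + RF m c a b x"
proof -
  have "fr3 (cov3 T s) a b c x = fr3 (\<lambda>i j k. Rl s i j k) a b c x + fr3 (\<lambda>i j k. Rl s i j k) b c a x + fr3 (\<lambda>i j k. Rl s i j k) c a b x" for s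
  proof -
    have "fr3 (cov3 T s) a b c x = fr3 (\<lambda>i j k x. Rl s i j k x + Rl s j k i x + Rl s k i j x) a b c x"
      unfolding fr3_triple curvature_last_cyclic[OF x, symmetric] ..
    also have "\<dots> = fr3 (\<lambda>i j k. Rl s i j k) a b c x + fr3 (\<lambda>i j k. Rl s j k i) a b c x + fr3 (\<lambda>i j k. Rl s k i j) a b c x"
      by (simp only: fr3_add)
    also have "fr3 (\<lambda>i j k. Rl s j k i) a b c x = fr3 (\<lambda>i j k. Rl s i j k) b c a x" by (rule fr3_rot)
    also have "fr3 (\<lambda>i j k. Rl s k i j) a b c x = fr3 (\<lambda>i j k. Rl s i j k) c a b x"
      by (rule fr3_rot[of "\<lambda>i j k. Rl s k i j" c a b x, symmetric])
    finally show ?thesis .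
  qed
  then show ?thesis unfolding NF_def RF_eq[OF x] by (simp add: distrib_left sum.distrib)
qed

lemma fd_TF:
  assumes x: "x \<in> W"
  shows "fd m (TF a b c) x = NF m a b c x + (\<Sum>p\<in>UNIV. omh m a p x * TF p b c x)
    + (\<Sum>p\<in>UNIV. omh m b p x * TF a p c x) + (\<Sum>p\<in>UNIV. omh m c p x * TF a b p x)"
proof -
  have s: "(\<Sum>s\<in>UNIV. ev m s x * (\<Sum>p\<in>UNIV. om s a p x * g p)) = (\<Sum>p\<in>UNIV. omh m a p x * g p)" for a and g :: "'n \<Rightarrow> real"
    unfolding omh_def sum_distrib_left sum_distrib_right by (subst sum.swap) (simp add: mult.assoc)
  show ?thesis
    unfolding fd_def TF_def pd_fr3[OF x smooth_T] NF_def distrib_left sum.distrib s by simp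
qed

lemma omh_skew: "x \<in> W \<Longrightarrow> omh m b a x = - omh m a b x"
  unfolding omh_def sum_negf[symmetric] by (intro sum.cong refl) (subst om_skew, simp_all)

lemma smooth_TF: "smooth_on W (TF a b c)"
  unfolding TF_def by (rule smooth_fr3) (rule smooth_T)

text \<open>With its last index raised again, the torsion is the antisymmetrised Christoffel symbol;
  this recognises the torsion term in the second Bianchi identity.\<close>

lemma torsion_frame_expand:
  assumes x: "x \<in> W"
  shows "(\<Sum>q\<in>UNIV. TF m i q x * ev q l x) = fr2 (\<lambda>s p x. C x s p l - C x p s l) m i x"
proof -
  have "TF m i q x = (\<Sum>l\<in>UNIV. E x $ q $ l * fr2 (\<lambda>s p x. C x s p l - C x p s l) m i x)" for q
  proof -
    have "TF m i q x = (\<Sum>s\<in>UNIV. \<Sum>p\<in>UNIV. (\<Sum>k\<in>UNIV. T s p k x * ev q k x) * (ev m s x * ev i p x))"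
      unfolding TF_def fr3_triple sum_distrib_right by (simp add: mult_ac)
    also have "\<dots> = (\<Sum>s\<in>UNIV. \<Sum>p\<in>UNIV. \<Sum>l\<in>UNIV. E x $ q $ l * ((C x s p l - C x p s l) * (ev m s x * ev i p x)))"
    proof (intro sum.cong refl)
      fix s p
      have "(\<Sum>k\<in>UNIV. T s p k x * ev q k x) = (\<Sum>l\<in>UNIV. (C x s p l - C x p s l) * (\<Sum>k\<in>UNIV. gm l k x * ev q k x))"
        unfolding T_def sum_distrib_left sum_distrib_right by (subst sum.swap) (simp add: mult.assoc)
      then have e: "(\<Sum>k\<in>UNIV. T s p k x * ev q k x) = (\<Sum>l\<in>UNIV. (C x s p l - C x p s l) * E x $ q $ l)"
        unfolding gm_ev[OF x] .
      show "(\<Sum>k\<in>UNIV. T s p k x * ev q k x) * (ev m s x * ev i p x)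
        = (\<Sum>l\<in>UNIV. E x $ q $ l * ((C x s p l - C x p s l) * (ev m s x * ev i p x)))"
        unfolding e sum_distrib_right by (simp add: mult_ac)
    qed
    also have "\<dots> = (\<Sum>l\<in>UNIV. \<Sum>s\<in>UNIV. \<Sum>p\<in>UNIV. E x $ q $ l * ((C x s p l - C x p s l) * (ev m s x * ev i p x)))"
      by (rule sum3_rot[symmetric])
    finally show ?thesis unfolding fr2_triple sum_distrib_left .
  qed
  then show ?thesis using frame_expand[OF x, of "\<lambda>l. fr2 (\<lambda>s p x. C x s p l - C x p s l) m i x" l] by simp
qed

end

text \<open>Invariance of the trace pairing under so(n): the commutator [w, a] paired with t cancels
  a paired with the rotated t.\<close>

lemma skew_bracket_cancel:
  fixes w a t :: "'n::finite \<Rightarrow> 'n \<Rightarrow> real"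
  assumes w: "\<And>k q. w q k = - w k q"
  shows "(\<Sum>k\<in>UNIV. \<Sum>l\<in>UNIV. ((\<Sum>q\<in>UNIV. w k q * a q l) - (\<Sum>q\<in>UNIV. a k q * w q l)) * t k l
     + a k l * ((\<Sum>q\<in>UNIV. w k q * t q l) + (\<Sum>q\<in>UNIV. w l q * t k q))) = 0"
proof -
  define p1 where "p1 = (\<Sum>k\<in>UNIV. \<Sum>l\<in>UNIV. \<Sum>q\<in>UNIV. w k q * a q l * t k l)"
  define p2 where "p2 = (\<Sum>k\<in>UNIV. \<Sum>l\<in>UNIV. \<Sum>q\<in>UNIV. a k q * w q l * t k l)"
  have "(\<Sum>k\<in>UNIV. \<Sum>l\<in>UNIV. ((\<Sum>q\<in>UNIV. w k q * a q l) - (\<Sum>q\<in>UNIV. a k q * w q l)) * t k l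
     + a k l * ((\<Sum>q\<in>UNIV. w k q * t q l) + (\<Sum>q\<in>UNIV. w l q * t k q)))
    = p1 - p2 + (\<Sum>k\<in>UNIV. \<Sum>l\<in>UNIV. \<Sum>q\<in>UNIV. w k q * a k l * t q l) + (\<Sum>k\<in>UNIV. \<Sum>l\<in>UNIV. \<Sum>q\<in>UNIV. a k l * w l q * t k q)"
    unfolding p1_def p2_def sum.distrib[symmetric] sum_subtractf[symmetric]
    unfolding left_diff_distrib distrib_left sum_distrib_left sum_distrib_right sum_subtractf sum.distrib
    by (simp add: mult_ac)
  moreover have "(\<Sum>k\<in>UNIV. \<Sum>l\<in>UNIV. \<Sum>q\<in>UNIV. a k l * w l q * t k q) = p2"
    unfolding p2_def by (rule sum.cong[OF refl], rule sum.swap)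
  moreover have "(\<Sum>k\<in>UNIV. \<Sum>l\<in>UNIV. \<Sum>q\<in>UNIV. w k q * a k l * t q l) = - p1"
  proof -
    have "(\<Sum>k\<in>UNIV. \<Sum>l\<in>UNIV. \<Sum>q\<in>UNIV. w k q * a k l * t q l) = (\<Sum>q\<in>UNIV. \<Sum>k\<in>UNIV. \<Sum>l\<in>UNIV. w k q * a k l * t q l)"
      by (rule sum3_rot[symmetric])
    also have "\<dots> = (\<Sum>q\<in>UNIV. \<Sum>l\<in>UNIV. \<Sum>k\<in>UNIV. w k q * a k l * t q l)"
      by (rule sum.cong[OF refl], rule sum.swap)
    also have "\<dots> = - p1" unfolding p1_def sum_negf[symmetric] by (intro sum.cong refl) (subst w, simp)
    finally show ?thesis .
  qed
  ultimately show ?thesis by simp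
qed

context frame_chart begin

lemma fr3_sum: "fr3 (\<lambda>i j k x. \<Sum>q\<in>Q. \<alpha> q i j k x) a b c x = (\<Sum>q\<in>Q. fr3 (\<alpha> q) a b c x)"
proof -
  have "fr3 (\<lambda>i j k x. \<Sum>q\<in>Q. \<alpha> q i j k x) a b c x
    = (\<Sum>i\<in>UNIV. \<Sum>j\<in>UNIV. \<Sum>q\<in>Q. \<Sum>k\<in>UNIV. \<alpha> q i j k x * (ev a i x * ev b j x * ev c k x))"
    unfolding fr3_triple sum_distrib_right by (intro sum.cong refl) (rule sum.swap)
  also have "\<dots> = (\<Sum>i\<in>UNIV. \<Sum>q\<in>Q. \<Sum>j\<in>UNIV. \<Sum>k\<in>UNIV. \<alpha> q i j k x * (ev a i x * ev b j x * ev c k x))"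
    by (rule sum.cong[OF refl], rule sum.swap)
  also have "\<dots> = (\<Sum>q\<in>Q. fr3 (\<alpha> q) a b c x)" unfolding fr3_triple by (rule sum.swap)
  finally show ?thesis .
qed

lemma fr3_prod_left: "fr3 (\<lambda>s p r x. A s x * B p r x) m i j x = (\<Sum>s\<in>UNIV. ev m s x * A s x) * fr2 B i j x"
proof -
  have "fr3 (\<lambda>s p r x. A s x * B p r x) m i j x
    = (\<Sum>s\<in>UNIV. (ev m s x * A s x) * (\<Sum>p\<in>UNIV. \<Sum>r\<in>UNIV. B p r x * (ev i p x * ev j r x)))"
    unfolding fr3_triple sum_distrib_left by (simp add: mult_ac)
  then show ?thesis unfolding fr2_triple sum_distrib_right .
qed

lemma fr3_prod_right: "fr3 (\<lambda>s p r x. A s p x * B r x) m i j x = fr2 A m i x * (\<Sum>r\<in>UNIV. B r x * ev j r x)"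
  unfolding fr3_triple fr2_triple by (simp add: mult_ac sum_distrib_left sum_distrib_right)

end

context torsion_chart begin

text \<open>The contraction X_prn = R_prkl T_nkl. The first pair stays in coordinates, where
  \<open>second_bianchi\<close> holds without torsion terms. \<open>XF\<close> has all indices in
  the frame, and \<open>MF\<close> is the part of its derivative that falls on
  \<open>T\<close>.\<close>

definition Xc :: "'n \<Rightarrow> 'n \<Rightarrow> 'n \<Rightarrow> real^'n \<Rightarrow> real" where
  "Xc p r n x = (\<Sum>k\<in>UNIV. \<Sum>l\<in>UNIV. Om p r k l x * TF n k l x)"

definition XF :: "'n \<Rightarrow> 'n \<Rightarrow> 'n \<Rightarrow> real^'n \<Rightarrow> real" where
  "XF i j n = fr2 (\<lambda>p r. Xc p r n) i j"

definition MF :: "'n \<Rightarrow> 'n \<Rightarrow> 'n \<Rightarrow> 'n \<Rightarrow> real^'n \<Rightarrow> real" where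
  "MF m i j n x = (\<Sum>k\<in>UNIV. \<Sum>l\<in>UNIV. NF m n k l x * RF i j k l x)"

lemma smooth_Xc: "smooth_on W (Xc p r n)"
  unfolding Xc_def[abs_def] by (intro smooth_rules smooth_Om smooth_TF)

lemma smooth_XF: "smooth_on W (XF i j n)"
  unfolding XF_def fr2_def[abs_def] by (intro smooth_rules smooth_Xc smooth_ev)

lemma Xc_swap: "Xc r p n x = - Xc p r n x"
  unfolding Xc_def sum_negf[symmetric] by (intro sum.cong refl) (subst Om_swap12, simp)

lemma XF_swap: "XF j i n x = - XF i j n x"
  unfolding XF_def by (rule fr2_swap) (rule Xc_swap)

lemma XF_eq: "XF i j n x = (\<Sum>k\<in>UNIV. \<Sum>l\<in>UNIV. RF i j k l x * TF n k l x)"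
proof -
  have s: "(\<Sum>p\<in>UNIV. \<Sum>r\<in>UNIV. (\<Sum>k\<in>UNIV. f p r k) * g p r) = (\<Sum>k\<in>UNIV. \<Sum>p\<in>UNIV. \<Sum>r\<in>UNIV. f p r k * g p r)"
    for f :: "'n \<Rightarrow> 'n \<Rightarrow> 'n \<Rightarrow> real" and g
    unfolding sum_distrib_right by (rule sum3_rot[symmetric])
  have "XF i j n x = (\<Sum>k\<in>UNIV. \<Sum>l\<in>UNIV. \<Sum>p\<in>UNIV. \<Sum>r\<in>UNIV. Om p r k l x * TF n k l x * (ev i p x * ev j r x))"
    unfolding XF_def fr2_triple Xc_def s ..
  then show ?thesis unfolding RF_def fr2_triple sum_distrib_right by (simp add: mult_ac)
qed

text \<open>Leibniz rule. The rotations of the contracted indices k and l cancel by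
  \<open>skew_bracket_cancel\<close>, so that only the free frame index n is rotated.\<close>

lemma pd_Xc:
  assumes x: "x \<in> W"
  shows "partial_diff s (Xc p r n) x = (\<Sum>k\<in>UNIV. \<Sum>l\<in>UNIV. DOm s p r k l x * TF n k l x)
    + (\<Sum>k\<in>UNIV. \<Sum>l\<in>UNIV. fr3 (cov3 T s) n k l x * Om p r k l x) + (\<Sum>q\<in>UNIV. om s n q x * Xc p r q x)"
proof -
  have pT: "partial_diff s (TF n k l) x = fr3 (cov3 T s) n k l x + (\<Sum>q\<in>UNIV. om s n q x * TF q k l x)
    + ((\<Sum>q\<in>UNIV. om s k q x * TF n q l x) + (\<Sum>q\<in>UNIV. om s l q x * TF n k q x))" for k l
    unfolding TF_def pd_fr3[OF x smooth_T] by simp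
  have pO: "partial_diff s (Om p r k l) x = DOm s p r k l x + ((\<Sum>q\<in>UNIV. om s k q x * Om p r q l x) - (\<Sum>q\<in>UNIV. Om p r k q x * om s q l x))" for k l
    unfolding DOm_def by simp
  have "partial_diff s (Xc p r n) x = (\<Sum>k\<in>UNIV. partial_diff s (\<lambda>y. \<Sum>l\<in>UNIV. Om p r k l y * TF n k l y) x)"
    unfolding Xc_def[abs_def] by (rule pd_sum[OF x]) (intro smooth_rules smooth_Om smooth_TF finite)+
  also have "\<dots> = (\<Sum>k\<in>UNIV. \<Sum>l\<in>UNIV. partial_diff s (\<lambda>y. Om p r k l y * TF n k l y) x)"
    by (rule sum.cong[OF refl], rule pd_sum[OF x]) (intro smooth_rules smooth_Om smooth_TF finite)+
  also have "\<dots> = (\<Sum>k\<in>UNIV. \<Sum>l\<in>UNIV. partial_diff s (Om p r k l) x * TF n k l x + Om p r k l x * partial_diff s (TF n k l) x)"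
    by (intro sum.cong refl pd_mult[OF x] smooth_Om smooth_TF)
  also have "\<dots> = (\<Sum>k\<in>UNIV. \<Sum>l\<in>UNIV. DOm s p r k l x * TF n k l x)
     + (\<Sum>k\<in>UNIV. \<Sum>l\<in>UNIV. fr3 (cov3 T s) n k l x * Om p r k l x)
     + (\<Sum>k\<in>UNIV. \<Sum>l\<in>UNIV. \<Sum>q\<in>UNIV. om s n q x * (Om p r k l x * TF q k l x))
     + (\<Sum>k\<in>UNIV. \<Sum>l\<in>UNIV. ((\<Sum>q\<in>UNIV. om s k q x * Om p r q l x) - (\<Sum>q\<in>UNIV. Om p r k q x * om s q l x)) * TF n k l x
       + Om p r k l x * ((\<Sum>q\<in>UNIV. om s k q x * TF n q l x) + (\<Sum>q\<in>UNIV. om s l q x * TF n k q x)))"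
    unfolding pT pO sum.distrib[symmetric]
    by (intro sum.cong refl) (simp add: distrib_left distrib_right sum_distrib_left mult_ac)
  also have "(\<Sum>k\<in>UNIV. \<Sum>l\<in>UNIV. ((\<Sum>q\<in>UNIV. om s k q x * Om p r q l x) - (\<Sum>q\<in>UNIV. Om p r k q x * om s q l x)) * TF n k l x
       + Om p r k l x * ((\<Sum>q\<in>UNIV. om s k q x * TF n q l x) + (\<Sum>q\<in>UNIV. om s l q x * TF n k q x))) = 0"
    by (rule skew_bracket_cancel) (rule om_skew[OF x])
  also have "(\<Sum>k\<in>UNIV. \<Sum>l\<in>UNIV. \<Sum>q\<in>UNIV. om s n q x * (Om p r k l x * TF q k l x)) = (\<Sum>q\<in>UNIV. om s n q x * Xc p r q x)"
    unfolding Xc_def sum_distrib_left by (rule sum3_rot[symmetric])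
  finally show ?thesis by simp
qed

text \<open>\<open>omh m i q - omh i m q - TF m i q\<close> are the components of the bracket of the
  frame fields e_m and e_i. The cyclic sum of F is thus the invariant formula for the exterior
  covariant derivative of the curvature, paired with T.\<close>

lemma contracted_second_bianchi:
  assumes x: "x \<in> W"
  defines "F \<equiv> \<lambda>m i j n. fd m (XF i j n) x - MF m i j n x - (\<Sum>p\<in>UNIV. omh m n p x * XF i j p x)
    - (\<Sum>q\<in>UNIV. (omh m i q x - omh i m q x - TF m i q x) * XF q j n x)"
  shows "F m i j n + F i j m n + F j m i n = 0"
proof -
  \<comment> \<open>The coordinate version of F. Its torsion term exchanges the lower indices of one
    Christoffel symbol, after which the Christoffel terms \<open>P\<close> cancel in the cyclic
    sum.\<close>
  define Q where "Q s p r y = cov2 (\<lambda>p r. Xc p r n) s p r y - (\<Sum>k\<in>UNIV. \<Sum>l\<in>UNIV. fr3 (cov3 T s) n k l y * Om p r k l y)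
     - (\<Sum>q\<in>UNIV. om s n q y * Xc p r q y) + (\<Sum>l\<in>UNIV. (C y s p l - C y p s l) * Xc l r n y)" for s p r y
  define P where "P p s r = (\<Sum>l\<in>UNIV. C x p s l * Xc l r n x)" for p s r
  define DT where "DT s p r = (\<Sum>k\<in>UNIV. \<Sum>l\<in>UNIV. DOm s p r k l x * TF n k l x)" for s p r
  have Q: "Q s p r x = DT s p r - P p s r + P s r p" for s p r
  proof -
    have "(\<Sum>l\<in>UNIV. C x s r l * Xc p l n x) = - P s r p"
      unfolding P_def sum_negf[symmetric] by (intro sum.cong refl) (subst Xc_swap, simp)
    moreover have "(\<Sum>l\<in>UNIV. (C x s p l - C x p s l) * Xc l r n x) = P s p r - P p s r"
      unfolding P_def by (simp add: left_diff_distrib sum_subtractf)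
    ultimately show ?thesis unfolding Q_def cov2_def pd_Xc[OF x] by (simp add: P_def DT_def)
  qed
  have DT: "DT s p r + DT p r s + DT r s p = 0" for s p r
    unfolding DT_def sum.distrib[symmetric] distrib_right[symmetric] second_bianchi[OF x] by simp
  have Qcyc: "Q s p r x + Q p r s x + Q r s p x = 0" for s p r
    unfolding Q using DT[of s p r] by simp
  have qcyc: "fr3 Q m i j x + fr3 Q i j m x + fr3 Q j m i x = 0"
  proof -
    have "fr3 Q i j m x = fr3 (\<lambda>s p r. Q p r s) m i j x" by (rule fr3_rot[symmetric])
    moreover have "fr3 Q j m i x = fr3 (\<lambda>s p r. Q r s p) m i j x" by (rule fr3_rot[of "\<lambda>s p r. Q r s p" j m i x])
    moreover have "fr3 Q m i j x + fr3 (\<lambda>s p r. Q p r s) m i j x + fr3 (\<lambda>s p r. Q r s p) m i j x = 0"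
      unfolding fr3_triple sum.distrib[symmetric] distrib_right[symmetric] Qcyc by simp
    ultimately show ?thesis by simp
  qed
  define S where "S m j i = (\<Sum>p\<in>UNIV. omh m j p x * XF p i n x)" for m j i
  have F: "F m i j n = fr3 Q m i j x - S m j i + S i m j" for m i j
  proof -
    have f1: "fr3 (\<lambda>s p r y. \<Sum>k\<in>UNIV. \<Sum>l\<in>UNIV. fr3 (cov3 T s) n k l y * Om p r k l y) m i j x = MF m i j n x"
      unfolding fr3_sum fr3_prod_left MF_def NF_def RF_def ..
    have f2: "fr3 (\<lambda>s p r y. \<Sum>q\<in>UNIV. om s n q y * Xc p r q y) m i j x = (\<Sum>q\<in>UNIV. omh m n q x * XF i j q x)"
      unfolding fr3_sum fr3_prod_left omh_def XF_def ..
    have f3: "fr3 (\<lambda>s p r y. \<Sum>l\<in>UNIV. (C y s p l - C y p s l) * Xc l r n y) m i j x = (\<Sum>q\<in>UNIV. TF m i q x * XF q j n x)"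
    proof -
      have "fr3 (\<lambda>s p r y. \<Sum>l\<in>UNIV. (C y s p l - C y p s l) * Xc l r n y) m i j x
        = (\<Sum>l\<in>UNIV. (\<Sum>q\<in>UNIV. TF m i q x * ev q l x) * (\<Sum>r\<in>UNIV. Xc l r n x * ev j r x))"
        unfolding fr3_sum fr3_prod_right torsion_frame_expand[OF x] ..
      also have "\<dots> = (\<Sum>q\<in>UNIV. \<Sum>l\<in>UNIV. TF m i q x * ev q l x * (\<Sum>r\<in>UNIV. Xc l r n x * ev j r x))"
        unfolding sum_distrib_right by (rule sum.swap)
      also have "\<dots> = (\<Sum>q\<in>UNIV. TF m i q x * XF q j n x)"
        unfolding XF_def fr2_def by (intro sum.cong refl) (simp add: sum_distrib_left sum_distrib_right mult_ac)
      finally show ?thesis .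
    qed
    have f0: "fr3 (\<lambda>s p r. cov2 (\<lambda>p r. Xc p r n) s p r) m i j x = fd m (XF i j n) x - S m i j + S m j i"
    proof -
      have "fr3 (\<lambda>s p r. cov2 (\<lambda>p r. Xc p r n) s p r) m i j x = (\<Sum>s\<in>UNIV. ev m s x * fr2 (cov2 (\<lambda>p r. Xc p r n) s) i j x)"
        unfolding fr3_def fr2_def by (simp add: mult.commute)
      moreover have "partial_diff s (XF i j n) x = fr2 (cov2 (\<lambda>p r. Xc p r n) s) i j x
         + (\<Sum>p\<in>UNIV. om s i p x * XF p j n x) + (\<Sum>p\<in>UNIV. om s j p x * XF i p n x)" for s
        unfolding XF_def by (rule pd_fr2[OF x]) (rule smooth_Xc)
      moreover have "(\<Sum>s\<in>UNIV. ev m s x * (\<Sum>p\<in>UNIV. om s a p x * g p)) = (\<Sum>p\<in>UNIV. omh m a p x * g p)" for a and g :: "'n \<Rightarrow> real"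
        unfolding omh_def sum_distrib_left sum_distrib_right by (subst sum.swap) (simp add: mult.assoc)
      moreover have "(\<Sum>p\<in>UNIV. omh m j p x * XF i p n x) = - S m j i"
        unfolding S_def sum_negf[symmetric] by (intro sum.cong refl) (subst XF_swap, simp)
      ultimately show ?thesis unfolding fd_def S_def by (simp add: distrib_left sum.distrib)
    qed
    have "fr3 Q m i j x = fd m (XF i j n) x - S m i j + S m j i - MF m i j n x - (\<Sum>q\<in>UNIV. omh m n q x * XF i j q x)
       + (\<Sum>q\<in>UNIV. TF m i q x * XF q j n x)"
      unfolding Q_def[abs_def] fr3_add fr3_diff f0 f1 f2 f3 ..
    then show ?thesis unfolding F_def S_def by (simp add: left_diff_distrib sum_subtractf)
  qed
  show ?thesis unfolding F using qcyc by simp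
qed

end

section \<open>\<open>G\<^sub>2\<close> connections and the Bochner identity\<close>

text \<open>The derivations of a 3-tensor form a Lie algebra. In the two orders of composition
  \<open>D \<alpha> \<beta>\<close> and \<open>D \<beta> \<alpha>\<close> the terms with the
  matrices in different slots agree, so the difference is the action of the commutator.\<close>

lemma derivation_commutator:
  fixes \<alpha> \<beta> :: "'n::finite \<Rightarrow> 'n \<Rightarrow> real" and \<phi> :: "'n \<Rightarrow> 'n \<Rightarrow> 'n \<Rightarrow> real"
  assumes \<alpha>: "\<And>i j k. (\<Sum>q\<in>UNIV. \<alpha> i q * \<phi> q j k + \<alpha> j q * \<phi> i q k + \<alpha> k q * \<phi> i j q) = 0"
    and \<beta>: "\<And>i j k. (\<Sum>q\<in>UNIV. \<beta> i q * \<phi> q j k + \<beta> j q * \<phi> i q k + \<beta> k q * \<phi> i j q) = 0"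
  defines "\<gamma> \<equiv> \<lambda>i q. \<Sum>p\<in>UNIV. \<alpha> i p * \<beta> p q - \<beta> i p * \<alpha> p q"
  shows "(\<Sum>q\<in>UNIV. \<gamma> i q * \<phi> q j k + \<gamma> j q * \<phi> i q k + \<gamma> k q * \<phi> i j q) = 0"
proof -
  define s where "s h = (\<Sum>p\<in>UNIV. \<Sum>q\<in>UNIV. (h p q :: real))" for h :: "'n \<Rightarrow> 'n \<Rightarrow> real"
  have sadd: "s (\<lambda>p q. h p q + h' p q) = s h + s h'" and sdiff: "s (\<lambda>p q. h p q - h' p q) = s h - s h'" for h h'
    by (simp_all add: s_def sum.distrib sum_subtractf)
  have sw: "s h = s (\<lambda>p q. h q p)" for h unfolding s_def by (rule sum.swap)
  define D where "D a b = s (\<lambda>p q. a i p * b p q * \<phi> q j k) + s (\<lambda>p q. a i p * b j q * \<phi> p q k) + s (\<lambda>p q. a i p * b k q * \<phi> p j q)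
    + s (\<lambda>p q. a j p * b i q * \<phi> q p k) + s (\<lambda>p q. a j p * b p q * \<phi> i q k) + s (\<lambda>p q. a j p * b k q * \<phi> i p q)
    + s (\<lambda>p q. a k p * b i q * \<phi> q j p) + s (\<lambda>p q. a k p * b j q * \<phi> i q p) + s (\<lambda>p q. a k p * b p q * \<phi> i j q)" for a b :: "'n \<Rightarrow> 'n \<Rightarrow> real"
  have D0: "D a b = 0" if b: "\<And>i j k. (\<Sum>q\<in>UNIV. b i q * \<phi> q j k + b j q * \<phi> i q k + b k q * \<phi> i j q) = 0" for a b
  proof -
    have "D a b = (\<Sum>p\<in>UNIV. a i p * (\<Sum>q\<in>UNIV. b p q * \<phi> q j k + b j q * \<phi> p q k + b k q * \<phi> p j q))
      + (\<Sum>p\<in>UNIV. a j p * (\<Sum>q\<in>UNIV. b i q * \<phi> q p k + b p q * \<phi> i q k + b k q * \<phi> i p q))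
      + (\<Sum>p\<in>UNIV. a k p * (\<Sum>q\<in>UNIV. b i q * \<phi> q j p + b j q * \<phi> i q p + b p q * \<phi> i j q))"
      unfolding D_def s_def sum_distrib_left distrib_left sum.distrib by (simp add: mult.assoc)
    then show ?thesis unfolding b by simp
  qed
  have "(\<Sum>q\<in>UNIV. \<gamma> i q * \<phi> q j k + \<gamma> j q * \<phi> i q k + \<gamma> k q * \<phi> i j q)
    = (\<Sum>q\<in>UNIV. \<Sum>p\<in>UNIV. (\<alpha> i p * \<beta> p q - \<beta> i p * \<alpha> p q) * \<phi> q j k + (\<alpha> j p * \<beta> p q - \<beta> j p * \<alpha> p q) * \<phi> i q k
       + (\<alpha> k p * \<beta> p q - \<beta> k p * \<alpha> p q) * \<phi> i j q)"
    unfolding \<gamma>_def by (simp add: sum_distrib_right sum.distrib)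
  also have "\<dots> = s (\<lambda>p q. (\<alpha> i p * \<beta> p q - \<beta> i p * \<alpha> p q) * \<phi> q j k + (\<alpha> j p * \<beta> p q - \<beta> j p * \<alpha> p q) * \<phi> i q k
       + (\<alpha> k p * \<beta> p q - \<beta> k p * \<alpha> p q) * \<phi> i j q)"
    unfolding s_def by (rule sum.swap)
  also have "\<dots> = D \<alpha> \<beta> - D \<beta> \<alpha>"
  proof -
    have "s (\<lambda>p q. \<alpha> i p * \<beta> j q * \<phi> p q k) = s (\<lambda>p q. \<beta> j p * \<alpha> i q * \<phi> q p k)"
      "s (\<lambda>p q. \<alpha> i p * \<beta> k q * \<phi> p j q) = s (\<lambda>p q. \<beta> k p * \<alpha> i q * \<phi> q j p)"
      "s (\<lambda>p q. \<alpha> j p * \<beta> i q * \<phi> q p k) = s (\<lambda>p q. \<beta> i p * \<alpha> j q * \<phi> p q k)"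
      "s (\<lambda>p q. \<alpha> j p * \<beta> k q * \<phi> i p q) = s (\<lambda>p q. \<beta> k p * \<alpha> j q * \<phi> i q p)"
      "s (\<lambda>p q. \<alpha> k p * \<beta> i q * \<phi> q j p) = s (\<lambda>p q. \<beta> i p * \<alpha> k q * \<phi> p j q)"
      "s (\<lambda>p q. \<alpha> k p * \<beta> j q * \<phi> i q p) = s (\<lambda>p q. \<beta> j p * \<alpha> k q * \<phi> i p q)"
      by (subst sw, simp add: mult.commute)+
    then show ?thesis unfolding D_def left_diff_distrib sadd sdiff by simp
  qed
  also have "\<dots> = 0" using D0[of \<beta> \<alpha>] D0[of \<alpha> \<beta>] \<alpha> \<beta> by simp
  finally show ?thesis .
qed

locale g2_chart = torsion_chart W C E gm T for W :: "(real^7) set" and C E gm T +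
  fixes P
  defines "P \<equiv> \<lambda>i j k x. \<Sum>a\<in>UNIV. \<Sum>b\<in>UNIV. \<Sum>c\<in>UNIV. phi0 a b c * (E x $ a $ i * E x $ b $ j * E x $ c $ k)"
  assumes parallel: "\<And>x m i j k. x \<in> W \<Longrightarrow> cov3 P m i j k x = 0"
begin

lemma smooth_P: "smooth_on W (P i j k)"
  unfolding P_def by (intro smooth_rules E)

lemma fr3_P:
  assumes x: "x \<in> W" shows "fr3 P a b c x = phi0 a b c"
proof -
  have d: "(\<Sum>q\<in>UNIV. f q * (if a = q then 1 else 0)) = f a" for f :: "7 \<Rightarrow> real" and a
    by (simp add: if_distrib cong: if_cong)
  have 1: "(\<Sum>k\<in>UNIV. P i j k x * ev c k x) = (\<Sum>a\<in>UNIV. \<Sum>b\<in>UNIV. phi0 a b c * (E x $ a $ i * E x $ b $ j))" for i j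
  proof -
    have "(\<Sum>k\<in>UNIV. P i j k x * ev c k x) = (\<Sum>k\<in>UNIV. \<Sum>r\<in>UNIV. (\<Sum>a\<in>UNIV. \<Sum>b\<in>UNIV. phi0 a b r * (E x $ a $ i * E x $ b $ j)) * (E x $ r $ k * ev c k x))"
    proof (rule sum.cong[OF refl])
      fix k
      have "P i j k x = (\<Sum>r\<in>UNIV. (\<Sum>a\<in>UNIV. \<Sum>b\<in>UNIV. phi0 a b r * (E x $ a $ i * E x $ b $ j)) * E x $ r $ k)"
        unfolding P_def sum_distrib_right mult.assoc[symmetric] by (rule sum3_rot[symmetric])
      then show "P i j k x * ev c k x = (\<Sum>r\<in>UNIV. (\<Sum>a\<in>UNIV. \<Sum>b\<in>UNIV. phi0 a b r * (E x $ a $ i * E x $ b $ j)) * (E x $ r $ k * ev c k x))"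
        by (simp add: sum_distrib_right mult.assoc)
    qed
    also have "\<dots> = (\<Sum>r\<in>UNIV. (\<Sum>a\<in>UNIV. \<Sum>b\<in>UNIV. phi0 a b r * (E x $ a $ i * E x $ b $ j)) * (\<Sum>k\<in>UNIV. E x $ r $ k * ev c k x))"
      by (subst sum.swap) (simp add: sum_distrib_left)
    finally show ?thesis unfolding dual1[OF x] d .
  qed
  have 2: "(\<Sum>j\<in>UNIV. (\<Sum>a\<in>UNIV. \<Sum>b\<in>UNIV. phi0 a b c * (E x $ a $ i * E x $ b $ j)) * ev r j x) = (\<Sum>a\<in>UNIV. phi0 a r c * E x $ a $ i)" for i r
  proof -
    have "(\<Sum>j\<in>UNIV. (\<Sum>a\<in>UNIV. \<Sum>b\<in>UNIV. phi0 a b c * (E x $ a $ i * E x $ b $ j)) * ev r j x)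
      = (\<Sum>j\<in>UNIV. \<Sum>a\<in>UNIV. \<Sum>b\<in>UNIV. phi0 a b c * E x $ a $ i * (E x $ b $ j * ev r j x))"
      unfolding sum_distrib_right by (simp add: mult.assoc)
    also have "\<dots> = (\<Sum>a\<in>UNIV. \<Sum>b\<in>UNIV. phi0 a b c * E x $ a $ i * (\<Sum>j\<in>UNIV. E x $ b $ j * ev r j x))"
      unfolding sum_distrib_left by (rule sum3_rot)
    finally show ?thesis unfolding dual1[OF x] d .
  qed
  have 3: "(\<Sum>i\<in>UNIV. (\<Sum>a\<in>UNIV. phi0 a b c * E x $ a $ i) * ev r i x) = phi0 r b c" for r
  proof -
    have "(\<Sum>i\<in>UNIV. (\<Sum>a\<in>UNIV. phi0 a b c * E x $ a $ i) * ev r i x) = (\<Sum>a\<in>UNIV. phi0 a b c * (\<Sum>i\<in>UNIV. E x $ a $ i * ev r i x))"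
      unfolding sum_distrib_left sum_distrib_right by (subst sum.swap) (simp add: mult.assoc)
    then show ?thesis unfolding dual1[OF x] d .
  qed
  show ?thesis unfolding fr3_def 1 2 3 ..
qed

text \<open>The form \<phi> is parallel and has the constant frame components \<open>phi0\<close>,
  so differentiating them leaves only the action of \<open>om\<close> on
  \<open>phi0\<close>.\<close>

lemma om_derivation:
  assumes x: "x \<in> W"
  shows "(\<Sum>q\<in>UNIV. om m a q x * phi0 q b c + om m b q x * phi0 a q c + om m c q x * phi0 a b q) = 0"
proof -
  have "partial_diff m (fr3 P a b c) x = partial_diff m (\<lambda>_. phi0 a b c) x"
    by (rule partial_diff_cong[OF W x]) (rule fr3_P)
  moreover have "fr3 (cov3 P m) a b c x = 0" unfolding fr3_def parallel[OF x] by simp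
  ultimately show ?thesis
    unfolding pd_fr3[OF x smooth_P] fr3_P[OF x] by (simp add: partial_diff_const sum.distrib)
qed

lemma omh_derivation:
  assumes x: "x \<in> W"
  shows "(\<Sum>q\<in>UNIV. omh m a q x * phi0 q b c + omh m b q x * phi0 a q c + omh m c q x * phi0 a b q) = 0"
proof -
  have "(\<Sum>q\<in>UNIV. omh m a q x * phi0 q b c + omh m b q x * phi0 a q c + omh m c q x * phi0 a b q)
    = (\<Sum>s\<in>UNIV. ev m s x * (\<Sum>q\<in>UNIV. om s a q x * phi0 q b c + om s b q x * phi0 a q c + om s c q x * phi0 a b q))"
    unfolding omh_def sum_distrib_left sum_distrib_right
    by (subst sum.swap) (simp add: sum.distrib distrib_left mult.assoc)
  then show ?thesis unfolding om_derivation[OF x] by simp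
qed

text \<open>The curvature is a derivative of \<open>om\<close> plus a commutator. The first part is
  a derivation because \<open>om_derivation\<close> can be differentiated, the second by
  \<open>derivation_commutator\<close>.\<close>

lemma Om_derivation:
  assumes x: "x \<in> W"
  shows "(\<Sum>q\<in>UNIV. Om k l a q x * phi0 q b c + Om k l b q x * phi0 a q c + Om k l c q x * phi0 a b q) = 0"
proof -
  have d: "(\<Sum>q\<in>UNIV. partial_diff k (om l a q) x * phi0 q b c + partial_diff k (om l b q) x * phi0 a q c
     + partial_diff k (om l c q) x * phi0 a b q) = 0" for k l
  proof -
    let ?h = "\<lambda>q y. om l a q y * phi0 q b c + om l b q y * phi0 a q c + om l c q y * phi0 a b q"
    have c: "partial_diff k (\<lambda>y. f y * r) x = partial_diff k f x * r" if "smooth_on W f" for f r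
      using pd_mult[OF x that smooth_on_const[of W r], of k] by (simp add: partial_diff_const)
    have "0 = partial_diff k (\<lambda>y. \<Sum>q\<in>UNIV. ?h q y) x"
      using partial_diff_cong[OF W x, of "\<lambda>y. \<Sum>q\<in>UNIV. ?h q y" "\<lambda>_. 0" k] om_derivation by (simp add: partial_diff_const)
    also have "\<dots> = (\<Sum>q\<in>UNIV. partial_diff k (?h q) x)"
      by (rule pd_sum[OF x]) (intro smooth_rules smooth_om finite)+
    also have "\<dots> = (\<Sum>q\<in>UNIV. partial_diff k (\<lambda>y. om l a q y * phi0 q b c) x + partial_diff k (\<lambda>y. om l b q y * phi0 a q c) x
       + partial_diff k (\<lambda>y. om l c q y * phi0 a b q) x)"
      by (intro sum.cong refl, subst pd_add[OF x], (intro smooth_rules smooth_om)+, subst pd_add[OF x], (intro smooth_rules smooth_om)+, rule refl)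
    finally show ?thesis unfolding c[OF smooth_om] ..
  qed
  have "(\<Sum>q\<in>UNIV. (\<Sum>p\<in>UNIV. om l a p x * om k p q x - om k a p x * om l p q x) * phi0 q b c
     + (\<Sum>p\<in>UNIV. om l b p x * om k p q x - om k b p x * om l p q x) * phi0 a q c
     + (\<Sum>p\<in>UNIV. om l c p x * om k p q x - om k c p x * om l p q x) * phi0 a b q) = 0"
    by (rule derivation_commutator) (rule om_derivation[OF x])+
  moreover have "(\<Sum>q\<in>UNIV. Om k l a q x * phi0 q b c + Om k l b q x * phi0 a q c + Om k l c q x * phi0 a b q)
    = (\<Sum>q\<in>UNIV. partial_diff k (om l a q) x * phi0 q b c + partial_diff k (om l b q) x * phi0 a q c
       + partial_diff k (om l c q) x * phi0 a b q)
    - (\<Sum>q\<in>UNIV. partial_diff l (om k a q) x * phi0 q b c + partial_diff l (om k b q) x * phi0 a q c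
       + partial_diff l (om k c q) x * phi0 a b q)
    + (\<Sum>q\<in>UNIV. (\<Sum>p\<in>UNIV. om l a p x * om k p q x - om k a p x * om l p q x) * phi0 q b c
     + (\<Sum>p\<in>UNIV. om l b p x * om k p q x - om k b p x * om l p q x) * phi0 a q c
     + (\<Sum>p\<in>UNIV. om l c p x * om k p q x - om k c p x * om l p q x) * phi0 a b q)"
    unfolding sum.distrib[symmetric] sum_subtractf[symmetric] Om_def by (intro sum.cong refl) (simp add: algebra_simps)
  ultimately show ?thesis unfolding d by simp
qed

lemma RF_kernel:
  assumes x: "x \<in> W"
  shows "(\<Sum>a\<in>UNIV. \<Sum>b\<in>UNIV. RF i j a b x * phi0 a b c) = 0"
proof -
  have "(\<Sum>a\<in>UNIV. \<Sum>b\<in>UNIV. Om k l a b x * phi0 a b c) = 0" for k l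
    by (rule g2_derivation_imp_kernel) (rule Om_skew[OF x], rule Om_derivation[OF x])
  moreover have "(\<Sum>a\<in>UNIV. \<Sum>b\<in>UNIV. RF i j a b x * phi0 a b c)
    = (\<Sum>k\<in>UNIV. \<Sum>l\<in>UNIV. (\<Sum>a\<in>UNIV. \<Sum>b\<in>UNIV. Om k l a b x * phi0 a b c) * (ev i k x * ev j l x))"
  proof -
    have "(\<Sum>a\<in>UNIV. \<Sum>b\<in>UNIV. RF i j a b x * phi0 a b c)
      = (\<Sum>a\<in>UNIV. \<Sum>b\<in>UNIV. \<Sum>k\<in>UNIV. \<Sum>l\<in>UNIV. Om k l a b x * phi0 a b c * (ev i k x * ev j l x))"
      unfolding RF_def fr2_triple sum_distrib_right by (simp add: mult_ac)
    also have "\<dots> = (\<Sum>k\<in>UNIV. \<Sum>a\<in>UNIV. \<Sum>b\<in>UNIV. \<Sum>l\<in>UNIV. Om k l a b x * phi0 a b c * (ev i k x * ev j l x))"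
      by (rule sum3_rot[symmetric])
    also have "\<dots> = (\<Sum>k\<in>UNIV. \<Sum>l\<in>UNIV. \<Sum>a\<in>UNIV. \<Sum>b\<in>UNIV. Om k l a b x * phi0 a b c * (ev i k x * ev j l x))"
      by (rule sum.cong[OF refl]) (rule sum3_rot[symmetric])
    finally show ?thesis unfolding sum_distrib_right .
  qed
  ultimately show ?thesis by simp
qed

lemma parallel_torsion_imp_instanton:
  assumes x: "x \<in> W" and p: "\<And>m i j k. cov3 T m i j k x = 0"
  shows "(\<Sum>a\<in>UNIV. \<Sum>b\<in>UNIV. RF a b i j x * phi0 a b k) = 0"
proof -
  have "NF m a b c x = 0" for m a b c unfolding NF_def fr3_def p by simp
  then have b: "RF m a b c x + RF m b c a x + RF m c a b x = 0" for m a b c using NF_eq[OF x] by metis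
  \<comment> \<open>Pair symmetry by the classical combination of four cyclic identities with
    skewness in both pairs; here the cycle runs over the last three indices.\<close>
  have "RF a b i j x = RF i j a b x" for a b i j
    using b[of a b i j] b[of b i j a] b[of i j a b] b[of j a b i]
      RF_swap34[OF x, of a i j b] RF_swap34[OF x, of b i j a] RF_swap34[OF x, of i j a b] RF_swap34[OF x, of j a b i]
      RF_swap12[of b a i j x] RF_swap12[of b i a j x] RF_swap12[of b j a i x] RF_swap12[of i a j b x] RF_swap12[of i a b j x]
      RF_swap12[of i j a b x] RF_swap12[of j a b i x] RF_swap12[of j b i a x] RF_swap12[of j b a i x] RF_swap12[of i b a j x] RF_swap12[of i b j a x]
      RF_swap34[OF x, of b j a i] RF_swap34[OF x, of a b i j] RF_swap34[OF x, of b a i j] RF_swap34[OF x, of i b a j]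
      RF_swap34[OF x, of i a j b] RF_swap34[OF x, of j i a b] RF_swap34[OF x, of a j b i] RF_swap34[OF x, of j b i a]
    by argo
  then show ?thesis using RF_kernel[OF x, of i j k] by simp
qed

end

section \<open>The elliptic equation for the norm of the torsion\<close>

context frame_chart begin

lemma fr3_eq_0_imp:
  assumes x: "x \<in> W" and z: "\<And>a b c. fr3 \<beta> a b c x = 0"
  shows "\<beta> i j k x = 0"
proof -
  have slot: "v i = 0" if "\<And>a. (\<Sum>i\<in>UNIV. v i * ev a i x) = 0" for v i
  proof -
    have "(\<Sum>a\<in>UNIV. E x $ a $ i * (\<Sum>j\<in>UNIV. v j * ev a j x)) = (\<Sum>j\<in>UNIV. v j * (\<Sum>a\<in>UNIV. ev a j x * E x $ a $ i))"
      unfolding sum_distrib_left by (subst sum.swap) (simp add: mult_ac)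
    then show ?thesis unfolding dual2[OF x] that by (simp add: if_distrib cong: if_cong)
  qed
  have "(\<Sum>j\<in>UNIV. (\<Sum>k\<in>UNIV. \<beta> i j k x * ev c k x) * ev b j x) = 0" for b c i
    using slot[of "\<lambda>i. \<Sum>j\<in>UNIV. (\<Sum>k\<in>UNIV. \<beta> i j k x * ev c k x) * ev b j x"] z unfolding fr3_def by blast
  then have "(\<Sum>k\<in>UNIV. \<beta> i j k x * ev c k x) = 0" for c i j
    using slot[of "\<lambda>j. \<Sum>k\<in>UNIV. \<beta> i j k x * ev c k x"] by blast
  then show ?thesis using slot[of "\<lambda>k. \<beta> i j k x"] by blast
qed

lemma ev_sum_eq_0_imp:
  assumes x: "x \<in> W" and z: "\<And>m. (\<Sum>s\<in>UNIV. ev m s x * v s) = 0"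
  shows "v s = 0"
proof -
  have "(\<Sum>a\<in>UNIV. E x $ a $ s * (\<Sum>j\<in>UNIV. ev a j x * v j)) = (\<Sum>j\<in>UNIV. v j * (\<Sum>a\<in>UNIV. ev a j x * E x $ a $ s))"
    unfolding sum_distrib_left by (subst sum.swap) (simp add: mult_ac)
  then show ?thesis unfolding dual2[OF x] z by (simp add: if_distrib cong: if_cong)
qed

lemma smooth_fd: "smooth_on W f \<Longrightarrow> smooth_on W (fd m f)"
  unfolding fd_def[abs_def] by (intro smooth_rules smooth_ev)

text \<open>Separates second-order and first-order terms as \<open>strong_maximum_principle\<close>
  requires.\<close>

lemma fd_fd:
  assumes x: "x \<in> W" and f: "smooth_on W f"
  shows "fd m (fd m f) x = (\<Sum>i\<in>UNIV. \<Sum>j\<in>UNIV. ev m i x * ev m j x * partial_diff j (partial_diff i f) x)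
    + (\<Sum>i\<in>UNIV. fd m (ev m i) x * partial_diff i f x)"
proof -
  have "partial_diff s (fd m f) x = (\<Sum>i\<in>UNIV. partial_diff s (\<lambda>y. ev m i y * partial_diff i f y) x)" for s
    unfolding fd_def[abs_def] by (rule pd_sum[OF x]) (intro smooth_rules smooth_ev f finite)+
  also have "\<dots> s = (\<Sum>i\<in>UNIV. partial_diff s (ev m i) x * partial_diff i f x + ev m i x * partial_diff s (partial_diff i f) x)" for s
    by (intro sum.cong refl pd_mult[OF x] smooth_ev smooth_rules f)
  finally have "fd m (fd m f) x = (\<Sum>s\<in>UNIV. \<Sum>i\<in>UNIV. ev m s x * (partial_diff s (ev m i) x * partial_diff i f x + ev m i x * partial_diff s (partial_diff i f) x))"
    unfolding fd_def[of m "fd m f"] by (simp add: sum_distrib_left)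
  also have "\<dots> = (\<Sum>i\<in>UNIV. \<Sum>s\<in>UNIV. ev m i x * ev m s x * partial_diff s (partial_diff i f) x + ev m s x * partial_diff s (ev m i) x * partial_diff i f x)"
    by (subst sum.swap) (simp add: algebra_simps)
  finally show ?thesis unfolding fd_def sum.distrib sum_distrib_right .
qed

lemma fd_sum:
  assumes x: "x \<in> W" and f: "\<And>i. i \<in> I \<Longrightarrow> smooth_on W (f i)" and I: "finite I"
  shows "fd m (\<lambda>y. \<Sum>i\<in>I. f i y) x = (\<Sum>i\<in>I. fd m (f i) x)"
proof -
  have "partial_diff s (\<lambda>y. \<Sum>i\<in>I. f i y) x = (\<Sum>i\<in>I. partial_diff s (f i) x)" for s by (rule pd_sum[OF x f I])
  then show ?thesis unfolding fd_def by (simp add: sum_distrib_left sum.swap[of _ UNIV])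
qed

lemma fd_mult:
  assumes x: "x \<in> W" and f: "smooth_on W f" "smooth_on W g"
  shows "fd m (\<lambda>y. f y * g y) x = fd m f x * g x + f x * fd m g x"
  unfolding fd_def pd_mult[OF x f] by (simp add: distrib_left sum.distrib sum_distrib_left sum_distrib_right mult_ac)

lemma fd_cmult:
  assumes x: "x \<in> W" and f: "smooth_on W f"
  shows "fd m (\<lambda>y. c * f y) x = c * fd m f x"
  using fd_mult[OF x smooth_on_const[of W c] f, of m] by (simp add: fd_def partial_diff_const)

lemma fd_cong: "x \<in> W \<Longrightarrow> (\<And>y. y \<in> W \<Longrightarrow> f y = g y) \<Longrightarrow> fd m f x = fd m g x"
  unfolding fd_def using partial_diff_cong[OF W] by metis

end

context torsion_chart begin

definition tau :: "real^'n \<Rightarrow> real" where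
  "tau x = (\<Sum>a\<in>UNIV. \<Sum>b\<in>UNIV. \<Sum>c\<in>UNIV. TF a b c x * TF a b c x)"

text \<open>The contraction R_mnkl T_nkl, a sixth of the derivative of |T|^2 along e_m.\<close>

definition YF :: "'n \<Rightarrow> real^'n \<Rightarrow> real" where
  "YF m x = (\<Sum>n\<in>UNIV. XF m n n x)"

lemma smooth_tau: "smooth_on W tau"
  unfolding tau_def[abs_def] by (intro smooth_rules smooth_TF)

lemma smooth_YF: "smooth_on W (YF m)"
  unfolding YF_def[abs_def] by (intro smooth_rules smooth_XF)

text \<open>The rotations by the skew matrices \<open>omh\<close> drop out of the derivative of the
  square. As T is cyclic, each of the three curvature terms of \<open>NF\<close> contributes
  \<open>YF\<close>; with the 2 from the square this makes 6.\<close>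

lemma fd_tau:
  assumes x: "x \<in> W"
  shows "fd m tau x = 6 * YF m x"
proof -
  let ?S = "\<lambda>F. \<Sum>a\<in>UNIV. \<Sum>b\<in>UNIV. \<Sum>c\<in>(UNIV::'n set). (F a b c :: real)"
  let ?K = "\<lambda>a b c. (\<Sum>p\<in>UNIV. omh m a p x * TF p b c x) * TF a b c x"
  have rot: "?S (\<lambda>a b c. F b c a) = ?S F" for F by (rule sum3_rot)
  have K0: "?S ?K = 0"
  proof -
    define w where "w a p = (\<Sum>b\<in>UNIV. \<Sum>c\<in>UNIV. TF p b c x * TF a b c x)" for a p
    have "?S ?K = (\<Sum>a\<in>UNIV. \<Sum>p\<in>UNIV. \<Sum>b\<in>UNIV. \<Sum>c\<in>UNIV. omh m a p x * (TF p b c x * TF a b c x))"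
    proof (rule sum.cong[OF refl])
      fix a
      show "(\<Sum>b\<in>UNIV. \<Sum>c\<in>UNIV. ?K a b c) = (\<Sum>p\<in>UNIV. \<Sum>b\<in>UNIV. \<Sum>c\<in>UNIV. omh m a p x * (TF p b c x * TF a b c x))"
        unfolding sum_distrib_right mult.assoc by (rule sum3_rot[symmetric])
    qed
    then have e: "?S ?K = (\<Sum>a\<in>UNIV. \<Sum>p\<in>UNIV. omh m a p x * w a p)" unfolding w_def sum_distrib_left .
    also have "\<dots> = (\<Sum>a\<in>UNIV. \<Sum>p\<in>UNIV. omh m p a x * w p a)" by (rule sum.swap)
    also have "\<dots> = - (\<Sum>a\<in>UNIV. \<Sum>p\<in>UNIV. omh m a p x * w a p)"
      unfolding sum_negf[symmetric]
    proof (intro sum.cong refl)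
      fix a p show "omh m p a x * w p a = - (omh m a p x * w a p)"
        using omh_skew[OF x, of m p a] by (simp add: w_def mult.commute)
    qed
    finally show ?thesis using e by linarith
  qed
  have K2: "?S (\<lambda>a b c. (\<Sum>p\<in>UNIV. omh m b p x * TF a p c x) * TF a b c x) = ?S ?K"
  proof -
    have "(\<Sum>p\<in>UNIV. omh m b p x * TF a p c x) * TF a b c x = ?K b c a" for a b c
      by (simp only: TF_cyc[OF x, of _ c a])
    then show ?thesis using rot[of ?K] by simp
  qed
  have K3: "?S (\<lambda>a b c. (\<Sum>p\<in>UNIV. omh m c p x * TF a b p x) * TF a b c x) = ?S ?K"
  proof -
    have "(\<Sum>p\<in>UNIV. omh m c p x * TF a b p x) * TF a b c x = ?K c a b" for a b c
      by (simp only: TF_cyc[OF x, of a b])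
    then show ?thesis using rot[of "\<lambda>a b c. ?K c a b"] by simp
  qed
  have R: "?S (\<lambda>a b c. RF m a b c x * TF a b c x) = YF m x"
    unfolding YF_def XF_eq ..
  have R2: "?S (\<lambda>a b c. RF m b c a x * TF a b c x) = YF m x"
    using rot[of "\<lambda>a b c. RF m a b c x * TF a b c x"] unfolding TF_cyc[OF x] R .
  have R3: "?S (\<lambda>a b c. RF m c a b x * TF a b c x) = YF m x"
    using rot[of "\<lambda>a b c. RF m c a b x * TF a b c x"] unfolding TF_cyc[OF x] R by simp
  have "fd m tau x = ?S (\<lambda>a b c. fd m (\<lambda>y. TF a b c y * TF a b c y) x)"
    unfolding tau_def[abs_def]
    by (subst fd_sum[OF x], (intro smooth_rules smooth_TF finite)+, rule sum.cong[OF refl],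
        subst fd_sum[OF x], (intro smooth_rules smooth_TF finite)+, rule sum.cong[OF refl],
        subst fd_sum[OF x], (intro smooth_rules smooth_TF finite)+, rule refl)
  also have "\<dots> = ?S (\<lambda>a b c. 2 * (fd m (TF a b c) x * TF a b c x))"
    by (intro sum.cong refl, subst fd_mult[OF x smooth_TF smooth_TF]) simp
  also have "\<dots> = 2 * ?S (\<lambda>a b c. fd m (TF a b c) x * TF a b c x)"
    unfolding sum_distrib_left ..
  also have "?S (\<lambda>a b c. fd m (TF a b c) x * TF a b c x) = 3 * YF m x"
    unfolding fd_TF[OF x] NF_eq[OF x] distrib_right sum.distrib K2 K3 K0 R R2 R3 by simp
  finally show ?thesis by simp
qed

end

context g2_chart begin

text \<open>\<open>NF\<close> is the cyclic sum of \<open>RF\<close> over the last three indices and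
  is itself cyclic, so its pairings with the three summands are equal.\<close>

lemma NF_square:
  assumes x: "x \<in> W"
  shows "3 * (\<Sum>m\<in>UNIV. \<Sum>a\<in>UNIV. \<Sum>b\<in>UNIV. \<Sum>c\<in>UNIV. NF m a b c x * RF m a b c x)
    = (\<Sum>m\<in>UNIV. \<Sum>a\<in>UNIV. \<Sum>b\<in>UNIV. \<Sum>c\<in>UNIV. NF m a b c x * NF m a b c x)"
proof -
  have "3 * (\<Sum>a\<in>UNIV. \<Sum>b\<in>UNIV. \<Sum>c\<in>UNIV. NF m a b c x * RF m a b c x) = (\<Sum>a\<in>UNIV. \<Sum>b\<in>UNIV. \<Sum>c\<in>UNIV. NF m a b c x * NF m a b c x)" for m
  proof -
    let ?S = "\<lambda>F. \<Sum>a\<in>UNIV. \<Sum>b\<in>UNIV. \<Sum>c\<in>(UNIV::7 set). (F a b c :: real)"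
    have rot: "?S (\<lambda>a b c. F b c a) = ?S F" for F by (rule sum3_rot)
    have cyc: "NF m b c a x = NF m a b c x" for a b c unfolding NF_eq[OF x] by simp
    have 2: "?S (\<lambda>a b c. NF m a b c x * RF m b c a x) = ?S (\<lambda>a b c. NF m a b c x * RF m a b c x)"
      using rot[of "\<lambda>a b c. NF m a b c x * RF m a b c x"] unfolding cyc .
    have 3: "?S (\<lambda>a b c. NF m a b c x * RF m c a b x) = ?S (\<lambda>a b c. NF m a b c x * RF m a b c x)"
      using rot[of "\<lambda>a b c. NF m a b c x * RF m c a b x"] unfolding cyc by simp
    have "?S (\<lambda>a b c. NF m a b c x * NF m a b c x) = ?S (\<lambda>a b c. NF m a b c x * RF m a b c x)
      + ?S (\<lambda>a b c. NF m a b c x * RF m b c a x) + ?S (\<lambda>a b c. NF m a b c x * RF m c a b x)"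
      unfolding sum.distrib[symmetric] distrib_left[symmetric] NF_eq[OF x, symmetric] ..
    then show ?thesis unfolding 2 3 by simp
  qed
  then show ?thesis unfolding sum_distrib_left[of 3] by simp
qed

text \<open>The coefficients of the first-order term of the elliptic equation for \<open>\<bar>T\<bar>\<^sup>2\<close>; only their
  continuity matters.\<close>

definition drift :: "7 \<Rightarrow> real^7 \<Rightarrow> real" where
  "drift q x = (\<Sum>m\<in>UNIV. omh m m q x) + (\<Sum>m\<in>UNIV. \<Sum>i\<in>UNIV. \<Sum>p\<in>UNIV. TF m i p x * psi0 m i p q) / 6"

context
  assumes inst: "\<And>x i j k. x \<in> W \<Longrightarrow> (\<Sum>a\<in>UNIV. \<Sum>b\<in>UNIV. RF a b i j x * phi0 a b k) = 0"
begin

lemma XF_kernel: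
  assumes x: "x \<in> W"
  shows "(\<Sum>a\<in>UNIV. \<Sum>b\<in>UNIV. XF a b n x * phi0 a b k) = 0"
proof -
  have "(\<Sum>a\<in>UNIV. \<Sum>b\<in>UNIV. XF a b n x * phi0 a b k)
    = (\<Sum>a\<in>UNIV. \<Sum>b\<in>UNIV. \<Sum>i\<in>UNIV. \<Sum>j\<in>UNIV. RF a b i j x * phi0 a b k * TF n i j x)"
    unfolding XF_eq sum_distrib_right by (simp add: mult_ac)
  also have "\<dots> = (\<Sum>i\<in>UNIV. \<Sum>a\<in>UNIV. \<Sum>b\<in>UNIV. \<Sum>j\<in>UNIV. RF a b i j x * phi0 a b k * TF n i j x)"
    by (rule sum3_rot[symmetric])
  also have "\<dots> = (\<Sum>i\<in>UNIV. \<Sum>j\<in>UNIV. \<Sum>a\<in>UNIV. \<Sum>b\<in>UNIV. RF a b i j x * phi0 a b k * TF n i j x)"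
    by (rule sum.cong[OF refl]) (rule sum3_rot[symmetric])
  finally show ?thesis unfolding sum_distrib_right[symmetric] inst[OF x] by simp
qed

text \<open>The first pair of X lies in g2 by the instanton condition, and there the contraction
  with the 4-form is multiplication by -2 up to the order of the indices. This turns the cyclic sum
  into a divergence.\<close>

lemma psi0_XF:
  assumes x: "x \<in> W"
  shows "(\<Sum>i\<in>UNIV. \<Sum>j\<in>UNIV. psi0 m i j n * XF i j n' x) = - 2 * XF m n n' x"
proof -
  have "(\<Sum>i\<in>UNIV. \<Sum>j\<in>UNIV. psi0 m i j n * XF i j n' x) = - (\<Sum>i\<in>UNIV. \<Sum>j\<in>UNIV. XF i j n' x * psi0 i j n m)"
    unfolding sum_negf[symmetric] by (intro sum.cong refl, subst psi0_front_last) simp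
  also have "\<dots> = 2 * XF n m n' x"
    by (subst g2_psi0_contract, rule XF_swap, rule XF_kernel[OF x], simp)
  also have "\<dots> = - 2 * XF m n n' x" using XF_swap[of n m n' x] by simp
  finally show ?thesis .
qed

lemma psi0_RF:
  assumes x: "x \<in> W"
  shows "(\<Sum>i\<in>UNIV. \<Sum>j\<in>UNIV. psi0 m i j n * RF i j k l x) = - 2 * RF m n k l x"
proof -
  have "(\<Sum>i\<in>UNIV. \<Sum>j\<in>UNIV. psi0 m i j n * RF i j k l x) = - (\<Sum>i\<in>UNIV. \<Sum>j\<in>UNIV. RF i j k l x * psi0 i j n m)"
    unfolding sum_negf[symmetric] by (intro sum.cong refl, subst psi0_front_last) simp
  also have "\<dots> = 2 * RF n m k l x"
    by (subst g2_psi0_contract, rule RF_swap12, rule inst[OF x], simp)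
  also have "\<dots> = - 2 * RF m n k l x" using RF_swap12[of n m k l x] by simp
  finally show ?thesis .
qed

text \<open>\<open>psi0\<close> is constant in the frame and moves under the derivative in
  \<open>contracted_bianchi_divergence\<close>: G contributes -2 times the divergence of Y and 2
  times the pairing of \<open>NF\<close> with \<open>RF\<close>. The remaining terms are linear in Y
  with coefficients \<open>drift\<close>.\<close>

lemma divergence_YF:
  assumes x: "x \<in> W"
  shows "(\<Sum>m\<in>UNIV. fd m (YF m) x)
    = (\<Sum>m\<in>UNIV. \<Sum>a\<in>UNIV. \<Sum>b\<in>UNIV. \<Sum>c\<in>UNIV. NF m a b c x * NF m a b c x) / 3 + (\<Sum>q\<in>UNIV. drift q x * YF q x)"
proof -
  let ?N = "\<Sum>m\<in>UNIV. \<Sum>a\<in>UNIV. \<Sum>b\<in>UNIV. \<Sum>c\<in>UNIV. NF m a b c x * RF m a b c x"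
  have 0: "3 * (\<Sum>m\<in>UNIV. \<Sum>i\<in>UNIV. \<Sum>j\<in>UNIV. \<Sum>n\<in>UNIV. psi0 m i j n * (fd m (XF i j n) x - MF m i j n x))
    = - (\<Sum>q\<in>UNIV. (6 * (\<Sum>m\<in>UNIV. omh m m q x) + (\<Sum>m\<in>UNIV. \<Sum>i\<in>UNIV. \<Sum>p\<in>UNIV. TF m i p x * psi0 m i p q))
        * (\<Sum>n\<in>UNIV. XF q n n x))"
    by (rule contracted_bianchi_divergence[where X = "\<lambda>i j n. XF i j n x" and om = "\<lambda>m i j. omh m i j x"
        and T = "\<lambda>i j k. TF i j k x" and G = "\<lambda>m i j n. fd m (XF i j n) x - MF m i j n x"
        and F = "\<lambda>m i j n. fd m (XF i j n) x - MF m i j n x - (\<Sum>p\<in>UNIV. omh m n p x * XF i j p x)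
          - (\<Sum>q\<in>UNIV. (omh m i q x - omh i m q x - TF m i q x) * XF q j n x)"])
      (rule omh_skew[OF x] omh_derivation[OF x] XF_swap XF_kernel[OF x] TF_cyc[OF x] TF_swap12
        contracted_second_bianchi[OF x] refl)+
  have s: "(\<Sum>i\<in>UNIV. \<Sum>j\<in>UNIV. \<Sum>n\<in>UNIV. F i j n) = (\<Sum>n\<in>UNIV. \<Sum>i\<in>UNIV. \<Sum>j\<in>UNIV. F i j n)" for F :: "7 \<Rightarrow> 7 \<Rightarrow> 7 \<Rightarrow> real"
    by (rule sum3_rot[symmetric])
  have 1: "(\<Sum>i\<in>UNIV. \<Sum>j\<in>UNIV. \<Sum>n\<in>UNIV. psi0 m i j n * fd m (XF i j n) x) = - 2 * fd m (YF m) x" for m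
  proof -
    have "(\<Sum>i\<in>UNIV. \<Sum>j\<in>UNIV. psi0 m i j n * fd m (XF i j n) x) = - 2 * fd m (XF m n n) x" for n
    proof -
      have "(\<Sum>i\<in>UNIV. \<Sum>j\<in>UNIV. psi0 m i j n * fd m (XF i j n) x) = fd m (\<lambda>y. \<Sum>i\<in>UNIV. \<Sum>j\<in>UNIV. psi0 m i j n * XF i j n y) x"
        by (subst fd_sum[OF x], (intro smooth_rules smooth_XF finite)+, rule sum.cong[OF refl],
            subst fd_sum[OF x], (intro smooth_rules smooth_XF finite)+, rule sum.cong[OF refl], rule fd_cmult[OF x smooth_XF, symmetric])
      also have "\<dots> = fd m (\<lambda>y. - 2 * XF m n n y) x" by (rule fd_cong[OF x]) (rule psi0_XF)
      also have "\<dots> = - 2 * fd m (XF m n n) x" by (rule fd_cmult[OF x smooth_XF])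
      finally show ?thesis .
    qed
    then have "(\<Sum>i\<in>UNIV. \<Sum>j\<in>UNIV. \<Sum>n\<in>UNIV. psi0 m i j n * fd m (XF i j n) x) = (\<Sum>n\<in>UNIV. - 2 * fd m (XF m n n) x)"
      by (subst s) simp
    also have "\<dots> = - 2 * fd m (YF m) x"
      unfolding YF_def[abs_def] sum_distrib_left[symmetric] by (subst fd_sum[OF x]) (intro smooth_XF finite refl)+
    finally show ?thesis .
  qed
  have 2: "(\<Sum>i\<in>UNIV. \<Sum>j\<in>UNIV. \<Sum>n\<in>UNIV. psi0 m i j n * MF m i j n x)
    = - 2 * (\<Sum>a\<in>UNIV. \<Sum>b\<in>UNIV. \<Sum>c\<in>UNIV. NF m a b c x * RF m a b c x)" for m
  proof -
    have "(\<Sum>i\<in>UNIV. \<Sum>j\<in>UNIV. psi0 m i j n * MF m i j n x) = - 2 * (\<Sum>k\<in>UNIV. \<Sum>l\<in>UNIV. NF m n k l x * RF m n k l x)" for n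
    proof -
      have "(\<Sum>i\<in>UNIV. \<Sum>j\<in>UNIV. psi0 m i j n * MF m i j n x)
        = (\<Sum>i\<in>UNIV. \<Sum>j\<in>UNIV. \<Sum>k\<in>UNIV. \<Sum>l\<in>UNIV. NF m n k l x * (psi0 m i j n * RF i j k l x))"
        unfolding MF_def sum_distrib_left by (simp add: mult_ac)
      also have "\<dots> = (\<Sum>k\<in>UNIV. \<Sum>i\<in>UNIV. \<Sum>j\<in>UNIV. \<Sum>l\<in>UNIV. NF m n k l x * (psi0 m i j n * RF i j k l x))"
        by (rule sum3_rot[symmetric])
      also have "\<dots> = (\<Sum>k\<in>UNIV. \<Sum>l\<in>UNIV. \<Sum>i\<in>UNIV. \<Sum>j\<in>UNIV. NF m n k l x * (psi0 m i j n * RF i j k l x))"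
        by (rule sum.cong[OF refl]) (rule sum3_rot[symmetric])
      finally show ?thesis unfolding sum_distrib_left[symmetric] psi0_RF[OF x]
        by (simp add: sum_distrib_left mult_ac)
    qed
    then show ?thesis by (subst s) (simp add: sum_distrib_left)
  qed
  have "(\<Sum>m\<in>UNIV. \<Sum>i\<in>UNIV. \<Sum>j\<in>UNIV. \<Sum>n\<in>UNIV. psi0 m i j n * (fd m (XF i j n) x - MF m i j n x))
    = - 2 * (\<Sum>m\<in>UNIV. fd m (YF m) x) + 2 * ?N"
    unfolding right_diff_distrib sum_subtractf 1 2 by (simp add: sum_distrib_left sum_negf)
  moreover have "(\<Sum>q\<in>UNIV. (6 * (\<Sum>m\<in>UNIV. omh m m q x) + (\<Sum>m\<in>UNIV. \<Sum>i\<in>UNIV. \<Sum>p\<in>UNIV. TF m i p x * psi0 m i p q))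
        * (\<Sum>n\<in>UNIV. XF q n n x)) = 6 * (\<Sum>q\<in>UNIV. drift q x * YF q x)"
  proof -
    have "6 * drift q x = 6 * (\<Sum>m\<in>UNIV. omh m m q x) + (\<Sum>m\<in>UNIV. \<Sum>i\<in>UNIV. \<Sum>p\<in>UNIV. TF m i p x * psi0 m i p q)" for q
      unfolding drift_def by simp
    then show ?thesis unfolding sum_distrib_left[of 6] YF_def mult.assoc[symmetric] by simp
  qed
  ultimately show ?thesis using 0 NF_square[OF x] by linarith
qed

text \<open>Sum over m of e_m e_m |T|^2 = 6 e_m Y_m, with \<open>divergence_YF\<close> inserted.
  There 6 Y is again the gradient of |T|^2, so the terms with \<open>drift\<close> become
  first-order terms in |T|^2.\<close>

lemma bochner:
  assumes x: "x \<in> W"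
  shows "(\<Sum>a\<in>UNIV. \<Sum>i\<in>UNIV. \<Sum>j\<in>UNIV. ev a i x * ev a j x * partial_diff j (partial_diff i tau) x)
    + (\<Sum>i\<in>UNIV. ((\<Sum>a\<in>UNIV. fd a (ev a i) x) - (\<Sum>q\<in>UNIV. drift q x * ev q i x)) * partial_diff i tau x)
    = 2 * (\<Sum>m\<in>UNIV. \<Sum>a\<in>UNIV. \<Sum>b\<in>UNIV. \<Sum>c\<in>UNIV. NF m a b c x * NF m a b c x)"
proof -
  have "(\<Sum>m\<in>UNIV. fd m (fd m tau) x) = 6 * (\<Sum>m\<in>UNIV. fd m (YF m) x)"
  proof -
    have "fd m (fd m tau) x = fd m (\<lambda>y. 6 * YF m y) x" for m by (rule fd_cong[OF x]) (rule fd_tau)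
    then show ?thesis unfolding fd_cmult[OF x smooth_YF] by (simp add: sum_distrib_left)
  qed
  also have "\<dots> = 2 * (\<Sum>m\<in>UNIV. \<Sum>a\<in>UNIV. \<Sum>b\<in>UNIV. \<Sum>c\<in>UNIV. NF m a b c x * NF m a b c x) + (\<Sum>q\<in>UNIV. drift q x * fd q tau x)"
    unfolding divergence_YF[OF x] fd_tau[OF x] by (simp add: sum_distrib_left mult_ac)
  finally have 1: "(\<Sum>m\<in>UNIV. fd m (fd m tau) x) = \<dots>" .
  have 2: "(\<Sum>i\<in>UNIV. (\<Sum>a\<in>UNIV. fd a (ev a i) x) * partial_diff i tau x) = (\<Sum>a\<in>UNIV. \<Sum>i\<in>UNIV. fd a (ev a i) x * partial_diff i tau x)"
    unfolding sum_distrib_right by (rule sum.swap)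
  have 3: "(\<Sum>i\<in>UNIV. (\<Sum>q\<in>UNIV. drift q x * ev q i x) * partial_diff i tau x) = (\<Sum>q\<in>UNIV. drift q x * fd q tau x)"
    unfolding fd_def sum_distrib_right sum_distrib_left by (subst sum.swap) (simp add: mult.assoc)
  show ?thesis using 1 unfolding fd_fd[OF x smooth_tau] left_diff_distrib sum_subtractf sum.distrib 2 3 by simp
qed

lemma tau_local_max:
  assumes V: "open V" "V \<subseteq> W" and x0: "x0 \<in> V" and max: "\<And>y. y \<in> V \<Longrightarrow> tau y \<le> tau x0"
  shows "\<exists>d>0. \<forall>y\<in>ball x0 d. tau y = tau x0"
proof (rule strong_maximum_principle[where W = V and e = "\<lambda>x a. \<chi> i. ev a i x"
      and b = "\<lambda>x. \<chi> i. (\<Sum>a\<in>UNIV. fd a (ev a i) x) - (\<Sum>q\<in>UNIV. drift q x * ev q i x)"])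
  show "open V" "x0 \<in> V" by fact+
  show "smooth_on V tau" by (rule smooth_on_subset[OF smooth_tau V(2)])
  show "tau y \<le> tau x0" if "y \<in> V" for y using that by (rule max)
  show "continuous_on V (\<lambda>x. (\<chi> i. ev a i x) $ i)" for a i
    using continuous_on_subset[OF smooth_on_continuous_on[OF smooth_ev] V(2)] by simp
  have "smooth_on W (\<lambda>x. (\<Sum>a\<in>UNIV. fd a (ev a i) x) - (\<Sum>q\<in>UNIV. drift q x * ev q i x))" for i
    unfolding drift_def[abs_def] omh_def divide_inverse
    by (intro smooth_rules smooth_fd smooth_ev smooth_om smooth_TF)
  then show "continuous_on V (\<lambda>x. (\<chi> i. (\<Sum>a\<in>UNIV. fd a (ev a i) x) - (\<Sum>q\<in>UNIV. drift q x * ev q i x)) $ i)" for i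
    using continuous_on_subset[OF smooth_on_continuous_on V(2)] by simp
  show "w = 0" if x: "x \<in> V" and z: "\<And>a. (\<Sum>i\<in>UNIV. (\<chi> i. ev a i x) $ i * w $ i) = 0" for x w
    using ev_sum_eq_0_imp[of x "\<lambda>i. w $ i"] x z V(2) by (auto simp: vec_eq_iff)
  show "0 \<le> (\<Sum>a\<in>UNIV. \<Sum>i\<in>UNIV. \<Sum>j\<in>UNIV. (\<chi> i. ev a i x) $ i * (\<chi> i. ev a i x) $ j * partial_diff j (partial_diff i tau) x)
      + (\<Sum>i\<in>UNIV. (\<chi> i. (\<Sum>a\<in>UNIV. fd a (ev a i) x) - (\<Sum>q\<in>UNIV. drift q x * ev q i x)) $ i * partial_diff i tau x)"
    if x: "x \<in> V" for x
  proof -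
    have "x \<in> W" using x V(2) by blast
    then show ?thesis using bochner[of x] by (simp add: sum_nonneg)
  qed
qed

text \<open>The derivatives of |T|^2 vanish on V, and the Bochner identity leaves a vanishing sum of
  squares of the components of \<nabla>T.\<close>

lemma tau_locally_constant_imp_parallel:
  assumes V: "open V" "V \<subseteq> W" and x: "x \<in> V" and const: "\<And>y. y \<in> V \<Longrightarrow> tau y = tau x"
  shows "cov3 T m i j k x = 0"
proof -
  have xW: "x \<in> W" using V x by blast
  have p0: "partial_diff i tau y = 0" if "y \<in> V" for i y
    using partial_diff_cong[OF V(1) that, of tau "\<lambda>_. tau x" i] const by (simp add: partial_diff_const)
  have "partial_diff j (partial_diff i tau) x = 0" for i j
    using partial_diff_cong[OF V(1) x, of "partial_diff i tau" "\<lambda>_. 0" j] p0 by (simp add: partial_diff_const)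
  then have "(\<Sum>m\<in>UNIV. \<Sum>a\<in>UNIV. \<Sum>b\<in>UNIV. \<Sum>c\<in>UNIV. NF m a b c x * NF m a b c x) = 0"
    using bochner[OF xW] p0[OF x] by simp
  then have N: "NF m a b c x = 0" for m a b c
    by (simp add: sum_nonneg_eq_0_iff sum_nonneg)
  have "fr3 (cov3 T s) a b c x = 0" for s a b c
    using ev_sum_eq_0_imp[OF xW, of "\<lambda>s. fr3 (cov3 T s) a b c x"] N unfolding NF_def by blast
  then show ?thesis by (rule fr3_eq_0_imp[OF xW])
qed

end

end

section \<open>The invariantly defined tensors in a chart\<close>

lemma cov_deriv_const: "cov_deriv C (\<lambda>_. u) (\<lambda>_. v) x $ k = (\<Sum>i\<in>UNIV. \<Sum>j\<in>UNIV. C x i j k * u $ i * v $ j)"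
  by (simp add: cov_deriv_def partial_diff_const)

lemma lie_bracket_const: "lie_bracket (\<lambda>_. u) (\<lambda>_. v) = (\<lambda>_. 0)"
  by (simp add: lie_bracket_def partial_diff_const fun_eq_iff vec_eq_iff)

lemma torsion3_axis:
  "torsion3 g C (\<lambda>_. axis i 1) (\<lambda>_. axis j 1) (\<lambda>_. axis k 1) x = (\<Sum>p\<in>UNIV. (C x i j p - C x j i p) * g x $ p $ k)"
proof -
  have "(cov_deriv C (\<lambda>_. axis i 1) (\<lambda>_. axis j 1) x) $ p = C x i j p" for i j p
  proof -
    have "(\<Sum>b\<in>UNIV. C x a b p * axis i 1 $ a * axis j 1 $ b) = (if a = i then C x i j p else 0)" for a
    proof -
      have "C x a b p * axis i 1 $ a * axis j 1 $ b = (if b = j then if a = i then C x i j p else 0 else 0)" for b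
        by (simp add: axis_def)
      then show ?thesis by simp
    qed
    then show ?thesis unfolding cov_deriv_const by simp
  qed
  then show ?thesis
    by (simp add: torsion3_def lie_bracket_const inner_vec_def matrix_vector_mult_basis column_def)
qed

lemma torsion_tensor_eq:
  "torsion_tensor \<phi> \<Gamma> \<kappa> x [i, j, k] = (\<Sum>p\<in>UNIV. (\<Gamma> \<kappa> x i j p - \<Gamma> \<kappa> x j i p) * metric_field (\<phi> \<kappa>) x $ p $ k)"
  unfolding torsion_tensor_def by (simp add: torsion3_axis)

lemma length_3_conv: "length J = 3 \<longleftrightarrow> (\<exists>i j k. J = [i, j, k])"
  by (auto simp: numeral_3_eq_3 length_Suc_conv)

lemma lists_3_sum: "(\<Sum>I | length I = 3. f I) = (\<Sum>i\<in>UNIV. \<Sum>j\<in>UNIV. \<Sum>k\<in>UNIV. f [i, j, k :: 'n::finite] :: real)"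
proof -
  have "(\<Sum>I | length I = 3. f I) = (\<Sum>(i, j, k)\<in>UNIV. f [i, j, k :: 'n])"
    by (rule sum.reindex_bij_witness[where j = "\<lambda>I. (I ! 0, I ! 1, I ! 2)" and i = "\<lambda>(i, j, k). [i, j, k]"])
       (auto simp: length_3_conv)
  also have "\<dots> = (\<Sum>i\<in>UNIV. \<Sum>j\<in>UNIV. \<Sum>k\<in>UNIV. f [i, j, k])"
    by (simp add: sum.cartesian_product UNIV_Times_UNIV[symmetric] del: UNIV_Times_UNIV)
  finally show ?thesis .
qed

lemma tensor_eval_3:
  "tensor_eval 3 a [u, v, w] = (\<Sum>i\<in>UNIV. \<Sum>j\<in>UNIV. \<Sum>k\<in>UNIV. a [i, j, k] * (u $ i * v $ j * w $ k))"
  unfolding tensor_eval_def lists_3_sum by (simp add: numeral_3_eq_3)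

lemma cov_deriv_tensor_2:
  "cov_deriv_tensor C \<alpha> x m [i, j] = partial_diff m (\<lambda>y. \<alpha> y [i, j]) x
     - (\<Sum>l\<in>UNIV. C x m i l * \<alpha> x [l, j]) - (\<Sum>l\<in>UNIV. C x m j l * \<alpha> x [i, l])"
  by (simp add: cov_deriv_tensor_def)

lemma cov_deriv_tensor_3:
  "cov_deriv_tensor C \<alpha> x m [i, j, k] = partial_diff m (\<lambda>y. \<alpha> y [i, j, k]) x - (\<Sum>l\<in>UNIV. C x m i l * \<alpha> x [l, j, k])
     - (\<Sum>l\<in>UNIV. C x m j l * \<alpha> x [i, l, k]) - (\<Sum>l\<in>UNIV. C x m k l * \<alpha> x [i, j, l])"
  by (simp add: cov_deriv_tensor_def numeral_2_eq_2)

lemma ext_d_3: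
  "ext_d \<alpha> x [i, j, k, l] = partial_diff i (\<lambda>y. \<alpha> y [j, k, l]) x - partial_diff j (\<lambda>y. \<alpha> y [i, k, l]) x
     + partial_diff k (\<lambda>y. \<alpha> y [i, j, l]) x - partial_diff l (\<lambda>y. \<alpha> y [i, j, k]) x"
  by (simp add: ext_d_def eval_nat_numeral)

lemma alternating_swap23:
  assumes "alternating 3 a" shows "a [i, k, j] = - a [i, j, k]"
proof -
  let ?s = "Transposition.transpose (1::nat) 2"
  have p: "?s permutes {..<3}" by (rule permutes_swap_id) auto
  have "a (permute_list ?s [i, j, k]) = of_int (sign ?s) * a [i, j, k]"
    using assms p unfolding alternating_def by auto
  moreover have "permute_list ?s [i, j, k] = [i, k, j]"
    by (simp add: permute_list_def upt_rec Transposition.transpose_def)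
  ultimately show ?thesis by (simp add: sign_swap_id)
qed

context frame_chart begin

text \<open>Constant fields commute, so the last term of the curvature is a derivative along the
  zero field.\<close>

lemma curvature_const:
  assumes x: "x \<in> W"
  shows "curvature C (\<lambda>_. u) (\<lambda>_. v) (\<lambda>_. w) x $ q = (\<Sum>k\<in>UNIV. \<Sum>l\<in>UNIV. \<Sum>i\<in>UNIV. Cv k l i q x * (u $ k * v $ l * w $ i))"
proof -
  define H where "H u v = (\<Sum>k\<in>UNIV. \<Sum>l\<in>UNIV. \<Sum>i\<in>UNIV.
     (partial_diff k (\<lambda>y. C y l i q) x + (\<Sum>p\<in>UNIV. C x k p q * C x l i p)) * (u $ k * v $ l * w $ i))" for u v :: "real^'n"
  have c: "cov_deriv C (\<lambda>_. u) (cov_deriv C (\<lambda>_. v) (\<lambda>_. w)) x $ q = H u v" for u v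
  proof -
    have "partial_diff k (\<lambda>y. cov_deriv C (\<lambda>_. v) (\<lambda>_. w) y $ q) x = (\<Sum>l\<in>UNIV. \<Sum>i\<in>UNIV. partial_diff k (\<lambda>y. C y l i q) x * (v $ l * w $ i))" for k
    proof -
      have "partial_diff k (\<lambda>y. cov_deriv C (\<lambda>_. v) (\<lambda>_. w) y $ q) x = (\<Sum>l\<in>UNIV. \<Sum>i\<in>UNIV. partial_diff k (\<lambda>y. C y l i q * (v $ l * w $ i)) x)"
        unfolding cov_deriv_const mult.assoc
        by (subst pd_sum[OF x], (intro smooth_rules C finite)+, rule sum.cong[OF refl], rule pd_sum[OF x])
           (intro smooth_rules C finite)+
      also have "\<dots> = (\<Sum>l\<in>UNIV. \<Sum>i\<in>UNIV. partial_diff k (\<lambda>y. C y l i q) x * (v $ l * w $ i))"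
        by (intro sum.cong refl, subst pd_mult[OF x C smooth_on_const]) (simp add: partial_diff_const)
      finally show ?thesis .
    qed
    then have "cov_deriv C (\<lambda>_. u) (cov_deriv C (\<lambda>_. v) (\<lambda>_. w)) x $ q
      = (\<Sum>k\<in>UNIV. u $ k * (\<Sum>l\<in>UNIV. \<Sum>i\<in>UNIV. partial_diff k (\<lambda>y. C y l i q) x * (v $ l * w $ i)))
       + (\<Sum>k\<in>UNIV. \<Sum>p\<in>UNIV. C x k p q * u $ k * (\<Sum>l\<in>UNIV. \<Sum>i\<in>UNIV. C x l i p * v $ l * w $ i))"
      by (simp add: cov_deriv_def[of C "\<lambda>_. u"] cov_deriv_const)
    also have "(\<Sum>k\<in>UNIV. \<Sum>p\<in>UNIV. C x k p q * u $ k * (\<Sum>l\<in>UNIV. \<Sum>i\<in>UNIV. C x l i p * v $ l * w $ i))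
      = (\<Sum>k\<in>UNIV. \<Sum>l\<in>UNIV. \<Sum>i\<in>UNIV. \<Sum>p\<in>UNIV. C x k p q * C x l i p * (u $ k * v $ l * w $ i))"
      unfolding sum_distrib_left
      by (rule sum.cong[OF refl], subst sum3_rot) (simp add: mult_ac)
    also have "(\<Sum>k\<in>UNIV. u $ k * (\<Sum>l\<in>UNIV. \<Sum>i\<in>UNIV. partial_diff k (\<lambda>y. C y l i q) x * (v $ l * w $ i)))
      = (\<Sum>k\<in>UNIV. \<Sum>l\<in>UNIV. \<Sum>i\<in>UNIV. partial_diff k (\<lambda>y. C y l i q) x * (u $ k * v $ l * w $ i))"
      unfolding sum_distrib_left by (simp add: mult_ac)
    finally show ?thesis unfolding H_def distrib_right sum.distrib sum_distrib_right .
  qed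
  have "cov_deriv C (\<lambda>_. 0) (\<lambda>_. w) x $ q = 0" unfolding cov_deriv_const by simp
  then have "curvature C (\<lambda>_. u) (\<lambda>_. v) (\<lambda>_. w) x $ q = H u v - H v u"
    unfolding curvature_def lie_bracket_const by (simp add: c)
  also have "H v u = (\<Sum>k\<in>UNIV. \<Sum>l\<in>UNIV. \<Sum>i\<in>UNIV.
     (partial_diff l (\<lambda>y. C y k i q) x + (\<Sum>p\<in>UNIV. C x l p q * C x k i p)) * (u $ k * v $ l * w $ i))"
    unfolding H_def by (subst sum.swap) (simp add: mult_ac)
  finally show ?thesis
    unfolding H_def sum_subtractf[symmetric] left_diff_distrib[symmetric]
    by (simp add: Cv_def sum_subtractf add_diff_add)
qed

end

context torsion_chart begin

lemma curvature4_const: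
  assumes x: "x \<in> W" and g: "\<And>i j. g x $ i $ j = gm i j x"
  shows "curvature4 g C (\<lambda>_. u) (\<lambda>_. v) (\<lambda>_. w) (\<lambda>_. z) x = (\<Sum>k\<in>UNIV. \<Sum>l\<in>UNIV. (\<Sum>c\<in>UNIV. \<Sum>d\<in>UNIV.
     Om k l c d x * ((\<Sum>i\<in>UNIV. E x $ c $ i * w $ i) * (\<Sum>m\<in>UNIV. E x $ d $ m * z $ m))) * (u $ k * v $ l))"
proof -
  have "curvature4 g C (\<lambda>_. u) (\<lambda>_. v) (\<lambda>_. w) (\<lambda>_. z) x
    = (\<Sum>q\<in>UNIV. \<Sum>k\<in>UNIV. \<Sum>l\<in>UNIV. (\<Sum>i\<in>UNIV. Cv k l i q x * w $ i * (\<Sum>m\<in>UNIV. gm q m x * z $ m)) * (u $ k * v $ l))"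
  proof -
    have "curvature C (\<lambda>_. u) (\<lambda>_. v) (\<lambda>_. w) x $ q * (g x *v z) $ q
      = (\<Sum>k\<in>UNIV. \<Sum>l\<in>UNIV. (\<Sum>i\<in>UNIV. Cv k l i q x * w $ i * (\<Sum>m\<in>UNIV. gm q m x * z $ m)) * (u $ k * v $ l))" for q
      unfolding curvature_const[OF x] matrix_vector_mult_def vec_lambda_beta g sum_distrib_right
      by (intro sum.cong refl) (simp add: mult_ac)
    then show ?thesis unfolding curvature4_def inner_vec_def by simp
  qed
  also have "\<dots> = (\<Sum>k\<in>UNIV. \<Sum>l\<in>UNIV. \<Sum>q\<in>UNIV. (\<Sum>i\<in>UNIV. Cv k l i q x * w $ i * (\<Sum>m\<in>UNIV. gm q m x * z $ m)) * (u $ k * v $ l))"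
    by (rule sum3_rot)
  also have "\<dots> = (\<Sum>k\<in>UNIV. \<Sum>l\<in>UNIV. (\<Sum>i\<in>UNIV. \<Sum>m\<in>UNIV. Rl k l i m x * (w $ i * z $ m)) * (u $ k * v $ l))"
  proof (intro sum.cong refl)
    fix k l
    have "(\<Sum>q\<in>UNIV. (\<Sum>i\<in>UNIV. Cv k l i q x * w $ i * (\<Sum>m\<in>UNIV. gm q m x * z $ m)) * (u $ k * v $ l))
      = (\<Sum>q\<in>UNIV. \<Sum>i\<in>UNIV. \<Sum>m\<in>UNIV. Cv k l i q x * gm q m x * (w $ i * z $ m)) * (u $ k * v $ l)"
      unfolding sum_distrib_left sum_distrib_right by (simp add: mult_ac)
    also have "(\<Sum>q\<in>UNIV. \<Sum>i\<in>UNIV. \<Sum>m\<in>UNIV. Cv k l i q x * gm q m x * (w $ i * z $ m))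
      = (\<Sum>i\<in>UNIV. \<Sum>m\<in>UNIV. \<Sum>q\<in>UNIV. Cv k l i q x * gm q m x * (w $ i * z $ m))" by (rule sum3_rot)
    finally show "(\<Sum>q\<in>UNIV. (\<Sum>i\<in>UNIV. Cv k l i q x * w $ i * (\<Sum>m\<in>UNIV. gm q m x * z $ m)) * (u $ k * v $ l))
      = (\<Sum>i\<in>UNIV. \<Sum>m\<in>UNIV. Rl k l i m x * (w $ i * z $ m)) * (u $ k * v $ l)"
      unfolding Rl_def sum_distrib_right .
  qed
  finally have 1: "curvature4 g C (\<lambda>_. u) (\<lambda>_. v) (\<lambda>_. w) (\<lambda>_. z) x
    = (\<Sum>k\<in>UNIV. \<Sum>l\<in>UNIV. (\<Sum>i\<in>UNIV. \<Sum>m\<in>UNIV. Rl k l i m x * (w $ i * z $ m)) * (u $ k * v $ l))" .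
  have 2: "(\<Sum>i\<in>UNIV. \<Sum>m\<in>UNIV. Rl k l i m x * (w $ i * z $ m)) = (\<Sum>c\<in>UNIV. \<Sum>d\<in>UNIV.
     Om k l c d x * ((\<Sum>i\<in>UNIV. E x $ c $ i * w $ i) * (\<Sum>m\<in>UNIV. E x $ d $ m * z $ m)))" for k l
  proof -
    have "(\<Sum>i\<in>UNIV. \<Sum>m\<in>UNIV. Rl k l i m x * (w $ i * z $ m))
      = (\<Sum>i\<in>UNIV. \<Sum>m\<in>UNIV. \<Sum>c\<in>UNIV. \<Sum>d\<in>UNIV. Om k l c d x * (E x $ c $ i * w $ i * (E x $ d $ m * z $ m)))"
      unfolding Rl_frame[OF x] sum_distrib_right by (simp add: mult_ac)
    also have "\<dots> = (\<Sum>c\<in>UNIV. \<Sum>i\<in>UNIV. \<Sum>m\<in>UNIV. \<Sum>d\<in>UNIV. Om k l c d x * (E x $ c $ i * w $ i * (E x $ d $ m * z $ m)))"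
      by (rule sum3_rot[symmetric])
    also have "\<dots> = (\<Sum>c\<in>UNIV. \<Sum>d\<in>UNIV. \<Sum>i\<in>UNIV. \<Sum>m\<in>UNIV. Om k l c d x * (E x $ c $ i * w $ i * (E x $ d $ m * z $ m)))"
      by (rule sum.cong[OF refl]) (rule sum3_rot[symmetric])
    finally show ?thesis unfolding sum_product unfolding sum_distrib_left .
  qed
  show ?thesis unfolding 1 2 ..
qed

end

text \<open>Let M have the rows e_a. Orthonormality says that M E^T is orthogonal, whence M^T M is
  the inverse of the metric E^T E. Thus the sum over a of e_a tensor e_a is the same for all
  orthonormal frames.\<close>

lemma orthonormal_frame_dual:
  fixes E :: "real^'n^'n" and e :: "'n \<Rightarrow> real^'n"
  assumes E: "invertible E" and e: "\<And>a b. e a \<bullet> ((transpose E ** E) *v e b) = (if a = b then 1 else 0)"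
  shows "(\<Sum>a\<in>UNIV. e a $ k * e a $ m) = (matrix_inv E ** transpose (matrix_inv E)) $ k $ m"
proof -
  define M where "M = (\<chi> a i. e a $ i)"
  have rowM: "M *v v = (\<chi> a. e a \<bullet> v)" for v
    by (simp add: M_def matrix_vector_mult_def inner_vec_def vec_eq_iff)
  have "(M ** transpose E) ** transpose (M ** transpose E) = mat 1"
  proof -
    have "(M ** ((transpose E ** E) ** transpose M)) $ a $ b = (if a = b then 1 else 0)" for a b
    proof -
      have "(M ** ((transpose E ** E) ** transpose M)) $ a $ b = (\<Sum>i\<in>UNIV. e a $ i * ((transpose E ** E) *v e b) $ i)"
      proof -
        have "(B ** transpose M) $ i $ b = (B *v e b) $ i" for B :: "real^'n^'n" and i
          by (simp add: matrix_matrix_mult_def matrix_vector_mult_def M_def transpose_def)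
        then show ?thesis by (subst matrix_matrix_mult_def) (simp add: M_def)
      qed
      then show ?thesis using e[of a b] by (simp add: inner_vec_def)
    qed
    then show ?thesis by (simp add: vec_eq_iff mat_def matrix_transpose_mul matrix_mul_assoc)
  qed
  then have "transpose (M ** transpose E) ** (M ** transpose E) = mat 1"
    by (simp add: matrix_left_right_inverse)
  then have i: "E ** (transpose M ** M) ** transpose E = mat 1"
    by (simp add: matrix_transpose_mul matrix_mul_assoc)
  have l: "matrix_inv E ** E = mat 1" and r: "transpose E ** transpose (matrix_inv E) = mat 1"
    using matrix_inv_mult[OF E] by (simp_all add: matrix_transpose_mul[symmetric])
  have "transpose M ** M = (matrix_inv E ** E) ** (transpose M ** M) ** (transpose E ** transpose (matrix_inv E))"
    unfolding l r by simp
  also have "\<dots> = matrix_inv E ** (E ** (transpose M ** M) ** transpose E) ** transpose (matrix_inv E)"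
    by (simp only: matrix_mul_assoc)
  finally have "transpose M ** M = matrix_inv E ** transpose (matrix_inv E)" unfolding i by simp
  moreover have "(transpose M ** M) $ k $ m = (\<Sum>a\<in>UNIV. e a $ k * e a $ m)"
    by (simp add: M_def matrix_matrix_mult_def transpose_def)
  ultimately show ?thesis by simp
qed

text \<open>A double contraction sees the frame only through the sum of e_a tensor e_a; the two
  frame indices are exchanged one after the other.\<close>

lemma frame_contract_independent:
  fixes e e' :: "'n::finite \<Rightarrow> real^'n"
  assumes h: "\<And>k m. (\<Sum>a\<in>UNIV. e a $ k * e a $ m) = (\<Sum>a\<in>UNIV. e' a $ k * e' a $ m)"
  shows "(\<Sum>a\<in>UNIV. \<Sum>b\<in>UNIV. (\<Sum>k\<in>UNIV. \<Sum>l\<in>UNIV. F k l * (e a $ k * e b $ l)) * (\<Sum>m\<in>UNIV. \<Sum>n\<in>UNIV. G m n * (e a $ m * e b $ n)))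
    = (\<Sum>a\<in>UNIV. \<Sum>b\<in>UNIV. (\<Sum>k\<in>UNIV. \<Sum>l\<in>UNIV. F k l * (e' a $ k * e' b $ l)) * (\<Sum>m\<in>UNIV. \<Sum>n\<in>UNIV. G m n * (e' a $ m * e' b $ n)))"
proof -
  have expand: "(\<Sum>a\<in>UNIV. (\<Sum>k\<in>UNIV. A k * d a $ k) * (\<Sum>m\<in>UNIV. B m * d a $ m)) = (\<Sum>k\<in>UNIV. \<Sum>m\<in>UNIV. A k * B m * (\<Sum>a\<in>UNIV. d a $ k * d a $ m))"
    for A B :: "'n \<Rightarrow> real" and d :: "'n \<Rightarrow> real^'n"
  proof -
    have "(\<Sum>a\<in>UNIV. (\<Sum>k\<in>UNIV. A k * d a $ k) * (\<Sum>m\<in>UNIV. B m * d a $ m)) = (\<Sum>a\<in>UNIV. \<Sum>k\<in>UNIV. \<Sum>m\<in>UNIV. A k * B m * (d a $ k * d a $ m))"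
      unfolding sum_product by (simp add: mult_ac)
    also have "\<dots> = (\<Sum>k\<in>UNIV. \<Sum>m\<in>UNIV. \<Sum>a\<in>UNIV. A k * B m * (d a $ k * d a $ m))" by (rule sum3_rot)
    finally show ?thesis unfolding sum_distrib_left .
  qed
  have slot: "(\<Sum>a\<in>UNIV. (\<Sum>k\<in>UNIV. A k * e a $ k) * (\<Sum>m\<in>UNIV. B m * e a $ m)) = (\<Sum>a\<in>UNIV. (\<Sum>k\<in>UNIV. A k * e' a $ k) * (\<Sum>m\<in>UNIV. B m * e' a $ m))" for A B
    unfolding expand h ..
  have 1: "(\<Sum>k\<in>UNIV. \<Sum>l\<in>UNIV. F k l * (u $ k * v $ l)) = (\<Sum>k\<in>UNIV. (\<Sum>l\<in>UNIV. F k l * v $ l) * u $ k)" for F :: "'n \<Rightarrow> 'n \<Rightarrow> real" and u v :: "real^'n"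
    unfolding sum_distrib_right by (simp add: mult_ac)
  have 2: "(\<Sum>k\<in>UNIV. \<Sum>l\<in>UNIV. F k l * (u $ k * v $ l)) = (\<Sum>l\<in>UNIV. (\<Sum>k\<in>UNIV. F k l * u $ k) * v $ l)" for F :: "'n \<Rightarrow> 'n \<Rightarrow> real" and u v :: "real^'n"
    unfolding sum_distrib_right by (subst sum.swap) (simp add: mult_ac)
  have "(\<Sum>a\<in>UNIV. \<Sum>b\<in>UNIV. (\<Sum>k\<in>UNIV. \<Sum>l\<in>UNIV. F k l * (e a $ k * e b $ l)) * (\<Sum>m\<in>UNIV. \<Sum>n\<in>UNIV. G m n * (e a $ m * e b $ n)))
    = (\<Sum>a\<in>UNIV. \<Sum>b\<in>UNIV. (\<Sum>k\<in>UNIV. \<Sum>l\<in>UNIV. F k l * (e a $ k * e' b $ l)) * (\<Sum>m\<in>UNIV. \<Sum>n\<in>UNIV. G m n * (e a $ m * e' b $ n)))"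
    unfolding 2 slot ..
  also have "\<dots> = (\<Sum>b\<in>UNIV. \<Sum>a\<in>UNIV. (\<Sum>k\<in>UNIV. \<Sum>l\<in>UNIV. F k l * (e a $ k * e' b $ l)) * (\<Sum>m\<in>UNIV. \<Sum>n\<in>UNIV. G m n * (e a $ m * e' b $ n)))"
    by (rule sum.swap)
  also have "\<dots> = (\<Sum>b\<in>UNIV. \<Sum>a\<in>UNIV. (\<Sum>k\<in>UNIV. \<Sum>l\<in>UNIV. F k l * (e' a $ k * e' b $ l)) * (\<Sum>m\<in>UNIV. \<Sum>n\<in>UNIV. G m n * (e' a $ m * e' b $ n)))"
    unfolding 1 slot ..
  finally show ?thesis by (subst (asm) (2) sum.swap)
qed

context g2_chart begin

definition evec :: "real^7 \<Rightarrow> 7 \<Rightarrow> real^7" where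
  "evec x a = (\<chi> i. ev a i x)"

lemma evec_orthonormal:
  assumes x: "x \<in> W"
  shows "evec x a \<bullet> ((transpose (E x) ** E x) *v evec x b) = (if a = b then 1 else 0)"
proof -
  have "(E x *v evec x a) $ c = (if a = c then 1 else 0)" for a c
    using dual1[OF x, of c a] by (simp add: matrix_vector_mult_def evec_def)
  then have "E x *v evec x a = axis a 1" for a by (auto simp: vec_eq_iff axis_def)
  moreover have "u \<bullet> ((transpose (E x) ** E x) *v v) = (E x *v u) \<bullet> (E x *v v)" for u v
    unfolding matrix_vector_mul_assoc[symmetric] transpose_matrix_vector inner_commute[of u] dot_lmul_matrix
    by (rule inner_commute)
  ultimately show ?thesis by (simp add: inner_axis_axis)
qed

lemma curvature4_evec:
  assumes x: "x \<in> W" and g: "\<And>i j. g x $ i $ j = gm i j x"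
  shows "curvature4 g C (\<lambda>_. evec x r) (\<lambda>_. evec x s) (\<lambda>_. w) (\<lambda>_. z) x
    = (\<Sum>c\<in>UNIV. \<Sum>d\<in>UNIV. RF r s c d x * ((\<Sum>i\<in>UNIV. E x $ c $ i * w $ i) * (\<Sum>m\<in>UNIV. E x $ d $ m * z $ m)))"
proof -
  let ?w = "\<lambda>c. \<Sum>i\<in>UNIV. E x $ c $ i * w $ i" and ?z = "\<lambda>d. \<Sum>m\<in>UNIV. E x $ d $ m * z $ m"
  have "curvature4 g C (\<lambda>_. evec x r) (\<lambda>_. evec x s) (\<lambda>_. w) (\<lambda>_. z) x
    = (\<Sum>k\<in>UNIV. \<Sum>l\<in>UNIV. \<Sum>c\<in>UNIV. \<Sum>d\<in>UNIV. Om k l c d x * (ev r k x * ev s l x) * (?w c * ?z d))"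
    unfolding curvature4_const[where g = g, OF x g] evec_def vec_lambda_beta sum_distrib_right[of _ _ "ev r k x * ev s l x" for k l]
    by (simp add: mult_ac)
  also have "\<dots> = (\<Sum>c\<in>UNIV. \<Sum>k\<in>UNIV. \<Sum>l\<in>UNIV. \<Sum>d\<in>UNIV. Om k l c d x * (ev r k x * ev s l x) * (?w c * ?z d))"
    by (rule sum3_rot[symmetric])
  also have "\<dots> = (\<Sum>c\<in>UNIV. \<Sum>d\<in>UNIV. \<Sum>k\<in>UNIV. \<Sum>l\<in>UNIV. Om k l c d x * (ev r k x * ev s l x) * (?w c * ?z d))"
    by (rule sum.cong[OF refl]) (rule sum3_rot[symmetric])
  finally show ?thesis unfolding RF_def fr2_triple sum_distrib_right[of _ _ "?w c * ?z d" for c d] .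
qed

lemma tensor_eval_evec:
  assumes x: "x \<in> W" and p: "\<And>i j k. a [i, j, k] = P i j k x"
  shows "tensor_eval 3 a [evec x r, evec x s, u] = (\<Sum>k\<in>UNIV. phi0 r s k * (\<Sum>i\<in>UNIV. E x $ k $ i * u $ i))"
proof -
  let ?u = "\<lambda>c. \<Sum>i\<in>UNIV. E x $ c $ i * u $ i"
  have u: "u $ k = (\<Sum>c\<in>UNIV. ?u c * ev c k x)" for k using frame_expand[OF x, of "\<lambda>i. u $ i" k] by simp
  have "tensor_eval 3 a [evec x r, evec x s, u]
    = (\<Sum>i\<in>UNIV. \<Sum>j\<in>UNIV. \<Sum>k\<in>UNIV. \<Sum>c\<in>UNIV. P i j k x * (ev r i x * ev s j x * ev c k x) * ?u c)"
    unfolding tensor_eval_3 p evec_def vec_lambda_beta by (subst u) (simp add: sum_distrib_left mult_ac)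
  also have "\<dots> = (\<Sum>i\<in>UNIV. \<Sum>c\<in>UNIV. \<Sum>j\<in>UNIV. \<Sum>k\<in>UNIV. P i j k x * (ev r i x * ev s j x * ev c k x) * ?u c)"
    by (rule sum.cong[OF refl]) (rule sum3_rot[symmetric])
  also have "\<dots> = (\<Sum>c\<in>UNIV. \<Sum>i\<in>UNIV. \<Sum>j\<in>UNIV. \<Sum>k\<in>UNIV. P i j k x * (ev r i x * ev s j x * ev c k x) * ?u c)"
    by (rule sum.swap)
  also have "\<dots> = (\<Sum>c\<in>UNIV. fr3 P r s c x * ?u c)"
    unfolding fr3_triple sum_distrib_right[of _ _ "?u c" for c] ..
  finally show ?thesis unfolding fr3_P[OF x] .
qed

text \<open>\<open>g2_instanton\<close> speaks of all orthonormal frames, the local calculus of the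
  one dual to E. The contraction over r and s is moved to that frame by
  \<open>frame_contract_independent\<close>; the vectors w, z, u are arbitrary and are expanded in
  it.\<close>

lemma instanton_frameI:
  fixes e :: "7 \<Rightarrow> real^7"
  assumes x: "x \<in> W" and g: "g x = transpose (E x) ** E x" and p: "\<And>i j k. a [i, j, k] = P i j k x"
    and e: "\<And>a b. e a \<bullet> (g x *v e b) = (if a = b then 1 else 0)"
    and K: "\<And>i j k. (\<Sum>a\<in>UNIV. \<Sum>b\<in>UNIV. RF a b i j x * phi0 a b k) = 0"
  shows "(\<Sum>r\<in>UNIV. \<Sum>s\<in>UNIV. curvature4 g C (\<lambda>_. e r) (\<lambda>_. e s) (\<lambda>_. w) (\<lambda>_. z) x * tensor_eval 3 a [e r, e s, u]) = 0"
proof -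
  have gm: "g x $ i $ j = gm i j x" for i j
    unfolding g gm_def by (simp add: matrix_matrix_mult_def transpose_def)
  have h: "(\<Sum>a\<in>UNIV. e a $ k * e a $ m) = (\<Sum>a\<in>UNIV. evec x a $ k * evec x a $ m)" for k m
    using orthonormal_frame_dual[OF E_inv[OF x], of e k m] orthonormal_frame_dual[OF E_inv[OF x] evec_orthonormal[OF x], of k m] e g by simp
  let ?w = "\<lambda>c. \<Sum>i\<in>UNIV. E x $ c $ i * w $ i" and ?z = "\<lambda>d. \<Sum>m\<in>UNIV. E x $ d $ m * z $ m"
    and ?u = "\<lambda>k. \<Sum>i\<in>UNIV. E x $ k $ i * u $ i"
  have t: "tensor_eval 3 a [v, v', u] = (\<Sum>m\<in>UNIV. \<Sum>n\<in>UNIV. (\<Sum>k\<in>UNIV. a [m, n, k] * u $ k) * (v $ m * v' $ n))" for v v'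
    unfolding tensor_eval_3 sum_distrib_right by (simp add: mult_ac)
  have "(\<Sum>r\<in>UNIV. \<Sum>s\<in>UNIV. curvature4 g C (\<lambda>_. e r) (\<lambda>_. e s) (\<lambda>_. w) (\<lambda>_. z) x * tensor_eval 3 a [e r, e s, u])
    = (\<Sum>r\<in>UNIV. \<Sum>s\<in>UNIV. curvature4 g C (\<lambda>_. evec x r) (\<lambda>_. evec x s) (\<lambda>_. w) (\<lambda>_. z) x * tensor_eval 3 a [evec x r, evec x s, u])"
    unfolding curvature4_const[where g = g, OF x gm] t by (rule frame_contract_independent[OF h])
  also have "\<dots> = (\<Sum>r\<in>UNIV. \<Sum>s\<in>UNIV. \<Sum>c\<in>UNIV. \<Sum>d\<in>UNIV. \<Sum>k\<in>UNIV. RF r s c d x * phi0 r s k * (?w c * ?z d * ?u k))"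
    unfolding curvature4_evec[where g = g, OF x gm] tensor_eval_evec[OF x p]
    unfolding sum_distrib_right[of _ _ "\<Sum>k\<in>UNIV. phi0 r s k * ?u k" for r s] unfolding sum_distrib_left[of "RF r s c d x * v" for r s c d v]
    by (simp add: mult_ac)
  also have "\<dots> = (\<Sum>c\<in>UNIV. \<Sum>r\<in>UNIV. \<Sum>s\<in>UNIV. \<Sum>d\<in>UNIV. \<Sum>k\<in>UNIV. RF r s c d x * phi0 r s k * (?w c * ?z d * ?u k))"
    by (rule sum3_rot[symmetric])
  also have "\<dots> = (\<Sum>c\<in>UNIV. \<Sum>d\<in>UNIV. \<Sum>r\<in>UNIV. \<Sum>s\<in>UNIV. \<Sum>k\<in>UNIV. RF r s c d x * phi0 r s k * (?w c * ?z d * ?u k))"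
    by (rule sum.cong[OF refl]) (rule sum3_rot[symmetric])
  also have "\<dots> = (\<Sum>c\<in>UNIV. \<Sum>d\<in>UNIV. \<Sum>k\<in>UNIV. \<Sum>r\<in>UNIV. \<Sum>s\<in>UNIV. RF r s c d x * phi0 r s k * (?w c * ?z d * ?u k))"
    by (rule sum.cong[OF refl], rule sum.cong[OF refl]) (rule sum3_rot[symmetric])
  also have "\<dots> = 0" unfolding sum_distrib_right[of _ _ "?w c * ?z d * ?u k" for c d k, symmetric] K by simp
  finally show ?thesis .
qed

lemma instanton_frameD:
  assumes x: "x \<in> W" and g: "g x = transpose (E x) ** E x" and p: "\<And>i j k. a [i, j, k] = P i j k x"
    and z: "(\<Sum>r\<in>UNIV. \<Sum>s\<in>UNIV. curvature4 g C (\<lambda>_. evec x r) (\<lambda>_. evec x s) (\<lambda>_. evec x i) (\<lambda>_. evec x j) x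
      * tensor_eval 3 a [evec x r, evec x s, evec x k]) = 0"
  shows "(\<Sum>a\<in>UNIV. \<Sum>b\<in>UNIV. RF a b i j x * phi0 a b k) = 0"
proof -
  have gm: "g x $ i $ j = gm i j x" for i j
    unfolding g gm_def by (simp add: matrix_matrix_mult_def transpose_def)
  have d: "(\<Sum>i\<in>UNIV. E x $ c $ i * evec x a $ i) = (if c = a then 1 else 0)" for a c
    using dual1[OF x, of c a] by (simp add: evec_def eq_commute)
  have "curvature4 g C (\<lambda>_. evec x r) (\<lambda>_. evec x s) (\<lambda>_. evec x i) (\<lambda>_. evec x j) x = RF r s i j x" for r s
  proof -
    have "RF r s c d x * ((if c = i then 1 else 0) * (if d = j then 1 else 0)) = (if d = j then if c = i then RF r s i j x else 0 else 0)" for c d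
      by simp
    then show ?thesis unfolding curvature4_evec[where g = g, OF x gm] d by simp
  qed
  moreover have "tensor_eval 3 a [evec x r, evec x s, evec x k] = phi0 r s k" for r s
    unfolding tensor_eval_evec[OF x p] d by (simp add: if_distrib cong: if_cong)
  ultimately show ?thesis using z by simp
qed

end

section \<open>Change of chart and globalisation\<close>

text \<open>Pullback of a covariant 3-tensor by B. With B the inverse of a coframe matrix it gives
  frame components, with B a Jacobian the change of chart.\<close>

definition contract_matrix :: "('n::finite \<Rightarrow> 'n \<Rightarrow> 'n \<Rightarrow> real) \<Rightarrow> real^'n^'n \<Rightarrow> 'n \<Rightarrow> 'n \<Rightarrow> 'n \<Rightarrow> real" where
  "contract_matrix T B a b c = (\<Sum>i\<in>UNIV. \<Sum>j\<in>UNIV. \<Sum>k\<in>UNIV. T i j k * (B $ i $ a * B $ j $ b * B $ k $ c))"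

definition cube_norm :: "('n::finite \<Rightarrow> 'n \<Rightarrow> 'n \<Rightarrow> real) \<Rightarrow> real" where
  "cube_norm t = (\<Sum>a\<in>UNIV. \<Sum>b\<in>UNIV. \<Sum>c\<in>UNIV. t a b c * t a b c)"

lemma contract_matrix_slots:
  "contract_matrix T B a b c = (\<Sum>i\<in>UNIV. (\<Sum>j\<in>UNIV. (\<Sum>k\<in>UNIV. T i j k * B $ k $ c) * B $ j $ b) * B $ i $ a)"
  unfolding contract_matrix_def sum_distrib_right by (simp add: mult_ac)

lemma contract_matrix_mult: "contract_matrix (contract_matrix T B) D = contract_matrix T (B ** D)"
proof (intro ext)
  fix a b c
  let ?S = "\<lambda>F. \<Sum>i\<in>UNIV. \<Sum>j\<in>UNIV. \<Sum>k\<in>(UNIV::'a set). (F i j k :: real)"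
  have rot: "?S (\<lambda>p q r. \<Sum>i\<in>UNIV. F p q r i) = (\<Sum>i\<in>UNIV. ?S (\<lambda>p q r. F p q r i))" for F :: "'a \<Rightarrow> 'a \<Rightarrow> 'a \<Rightarrow> 'a \<Rightarrow> real"
  proof -
    have "?S (\<lambda>p q r. \<Sum>i\<in>UNIV. F p q r i) = (\<Sum>p\<in>UNIV. \<Sum>i\<in>UNIV. \<Sum>q\<in>UNIV. \<Sum>r\<in>UNIV. F p q r i)"
      by (rule sum.cong[OF refl]) (rule sum3_rot[symmetric])
    also have "\<dots> = (\<Sum>i\<in>UNIV. ?S (\<lambda>p q r. F p q r i))" by (rule sum.swap)
    finally show ?thesis .
  qed
  let ?t = "\<lambda>p q r i j k. T i j k * (B $ i $ p * D $ p $ a * (B $ j $ q * D $ q $ b * (B $ k $ r * D $ r $ c)))"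
  have prod3: "(\<Sum>p\<in>UNIV. f p) * ((\<Sum>q\<in>UNIV. g q) * (\<Sum>r\<in>UNIV. h r)) = ?S (\<lambda>p q r. f p * (g q * h r))" for f g h :: "'a \<Rightarrow> real"
    unfolding sum_distrib_right unfolding sum_distrib_left ..
  have "contract_matrix (contract_matrix T B) D a b c = ?S (\<lambda>p q r. \<Sum>i\<in>UNIV. \<Sum>j\<in>UNIV. \<Sum>k\<in>UNIV. ?t p q r i j k)"
    unfolding contract_matrix_def sum_distrib_right by (simp add: mult_ac)
  also have "\<dots> = (\<Sum>i\<in>UNIV. ?S (\<lambda>p q r. \<Sum>j\<in>UNIV. \<Sum>k\<in>UNIV. ?t p q r i j k))"
    by (rule rot)
  also have "\<dots> = (\<Sum>i\<in>UNIV. \<Sum>j\<in>UNIV. ?S (\<lambda>p q r. \<Sum>k\<in>UNIV. ?t p q r i j k))"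
    by (rule sum.cong[OF refl], rule rot)
  also have "\<dots> = ?S (\<lambda>i j k. ?S (\<lambda>p q r. ?t p q r i j k))"
    by (rule sum.cong[OF refl], rule sum.cong[OF refl], rule rot)
  also have "\<dots> = ?S (\<lambda>i j k. T i j k * ((B ** D) $ i $ a * (B ** D) $ j $ b * (B ** D) $ k $ c))"
  proof -
    have e: "(B ** D) $ i $ a * (B ** D) $ j $ b * (B ** D) $ k $ c
      = ?S (\<lambda>p q r. B $ i $ p * D $ p $ a * (B $ j $ q * D $ q $ b * (B $ k $ r * D $ r $ c)))" for i j k
      unfolding matrix_matrix_mult_def vec_lambda_beta prod3[symmetric] by (rule mult.assoc)
    show ?thesis unfolding e sum_distrib_left ..
  qed
  finally show "contract_matrix (contract_matrix T B) D a b c = contract_matrix T (B ** D) a b c"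
    unfolding contract_matrix_def[of T "B ** D"] .
qed

lemma cube_norm_orthogonal:
  assumes Q: "Q ** transpose Q = mat 1"
  shows "cube_norm (contract_matrix t Q) = cube_norm t"
proof -
  have slot: "(\<Sum>a\<in>UNIV. (\<Sum>i\<in>UNIV. v i * Q $ i $ a) * (\<Sum>i\<in>UNIV. v i * Q $ i $ a)) = (\<Sum>i\<in>UNIV. v i * v i)" for v
  proof -
    have "(\<Sum>a\<in>UNIV. (\<Sum>i\<in>UNIV. v i * Q $ i $ a) * (\<Sum>i\<in>UNIV. v i * Q $ i $ a)) = (\<Sum>a\<in>UNIV. \<Sum>i\<in>UNIV. \<Sum>j\<in>UNIV. v i * v j * (Q $ i $ a * Q $ j $ a))"
      unfolding sum_product by (simp add: mult_ac)
    also have "\<dots> = (\<Sum>i\<in>UNIV. \<Sum>j\<in>UNIV. v i * v j * (\<Sum>a\<in>UNIV. Q $ i $ a * Q $ j $ a))"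
      unfolding sum_distrib_left by (rule sum3_rot)
    also have "\<dots> = (\<Sum>i\<in>UNIV. \<Sum>j\<in>UNIV. v i * v j * (Q ** transpose Q) $ i $ j)"
      by (simp add: matrix_matrix_mult_def transpose_def)
    finally show ?thesis unfolding Q by (simp add: mat_def if_distrib cong: if_cong)
  qed
  let ?u = "\<lambda>i j c. \<Sum>k\<in>UNIV. t i j k * Q $ k $ c"
  let ?v = "\<lambda>i b c. \<Sum>j\<in>UNIV. ?u i j c * Q $ j $ b"
  have "cube_norm (contract_matrix t Q) = (\<Sum>b\<in>UNIV. \<Sum>c\<in>UNIV. \<Sum>a\<in>UNIV. contract_matrix t Q a b c * contract_matrix t Q a b c)"
    unfolding cube_norm_def by (rule sum3_rot)
  also have "\<dots> = (\<Sum>b\<in>UNIV. \<Sum>c\<in>UNIV. \<Sum>i\<in>UNIV. ?v i b c * ?v i b c)" unfolding contract_matrix_slots slot ..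
  also have "\<dots> = (\<Sum>c\<in>UNIV. \<Sum>i\<in>UNIV. \<Sum>b\<in>UNIV. ?v i b c * ?v i b c)" by (rule sum3_rot)
  also have "\<dots> = (\<Sum>c\<in>UNIV. \<Sum>i\<in>UNIV. \<Sum>j\<in>UNIV. ?u i j c * ?u i j c)" unfolding slot ..
  also have "\<dots> = (\<Sum>i\<in>UNIV. \<Sum>j\<in>UNIV. \<Sum>c\<in>UNIV. ?u i j c * ?u i j c)" by (rule sum3_rot)
  also have "\<dots> = cube_norm t" unfolding slot cube_norm_def ..
  finally show ?thesis .
qed

text \<open>E and F J are orthonormal coframes of the same metric, so they differ by an orthogonal
  matrix, which preserves \<open>cube_norm\<close>.\<close>

lemma cube_norm_frame:
  assumes E: "invertible E" "invertible F" and m: "transpose E ** E = transpose (F ** J) ** (F ** J)"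
  shows "cube_norm (contract_matrix (contract_matrix T J) (matrix_inv E)) = cube_norm (contract_matrix T (matrix_inv F))"
proof -
  let ?Q = "F ** J ** matrix_inv E"
  have "transpose ?Q ** ?Q = transpose (matrix_inv E) ** (transpose (F ** J) ** (F ** J)) ** matrix_inv E"
    by (simp only: matrix_transpose_mul matrix_mul_assoc)
  also have "\<dots> = transpose (E ** matrix_inv E) ** (E ** matrix_inv E)"
    unfolding m[symmetric] by (simp only: matrix_transpose_mul matrix_mul_assoc)
  also have "\<dots> = mat 1" by (simp add: matrix_inv_mult[OF E(1)] transpose_mat)
  finally have Q: "?Q ** transpose ?Q = mat 1" by (simp add: matrix_left_right_inverse)
  have "J ** matrix_inv E = matrix_inv F ** ?Q"
    by (simp add: matrix_mul_assoc matrix_inv_mult[OF E(2)])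
  then have "contract_matrix (contract_matrix T J) (matrix_inv E) = contract_matrix (contract_matrix T (matrix_inv F)) ?Q"
    unfolding contract_matrix_mult by simp
  then show ?thesis by (simp add: cube_norm_orthogonal[OF Q])
qed

text \<open>Invertibility of J follows from the forms themselves: a vector in the kernel of J has
  zero interior product with a, hence vanishes by \<open>adapted_nondegenerate\<close>.\<close>

lemma g2_adapted_pullback:
  assumes a: "g2_adapted a E" and F: "g2_adapted b F"
    and ab: "\<And>i j k. a [i, j, k] = contract_matrix (\<lambda>i j k. b [i, j, k]) J i j k"
  shows "g2_adapted a (F ** J)"
proof -
  have eq: "a [i, j, k] = g2_model (F ** J) [i, j, k]" for i j k
  proof -
    have e: "b [p, q, r] = contract_matrix phi0 F p q r" for p q r
      using F unfolding g2_adapted_def by (simp add: g2_model_eq contract_matrix_def)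
    have "a [i, j, k] = contract_matrix (contract_matrix phi0 F) J i j k" unfolding ab e ..
    then show ?thesis unfolding contract_matrix_mult g2_model_eq contract_matrix_def .
  qed
  have "inj ((*v) J)"
  proof (rule injI)
    fix u v assume uv: "J *v u = J *v v"
    have z: "J *v (u - v) = 0" using uv by (simp add: matrix_vector_mult_diff_distrib)
    have "(\<Sum>i\<in>UNIV. (u - v) $ i * a [i, j, k]) = 0" for j k
    proof -
      have s: "(\<Sum>i\<in>UNIV. w i * contract_matrix t J i j k) = (\<Sum>p\<in>UNIV. \<Sum>q\<in>UNIV. \<Sum>r\<in>UNIV. t p q r * (J $ q $ j * J $ r $ k) * (\<Sum>i\<in>UNIV. J $ p $ i * w i))" for w t
      proof -
        have "(\<Sum>i\<in>UNIV. w i * contract_matrix t J i j k) = (\<Sum>i\<in>UNIV. \<Sum>p\<in>UNIV. \<Sum>q\<in>UNIV. \<Sum>r\<in>UNIV. t p q r * (J $ q $ j * J $ r $ k) * (J $ p $ i * w i))"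
          unfolding contract_matrix_def sum_distrib_left by (simp add: mult_ac)
        also have "\<dots> = (\<Sum>p\<in>UNIV. \<Sum>i\<in>UNIV. \<Sum>q\<in>UNIV. \<Sum>r\<in>UNIV. t p q r * (J $ q $ j * J $ r $ k) * (J $ p $ i * w i))"
          by (rule sum.swap)
        also have "\<dots> = (\<Sum>p\<in>UNIV. \<Sum>q\<in>UNIV. \<Sum>r\<in>UNIV. \<Sum>i\<in>UNIV. t p q r * (J $ q $ j * J $ r $ k) * (J $ p $ i * w i))"
          by (rule sum.cong[OF refl]) (rule sum3_rot)
        finally show ?thesis unfolding sum_distrib_left .
      qed
      have "(\<Sum>i\<in>UNIV. J $ p $ i * (u - v) $ i) = 0" for p
        using z by (simp add: matrix_vector_mult_def vec_eq_iff)
      then show ?thesis unfolding ab s by simp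
    qed
    then have "u - v = 0" by (rule adapted_nondegenerate[OF a])
    then show "u = v" by simp
  qed
  then have "invertible J" by (simp add: invertible_left_inverse matrix_left_invertible_injective)
  then have "invertible (F ** J)" using F by (simp add: g2_adapted_def invertible_mult)
  then show ?thesis unfolding g2_adapted_def using eq by (auto simp: length_3_conv)
qed

text \<open>On the compact set K where f fails to be locally constant, f has a maximum at some q.
  Values near q above f q are taken outside K only, where level sets are open; in a connected
  neighbourhood of q they cannot occur. So q is a local maximum of f, and by \<open>max\<close> it
  does not lie in K.\<close>

lemma compact_locally_constant:
  assumes X: "compact_space X" and f: "continuous_map X euclideanreal f"
    and conn: "\<And>p U. openin X U \<Longrightarrow> p \<in> U \<Longrightarrow> \<exists>V. openin X V \<and> p \<in> V \<and> V \<subseteq> U \<and> connectedin X V"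
    and max: "\<And>p U. openin X U \<Longrightarrow> p \<in> U \<Longrightarrow> (\<And>q. q \<in> U \<Longrightarrow> f q \<le> f p) \<Longrightarrow> \<exists>V. openin X V \<and> p \<in> V \<and> (\<forall>q\<in>V. f q = f p)"
    and p: "p \<in> topspace X"
  shows "\<exists>V. openin X V \<and> p \<in> V \<and> (\<forall>q\<in>V. f q = f p)"
proof -
  define Z where "Z = {p \<in> topspace X. \<exists>V. openin X V \<and> p \<in> V \<and> (\<forall>q\<in>V. f q = f p)}"
  define K where "K = topspace X - Z"
  have "openin X Z"
  proof (subst openin_subopen, intro ballI)
    fix p assume "p \<in> Z"
    then obtain V where V: "openin X V" "p \<in> V" "\<forall>q\<in>V. f q = f p" unfolding Z_def by blast
    have "V \<subseteq> Z"
    proof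
      fix q assume "q \<in> V"
      then have "q \<in> topspace X" "\<forall>r\<in>V. f r = f q" using V(3) openin_subset[OF V(1)] by (blast, metis)
      then show "q \<in> Z" unfolding Z_def using V(1) \<open>q \<in> V\<close> by blast
    qed
    then show "\<exists>T. openin X T \<and> p \<in> T \<and> T \<subseteq> Z" using V by blast
  qed
  then have "closedin X K" unfolding K_def by blast
  then have cK: "compactin X K" using X closedin_compact_space by blast
  have "K = {}"
  proof (rule ccontr)
    assume K: "K \<noteq> {}"
    have "compact (f ` K)" using image_compactin[OF cK f] by simp
    then obtain q where q: "q \<in> K" "\<And>r. r \<in> K \<Longrightarrow> f r \<le> f q"
      using compact_attains_sup[of "f ` K"] K by auto
    have qX: "q \<in> topspace X" using q(1) by (simp add: K_def)
    obtain V where V: "openin X V" "q \<in> V" "connectedin X V" using conn[OF openin_topspace qX] by blast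
    \<comment> \<open>A level set above \<open>f q\<close> avoids \<open>K\<close>, so it is open as well as closed in \<open>V\<close>.\<close>
    have "f y \<le> f q" if y: "y \<in> V" for y
    proof (rule ccontr)
      assume g: "\<not> f y \<le> f q"
      define S where "S = {z \<in> V. f z = f y}"
      have "openin X S"
      proof (subst openin_subopen, intro ballI)
        fix z assume z: "z \<in> S"
        then have "z \<in> Z" using q(2)[of z] g openin_subset[OF V(1)] by (auto simp: S_def K_def)
        then obtain U where U: "openin X U" "z \<in> U" "\<forall>w\<in>U. f w = f z" unfolding Z_def by blast
        have "openin X (U \<inter> V)" using U(1) V(1) by blast
        moreover have "z \<in> U \<inter> V" using z U(2) unfolding S_def by blast
        moreover have "U \<inter> V \<subseteq> S" 
        proof
          fix w assume w: "w \<in> U \<inter> V"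
          then have "f w = f z" using U(3) by blast
          then show "w \<in> S" using w z unfolding S_def by simp
        qed
        ultimately show "\<exists>T. openin X T \<and> z \<in> T \<and> T \<subseteq> S" by blast
      qed
      moreover have "openin X {z \<in> V. f z \<noteq> f y}"
      proof -
        have "openin X {z \<in> topspace X. f z \<in> - {f y}}"
          by (rule openin_continuous_map_preimage[OF f]) (simp add: open_Compl)
        then have "openin X (V \<inter> {z \<in> topspace X. f z \<in> - {f y}})" using V(1) by blast
        moreover have "V \<inter> {z \<in> topspace X. f z \<in> - {f y}} = {z \<in> V. f z \<noteq> f y}" using openin_subset[OF V(1)] by auto
        ultimately show ?thesis by simp
      qed
      moreover have "y \<in> S" "q \<in> {z \<in> V. f z \<noteq> f y}" using y V(2) g by (auto simp: S_def)
      moreover have "V \<subseteq> S \<union> {z \<in> V. f z \<noteq> f y}" "S \<inter> {z \<in> V. f z \<noteq> f y} \<inter> V = {}" by (auto simp: S_def)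
      ultimately have "\<not> connectedin X V"
        unfolding connectedin using y V(2) by blast
      then show False using V(3) by simp
    qed
    then have "\<exists>V. openin X V \<and> q \<in> V \<and> (\<forall>r\<in>V. f r = f q)" by (rule max[OF V(1,2)])
    then have "q \<in> Z" unfolding Z_def using qX by blast
    then show False using q(1) by (simp add: K_def)
  qed
  then show ?thesis using p unfolding K_def Z_def by blast
qed

section \<open>Charts as homeomorphisms\<close>

lemma chart_inj: "is_chart X \<kappa> \<Longrightarrow> inj_on (snd \<kappa>) (fst \<kappa>)"
  unfolding is_chart_def using homeomorphic_imp_injective_map[of "subtopology X (fst \<kappa>)"]
  by (metis openin_subset topspace_subtopology_subset)

lemma chart_image_open:
  assumes c: "is_chart X \<kappa>" and V: "openin X V"
  shows "open (snd \<kappa> ` (fst \<kappa> \<inter> V))"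
proof -
  have o: "openin X (fst \<kappa>)" "open (chart_img \<kappa>)"
    and h: "homeomorphic_map (subtopology X (fst \<kappa>)) (top_of_set (chart_img \<kappa>)) (snd \<kappa>)"
    using c unfolding is_chart_def by auto
  have "openin (subtopology X (fst \<kappa>)) (fst \<kappa> \<inter> V)" using V by (simp add: openin_subtopology_Int2)
  then have "openin (top_of_set (chart_img \<kappa>)) (snd \<kappa> ` (fst \<kappa> \<inter> V))"
    using homeomorphic_imp_open_map[OF h] unfolding open_map_def by blast
  then show ?thesis using o(2) openin_open_trans by blast
qed

lemma chart_preimage_open:
  assumes c: "is_chart X \<kappa>" and S: "open S"
  shows "openin X {p \<in> fst \<kappa>. snd \<kappa> p \<in> S}"
proof -
  have o: "openin X (fst \<kappa>)"
    and h: "homeomorphic_map (subtopology X (fst \<kappa>)) (top_of_set (chart_img \<kappa>)) (snd \<kappa>)"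
    using c unfolding is_chart_def by auto
  have "continuous_map (subtopology X (fst \<kappa>)) euclidean (snd \<kappa>)"
    using homeomorphic_imp_continuous_map[OF h] by (simp add: continuous_map_in_subtopology)
  then have "openin (subtopology X (fst \<kappa>)) {p \<in> topspace (subtopology X (fst \<kappa>)). snd \<kappa> p \<in> S}"
    by (rule openin_continuous_map_preimage) (simp add: S)
  moreover have "topspace (subtopology X (fst \<kappa>)) = fst \<kappa>" using openin_subset[OF o] by auto
  ultimately show ?thesis using o openin_trans_full by fastforce
qed

lemma chart_preimage_connected:
  assumes c: "is_chart X \<kappa>" and S: "connected S" "S \<subseteq> chart_img \<kappa>"
  shows "connectedin X {p \<in> fst \<kappa>. snd \<kappa> p \<in> S}"
proof -
  have o: "openin X (fst \<kappa>)"
    and h: "homeomorphic_map (subtopology X (fst \<kappa>)) (top_of_set (chart_img \<kappa>)) (snd \<kappa>)"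
    using c unfolding is_chart_def by auto
  have t: "topspace (subtopology X (fst \<kappa>)) = fst \<kappa>" using openin_subset[OF o] by auto
  have "snd \<kappa> ` {p \<in> fst \<kappa>. snd \<kappa> p \<in> S} = S" using S(2) unfolding chart_img_def by auto
  then have "connectedin (top_of_set (chart_img \<kappa>)) (snd \<kappa> ` {p \<in> fst \<kappa>. snd \<kappa> p \<in> S})"
    using S by (simp add: connectedin_subtopology)
  then have "connectedin (subtopology X (fst \<kappa>)) {p \<in> fst \<kappa>. snd \<kappa> p \<in> S}"
    using homeomorphic_map_connectedness[OF h, of "{p \<in> fst \<kappa>. snd \<kappa> p \<in> S}"] t by auto
  then show ?thesis by (simp add: connectedin_subtopology)
qed

lemma transition_chart:
  assumes "is_chart X \<kappa>" "p \<in> fst \<kappa>" shows "transition \<kappa> \<mu> (snd \<kappa> p) = snd \<mu> p"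
  using chart_inj[OF assms(1)] assms(2) by (simp add: transition_def)

lemma overlap_open:
  assumes "is_chart X \<kappa>" "is_chart X \<mu>" shows "open (overlap \<kappa> \<mu>)"
  unfolding overlap_def using chart_image_open[OF assms(1)] assms(2) by (simp add: is_chart_def)

section \<open>The norm of the torsion as a function on the manifold\<close>

definition adapted_on :: "(real^7 \<Rightarrow> 7 tensor) \<Rightarrow> (real^7) set \<Rightarrow> (real^7 \<Rightarrow> real^7^7) \<Rightarrow> bool" where
  "adapted_on f W E \<longleftrightarrow> open W \<and> (\<forall>a i. smooth_on W (\<lambda>x. E x $ a $ i)) \<and> (\<forall>x\<in>W. g2_adapted (f x) (E x))"

locale closed_torsion_g2 =
  fixes X :: "'a topology" and A :: "('a, 7) chart set"
    and \<phi> :: "('a, 7) chart \<Rightarrow> real^7 \<Rightarrow> 7 tensor" and \<Gamma> :: "('a, 7) chart \<Rightarrow> 7 christoffel"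
  assumes mfd: "g2_manifold X A \<phi>" and char: "characteristic_connection A \<phi> \<Gamma>"
    and closed: "closed_form A 3 (torsion_tensor \<phi> \<Gamma>)"
begin

lemma chart: "\<kappa> \<in> A \<Longrightarrow> is_chart X \<kappa>"
  using mfd unfolding g2_manifold_def smooth_manifold_def by blast

lemma adapted_exists:
  assumes "\<kappa> \<in> A" "x \<in> chart_img \<kappa>"
  obtains W E where "adapted_on (\<phi> \<kappa>) W E" "W \<subseteq> chart_img \<kappa>" "x \<in> W"
  using mfd assms unfolding g2_manifold_def g2_structure_def adapted_on_def by meson

abbreviation torsion_comp :: "('a, 7) chart \<Rightarrow> real^7 \<Rightarrow> 7 \<Rightarrow> 7 \<Rightarrow> 7 \<Rightarrow> real" where
  "torsion_comp \<kappa> x i j k \<equiv> torsion_tensor \<phi> \<Gamma> \<kappa> x [i, j, k]"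

lemma phi_transform:
  assumes "\<kappa> \<in> A" "\<mu> \<in> A" "x \<in> overlap \<kappa> \<mu>"
  shows "\<phi> \<kappa> x [i, j, k] = contract_matrix (\<lambda>i j k. \<phi> \<mu> (transition \<kappa> \<mu> x) [i, j, k]) (\<chi> p i. jacobian \<kappa> \<mu> x p i) i j k"
proof -
  have "\<phi> \<kappa> x [i, j, k] = (\<Sum>I | length I = 3. \<phi> \<mu> (transition \<kappa> \<mu> x) I * (\<Prod>m<3. jacobian \<kappa> \<mu> x (I ! m) ([i, j, k] ! m)))"
    using mfd assms unfolding g2_manifold_def g2_structure_def differential_form_def smooth_tensor_field_def by simp
  then show ?thesis unfolding lists_3_sum contract_matrix_def by (simp add: numeral_3_eq_3)
qed

lemma adapted_transform:
  assumes "\<kappa> \<in> A" "\<mu> \<in> A" "x \<in> overlap \<kappa> \<mu>" and F: "g2_adapted (\<phi> \<mu> (transition \<kappa> \<mu> x)) F"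
  shows "g2_adapted (\<phi> \<kappa> x) (F ** (\<chi> p i. jacobian \<kappa> \<mu> x p i))"
proof -
  have "x \<in> chart_img \<kappa>" using assms(3) unfolding overlap_def chart_img_def by blast
  then obtain W E where W: "adapted_on (\<phi> \<kappa>) W E" "x \<in> W" using adapted_exists[OF assms(1)] by metis
  then have E: "g2_adapted (\<phi> \<kappa> x) (E x)" unfolding adapted_on_def by blast
  show ?thesis by (rule g2_adapted_pullback[OF E F]) (rule phi_transform[OF assms(1-3)])
qed

text \<open>The inhomogeneous term of the Christoffel law is a second derivative of the transition
  map, symmetric in i and j, and cancels in the torsion. The metric lowering the last index
  transforms by the Jacobian, because an adapted coframe pulls back to an adapted one.\<close>

lemma torsion_transform:
  assumes A: "\<kappa> \<in> A" "\<mu> \<in> A" and x: "x \<in> overlap \<kappa> \<mu>"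
  shows "torsion_comp \<kappa> x = contract_matrix (torsion_comp \<mu> (transition \<kappa> \<mu> x)) (\<chi> p i. jacobian \<kappa> \<mu> x p i)"
proof (intro ext)
  fix i j k
  let ?y = "transition \<kappa> \<mu> x" and ?J = "\<chi> p i. jacobian \<kappa> \<mu> x p i"
  let ?g = "metric_field (\<phi> \<mu>) ?y"
  define a where "a i j p = \<Gamma> \<mu> ?y i j p - \<Gamma> \<mu> ?y j i p" for i j p
  have y: "?y \<in> chart_img \<mu>"
  proof -
    obtain p where "p \<in> fst \<kappa>" "p \<in> fst \<mu>" "x = snd \<kappa> p" using x unfolding overlap_def by blast
    then show ?thesis using transition_chart[OF chart[OF A(1)]] unfolding chart_img_def by auto
  qed
  obtain W E where W: "adapted_on (\<phi> \<mu>) W E" "?y \<in> W" using adapted_exists[OF A(2) y] by metis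
  then have F: "g2_adapted (\<phi> \<mu> ?y) (E ?y)" unfolding adapted_on_def by blast
  have "metric_field (\<phi> \<kappa>) x = transpose (E ?y ** ?J) ** (E ?y ** ?J)"
    unfolding metric_field_def by (rule g2_metric_eq) (rule adapted_transform[OF A x F])
  also have "\<dots> = transpose ?J ** ?g ** ?J"
    unfolding metric_field_def g2_metric_eq[OF F] by (simp only: matrix_transpose_mul matrix_mul_assoc)
  finally have g: "metric_field (\<phi> \<kappa>) x $ p $ k = (\<Sum>r\<in>UNIV. (\<Sum>q\<in>UNIV. jacobian \<kappa> \<mu> x q p * ?g $ q $ r) * jacobian \<kappa> \<mu> x r k)" for p
    by (simp add: matrix_matrix_mult_def transpose_def)
  have sym: "partial_diff i (\<lambda>y. jacobian \<kappa> \<mu> y l j) x = partial_diff j (\<lambda>y. jacobian \<kappa> \<mu> y l i) x" for i j l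
  proof -
    have s: "smooth_on (overlap \<kappa> \<mu>) (\<lambda>y. transition \<kappa> \<mu> y $ l)"
      using mfd A unfolding g2_manifold_def smooth_manifold_def by blast
    show ?thesis unfolding jacobian_def
      by (rule partial_diff_commute[OF overlap_open[OF chart[OF A(1)] chart[OF A(2)]] s x])
  qed
  have G: "(\<Sum>p\<in>UNIV. jacobian \<kappa> \<mu> x l p * (\<Gamma> \<kappa> x i j p - \<Gamma> \<kappa> x j i p))
    = (\<Sum>s\<in>UNIV. \<Sum>t\<in>UNIV. a s t l * (jacobian \<kappa> \<mu> x s i * jacobian \<kappa> \<mu> x t j))" for l
  proof -
    have L: "(\<Sum>p\<in>UNIV. jacobian \<kappa> \<mu> x l p * \<Gamma> \<kappa> x i j p) =
        (\<Sum>s\<in>UNIV. \<Sum>t\<in>UNIV. \<Gamma> \<mu> ?y s t l * jacobian \<kappa> \<mu> x s i * jacobian \<kappa> \<mu> x t j) + partial_diff i (\<lambda>y. jacobian \<kappa> \<mu> y l j) x" for i j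
      using char A x unfolding characteristic_connection_def linear_connection_def by blast
    have "(\<Sum>s\<in>UNIV. \<Sum>t\<in>UNIV. \<Gamma> \<mu> ?y s t l * jacobian \<kappa> \<mu> x s j * jacobian \<kappa> \<mu> x t i)
       = (\<Sum>s\<in>UNIV. \<Sum>t\<in>UNIV. \<Gamma> \<mu> ?y t s l * (jacobian \<kappa> \<mu> x s i * jacobian \<kappa> \<mu> x t j))"
      by (subst sum.swap) (simp add: mult_ac)
    then show ?thesis
      unfolding right_diff_distrib sum_subtractf L a_def left_diff_distrib by (simp add: sym[of i l j] mult.assoc)
  qed
  have "torsion_comp \<kappa> x i j k = (\<Sum>p\<in>UNIV. (\<Gamma> \<kappa> x i j p - \<Gamma> \<kappa> x j i p) * metric_field (\<phi> \<kappa>) x $ p $ k)"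
    by (rule torsion_tensor_eq)
  also have "\<dots> = (\<Sum>p\<in>UNIV. \<Sum>r\<in>UNIV. \<Sum>q\<in>UNIV. jacobian \<kappa> \<mu> x q p * (\<Gamma> \<kappa> x i j p - \<Gamma> \<kappa> x j i p) * (?g $ q $ r * jacobian \<kappa> \<mu> x r k))"
    unfolding g sum_distrib_left sum_distrib_right by (simp add: mult_ac)
  also have "\<dots> = (\<Sum>r\<in>UNIV. \<Sum>q\<in>UNIV. (\<Sum>p\<in>UNIV. jacobian \<kappa> \<mu> x q p * (\<Gamma> \<kappa> x i j p - \<Gamma> \<kappa> x j i p)) * (?g $ q $ r * jacobian \<kappa> \<mu> x r k))"
    unfolding sum_distrib_right by (rule sum3_rot)
  also have "\<dots> = (\<Sum>r\<in>UNIV. \<Sum>q\<in>UNIV. \<Sum>s\<in>UNIV. \<Sum>t\<in>UNIV. a s t q * ?g $ q $ r * (jacobian \<kappa> \<mu> x s i * jacobian \<kappa> \<mu> x t j * jacobian \<kappa> \<mu> x r k))"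
    unfolding G sum_distrib_right by (simp add: mult_ac)
  also have "\<dots> = (\<Sum>r\<in>UNIV. \<Sum>s\<in>UNIV. \<Sum>t\<in>UNIV. \<Sum>q\<in>UNIV. a s t q * ?g $ q $ r * (jacobian \<kappa> \<mu> x s i * jacobian \<kappa> \<mu> x t j * jacobian \<kappa> \<mu> x r k))"
    by (rule sum.cong[OF refl]) (rule sum3_rot)
  also have "\<dots> = (\<Sum>s\<in>UNIV. \<Sum>t\<in>UNIV. \<Sum>r\<in>UNIV. \<Sum>q\<in>UNIV. a s t q * ?g $ q $ r * (jacobian \<kappa> \<mu> x s i * jacobian \<kappa> \<mu> x t j * jacobian \<kappa> \<mu> x r k))"
    by (rule sum3_rot)
  also have "\<dots> = contract_matrix (torsion_comp \<mu> ?y) ?J i j k"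
    unfolding contract_matrix_def torsion_tensor_eq a_def sum_distrib_right vec_lambda_beta ..
  finally show "torsion_comp \<kappa> x i j k = contract_matrix (torsion_comp \<mu> ?y) ?J i j k" .
qed

text \<open>The choices of chart and coframe are harmless by \<open>torsion_norm_eq\<close>; a
  single function on the manifold is what the compactness argument works with.\<close>

definition torsion_norm :: "'a \<Rightarrow> real" where
  "torsion_norm p = (let \<kappa> = (SOME \<kappa>. \<kappa> \<in> A \<and> p \<in> fst \<kappa>) in
     cube_norm (contract_matrix (torsion_comp \<kappa> (snd \<kappa> p)) (matrix_inv (g2_coframe (\<phi> \<kappa> (snd \<kappa> p))))))"

lemma torsion_norm_eq:
  assumes A: "\<kappa> \<in> A" and p: "p \<in> fst \<kappa>" and E: "g2_adapted (\<phi> \<kappa> (snd \<kappa> p)) E"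
  shows "torsion_norm p = cube_norm (contract_matrix (torsion_comp \<kappa> (snd \<kappa> p)) (matrix_inv E))"
proof -
  define \<mu> where "\<mu> = (SOME \<kappa>. \<kappa> \<in> A \<and> p \<in> fst \<kappa>)"
  have \<mu>: "\<mu> \<in> A" "p \<in> fst \<mu>" unfolding \<mu>_def by (rule someI2[of _ \<kappa>]; use A p in simp)+
  have t: "transition \<kappa> \<mu> (snd \<kappa> p) = snd \<mu> p" by (rule transition_chart[OF chart[OF A] p])
  have o: "snd \<kappa> p \<in> overlap \<kappa> \<mu>" using p \<mu>(2) unfolding overlap_def by blast
  obtain W F where "adapted_on (\<phi> \<mu>) W F" "snd \<mu> p \<in> W"
    using adapted_exists[OF \<mu>(1), of "snd \<mu> p"] \<mu>(2) unfolding chart_img_def by blast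
  then have "g2_adapted (\<phi> \<mu> (snd \<mu> p)) (F (snd \<mu> p))" unfolding adapted_on_def by blast
  then have F: "g2_adapted (\<phi> \<mu> (snd \<mu> p)) (g2_coframe (\<phi> \<mu> (snd \<mu> p)))" unfolding g2_coframe_def by (rule someI)
  let ?F = "g2_coframe (\<phi> \<mu> (snd \<mu> p))" and ?J = "\<chi> q i. jacobian \<kappa> \<mu> (snd \<kappa> p) q i"
  have FJ: "g2_adapted (\<phi> \<kappa> (snd \<kappa> p)) (?F ** ?J)" by (rule adapted_transform[OF A \<mu>(1) o]) (simp add: t F)
  have "cube_norm (contract_matrix (contract_matrix (torsion_comp \<mu> (snd \<mu> p)) ?J) (matrix_inv E))
    = cube_norm (contract_matrix (torsion_comp \<mu> (snd \<mu> p)) (matrix_inv ?F))"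
    by (rule cube_norm_frame) (use E F adapted_metric_unique[OF E FJ] in \<open>simp_all add: g2_adapted_def\<close>)
  then show ?thesis unfolding torsion_transform[OF A \<mu>(1) o] t torsion_norm_def \<mu>_def[symmetric] Let_def by simp
qed

end

context closed_torsion_g2 begin

context
  fixes \<kappa> W E
  assumes \<kappa>: "\<kappa> \<in> A" and ad: "adapted_on (\<phi> \<kappa>) W E" "W \<subseteq> chart_img \<kappa>"
begin

lemma metric_field_eq: "x \<in> W \<Longrightarrow> metric_field (\<phi> \<kappa>) x = transpose (E x) ** E x"
  unfolding metric_field_def by (rule g2_metric_eq) (use ad in \<open>simp add: adapted_on_def\<close>)

lemma metric_comp: "x \<in> W \<Longrightarrow> metric_field (\<phi> \<kappa>) x $ i $ j = (\<Sum>a\<in>UNIV. E x $ a $ i * E x $ a $ j)"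
  unfolding metric_field_eq by (simp add: matrix_matrix_mult_def transpose_def)

lemma phi_comp: "x \<in> W \<Longrightarrow> \<phi> \<kappa> x [i, j, k] = (\<Sum>a\<in>UNIV. \<Sum>b\<in>UNIV. \<Sum>c\<in>UNIV. phi0 a b c * (E x $ a $ i * E x $ b $ j * E x $ c $ k))"
  using ad(1) unfolding adapted_on_def g2_adapted_def by (simp add: g2_model_eq)

lemma torsion_comp_eq:
  "x \<in> W \<Longrightarrow> torsion_comp \<kappa> x i j k = (\<Sum>p\<in>UNIV. (\<Gamma> \<kappa> x i j p - \<Gamma> \<kappa> x j i p) * (\<Sum>a\<in>UNIV. E x $ a $ p * E x $ a $ k))"
  unfolding torsion_tensor_eq metric_comp ..

lemma adapted_frame_chart: "frame_chart W (\<Gamma> \<kappa>) E"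
proof
  show "open W" "smooth_on W (\<lambda>x. E x $ a $ i)" for a i using ad(1) unfolding adapted_on_def by blast+
  show "invertible (E x)" if "x \<in> W" for x using ad(1) that unfolding adapted_on_def g2_adapted_def by blast
  have "smooth_on (chart_img \<kappa>) (\<lambda>x. \<Gamma> \<kappa> x i j k)" for i j k
    using char \<kappa> unfolding characteristic_connection_def linear_connection_def by blast
  then show "smooth_on W (\<lambda>x. \<Gamma> \<kappa> x i j k)" for i j k using ad(2) smooth_on_subset by blast
qed

text \<open>Translates the global conditions, stated for tensors indexed by lists, into the
  component equations of the local calculus.\<close>

lemma adapted_g2_chart: "g2_chart W (\<Gamma> \<kappa>) E"
proof -
  interpret frame_chart W "\<Gamma> \<kappa>" E by (rule adapted_frame_chart)
  let ?g = "\<lambda>i j x. \<Sum>a\<in>UNIV. E x $ a $ i * E x $ a $ j"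
  let ?T = "\<lambda>i j k x. \<Sum>p\<in>UNIV. (\<Gamma> \<kappa> x i j p - \<Gamma> \<kappa> x j i p) * ?g p k x"
  let ?P = "\<lambda>i j k x. \<Sum>a\<in>UNIV. \<Sum>b\<in>UNIV. \<Sum>c\<in>UNIV. phi0 a b c * (E x $ a $ i * E x $ b $ j * E x $ c $ k)"
  have o: "open W" using ad(1) unfolding adapted_on_def by blast
  have pd: "partial_diff m (\<lambda>y. metric_field (\<phi> \<kappa>) y $ i $ j) x = partial_diff m (?g i j) x"
    "partial_diff m (\<lambda>y. torsion_comp \<kappa> y i j k) x = partial_diff m (?T i j k) x"
    "partial_diff m (\<lambda>y. \<phi> \<kappa> y [i, j, k]) x = partial_diff m (?P i j k) x" if "x \<in> W" for m i j k x
    by (rule partial_diff_cong[OF o that], rule metric_comp torsion_comp_eq phi_comp, assumption)+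
  have m: "cov2 ?g m i j x = 0" if x: "x \<in> W" for m i j x
  proof -
    have "0 = cov_deriv_tensor (\<Gamma> \<kappa>) (metric_tensor \<phi> \<kappa>) x m [i, j]"
      using char \<kappa> ad(2) x unfolding characteristic_connection_def parallel_tensor_def by (simp add: subset_iff)
    also have "\<dots> = cov2 ?g m i j x"
      unfolding cov_deriv_tensor_2 cov2_def metric_tensor_def using pd(1)[OF x] metric_comp[OF x] by simp
    finally show ?thesis by simp
  qed
  have p: "cov3 ?P m i j k x = 0" if x: "x \<in> W" for m i j k x
  proof -
    have "0 = cov_deriv_tensor (\<Gamma> \<kappa>) (\<phi> \<kappa>) x m [i, j, k]"
      using char \<kappa> ad(2) x unfolding characteristic_connection_def parallel_tensor_def by (simp add: subset_iff)
    also have "\<dots> = cov3 ?P m i j k x"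
      unfolding cov_deriv_tensor_3 cov3_def phi_comp[OF x] pd(3)[OF x] ..
    finally show ?thesis by simp
  qed
  have s: "?T i k j x = - ?T i j k x" if x: "x \<in> W" for i j k x
  proof -
    have "alternating 3 (torsion_tensor \<phi> \<Gamma> \<kappa> x)"
      using char \<kappa> ad(2) x unfolding characteristic_connection_def by blast
    from alternating_swap23[OF this, of i k j] show ?thesis unfolding torsion_comp_eq[OF x] .
  qed
  have c: "partial_diff i (?T j k l) x - partial_diff j (?T i k l) x + partial_diff k (?T i j l) x - partial_diff l (?T i j k) x = 0"
    if x: "x \<in> W" for i j k l x
  proof -
    have "ext_d (torsion_tensor \<phi> \<Gamma> \<kappa>) x [i, j, k, l] = 0"
      using closed \<kappa> ad(2) x unfolding closed_form_def by (simp add: subset_iff)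
    then show ?thesis unfolding ext_d_3 pd(2)[OF x] .
  qed
  show ?thesis by unfold_locales (fact m p s c)+
qed

lemma cov_deriv_torsion:
  assumes x: "x \<in> W"
  shows "cov_deriv_tensor (\<Gamma> \<kappa>) (torsion_tensor \<phi> \<Gamma> \<kappa>) x m [i, j, k]
    = frame_chart.cov3 (\<Gamma> \<kappa>) (\<lambda>i j k x. \<Sum>p\<in>UNIV. (\<Gamma> \<kappa> x i j p - \<Gamma> \<kappa> x j i p) * (\<Sum>a\<in>UNIV. E x $ a $ p * E x $ a $ k)) m i j k x"
proof -
  have o: "open W" using ad(1) unfolding adapted_on_def by blast
  have "partial_diff m (\<lambda>y. torsion_comp \<kappa> y i j k) x
    = partial_diff m (\<lambda>x. \<Sum>p\<in>UNIV. (\<Gamma> \<kappa> x i j p - \<Gamma> \<kappa> x j i p) * (\<Sum>a\<in>UNIV. E x $ a $ p * E x $ a $ k)) x"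
    by (rule partial_diff_cong[OF o x]) (rule torsion_comp_eq)
  then show ?thesis
    unfolding cov_deriv_tensor_3 frame_chart.cov3_def[OF adapted_frame_chart] torsion_comp_eq[OF x] by simp
qed

lemma chart_tau:
  assumes x: "x \<in> W"
  shows "torsion_chart.tau (\<Gamma> \<kappa>) E x = cube_norm (contract_matrix (torsion_comp \<kappa> x) (matrix_inv (E x)))"
proof -
  interpret g2_chart W "\<Gamma> \<kappa>" E
    "\<lambda>i j x. \<Sum>a\<in>UNIV. E x $ a $ i * E x $ a $ j"
    "\<lambda>i j k x. \<Sum>p\<in>UNIV. (\<Gamma> \<kappa> x i j p - \<Gamma> \<kappa> x j i p) * (\<Sum>a\<in>UNIV. E x $ a $ p * E x $ a $ k)"
    "\<lambda>i j k x. \<Sum>a\<in>UNIV. \<Sum>b\<in>UNIV. \<Sum>c\<in>UNIV. phi0 a b c * (E x $ a $ i * E x $ b $ j * E x $ c $ k)"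
    by (rule adapted_g2_chart) simp_all
  show ?thesis
    unfolding tau_def TF_def fr3_triple cube_norm_def contract_matrix_def torsion_comp_eq[OF x] ev_def ..
qed

lemma parallel_imp_instanton_frame:
  fixes e :: "7 \<Rightarrow> real^7"
  assumes par: "parallel_tensor A \<Gamma> 3 (torsion_tensor \<phi> \<Gamma>)" and x: "x \<in> W"
    and e: "\<And>a b. e a \<bullet> (metric_field (\<phi> \<kappa>) x *v e b) = (if a = b then 1 else 0)"
  shows "(\<Sum>a\<in>UNIV. \<Sum>b\<in>UNIV.
        curvature4 (metric_field (\<phi> \<kappa>)) (\<Gamma> \<kappa>) (\<lambda>_. e a) (\<lambda>_. e b) (\<lambda>_. w) (\<lambda>_. z) x *
        tensor_eval 3 (\<phi> \<kappa> x) [e a, e b, u]) = 0"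
proof -
  interpret g2_chart W "\<Gamma> \<kappa>" E
    "\<lambda>i j x. \<Sum>a\<in>UNIV. E x $ a $ i * E x $ a $ j"
    "\<lambda>i j k x. \<Sum>p\<in>UNIV. (\<Gamma> \<kappa> x i j p - \<Gamma> \<kappa> x j i p) * (\<Sum>a\<in>UNIV. E x $ a $ p * E x $ a $ k)"
    "\<lambda>i j k x. \<Sum>a\<in>UNIV. \<Sum>b\<in>UNIV. \<Sum>c\<in>UNIV. phi0 a b c * (E x $ a $ i * E x $ b $ j * E x $ c $ k)"
    by (rule adapted_g2_chart) simp_all
  have c: "cov_deriv_tensor (\<Gamma> \<kappa>) (torsion_tensor \<phi> \<Gamma> \<kappa>) x m [i, j, k] = 0" for m i j k
    using par \<kappa> ad(2) x unfolding parallel_tensor_def by (simp add: subset_iff)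
  show ?thesis
    by (rule instanton_frameI[where g = "metric_field (\<phi> \<kappa>)" and a = "\<phi> \<kappa> x", OF x metric_field_eq[OF x] phi_comp[OF x] e])
       (rule parallel_torsion_imp_instanton[OF x], rule c[unfolded cov_deriv_torsion[OF x]])
qed

context
  assumes inst: "g2_instanton A \<phi> \<Gamma>"
begin

lemma instanton_RF:
  assumes x: "x \<in> W"
  shows "(\<Sum>a\<in>UNIV. \<Sum>b\<in>UNIV. frame_chart.RF (\<Gamma> \<kappa>) E a b i j x * phi0 a b k) = 0"
proof -
  interpret g2_chart W "\<Gamma> \<kappa>" E
    "\<lambda>i j x. \<Sum>a\<in>UNIV. E x $ a $ i * E x $ a $ j"
    "\<lambda>i j k x. \<Sum>p\<in>UNIV. (\<Gamma> \<kappa> x i j p - \<Gamma> \<kappa> x j i p) * (\<Sum>a\<in>UNIV. E x $ a $ p * E x $ a $ k)"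
    "\<lambda>i j k x. \<Sum>a\<in>UNIV. \<Sum>b\<in>UNIV. \<Sum>c\<in>UNIV. phi0 a b c * (E x $ a $ i * E x $ b $ j * E x $ c $ k)"
    by (rule adapted_g2_chart) simp_all
  have "\<forall>a b. evec x a \<bullet> (metric_field (\<phi> \<kappa>) x *v evec x b) = (if a = b then 1 else 0)"
    unfolding metric_field_eq[OF x] using evec_orthonormal[OF x] by blast
  then have "(\<Sum>a\<in>UNIV. \<Sum>b\<in>UNIV.
        curvature4 (metric_field (\<phi> \<kappa>)) (\<Gamma> \<kappa>) (\<lambda>_. evec x a) (\<lambda>_. evec x b) (\<lambda>_. evec x i) (\<lambda>_. evec x j) x *
        tensor_eval 3 (\<phi> \<kappa> x) [evec x a, evec x b, evec x k]) = 0"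
    using inst \<kappa> ad(2) x unfolding g2_instanton_def by blast
  then show ?thesis by (rule instanton_frameD[where g = "metric_field (\<phi> \<kappa>)" and a = "\<phi> \<kappa> x", OF x metric_field_eq[OF x] phi_comp[OF x]])
qed

lemma chart_tau_local_max:
  assumes "open V" "V \<subseteq> W" "x0 \<in> V" "\<And>y. y \<in> V \<Longrightarrow> torsion_chart.tau (\<Gamma> \<kappa>) E y \<le> torsion_chart.tau (\<Gamma> \<kappa>) E x0"
  shows "\<exists>d>0. \<forall>y\<in>ball x0 d. torsion_chart.tau (\<Gamma> \<kappa>) E y = torsion_chart.tau (\<Gamma> \<kappa>) E x0"
  by (rule g2_chart.tau_local_max[OF adapted_g2_chart instanton_RF assms])

lemma chart_tau_constant:
  assumes V: "open V" "V \<subseteq> W" "x \<in> V" "\<And>y. y \<in> V \<Longrightarrow> torsion_chart.tau (\<Gamma> \<kappa>) E y = torsion_chart.tau (\<Gamma> \<kappa>) E x"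
  shows "cov_deriv_tensor (\<Gamma> \<kappa>) (torsion_tensor \<phi> \<Gamma> \<kappa>) x m [i, j, k] = 0"
proof -
  have "x \<in> W" using V by blast
  show ?thesis unfolding cov_deriv_torsion[OF \<open>x \<in> W\<close>]
    by (rule g2_chart.tau_locally_constant_imp_parallel[OF adapted_g2_chart instanton_RF V])
qed

end

end

end

section \<open>From the chart domains to the compact manifold\<close>

context closed_torsion_g2 begin

lemma torsion_norm_chart:
  assumes "\<kappa> \<in> A" "adapted_on (\<phi> \<kappa>) W E" "W \<subseteq> chart_img \<kappa>" "p \<in> fst \<kappa>" "snd \<kappa> p \<in> W"
  shows "torsion_norm p = torsion_chart.tau (\<Gamma> \<kappa>) E (snd \<kappa> p)"
  using torsion_norm_eq[OF assms(1,4), of "E (snd \<kappa> p)"] chart_tau[OF assms(1-3,5)] assms(2,5)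
  unfolding adapted_on_def by simp

lemma adapted_neighbourhood:
  assumes "p \<in> topspace X"
  obtains \<kappa> W E where "\<kappa> \<in> A" "p \<in> fst \<kappa>" "adapted_on (\<phi> \<kappa>) W E" "W \<subseteq> chart_img \<kappa>" "snd \<kappa> p \<in> W"
proof -
  have "(\<Union>\<kappa>\<in>A. fst \<kappa>) = topspace X" using mfd unfolding g2_manifold_def smooth_manifold_def by blast
  then obtain \<kappa> where \<kappa>: "\<kappa> \<in> A" "p \<in> fst \<kappa>" using assms by blast
  then have "snd \<kappa> p \<in> chart_img \<kappa>" unfolding chart_img_def by blast
  from adapted_exists[OF \<kappa>(1) this] show ?thesis using that \<kappa> by metis
qed

lemma continuous_torsion_norm: "continuous_map X euclideanreal torsion_norm"
proof -
  have "openin X {p \<in> topspace X. torsion_norm p \<in> U}" if U: "open U" for U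
  proof (subst openin_subopen, intro ballI)
    fix p assume "p \<in> {p \<in> topspace X. torsion_norm p \<in> U}"
    then have p: "p \<in> topspace X" "torsion_norm p \<in> U" by auto
    obtain \<kappa> W E where c: "\<kappa> \<in> A" "p \<in> fst \<kappa>" "adapted_on (\<phi> \<kappa>) W E" "W \<subseteq> chart_img \<kappa>" "snd \<kappa> p \<in> W"
      by (rule adapted_neighbourhood[OF p(1)])
    let ?u = "torsion_chart.tau (\<Gamma> \<kappa>) E"
    have "smooth_on W ?u"
      using adapted_g2_chart[OF c(1,3,4)] g2_chart.axioms(1) torsion_chart.smooth_tau by blast
    then have "open (W \<inter> ?u -` U)"
      using continuous_open_preimage[of W ?u U] smooth_on_continuous_on U c(3) unfolding adapted_on_def by blast
    then have o: "openin X {q \<in> fst \<kappa>. snd \<kappa> q \<in> W \<inter> ?u -` U}" by (rule chart_preimage_open[OF chart[OF c(1)]])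
    note e = torsion_norm_chart[OF c(1,3,4)]
    have "p \<in> {q \<in> fst \<kappa>. snd \<kappa> q \<in> W \<inter> ?u -` U}" using c p e[of p] by auto
    moreover have "{q \<in> fst \<kappa>. snd \<kappa> q \<in> W \<inter> ?u -` U} \<subseteq> {p \<in> topspace X. torsion_norm p \<in> U}"
      using e openin_subset[OF o] by auto
    ultimately show "\<exists>T. openin X T \<and> p \<in> T \<and> T \<subseteq> {p \<in> topspace X. torsion_norm p \<in> U}" using o by blast
  qed
  then show ?thesis by (simp add: continuous_map)
qed

text \<open>The preimage of a coordinate ball that fits into the image of U; injectivity of the
  chart keeps it inside U.\<close>

lemma locally_connected_manifold:
  assumes U: "openin X U" "p \<in> U"
  shows "\<exists>V. openin X V \<and> p \<in> V \<and> V \<subseteq> U \<and> connectedin X V"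
proof -
  have "p \<in> topspace X" using U openin_subset by blast
  then obtain \<kappa> W E where c: "\<kappa> \<in> A" "p \<in> fst \<kappa>" "adapted_on (\<phi> \<kappa>) W E" "W \<subseteq> chart_img \<kappa>" "snd \<kappa> p \<in> W"
    by (rule adapted_neighbourhood)
  have "open (snd \<kappa> ` (fst \<kappa> \<inter> U))" by (rule chart_image_open[OF chart[OF c(1)] U(1)])
  then obtain d where d: "d > 0" "ball (snd \<kappa> p) d \<subseteq> snd \<kappa> ` (fst \<kappa> \<inter> U)"
    using c(2) U(2) open_contains_ball by (metis IntI imageI)
  let ?V = "{q \<in> fst \<kappa>. snd \<kappa> q \<in> ball (snd \<kappa> p) d}"
  have "openin X ?V" by (rule chart_preimage_open[OF chart[OF c(1)] open_ball])
  moreover have "connectedin X ?V"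
    by (rule chart_preimage_connected[OF chart[OF c(1)] connected_ball]) (use d(2) in \<open>auto simp: chart_img_def\<close>)
  moreover have "p \<in> ?V" using c(2) d(1) by simp
  moreover have "?V \<subseteq> U"
  proof
    fix q assume q: "q \<in> ?V"
    then obtain r where "r \<in> fst \<kappa>" "r \<in> U" "snd \<kappa> q = snd \<kappa> r" using d(2) by blast
    then show "q \<in> U" using inj_onD[OF chart_inj[OF chart[OF c(1)]], of q r] q by simp
  qed
  ultimately show ?thesis by blast
qed

lemma torsion_norm_local_max:
  assumes inst: "g2_instanton A \<phi> \<Gamma>" and U: "openin X U" "p \<in> U" and max: "\<And>q. q \<in> U \<Longrightarrow> torsion_norm q \<le> torsion_norm p"
  shows "\<exists>V. openin X V \<and> p \<in> V \<and> (\<forall>q\<in>V. torsion_norm q = torsion_norm p)"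
proof -
  have "p \<in> topspace X" using U openin_subset by blast
  then obtain \<kappa> W E where c: "\<kappa> \<in> A" "p \<in> fst \<kappa>" "adapted_on (\<phi> \<kappa>) W E" "W \<subseteq> chart_img \<kappa>" "snd \<kappa> p \<in> W"
    by (rule adapted_neighbourhood)
  let ?u = "torsion_chart.tau (\<Gamma> \<kappa>) E"
  note e = torsion_norm_chart[OF c(1,3,4)]
  have oW: "open W" using c(3) unfolding adapted_on_def by blast
  define S where "S = W \<inter> snd \<kappa> ` (fst \<kappa> \<inter> U)"
  have oS: "open S" unfolding S_def using oW chart_image_open[OF chart[OF c(1)] U(1)] by blast
  have "?u y \<le> ?u (snd \<kappa> p)" if y: "y \<in> S" for y
  proof -
    obtain q where "q \<in> fst \<kappa>" "q \<in> U" "y = snd \<kappa> q" "y \<in> W" using y unfolding S_def by blast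
    then show ?thesis using max[of q] e[of q] e[OF c(2,5)] by simp
  qed
  then have "\<exists>d>0. \<forall>y\<in>ball (snd \<kappa> p) d. ?u y = ?u (snd \<kappa> p)"
    using c(2,5) U(2) by (intro chart_tau_local_max[OF c(1,3,4) inst oS]) (auto simp: S_def)
  then obtain d where d: "d > 0" "\<And>y. y \<in> ball (snd \<kappa> p) d \<Longrightarrow> ?u y = ?u (snd \<kappa> p)" by blast
  let ?V = "{q \<in> fst \<kappa>. snd \<kappa> q \<in> W \<inter> ball (snd \<kappa> p) d}"
  have "openin X ?V" by (rule chart_preimage_open[OF chart[OF c(1)]]) (use oW in auto)
  moreover have "p \<in> ?V" using c d(1) by simp
  moreover have "torsion_norm q = torsion_norm p" if "q \<in> ?V" for q
    using that e[of q] e[OF c(2,5)] d(2)[of "snd \<kappa> q"] by simp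
  ultimately show ?thesis by blast
qed

lemma instanton_imp_parallel:
  assumes X: "compact_space X" and inst: "g2_instanton A \<phi> \<Gamma>"
  shows "parallel_tensor A \<Gamma> 3 (torsion_tensor \<phi> \<Gamma>)"
proof -
  have "cov_deriv_tensor (\<Gamma> \<kappa>) (torsion_tensor \<phi> \<Gamma> \<kappa>) x m [i, j, k] = 0"
    if \<kappa>: "\<kappa> \<in> A" and x: "x \<in> chart_img \<kappa>" for \<kappa> x m i j k
  proof -
    obtain W E where c: "adapted_on (\<phi> \<kappa>) W E" "W \<subseteq> chart_img \<kappa>" "x \<in> W" by (rule adapted_exists[OF \<kappa> x])
    obtain p where p: "p \<in> fst \<kappa>" "x = snd \<kappa> p" using x unfolding chart_img_def by blast
    have "p \<in> topspace X" using p(1) chart[OF \<kappa>] openin_subset unfolding is_chart_def by blast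
    then have "\<exists>V. openin X V \<and> p \<in> V \<and> (\<forall>q\<in>V. torsion_norm q = torsion_norm p)"
    proof (rule compact_locally_constant[OF X continuous_torsion_norm, rotated 2])
      show "\<exists>V. openin X V \<and> p \<in> V \<and> V \<subseteq> U \<and> connectedin X V" if "openin X U" "p \<in> U" for p U
        using that by (rule locally_connected_manifold)
      show "\<exists>V. openin X V \<and> p \<in> V \<and> (\<forall>q\<in>V. torsion_norm q = torsion_norm p)"
        if "openin X U" "p \<in> U" "\<And>q. q \<in> U \<Longrightarrow> torsion_norm q \<le> torsion_norm p" for p U
        using that by (rule torsion_norm_local_max[OF inst])
    qed
    then obtain V where V: "openin X V" "p \<in> V" "\<forall>q\<in>V. torsion_norm q = torsion_norm p" by blast
    define S where "S = W \<inter> snd \<kappa> ` (fst \<kappa> \<inter> V)"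
    have oS: "open S"
      unfolding S_def using c(1) chart_image_open[OF chart[OF \<kappa>] V(1)] unfolding adapted_on_def by blast
    have SW: "S \<subseteq> W" unfolding S_def by blast
    have xS: "x \<in> S" using c(3) p V(2) unfolding S_def by blast
    note e = torsion_norm_chart[OF \<kappa> c(1,2)]
    have "torsion_chart.tau (\<Gamma> \<kappa>) E y = torsion_chart.tau (\<Gamma> \<kappa>) E x" if y: "y \<in> S" for y
    proof -
      obtain q where q: "q \<in> fst \<kappa>" "q \<in> V" "y = snd \<kappa> q" "y \<in> W" using y unfolding S_def by blast
      then have "torsion_norm q = torsion_norm p" using V(3) by blast
      then show ?thesis using e[of q] e[of p] q p c(3) by simp
    qed
    then show ?thesis by (rule chart_tau_constant[OF \<kappa> c(1,2) inst oS SW xS])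
  qed
  then show ?thesis unfolding parallel_tensor_def by (auto simp: length_3_conv)
qed

lemma parallel_imp_instanton:
  assumes par: "parallel_tensor A \<Gamma> 3 (torsion_tensor \<phi> \<Gamma>)"
  shows "g2_instanton A \<phi> \<Gamma>"
  unfolding g2_instanton_def
proof (intro ballI allI impI)
  fix \<kappa> x i j k and e :: "7 \<Rightarrow> real^7"
  assume \<kappa>: "\<kappa> \<in> A" and x: "x \<in> chart_img \<kappa>"
    and e: "\<forall>a b. e a \<bullet> (metric_field (\<phi> \<kappa>) x *v e b) = (if a = b then 1 else 0)"
  obtain W E where c: "adapted_on (\<phi> \<kappa>) W E" "W \<subseteq> chart_img \<kappa>" "x \<in> W" by (rule adapted_exists[OF \<kappa> x])
  show "(\<Sum>a\<in>UNIV. \<Sum>b\<in>UNIV.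
        curvature4 (metric_field (\<phi> \<kappa>)) (\<Gamma> \<kappa>) (\<lambda>_. e a) (\<lambda>_. e b) (\<lambda>_. e i) (\<lambda>_. e j) x *
        tensor_eval 3 (\<phi> \<kappa> x) [e a, e b, e k]) = 0"
    by (rule parallel_imp_instanton_frame[OF \<kappa> c(1,2) par c(3)]) (use e in blast)
qed

end

theorem theorem5p11:
  fixes X :: "'a topology"
    and A :: "('a, 7) chart set"
    and \<phi> :: "('a, 7) chart \<Rightarrow> real^7 \<Rightarrow> 7 tensor"
    and \<Gamma> :: "('a, 7) chart \<Rightarrow> 7 christoffel"
  assumes "g2_manifold X A \<phi>"
    and "compact_space X"
    and "g2_integrable A \<phi>"
    and "characteristic_connection A \<phi> \<Gamma>"
    and "closed_form A 3 (torsion_tensor \<phi> \<Gamma>)"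
  shows "parallel_tensor A \<Gamma> 3 (torsion_tensor \<phi> \<Gamma>) \<longleftrightarrow> g2_instanton A \<phi> \<Gamma>"
proof -
  interpret closed_torsion_g2 X A \<phi> \<Gamma> by unfold_locales fact+
  show ?thesis using parallel_imp_instanton instanton_imp_parallel[OF assms(2)] by blast
qed

end
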